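(* There is a one-to-one correspondence between the set of nondegenerate $Z^H$-twisted Miura $G$-opers with admissible combinatorial data and the set of solutions to the $Z^H$-twisted Bethe Ansatz equations for ${}^L\mathfrak g$ with the same combinatorial data. Here the $Z^H$-twisted Bethe Ansatz equations for ${}^L\mathfrak g$ are $$\langle\alpha_i,Z^H\rangle+\partial_z\log\Big[\Lambda_i(z)\prod_{j}q^j_+(z)^{-a_{ji}}(z-w^i_\ell)^2\Big]\Big|_{z=w^i_\ell}=0,\qquad i=1,\dots,r,\ \ \ell=1,\dots,\deg q^i_+,$$ where $q^i_+(z)=\prod_\ell(z-w^i_\ell)$.
   Context: Let $G$ be a connected, simply connected, simple algebraic group over $\mathbb C$ of rank $r$ with Lie algebra $\mathfrak g$ (with Langlands dual ${}^L\mathfrak g$), opposite Borel subgroups $B_\pm$, maximal torus $H=B_+\cap B_-$, with Lie algebras $\mathfrak b_\pm,\mathfrak h$. Let $\alpha_i,\check\alpha_i$ be the simple roots and coroots (for $H\subset B_+$), $e_i,f_i,\check\alpha_i$ Chevalley generators, $a_{ij}=\langle\alpha_j,\check\alpha_i\rangle$, $s_i$ the simple reflections ($s_i(Y)=Y-\langle\alpha_i,Y\rangle\check\alpha_i$ on $\mathfrak h$), $w_0$ the longest Weyl group element. For an algebraic group $K$, $K(z)$ denotes its $\mathbb C(z)$-points. The gauge action of $g\in G(z)$ on $\partial_z+A(z)$ is $g(\partial_z+A)g^{-1}=\partial_z+gAg^{-1}+g\,\partial_z(g^{-1})$. Opers. Fix monic polynomials $\Lambda_1,\dots,\Lambda_r$.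 A Miura $G$-oper on $\mathbb P^1$ with regular singularities determined by the $\Lambda_i$ can be written as a connection $\nabla=\partial_z+\sum_i\Lambda_i(z)e_i+\sum_i g_i(z)\check\alpha_i$ with $g_i\in\mathbb C(z)$ (with the standard $B_\pm$-reductions), and is identified with this connection. Let $Z^H=\sum_i\zeta_i\check\alpha_i\in\mathfrak h$. It is a $Z^H$-twisted Miura oper if $\nabla=v(z)(\partial_z+Z^H)v(z)^{-1}$ for some $v(z)\in B_+(z)$. Then $g_i=\zeta_i-y_i^{-1}\partial_zy_i$ with $y_i\in\mathbb C(z)^\times$ unique up to scalars, and $\nabla$ is nondegenerate if the $y_i$ may be chosen to be monic polynomials such that: (a) no $y_i$ has a multiple root; (b) for each $i$, $y_i$ and $\Lambda_i$ have no common root; (c) if $i\neq j$ and $a_{ij}\neq0$, $y_i$ and $y_j$ have no common root. A solution of the Bethe Ansatz equations is a family of finite unordered collections $\{w^i_\ell\}_\ell$ of complex numbers, $i=1,\dots,r$ (equivalently, a family of monic polynomials $q^i_+(z)=\prod_\ell(z-w^i_\ell)$), such that $w^i_\ell$ is not a root of $\Lambda_i$, $w^i_\ell\ne w^j_s$ whenever $a_{ji}\ne0$ and $(i,\ell)\ne(j,s)$, and the equations hold. $qq$-system. For $Z^H\in\mathfrak h$ and monic $\Lambda_1,\dots,\Lambda_r$ it is $W(q^i_+,q^i_-)+\langle\alpha_i,Z^H\rangle q^i_+q^i_-=\Lambda_i\prod_{j\ne i}(q^j_+)^{-a_{ji}}$, $i=1,\dots,r$, with $W(q_+,q_-)=q_+\partial_zq_--q_-\partial_zq_+$.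 A polynomial solution is nondegenerate if the $q^i_+$ are monic and satisfy (a)–(c) with $y_i=q^i_+$. To a solution $S$ associate the connection $\nabla_S=\partial_z+Z^H-\sum_i\frac{\partial_zq^i_+}{q^i_+}\check\alpha_i+\sum_i\Lambda_ie_i$, and for each $i$ the connection $\nabla_S^{(i)}=e^{\mu_if_i}\nabla_Se^{-\mu_if_i}$, where $\mu_i=\Lambda_i^{-1}\big[\partial_z\log(q^i_-/q^i_+)+\langle\alpha_i,Z^H\rangle\big]$. Genericity. Let $w=s_{i_1}\cdots s_{i_k}$ be a reduced decomposition. A polynomial solution $S_0$ of the $qq$-system for $Z^H$ is $(i_1,\dots,i_k)$-generic if it is nondegenerate and there are nondegenerate polynomial solutions $S_\ell$, $1\le\ell\le k$, of the $qq$-system (same $\Lambda_i$) for the twist $s_{i_{k-\ell+1}}\cdots s_{i_k}(Z^H)$ such that $\nabla_{S_\ell}=\nabla_{S_{\ell-1}}^{(i_{k-\ell+1})}$. It is $w_0$-generic if it is $(i_1,\dots,i_k)$-generic for some reduced decomposition of $w_0$. Admissibility. For a set $\Psi$ of roots let $\mathfrak h_\Psi=\{Y\in\mathfrak h\mid\beta(Y)=0\iff\beta\in\Psi\}$. A combinatorial datum is a triple $(\mathbf d,\mathbf N,\Psi)$ with $\mathbf d=(d_1,\dots,d_r)$, $\mathbf N=(N_1,\dots,N_r)$ tuples of nonnegative integers. It is admissible if there exists a $w_0$-generic solution of a $qq$-system with twist in $\mathfrak h_\Psi$, $\deg\Lambda_i=N_i$ and $\deg q^i_+=d_i$ for all $i$.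 The combinatorial datum of a nondegenerate $Z^H$-twisted Miura oper (resp. of a solution of the Bethe Ansatz equations) is given by $d_i=\deg y_i$ (resp. $d_i=\deg q^i_+$), $N_i=\deg\Lambda_i$, and $\Psi$ the set of roots vanishing on $Z^H$. *)

theory Defs
  imports
    "HOL-Analysis.Analysis"
    "HOL-Algebra.Solvable_Groups"
    "HOL-Library.Poly_Mapping"
    "HOL-Library.Multiset"
    "HOL-Computational_Algebra.Computational_Algebra"
    "HOL-Computational_Algebra.Field_as_Ring"
begin

hide_const (open) Coset.order

section \<open>The differential field of rational functions\<close>

type_synonym ratfun = "complex poly fract"

abbreviation rpoly :: "complex poly \<Rightarrow> ratfun" where
  "rpoly p \<equiv> to_fract p"

abbreviation rconst :: "complex \<Rightarrow> ratfun" where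
  "rconst c \<equiv> to_fract [:c:]"

definition rderiv :: "ratfun \<Rightarrow> ratfun" where
  "rderiv f = (let (p, q) = quot_of_fract f in Fraction_Field.Fract (pderiv p * q - p * pderiv q) (q * q))"

lemma rderiv_Fract:
  assumes "q \<noteq> 0"
  shows "rderiv (Fraction_Field.Fract p q) = Fraction_Field.Fract (pderiv p * q - p * pderiv q) (q * q)"
proof -
  obtain a b where ab: "quot_of_fract (Fract p q) = (a, b)" by (cases "quot_of_fract (Fract p q)")
  have b: "b \<noteq> 0" using snd_quot_of_fract_nonzero[of "Fract p q"] ab by simp
  have "Fract a b = Fract p q"
    using quot_to_fract_quot_of_fract[of "Fract p q"] ab by (simp add: quot_to_fract_def)
  hence h: "a * q = p * b" using b assms by (simp add: eq_fract)
  have D: "pderiv a * q + a * pderiv q = pderiv p * b + p * pderiv b"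
    using arg_cong[OF h, of pderiv] by (simp add: pderiv_mult algebra_simps)
  have "(pderiv a * b - a * pderiv b) * (q * q) - (pderiv p * q - p * pderiv q) * (b * b)
      = b * q * ((pderiv a * q + a * pderiv q) - (pderiv p * b + p * pderiv b))
        - (b * pderiv q + q * pderiv b) * (a * q - p * b)"
    by (simp add: algebra_simps)
  also have "\<dots> = 0" using h D by simp
  finally show ?thesis using b assms by (simp add: rderiv_def ab eq_fract)
qed

definition dlog :: "ratfun \<Rightarrow> ratfun" where
  "dlog f = rderiv f / f"

text \<open>Value of a rational function at a point where it is regular; removable singularities are
  removed because \<^const>\<open>quot_of_fract\<close> returns the reduced fraction.\<close>
definition rat_eval :: "ratfun \<Rightarrow> complex \<Rightarrow> complex" where
  "rat_eval f w = poly (fst (quot_of_fract f)) w / poly (snd (quot_of_fract f)) w"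

section \<open>Matrices and linear algebraic groups\<close>

definition msc :: "'a::comm_ring_1 \<Rightarrow> 'a^'n^'m \<Rightarrow> 'a^'n^'m" where
  "msc c A = (\<chi> i j. c * A $ i $ j)"

definition const_mat :: "complex^'n^'m \<Rightarrow> ratfun^'n^'m" where
  "const_mat A = (\<chi> i j. rconst (A $ i $ j))"

definition mat_deriv :: "ratfun^'n^'m \<Rightarrow> ratfun^'n^'m" where
  "mat_deriv A = (\<chi> i j. rderiv (A $ i $ j))"

definition lie_bracket :: "complex^'n^'n \<Rightarrow> complex^'n^'n \<Rightarrow> complex^'n^'n" where
  "lie_bracket A B = A ** B - B ** A"

text \<open>The exponential of a nilpotent square matrix: for such a matrix all omitted terms vanish.
  (Powers are written out, since \<open>*\<close> on vectors is componentwise.)\<close>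
definition nilp_exp :: "'a::field^'n^'n \<Rightarrow> 'a^'n^'n" where
  "nilp_exp M = (\<Sum>k<CARD('n). msc (inverse (of_nat (fact k))) (((\<lambda>X. M ** X) ^^ k) (mat 1)))"

text \<open>Polynomials over \<open>\<complex>\<close> in the matrix entries, and their values on matrices over a
  \<open>\<complex>\<close>-algebra with structure map \<open>\<phi>\<close>.\<close>
type_synonym 'n entry_poly = "('n \<times> 'n \<Rightarrow>\<^sub>0 nat) \<Rightarrow>\<^sub>0 complex"

definition entry_eval :: "(complex \<Rightarrow> 'a::comm_ring_1) \<Rightarrow> 'n entry_poly \<Rightarrow> 'a^'n^'n \<Rightarrow> 'a" where
  "entry_eval \<phi> f A = (\<Sum>m\<in>Poly_Mapping.keys f. \<phi> (Poly_Mapping.lookup f m) *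
     (\<Prod>v\<in>Poly_Mapping.keys m. (A $ fst v $ snd v) ^ Poly_Mapping.lookup m v))"

definition vanishing_ideal :: "(complex^'n^'n) set \<Rightarrow> 'n entry_poly set" where
  "vanishing_ideal S = {f. \<forall>A\<in>S. entry_eval (\<lambda>c. c) f A = 0}"

definition GL :: "(complex^'n^'n) monoid" where
  "GL = \<lparr>carrier = {A. invertible A}, mult = (**), one = mat 1\<rparr>"

text \<open>Zariski-closed subgroups of \<open>GL\<^sub>n(\<complex>)\<close>.  Every affine algebraic group is of this form.
  Connectedness and simple connectedness below are the library notions, for the
  complex topology.\<close>
definition algebraic_group :: "(complex^'n^'n) set \<Rightarrow> bool" where
  "algebraic_group S \<longleftrightarrow> subgroup S GL \<and>
     S = {A. invertible A \<and> (\<forall>f\<in>vanishing_ideal S. entry_eval (\<lambda>c. c) f A = 0)}"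

text \<open>The group of \<open>\<complex>(z)\<close>-points.\<close>
definition ratpoints :: "(complex^'n^'n) set \<Rightarrow> (ratfun^'n^'n) set" where
  "ratpoints S = {A. invertible A \<and> (\<forall>f\<in>vanishing_ideal S. entry_eval rconst f A = 0)}"

text \<open>The tangent space at the identity: all \<open>X\<close> such that each equation of the group vanishes to
  first order in \<open>t\<close> at the matrix \<open>1 + t X\<close>.\<close>
definition lie_algebra :: "(complex^'n^'n) set \<Rightarrow> (complex^'n^'n) set" where
  "lie_algebra S = {X. \<forall>f\<in>vanishing_ideal S.
     coeff (entry_eval (\<lambda>c. [:c:]) f (\<chi> i j. [:(if i = j then 1 else 0), X $ i $ j:])) 1 = 0}"

text \<open>Algebraic groups are called simple when they are noncommutative and have no proper
  nontrivial connected closed normal subgroups; a finite centre is allowed.\<close>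
definition simple_algebraic_group :: "(complex^'n^'n) set \<Rightarrow> bool" where
  "simple_algebraic_group S \<longleftrightarrow> algebraic_group S \<and> connected S \<and>
     (\<exists>A\<in>S. \<exists>B\<in>S. A ** B \<noteq> B ** A) \<and>
     (\<forall>N. algebraic_group N \<and> connected N \<and> N \<lhd> (GL\<lparr>carrier := S\<rparr>) \<longrightarrow> N = {mat 1} \<or> N = S)"

definition borel_subgroup :: "(complex^'n^'n) set \<Rightarrow> (complex^'n^'n) set \<Rightarrow> bool" where
  "borel_subgroup S B \<longleftrightarrow>
     (let P = (\<lambda>C. C \<subseteq> S \<and> algebraic_group C \<and> connected C \<and> solvable (GL\<lparr>carrier := C\<rparr>))
      in P B \<and> (\<forall>C. P C \<and> B \<subseteq> C \<longrightarrow> C = B))"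

definition torus :: "(complex^'n::finite^'n) set \<Rightarrow> bool" where
  "torus T \<longleftrightarrow> algebraic_group T \<and> connected T \<and>
     (\<exists>P::complex^'n^'n. invertible P \<and> (\<forall>A\<in>T. \<forall>i j. i \<noteq> j \<longrightarrow> (P ** A ** matrix_inv P) $ i $ j = 0))"

definition maximal_torus :: "(complex^'n^'n) set \<Rightarrow> (complex^'n^'n) set \<Rightarrow> bool" where
  "maximal_torus S T \<longleftrightarrow> T \<subseteq> S \<and> torus T \<and> (\<forall>T'. T' \<subseteq> S \<and> torus T' \<and> T \<subseteq> T' \<longrightarrow> T' = T)"

section \<open>The group with its Borel subgroups and Chevalley generators\<close>

text \<open>The index type \<open>'r\<close> labels the simple roots.  Functionals on the Cartan
  subalgebra are represented by functions that are \<^const>\<open>extensional\<close> on it, so that equality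
  of functionals is equality of functions.\<close>
record ('n, 'r) group_data =
  grp :: "(complex^'n^'n) set"
  borel_plus :: "(complex^'n^'n) set"
  borel_minus :: "(complex^'n^'n) set"
  sroot :: "'r \<Rightarrow> complex^'n^'n \<Rightarrow> complex"
  coroot :: "'r \<Rightarrow> complex^'n^'n"
  gen_e :: "'r \<Rightarrow> complex^'n^'n"
  gen_f :: "'r \<Rightarrow> complex^'n^'n"

definition max_torus :: "('n::finite, 'r::finite) group_data \<Rightarrow> (complex^'n^'n) set" where
  "max_torus D = borel_plus D \<inter> borel_minus D"

definition cartan :: "('n::finite, 'r::finite) group_data \<Rightarrow> (complex^'n^'n) set" where
  "cartan D = lie_algebra (max_torus D)"

text \<open>The nonzero weights of the Cartan subalgebra on a subspace \<open>V\<close> of the Lie algebra.\<close>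
definition roots_on ::
    "('n::finite, 'r::finite) group_data \<Rightarrow> (complex^'n^'n) set \<Rightarrow> (complex^'n^'n \<Rightarrow> complex) set" where
  "roots_on D V = {\<beta> \<in> extensional (cartan D). (\<exists>Y\<in>cartan D. \<beta> Y \<noteq> 0) \<and>
     (\<exists>X\<in>V. X \<noteq> 0 \<and> (\<forall>Y\<in>cartan D. lie_bracket Y X = msc (\<beta> Y) X))}"

definition all_roots :: "('n::finite, 'r::finite) group_data \<Rightarrow> (complex^'n^'n \<Rightarrow> complex) set" where
  "all_roots D = roots_on D (lie_algebra (grp D))"

definition nonneg_comb :: "('n::finite, 'r::finite) group_data \<Rightarrow> (complex^'n^'n \<Rightarrow> complex) \<Rightarrow> bool" where
  "nonneg_comb D \<beta> \<longleftrightarrow>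
     (\<exists>c::'r \<Rightarrow> nat. \<forall>Y\<in>cartan D. \<beta> Y = (\<Sum>i\<in>UNIV. of_nat (c i) * sroot D i Y))"

definition functional_on :: "(complex^'n^'n) set \<Rightarrow> (complex^'n^'n \<Rightarrow> complex) \<Rightarrow> bool" where
  "functional_on V \<beta> \<longleftrightarrow> (\<forall>X\<in>V. \<forall>Y\<in>V. \<beta> (X + Y) = \<beta> X + \<beta> Y) \<and> (\<forall>c. \<forall>X\<in>V. \<beta> (msc c X) = c * \<beta> X)"

text \<open>The \<open>sroot D i\<close> are the simple roots for \<open>H \<subset> B\<^sub>+\<close>: they are roots, they form a basis of the
  dual of the Cartan subalgebra, every root is up to sign a nonnegative integral
  combination of them, and the roots of \<open>B\<^sub>+\<close> are the positive ones.\<close>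
definition simple_roots :: "('n::finite, 'r::finite) group_data \<Rightarrow> bool" where
  "simple_roots D \<longleftrightarrow>
     (\<forall>i. sroot D i \<in> all_roots D) \<and>
     (\<forall>\<beta>. functional_on (cartan D) \<beta> \<longrightarrow>
        (\<exists>!c::'r \<Rightarrow> complex. \<forall>Y\<in>cartan D. \<beta> Y = (\<Sum>i\<in>UNIV. c i * sroot D i Y))) \<and>
     (\<forall>\<beta>\<in>all_roots D. nonneg_comb D \<beta> \<or> nonneg_comb D (\<lambda>Y. - \<beta> Y)) \<and>
     roots_on D (lie_algebra (borel_plus D)) = {\<beta>\<in>all_roots D. nonneg_comb D \<beta>}"

inductive_set lie_generated :: "(complex^'n^'n) set \<Rightarrow> (complex^'n^'n) set"
  for S :: "(complex^'n^'n) set" where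
  gen: "X \<in> S \<Longrightarrow> X \<in> lie_generated S"
| add: "X \<in> lie_generated S \<Longrightarrow> Y \<in> lie_generated S \<Longrightarrow> X + Y \<in> lie_generated S"
| scale: "X \<in> lie_generated S \<Longrightarrow> msc c X \<in> lie_generated S"
| bracket: "X \<in> lie_generated S \<Longrightarrow> Y \<in> lie_generated S \<Longrightarrow> lie_bracket X Y \<in> lie_generated S"

definition chevalley_generators :: "('n::finite, 'r::finite) group_data \<Rightarrow> bool" where
  "chevalley_generators D \<longleftrightarrow>
     (\<forall>i. gen_e D i \<in> lie_algebra (grp D) \<and>
          (\<forall>Y\<in>cartan D. lie_bracket Y (gen_e D i) = msc (sroot D i Y) (gen_e D i))) \<and>
     (\<forall>i. gen_f D i \<in> lie_algebra (grp D) \<and>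
          (\<forall>Y\<in>cartan D. lie_bracket Y (gen_f D i) = msc (- sroot D i Y) (gen_f D i))) \<and>
     (\<forall>i. lie_bracket (gen_e D i) (gen_f D i) = coroot D i) \<and>
     (\<forall>i. coroot D i \<in> cartan D \<and> sroot D i (coroot D i) = 2) \<and>
     lie_generated (range (gen_e D) \<union> range (gen_f D)) = lie_algebra (grp D)"

definition simple_group_setup :: "('n::finite, 'r::finite) group_data \<Rightarrow> bool" where
  "simple_group_setup D \<longleftrightarrow>
     simple_algebraic_group (grp D) \<and> simply_connected (grp D) \<and>
     borel_subgroup (grp D) (borel_plus D) \<and> borel_subgroup (grp D) (borel_minus D) \<and>
     maximal_torus (grp D) (max_torus D) \<and> simple_roots D \<and> chevalley_generators D"

text \<open>The integer \<open>a\<^sub>i\<^sub>j = \<langle>\<alpha>\<^sub>j, \<alpha>\<^sub>i\<^sup>\<or>\<rangle>\<close>.\<close>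
definition cartan_entry :: "('n::finite, 'r::finite) group_data \<Rightarrow> 'r \<Rightarrow> 'r \<Rightarrow> int" where
  "cartan_entry D i j = (THE k. of_int k = sroot D j (coroot D i))"

section \<open>The Weyl group\<close>

definition sreflect :: "('n::finite, 'r::finite) group_data \<Rightarrow> 'r \<Rightarrow> complex^'n^'n \<Rightarrow> complex^'n^'n" where
  "sreflect D i Y = Y - msc (sroot D i Y) (coroot D i)"

text \<open>The action of \<open>s\<^bsub>i\<^sub>1\<^esub> \<circ> \<dots> \<circ> s\<^bsub>i\<^sub>k\<^esub>\<close>; the last letter of the word acts first.\<close>
definition word_act :: "('n::finite, 'r::finite) group_data \<Rightarrow> 'r list \<Rightarrow> complex^'n^'n \<Rightarrow> complex^'n^'n" where
  "word_act D is = foldr (sreflect D) is"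

definition word_elt :: "('n::finite, 'r::finite) group_data \<Rightarrow> 'r list \<Rightarrow> complex^'n^'n \<Rightarrow> complex^'n^'n" where
  "word_elt D is = restrict (word_act D is) (cartan D)"

definition weyl_group :: "('n::finite, 'r::finite) group_data \<Rightarrow> (complex^'n^'n \<Rightarrow> complex^'n^'n) set" where
  "weyl_group D = range (word_elt D)"

definition weyl_length :: "('n::finite, 'r::finite) group_data \<Rightarrow> (complex^'n^'n \<Rightarrow> complex^'n^'n) \<Rightarrow> nat" where
  "weyl_length D w = (LEAST k. \<exists>is. length is = k \<and> word_elt D is = w)"

definition longest_element :: "('n::finite, 'r::finite) group_data \<Rightarrow> (complex^'n^'n \<Rightarrow> complex^'n^'n) \<Rightarrow> bool" where
  "longest_element D w \<longleftrightarrow> w \<in> weyl_group D \<and> (\<forall>w'\<in>weyl_group D. weyl_length D w' \<le> weyl_length D w)"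

definition reduced_word :: "('n::finite, 'r::finite) group_data \<Rightarrow> 'r list \<Rightarrow> bool" where
  "reduced_word D is \<longleftrightarrow> length is = weyl_length D (word_elt D is)"

section \<open>Miura opers\<close>

text \<open>A connection \<open>\<partial>\<^sub>z + A\<close> is represented by the matrix \<open>A\<close>.\<close>
definition gauge :: "ratfun^'n^'n \<Rightarrow> ratfun^'n^'n \<Rightarrow> ratfun^'n^'n" where
  "gauge g A = g ** A ** matrix_inv g + g ** mat_deriv (matrix_inv g)"

definition monic_family :: "('r \<Rightarrow> complex poly) \<Rightarrow> bool" where
  "monic_family p \<longleftrightarrow> (\<forall>i. lead_coeff (p i) = 1)"

definition miura_connection ::
    "('n::finite, 'r::finite) group_data \<Rightarrow> ('r \<Rightarrow> complex poly) \<Rightarrow> ('r \<Rightarrow> ratfun) \<Rightarrow> ratfun^'n^'n" where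
  "miura_connection D \<Lambda> g =
     (\<Sum>i\<in>UNIV. msc (rpoly (\<Lambda> i)) (const_mat (gen_e D i))) +
     (\<Sum>i\<in>UNIV. msc (g i) (const_mat (coroot D i)))"

definition miura_opers ::
    "('n::finite, 'r::finite) group_data \<Rightarrow> ('r \<Rightarrow> complex poly) \<Rightarrow> (ratfun^'n^'n) set" where
  "miura_opers D \<Lambda> = range (miura_connection D \<Lambda>)"

definition twisted_miura_opers ::
    "('n::finite, 'r::finite) group_data \<Rightarrow> ('r \<Rightarrow> complex poly) \<Rightarrow> complex^'n^'n \<Rightarrow> (ratfun^'n^'n) set" where
  "twisted_miura_opers D \<Lambda> Z =
     {A \<in> miura_opers D \<Lambda>. \<exists>v\<in>ratpoints (borel_plus D). A = gauge v (const_mat Z)}"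

text \<open>\<open>is_y_family D \<Lambda> Z A y\<close>: with \<open>Z = \<Sum>\<^sub>i \<zeta>\<^sub>i \<alpha>\<^sub>i\<^sup>\<or>\<close>, the oper \<open>A\<close> has \<open>g\<^sub>i = \<zeta>\<^sub>i - y\<^sub>i\<^sup>-\<^sup>1 \<partial>\<^sub>z y\<^sub>i\<close> for the
  monic polynomials \<open>y\<^sub>i\<close>.\<close>
definition is_y_family ::
    "('n::finite, 'r::finite) group_data \<Rightarrow> ('r \<Rightarrow> complex poly) \<Rightarrow> complex^'n^'n \<Rightarrow>
     ratfun^'n^'n \<Rightarrow> ('r \<Rightarrow> complex poly) \<Rightarrow> bool" where
  "is_y_family D \<Lambda> Z A y \<longleftrightarrow> monic_family y \<and>
     (\<exists>\<zeta>. Z = (\<Sum>i\<in>UNIV. msc (\<zeta> i) (coroot D i)) \<and>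
          A = miura_connection D \<Lambda> (\<lambda>i. rconst (\<zeta> i) - dlog (rpoly (y i))))"

definition nondegenerate_family ::
    "('n::finite, 'r::finite) group_data \<Rightarrow> ('r \<Rightarrow> complex poly) \<Rightarrow> ('r \<Rightarrow> complex poly) \<Rightarrow> bool" where
  "nondegenerate_family D \<Lambda> y \<longleftrightarrow>
     (\<forall>i w. Polynomial.order w (y i) \<le> 1) \<and>
     (\<forall>i. \<not> (\<exists>w. poly (y i) w = 0 \<and> poly (\<Lambda> i) w = 0)) \<and>
     (\<forall>i j. i \<noteq> j \<and> cartan_entry D i j \<noteq> 0 \<longrightarrow> \<not> (\<exists>w. poly (y i) w = 0 \<and> poly (y j) w = 0))"

definition nondegenerate_twisted_opers ::
    "('n::finite, 'r::finite) group_data \<Rightarrow> ('r \<Rightarrow> complex poly) \<Rightarrow> complex^'n^'n \<Rightarrow> (ratfun^'n^'n) set" where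
  "nondegenerate_twisted_opers D \<Lambda> Z =
     {A \<in> twisted_miura_opers D \<Lambda> Z. \<exists>y. is_y_family D \<Lambda> Z A y \<and> nondegenerate_family D \<Lambda> y}"

definition oper_polys ::
    "('n::finite, 'r::finite) group_data \<Rightarrow> ('r \<Rightarrow> complex poly) \<Rightarrow> complex^'n^'n \<Rightarrow>
     ratfun^'n^'n \<Rightarrow> 'r \<Rightarrow> complex poly" where
  "oper_polys D \<Lambda> Z A = (THE y. is_y_family D \<Lambda> Z A y)"

section \<open>The qq-system and genericity\<close>

definition wronskian :: "complex poly \<Rightarrow> complex poly \<Rightarrow> complex poly" where
  "wronskian p q = p * pderiv q - q * pderiv p"

text \<open>A candidate solution is the pair of families \<open>(q\<^sub>+, q\<^sub>-)\<close>.  The exponents \<open>- a\<^sub>j\<^sub>i\<close> with \<open>j \<noteq> i\<close>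
  are nonnegative.\<close>
type_synonym 'r qq_pair = "('r \<Rightarrow> complex poly) \<times> ('r \<Rightarrow> complex poly)"

definition qq_solution ::
    "('n::finite, 'r::finite) group_data \<Rightarrow> ('r \<Rightarrow> complex poly) \<Rightarrow> complex^'n^'n \<Rightarrow> 'r qq_pair \<Rightarrow> bool" where
  "qq_solution D \<Lambda> Z S \<longleftrightarrow> (\<forall>i.
     wronskian (fst S i) (snd S i) + smult (sroot D i Z) (fst S i * snd S i) =
     \<Lambda> i * (\<Prod>j\<in>UNIV - {i}. fst S j ^ nat (- cartan_entry D j i)))"

definition nondegenerate_qq_solution ::
    "('n::finite, 'r::finite) group_data \<Rightarrow> ('r \<Rightarrow> complex poly) \<Rightarrow> complex^'n^'n \<Rightarrow> 'r qq_pair \<Rightarrow> bool" where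
  "nondegenerate_qq_solution D \<Lambda> Z S \<longleftrightarrow>
     qq_solution D \<Lambda> Z S \<and> monic_family (fst S) \<and> nondegenerate_family D \<Lambda> (fst S)"

definition qq_connection ::
    "('n::finite, 'r::finite) group_data \<Rightarrow> ('r \<Rightarrow> complex poly) \<Rightarrow> complex^'n^'n \<Rightarrow> 'r qq_pair \<Rightarrow> ratfun^'n^'n" where
  "qq_connection D \<Lambda> Z S = const_mat Z
     - (\<Sum>i\<in>UNIV. msc (dlog (rpoly (fst S i))) (const_mat (coroot D i)))
     + (\<Sum>i\<in>UNIV. msc (rpoly (\<Lambda> i)) (const_mat (gen_e D i)))"

definition baecklund_mu ::
    "('n::finite, 'r::finite) group_data \<Rightarrow> ('r \<Rightarrow> complex poly) \<Rightarrow> complex^'n^'n \<Rightarrow> 'r qq_pair \<Rightarrow> 'r \<Rightarrow> ratfun" where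
  "baecklund_mu D \<Lambda> Z S i =
     inverse (rpoly (\<Lambda> i)) * (dlog (rpoly (snd S i) / rpoly (fst S i)) + rconst (sroot D i Z))"

definition baecklund_connection ::
    "('n::finite, 'r::finite) group_data \<Rightarrow> ('r \<Rightarrow> complex poly) \<Rightarrow> complex^'n^'n \<Rightarrow> 'r qq_pair \<Rightarrow> 'r \<Rightarrow> ratfun^'n^'n" where
  "baecklund_connection D \<Lambda> Z S i =
     gauge (nilp_exp (msc (baecklund_mu D \<Lambda> Z S i) (const_mat (gen_f D i)))) (qq_connection D \<Lambda> Z S)"

text \<open>With \<open>is = [i\<^sub>1, \<dots>, i\<^sub>k]\<close>, the suffix \<open>drop (k - l) is\<close> is \<open>[i\<^bsub>k-l+1\<^esub>, \<dots>, i\<^sub>k]\<close> and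
  \<open>is ! (k - l)\<close> is \<open>i\<^bsub>k-l+1\<^esub>\<close>.\<close>
definition word_generic ::
    "('n::finite, 'r::finite) group_data \<Rightarrow> ('r \<Rightarrow> complex poly) \<Rightarrow> complex^'n^'n \<Rightarrow> 'r list \<Rightarrow> 'r qq_pair \<Rightarrow> bool" where
  "word_generic D \<Lambda> Z is S\<^sub>0 \<longleftrightarrow> reduced_word D is \<and>
     (let k = length is; tw = (\<lambda>l. word_act D (drop (k - l) is) Z) in
      \<exists>S :: nat \<Rightarrow> 'r qq_pair. S 0 = S\<^sub>0 \<and>
        (\<forall>l\<le>k. nondegenerate_qq_solution D \<Lambda> (tw l) (S l)) \<and>
        (\<forall>l\<in>{1..k}. qq_connection D \<Lambda> (tw l) (S l) =
           baecklund_connection D \<Lambda> (tw (l - 1)) (S (l - 1)) (is ! (k - l))))"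

definition w0_generic ::
    "('n::finite, 'r::finite) group_data \<Rightarrow> ('r \<Rightarrow> complex poly) \<Rightarrow> complex^'n^'n \<Rightarrow> 'r qq_pair \<Rightarrow> bool" where
  "w0_generic D \<Lambda> Z S \<longleftrightarrow> (\<exists>is. reduced_word D is \<and> longest_element D (word_elt D is) \<and> word_generic D \<Lambda> Z is S)"

section \<open>Combinatorial data\<close>

type_synonym ('n, 'r) comb_datum =
  "('r \<Rightarrow> nat) \<times> ('r \<Rightarrow> nat) \<times> (complex^'n^'n \<Rightarrow> complex) set"

definition cartan_stratum ::
    "('n::finite, 'r::finite) group_data \<Rightarrow> (complex^'n^'n \<Rightarrow> complex) set \<Rightarrow> (complex^'n^'n) set" where
  "cartan_stratum D \<Psi> = {Y \<in> cartan D. \<forall>\<beta>\<in>all_roots D. \<beta> Y = 0 \<longleftrightarrow> \<beta> \<in> \<Psi>}"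

definition vanishing_roots ::
    "('n::finite, 'r::finite) group_data \<Rightarrow> complex^'n^'n \<Rightarrow> (complex^'n^'n \<Rightarrow> complex) set" where
  "vanishing_roots D Z = {\<beta> \<in> all_roots D. \<beta> Z = 0}"

definition admissible :: "('n::finite, 'r::finite) group_data \<Rightarrow> ('n, 'r) comb_datum \<Rightarrow> bool" where
  "admissible D dat \<longleftrightarrow> (case dat of (d, N, \<Psi>) \<Rightarrow> \<Psi> \<subseteq> all_roots D \<and>
     (\<exists>Z \<Lambda> S. Z \<in> cartan_stratum D \<Psi> \<and> monic_family \<Lambda> \<and> w0_generic D \<Lambda> Z S \<and>
        (\<forall>i. degree (\<Lambda> i) = N i) \<and> (\<forall>i. degree (fst S i) = d i)))"

definition oper_datum ::
    "('n::finite, 'r::finite) group_data \<Rightarrow> ('r \<Rightarrow> complex poly) \<Rightarrow> complex^'n^'n \<Rightarrow>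
     ratfun^'n^'n \<Rightarrow> ('n, 'r) comb_datum" where
  "oper_datum D \<Lambda> Z A =
     (\<lambda>i. degree (oper_polys D \<Lambda> Z A i), \<lambda>i. degree (\<Lambda> i), vanishing_roots D Z)"

section \<open>The Bethe Ansatz equations\<close>

text \<open>The unordered collection of Bethe roots with index \<open>i\<close> is a multiset \<open>W i\<close>.\<close>
definition bethe_poly :: "('r \<Rightarrow> complex multiset) \<Rightarrow> 'r \<Rightarrow> complex poly" where
  "bethe_poly W i = (\<Prod>w\<in>#W i. [:- w, 1:])"

definition bethe_equation ::
    "('n::finite, 'r::finite) group_data \<Rightarrow> ('r \<Rightarrow> complex poly) \<Rightarrow> complex^'n^'n \<Rightarrow>
     ('r \<Rightarrow> complex multiset) \<Rightarrow> 'r \<Rightarrow> complex \<Rightarrow> bool" where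
  "bethe_equation D \<Lambda> Z W i w \<longleftrightarrow>
     sroot D i Z + rat_eval (dlog (rpoly (\<Lambda> i) *
       (\<Prod>j\<in>UNIV. rpoly (bethe_poly W j) powi (- cartan_entry D j i)) *
       rpoly [:- w, 1:] ^ 2)) w = 0"

text \<open>In the distinctness condition one occurrence of \<open>w\<close> itself is discarded when \<open>i = j\<close>; as
  \<open>a\<^sub>i\<^sub>i = 2\<close>, it includes the distinctness of the roots with the same index.\<close>
definition bethe_solutions ::
    "('n::finite, 'r::finite) group_data \<Rightarrow> ('r \<Rightarrow> complex poly) \<Rightarrow> complex^'n^'n \<Rightarrow>
     ('r \<Rightarrow> complex multiset) set" where
  "bethe_solutions D \<Lambda> Z = {W.
     (\<forall>i. \<forall>w\<in>#W i. poly (\<Lambda> i) w \<noteq> 0) \<and>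
     (\<forall>i j. cartan_entry D j i \<noteq> 0 \<longrightarrow>
        (\<forall>w\<in>#W i. w \<notin># (if i = j then W i - {#w#} else W j))) \<and>
     (\<forall>i. \<forall>w\<in>#W i. bethe_equation D \<Lambda> Z W i w)}"

definition bethe_datum ::
    "('n::finite, 'r::finite) group_data \<Rightarrow> ('r \<Rightarrow> complex poly) \<Rightarrow> complex^'n^'n \<Rightarrow>
     ('r \<Rightarrow> complex multiset) \<Rightarrow> ('n, 'r) comb_datum" where
  "bethe_datum D \<Lambda> Z W =
     (\<lambda>i. degree (bethe_poly W i), \<lambda>i. degree (\<Lambda> i), vanishing_roots D Z)"

end

theory Submission
  imports "HOL-Complex_Analysis.Cauchy_Integral_Formula" Defs
begin

text \<open>
  Conjugate the torus into the diagonal matrices and grade all matrices by the height of the weights,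
  so that the simple root vectors have degree one.  Put
  \<open>G\<^sub>i = \<Lambda>\<^sub>i \<Prod>\<^sub>j y\<^sub>j\<^bsup>-a\<^sub>j\<^sub>i\<^esup>\<close>.  The Bethe equations say that \<open>x\<^sub>i' + \<langle>\<alpha>\<^sub>i, Z\<rangle> x\<^sub>i = G\<^sub>i\<close> has a rational solution
  \<open>x\<^sub>i\<close> for every \<open>i\<close>: the obstruction at a root \<open>w\<close> of \<open>y\<^sub>i\<close> is the residue of \<open>e\<^bsup>\<langle>\<alpha>\<^sub>i,Z\<rangle>z\<^esup> G\<^sub>i\<close>.

  If \<open>v\<close> gauges \<open>\<partial> + Z\<close> to the oper, then, after division by a constant of \<open>B\<^sub>+\<close>, its entries of degree
  one give such a solution up to a regular term.  Conversely, a rational gauge transformation in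
  \<open>B\<^sub>+\<close>, built degree by degree, brings the oper to the form \<open>\<partial> + Z + \<Sum>\<^sub>w N\<^sub>w/(z - w)\<close> with nilpotent
  \<open>N\<^sub>w\<close>.  Near \<open>w\<close> the \<open>x\<^sub>i\<close> with \<open>y\<^sub>i(w) = 0\<close> yield reflections \<open>exp(\<mu>\<^sub>i f\<^sub>i)\<close> that make the oper regular,
  and a simple pole with nilpotent residue that can be gauged away has residue zero.  Hence all
  \<open>N\<^sub>w\<close> vanish.
\<close>

no_notation fps_nth (infixl \<open>$\<close> 75)

section \<open>Rational functions\<close>

text \<open>The map sends an oper to the roots of its polynomials \<open>y\<close>; the inverse is
  the difficulty. Trivialising the oper amounts to one first order equation for every positive root.
  For a root that is not simple the right-hand side, hence its residues, is nonlinear in the earlier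
  solutions, whereas the Bethe equations speak of the simple roots only. These residues are never
  computed: the normal form collects them, and a local argument removes them together. The local
  gauge transformations are built from the global solutions x_i, so they are again rational matrices
  and no power series enter; they involve the f_i and leave B_+, which does no harm because the
  residue argument takes place among all invertible matrices.

  In the other direction nothing is assumed about the shape of the elements of B_+. The
  triangularity of the gauge transformation comes from its differential equation: off the diagonal,
  an entry of no positive degree solves a homogeneous equation with initial value 0.\<close>

definition regular_at :: "complex \<Rightarrow> ratfun \<Rightarrow> bool" where
  "regular_at w f \<longleftrightarrow> poly (snd (quot_of_fract f)) w \<noteq> 0"

abbreviation lin :: "complex \<Rightarrow> ratfun" where
  "lin w \<equiv> rpoly [:- w, 1:]"

text \<open>Coprimality of the reduced numerator and denominator excludes a common root at w, so any
  representative with nonvanishing denominator may be used.\<close>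

lemma regular_at_Fract:
  assumes "poly q w \<noteq> 0"
  shows "regular_at w (Fract p q)" and "rat_eval (Fract p q) w = poly p w / poly q w"
proof -
  obtain a b where ab: "quot_of_fract (Fract p q) = (a, b)" by (cases "quot_of_fract (Fract p q)")
  have b: "b \<noteq> 0" using snd_quot_of_fract_nonzero[of "Fract p q"] ab by simp
  have q: "q \<noteq> 0" using assms by auto
  have cop: "coprime a b" using coprime_quot_of_fract[of "Fract p q"] ab by simp
  have "Fract a b = Fract p q" using Fract_quot_of_fract[of "Fract p q"] ab by simp
  hence h: "a * q = p * b" using b q by (simp add: eq_fract)
  have h': "poly a w * poly q w = poly p w * poly b w" using arg_cong[OF h, of "\<lambda>x. poly x w"] by simp
  have bw: "poly b w \<noteq> 0"
  proof
    assume 0: "poly b w = 0"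
    hence "poly a w = 0" using h' assms by simp
    hence "[:-w,1:] dvd a" "[:-w,1:] dvd b" using 0 by (simp_all add: poly_eq_0_iff_dvd)
    hence "is_unit [:-w,1:]" using cop by (rule_tac coprime_common_divisor)
    thus False by (simp add: is_unit_iff_degree)
  qed
  show "regular_at w (Fract p q)" using bw ab by (simp add: regular_at_def)
  show "rat_eval (Fract p q) w = poly p w / poly q w"
    using bw ab h' assms by (simp add: rat_eval_def field_simps)
qed

lemma regular_atE:
  assumes "regular_at w f"
  obtains p q where "f = Fract p q" "poly q w \<noteq> 0"
  using assms unfolding regular_at_def by (metis Fract_quot_of_fract)

lemma regular_at_add: "regular_at w f \<Longrightarrow> regular_at w g \<Longrightarrow> regular_at w (f + g)"
  and rat_eval_add: "regular_at w f \<Longrightarrow> regular_at w g \<Longrightarrow> rat_eval (f + g) w = rat_eval f w + rat_eval g w"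
  and regular_at_mult: "regular_at w f \<Longrightarrow> regular_at w g \<Longrightarrow> regular_at w (f * g)"
  and rat_eval_mult: "regular_at w f \<Longrightarrow> regular_at w g \<Longrightarrow> rat_eval (f * g) w = rat_eval f w * rat_eval g w"
proof -
  assume a: "regular_at w f" "regular_at w g"
  obtain p q where f: "f = Fract p q" "poly q w \<noteq> 0" using a(1) by (rule regular_atE)
  obtain r s where g: "g = Fract r s" "poly s w \<noteq> 0" using a(2) by (rule regular_atE)
  have qs: "poly (q * s) w \<noteq> 0" "q \<noteq> 0" "s \<noteq> 0" using f g by auto
  show "regular_at w (f + g)" "rat_eval (f + g) w = rat_eval f w + rat_eval g w"
    "regular_at w (f * g)" "rat_eval (f * g) w = rat_eval f w * rat_eval g w"
    using f g qs by (simp_all add: regular_at_Fract add_frac_eq)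
qed

lemma regular_at_rpoly [simp]: "regular_at w (rpoly p)"
  and rat_eval_rpoly [simp]: "rat_eval (rpoly p) w = poly p w"
  by (simp_all add: regular_at_def rat_eval_def)

lemma regular_at_0 [simp]: "regular_at w 0" and rat_eval_0 [simp]: "rat_eval 0 w = 0"
  and regular_at_1 [simp]: "regular_at w 1" and rat_eval_1 [simp]: "rat_eval 1 w = 1"
  by (simp_all add: regular_at_def rat_eval_def)

lemma rconst_simps: "rconst 0 = 0" "rconst 1 = 1" "rconst (a + b) = rconst a + rconst b"
  "rconst (a * b) = rconst a * rconst b" "rconst (- a) = - rconst a" "rconst (a - b) = rconst a - rconst b"
  by (simp_all flip: to_fract_add to_fract_mult to_fract_uminus to_fract_diff to_fract_1 to_fract_0 add: one_pCons)

lemma rconst_sum: "rconst (sum f A) = (\<Sum>i\<in>A. rconst (f i))"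
  by (induction A rule: infinite_finite_induct) (simp_all add: rconst_simps)

lemma rconst_eq_0_iff [simp]: "rconst a = 0 \<longleftrightarrow> a = 0" by simp

lemma rconst_inverse: "rconst (inverse a) = inverse (rconst a)"
proof (cases "a = 0")
  case False
  hence "rconst (inverse a) * rconst a = 1" by (simp only: rconst_simps(4)[symmetric] left_inverse rconst_simps(2) not_False_eq_True)
  thus ?thesis by (metis inverse_unique mult.commute)
qed (simp add: rconst_simps)

lemma rconst_of_nat: "rconst (of_nat n) = of_nat n"
  by (induction n) (simp_all add: rconst_simps)

lemma rconst_of_int: "rconst (of_int n) = of_int n"
proof (cases n)
  case (nonneg m)
  then show ?thesis by (simp add: rconst_of_nat)
next
  case (neg m)
  then show ?thesis by (simp add: rconst_of_nat rconst_simps)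
qed

lemma regular_at_uminus: "regular_at w f \<Longrightarrow> regular_at w (- f)"
  and rat_eval_uminus: "regular_at w f \<Longrightarrow> rat_eval (- f) w = - rat_eval f w"
  using regular_at_mult[of w "rpoly (-1)" f] rat_eval_mult[of w "rpoly (-1)" f]
    regular_at_rpoly[of w "-1"] rat_eval_rpoly[of "-1" w] by (simp_all del: regular_at_rpoly rat_eval_rpoly)

lemma regular_at_diff: "regular_at w f \<Longrightarrow> regular_at w g \<Longrightarrow> regular_at w (f - g)"
  and rat_eval_diff: "regular_at w f \<Longrightarrow> regular_at w g \<Longrightarrow> rat_eval (f - g) w = rat_eval f w - rat_eval g w"
  using regular_at_add[of w f "- g"] rat_eval_add[of w f "- g"] regular_at_uminus[of w g] rat_eval_uminus[of w g]
  by simp_all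

lemma regular_at_inverse: "regular_at w f \<Longrightarrow> rat_eval f w \<noteq> 0 \<Longrightarrow> regular_at w (inverse f)"
  and rat_eval_inverse: "regular_at w f \<Longrightarrow> rat_eval f w \<noteq> 0 \<Longrightarrow> rat_eval (inverse f) w = inverse (rat_eval f w)"
proof -
  assume a: "regular_at w f" "rat_eval f w \<noteq> 0"
  obtain p q where f: "f = Fract p q" "poly q w \<noteq> 0" using a(1) by (rule regular_atE)
  show "regular_at w (inverse f)" "rat_eval (inverse f) w = inverse (rat_eval f w)"
    using a f by (auto simp: regular_at_Fract)
qed

lemma regular_at_sum: "(\<And>i. i \<in> A \<Longrightarrow> regular_at w (f i)) \<Longrightarrow> regular_at w (sum f A)"
  by (induction A rule: infinite_finite_induct) (simp_all add: regular_at_add)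

lemma rat_eval_sum: "(\<And>i. i \<in> A \<Longrightarrow> regular_at w (f i)) \<Longrightarrow> rat_eval (sum f A) w = (\<Sum>i\<in>A. rat_eval (f i) w)"
  by (induction A rule: infinite_finite_induct) (simp_all add: rat_eval_add regular_at_sum)

lemma regular_at_prod: "(\<And>i. i \<in> A \<Longrightarrow> regular_at w (f i)) \<Longrightarrow> regular_at w (prod f A)"
  by (induction A rule: infinite_finite_induct) (simp_all add: regular_at_mult)

lemma rat_eval_prod: "(\<And>i. i \<in> A \<Longrightarrow> regular_at w (f i)) \<Longrightarrow> rat_eval (prod f A) w = (\<Prod>i\<in>A. rat_eval (f i) w)"
  by (induction A rule: infinite_finite_induct) (simp_all add: rat_eval_mult regular_at_prod)

lemma regular_at_power: "regular_at w f \<Longrightarrow> regular_at w (f ^ n)"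
  and rat_eval_power: "regular_at w f \<Longrightarrow> rat_eval (f ^ n) w = rat_eval f w ^ n"
  by (induction n) (simp_all add: regular_at_mult rat_eval_mult)

lemma regular_at_powi: "regular_at w f \<Longrightarrow> rat_eval f w \<noteq> 0 \<Longrightarrow> regular_at w (f powi k)"
  and rat_eval_powi: "regular_at w f \<Longrightarrow> rat_eval f w \<noteq> 0 \<Longrightarrow> rat_eval (f powi k) w = rat_eval f w powi k"
  by (auto simp: power_int_def regular_at_power rat_eval_power regular_at_inverse rat_eval_inverse)

lemma eventually_regular_at: "\<forall>\<^sub>F w in cofinite. regular_at w f"
  unfolding eventually_cofinite regular_at_def by (simp add: poly_roots_finite)

text \<open>Otherwise the numerator of the difference would have infinitely many roots. This is the
  passage from the complex points of a group to C(z): identities are checked at almost every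
  point.\<close>

lemma ratfun_eqI:
  assumes "\<forall>\<^sub>F w in cofinite. rat_eval f w = rat_eval g w"
  shows "f = g"
proof (rule ccontr)
  assume "f \<noteq> g"
  hence n: "fst (quot_of_fract (f - g)) \<noteq> 0" by simp
  have "\<forall>\<^sub>F w in cofinite. poly (fst (quot_of_fract (f - g))) w \<noteq> 0"
    unfolding eventually_cofinite using n by (simp add: poly_roots_finite)
  with assms eventually_regular_at[of f] eventually_regular_at[of g] eventually_regular_at[of "f - g"]
  have "\<forall>\<^sub>F w::complex in cofinite. False"
  proof eventually_elim
    case (elim w)
    hence "rat_eval (f - g) w = 0" by (simp add: rat_eval_diff)
    thus ?case using elim by (simp add: rat_eval_def[of "f - g"] regular_at_def)
  qed
  thus False by (simp add: infinite_UNIV_char_0)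
qed

lemma eventually_rat_eval_nonzero: "f \<noteq> 0 \<Longrightarrow> \<forall>\<^sub>F w in cofinite. rat_eval f w \<noteq> 0"
  unfolding eventually_cofinite rat_eval_def
  by (rule finite_subset[of _ "{w. poly (fst (quot_of_fract f)) w = 0} \<union> {w. poly (snd (quot_of_fract f)) w = 0}"])
     (auto simp: poly_roots_finite)

subsection \<open>Derivation\<close>

lemma ratfun_cases: obtains p q where "f = Fract p q" "q \<noteq> 0"
  by (cases f)

lemma rderiv_add: "rderiv (f + g) = rderiv f + rderiv g"
proof -
  obtain p q where f: "f = Fract p q" "q \<noteq> 0" by (rule ratfun_cases)
  obtain r s where g: "g = Fract r s" "s \<noteq> 0" by (rule ratfun_cases)
  show ?thesis using f g
    by (simp add: rderiv_Fract eq_fract pderiv_mult pderiv_add) (simp add: algebra_simps)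
qed

lemma rderiv_mult: "rderiv (f * g) = rderiv f * g + f * rderiv g"
proof -
  obtain p q where f: "f = Fract p q" "q \<noteq> 0" by (rule ratfun_cases)
  obtain r s where g: "g = Fract r s" "s \<noteq> 0" by (rule ratfun_cases)
  show ?thesis using f g
    by (simp add: rderiv_Fract eq_fract pderiv_mult pderiv_add) (simp add: algebra_simps)
qed

lemma rderiv_rpoly: "rderiv (rpoly p) = rpoly (pderiv p)"
  unfolding to_fract_def by (subst rderiv_Fract) (simp_all add: eq_fract)

lemma rderiv_rconst [simp]: "rderiv (rconst c) = 0"
  by (simp add: rderiv_rpoly pderiv_pCons)

lemma rderiv_0 [simp]: "rderiv 0 = 0" and rderiv_1 [simp]: "rderiv 1 = 0"
  using rderiv_rconst[of 0] rderiv_rconst[of 1] by (simp_all only: rconst_simps)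

lemma rderiv_lin [simp]: "rderiv (lin w) = 1"
  by (simp add: rderiv_rpoly pderiv_pCons one_pCons flip: to_fract_1)

lemma rderiv_cmult: "rderiv (rconst c * f) = rconst c * rderiv f"
  by (simp add: rderiv_mult)

lemma rderiv_uminus: "rderiv (- f) = - rderiv f"
proof -
  have "rderiv (- f) + rderiv f = rderiv 0" unfolding rderiv_add[symmetric] by simp
  thus ?thesis by (simp add: eq_neg_iff_add_eq_0)
qed

lemma rderiv_diff: "rderiv (f - g) = rderiv f - rderiv g"
  using rderiv_add[of f "- g"] by (simp add: rderiv_uminus)

lemma rderiv_sum: "rderiv (sum f A) = (\<Sum>i\<in>A. rderiv (f i))"
  by (induction A rule: infinite_finite_induct) (simp_all add: rderiv_add)

lemma rderiv_inverse: "rderiv (inverse f) = - rderiv f / f\<^sup>2"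
proof (cases "f = 0")
  case False
  have "0 = rderiv (f * inverse f)" using False by simp
  also have "\<dots> = rderiv f * inverse f + f * rderiv (inverse f)" by (simp add: rderiv_mult)
  finally have "f * rderiv (inverse f) = - rderiv f * inverse f" by (simp add: eq_neg_iff_add_eq_0 add.commute)
  hence "rderiv (inverse f) = (- rderiv f * inverse f) / f" using False
    by (metis nonzero_mult_div_cancel_left)
  thus ?thesis by (simp add: divide_inverse power2_eq_square mult.assoc)
qed simp

lemma regular_at_rderiv: "regular_at w f \<Longrightarrow> regular_at w (rderiv f)"
proof -
  assume "regular_at w f"
  then obtain p q where f: "f = Fract p q" "poly q w \<noteq> 0" by (rule regular_atE)
  hence "q \<noteq> 0" by auto
  thus ?thesis using f by (simp add: rderiv_Fract regular_at_Fract)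
qed

lemma DERIV_rat_eval:
  assumes "regular_at w f"
  shows "(rat_eval f has_field_derivative rat_eval (rderiv f) w) (at w)"
proof -
  obtain p q where f: "f = Fract p q" "poly q w \<noteq> 0" using assms by (rule regular_atE)
  hence q: "q \<noteq> 0" by auto
  have "((\<lambda>s. poly p s / poly q s) has_field_derivative
      (poly (pderiv p) w * poly q w - poly p w * poly (pderiv q) w) / (poly q w * poly q w)) (at w)"
    using f by (auto intro!: derivative_eq_intros)
  moreover have "\<forall>\<^sub>F s in nhds w. poly q s \<noteq> 0"
    using f(2) by (intro eventually_nhds_in_open[of "{s. poly q s \<noteq> 0}", simplified])
       (auto simp: open_Collect_neq continuous_intros)
  hence "\<forall>\<^sub>F s in nhds w. rat_eval f s = poly p s / poly q s"
    by eventually_elim (simp add: f regular_at_Fract)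
  ultimately show ?thesis
    using f q by (subst DERIV_cong_ev[OF refl _ refl]) (auto simp: rderiv_Fract regular_at_Fract)
qed

lemma dlog_mult: "f \<noteq> 0 \<Longrightarrow> g \<noteq> 0 \<Longrightarrow> dlog (f * g) = dlog f + dlog g"
  by (simp add: dlog_def rderiv_mult field_simps)

lemma dlog_1 [simp]: "dlog 1 = 0" by (simp add: dlog_def)

lemma dlog_inverse: "dlog (inverse f) = - dlog f"
  by (cases "f = 0") (simp_all add: dlog_def rderiv_inverse power2_eq_square)

lemma dlog_power: "dlog (f ^ n) = of_nat n * dlog f"
  by (cases "f = 0"; induction n) (simp_all add: dlog_mult algebra_simps, simp_all add: dlog_def)

lemma dlog_powi: "dlog (f powi k) = of_int k * dlog f"
  by (auto simp: power_int_def dlog_power dlog_inverse)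

lemma dlog_prod: "(\<And>i. i \<in> A \<Longrightarrow> f i \<noteq> 0) \<Longrightarrow> dlog (prod f A) = (\<Sum>i\<in>A. dlog (f i))"
  by (induction A rule: infinite_finite_induct) (simp_all add: dlog_mult)

lemma rderiv_eq_dlog: "f \<noteq> 0 \<Longrightarrow> rderiv f = dlog f * f"
  by (simp add: dlog_def)

text \<open>The function exp(k z) is not rational for nonzero k: p' q - p q' has smaller degree than
  p q, so k = 0. Then coprimality gives that q divides q' and p divides p', and both are
  constant.\<close>

lemma dlog_const_imp:
  assumes f: "f \<noteq> 0" and d: "dlog f = rconst k"
  shows "k = 0" and "\<exists>c. c \<noteq> 0 \<and> f = rconst c"
proof -
  define p q where "p = fst (quot_of_fract f)" and "q = snd (quot_of_fract f)"
  have pq: "f = Fract p q" "q \<noteq> 0" "p \<noteq> 0" "coprime p q"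
    using f by (auto simp: p_def q_def coprime_quot_of_fract)
  have "rderiv f = rconst k * f" using f d by (simp add: dlog_def field_simps)
  hence "Fract (pderiv p * q - p * pderiv q) (q * q) = Fract (smult k p) q"
    using pq by (simp add: rderiv_Fract to_fract_def)
  hence "(pderiv p * q - p * pderiv q) * q = smult k p * (q * q)" using pq by (simp add: eq_fract)
  hence "(pderiv p * q - p * pderiv q) * q = smult k (p * q) * q" by (simp add: mult.assoc)
  hence e: "pderiv p * q - p * pderiv q = smult k (p * q)" using pq(2) mult_right_cancel by blast
  show k: "k = 0"
  proof (rule ccontr)
    assume k: "k \<noteq> 0"
    have dp: "degree (pderiv p) = degree p - 1" "degree (pderiv q) = degree q - 1" by (simp_all add: degree_pderiv)
    \<comment> \<open>If both degrees are 0, the truncated difference gives no strict bound; the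
      second conjunct covers this case.\<close>
    have "degree (pderiv p * q - p * pderiv q) \<le> degree p + degree q - 1 \<and> (degree p + degree q = 0 \<longrightarrow> pderiv p * q - p * pderiv q = 0)"
    proof (cases "degree p + degree q = 0")
      case True
      hence "pderiv p = 0" "pderiv q = 0" by (simp_all add: pderiv_eq_0_iff)
      then show ?thesis by simp
    next
      case False
      have "degree (pderiv p * q) \<le> degree p + degree q - 1"
      proof (cases "degree p = 0")
        case True
        hence "pderiv p = 0" by (simp add: pderiv_eq_0_iff)
        then show ?thesis by simp
      next
        case False
        then show ?thesis using degree_mult_le[of "pderiv p" q] dp by linarith
      qed
      moreover have "degree (p * pderiv q) \<le> degree p + degree q - 1"
      proof (cases "degree q = 0")
        case True
        hence "pderiv q = 0" by (simp add: pderiv_eq_0_iff)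
        then show ?thesis by simp
      next
        case False
        then show ?thesis using degree_mult_le[of p "pderiv q"] dp by linarith
      qed
      ultimately show ?thesis using degree_diff_le False by auto
    qed
    moreover have "degree (smult k (p * q)) = degree p + degree q" using k pq by (simp add: degree_mult_eq)
    moreover have "smult k (p * q) \<noteq> 0" using k pq by simp
    ultimately show False using e by force
  qed
  have e0: "pderiv p * q = p * pderiv q" using e k by simp
  have "q dvd p * pderiv q" using e0 by (metis dvd_triv_right)
  hence "q dvd pderiv q" using pq(4) by (metis coprime_commute coprime_dvd_mult_right_iff)
  hence q0: "degree q = 0" by (metis not_dvd_pderiv)
  have "p dvd pderiv p * q" using e0 by (metis dvd_triv_left)
  hence "p dvd pderiv p" using pq(4) by (metis coprime_dvd_mult_left_iff)
  hence p0: "degree p = 0" by (metis not_dvd_pderiv)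
  obtain a b where "p = [:a:]" "q = [:b:]" using p0 q0 by (meson degree_eq_zeroE)
  hence "f = rconst (a / b)" "a / b \<noteq> 0" using pq by (simp_all add: to_fract_def eq_fract)
  thus "\<exists>c. c \<noteq> 0 \<and> f = rconst c" by blast
qed

text \<open>The quotient has logarithmic derivative 0, hence is constant, and the leading
  coefficients make it 1. This is the source of the uniqueness of the \<open>y\<close> of an
  oper.\<close>

lemma dlog_rpoly_inj:
  assumes "lead_coeff p = 1" "lead_coeff q = 1" "dlog (rpoly p) = dlog (rpoly q)"
  shows "p = q"
proof -
  have nz: "rpoly p \<noteq> 0" "rpoly q \<noteq> 0" using assms by auto
  have "dlog (rpoly p * inverse (rpoly q)) = rconst 0"
    using nz assms(3) by (simp add: dlog_mult dlog_inverse rconst_simps)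
  then obtain c where c: "rpoly p * inverse (rpoly q) = rconst c"
    using dlog_const_imp(2)[of "rpoly p * inverse (rpoly q)" 0] nz by auto
  hence "rpoly p = rconst c * rpoly q" using nz by (simp add: field_simps)
  hence "rpoly p = rpoly (smult c q)" by (simp flip: to_fract_mult)
  hence "p = smult c q" by simp
  moreover have "lead_coeff p = c * lead_coeff q" unfolding \<open>p = smult c q\<close> by (rule lead_coeff_smult)
  hence "c = 1" by (simp only: assms mult_1_right)
  ultimately show ?thesis by simp
qed

subsection \<open>Pole orders\<close>

lemma lin_nonzero [simp]: "lin w \<noteq> 0"
  by simp

lemma ratfun_order:
  assumes "f \<noteq> 0"
  obtains m :: int and g where "f = lin w powi m * g" "regular_at w g" "rat_eval g w \<noteq> 0"
proof -
  have poly_order: "\<exists>n r. p = [:-w,1:] ^ n * r \<and> poly r w \<noteq> 0" if p: "p \<noteq> 0" for p :: "complex poly"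
  proof -
    obtain r where "p = [:-w,1:] ^ Polynomial.order w p * r" "\<not> [:-w,1:] dvd r"
      using order_decomp[OF p] by blast
    thus ?thesis by (metis poly_eq_0_iff_dvd)
  qed
  obtain p q where pq: "f = Fract p q" "q \<noteq> 0" "p \<noteq> 0"
    using assms by (metis ratfun_cases Zero_fract_def eq_fract(1) mult_zero_left one_neq_zero)
  obtain a r where ar: "p = [:-w,1:] ^ a * r" "poly r w \<noteq> 0" using poly_order[OF pq(3)] by blast
  obtain b s where bs: "q = [:-w,1:] ^ b * s" "poly s w \<noteq> 0" using poly_order[OF pq(2)] by blast
  have rp: "rpoly (p ^ n) = rpoly p ^ n" for p :: "complex poly" and n by (induction n) simp_all
  have "f = (rpoly ([:-w,1:] ^ a) * rpoly r) / (rpoly ([:-w,1:] ^ b) * rpoly s)"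
    using pq(1) ar bs by (simp add: Fract_conv_to_fract)
  also have "\<dots> = (lin w ^ a / lin w ^ b) * (rpoly r / rpoly s)" by (simp only: rp times_divide_times_eq)
  also have "lin w ^ a / lin w ^ b = lin w powi (int a - int b)" by (simp add: power_int_diff)
  finally have "f = lin w powi (int a - int b) * Fract r s" by (simp add: Fract_conv_to_fract)
  moreover have "regular_at w (Fract r s)" "rat_eval (Fract r s) w \<noteq> 0" using ar bs by (simp_all add: regular_at_Fract)
  ultimately show ?thesis using that by blast
qed

lemma regular_at_lin_powi: "0 \<le> k \<Longrightarrow> regular_at w (lin w powi k)"
  by (simp add: power_int_def regular_at_power)

lemma rat_eval_lin_powi: "0 < k \<Longrightarrow> rat_eval (lin w powi k) w = 0"
  by (simp add: power_int_def rat_eval_power)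

lemma rderiv_powi: "f \<noteq> 0 \<Longrightarrow> rderiv (f powi m) = of_int m * f powi (m - 1) * rderiv f"
  using rderiv_eq_dlog[of "f powi m"] by (simp add: dlog_powi power_int_diff) (simp add: dlog_def field_simps)

lemma of_int_ratfun: "(of_int m :: ratfun) = rconst (of_int m)"
  by (simp add: rconst_of_int)

text \<open>With \<open>H/t\<^sup>2\<close> a double pole at \<open>t = z - w = 0\<close>, the residue of \<open>e\<^bsup>cz\<^esup> H/t\<^sup>2\<close> is \<open>e\<^bsup>cw\<^esup> (H'(w) + c H(w))\<close>;
  it is this quantity that obstructs the solution of \<open>x' + c x = H/t\<^sup>2\<close>.\<close>
lemma first_order_residue:
  assumes eq: "rderiv x + rconst c * x + rconst \<rho> / lin w + s = H / (lin w)\<^sup>2"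
    and s: "regular_at w s" and H: "regular_at w H"
  shows "regular_at w (lin w * x)" "rat_eval (lin w * x) w = - rat_eval H w"
    "\<rho> = rat_eval (rderiv H) w + c * rat_eval H w"
proof -
  let ?t = "lin w"
  have "regular_at w (?t * x)"
  proof (cases "x = 0")
    case False
    obtain m g where mg: "x = ?t powi m * g" "regular_at w g" "rat_eval g w \<noteq> 0"
      using ratfun_order[OF False] .
    show ?thesis
    proof (cases "m \<ge> -1")
      case True
      have "?t * x = ?t powi (m + 1) * g" using mg by (simp add: power_int_add_1)
      moreover have "regular_at w (?t powi (m + 1) * g)"
        using True mg(2) by (intro regular_at_mult regular_at_lin_powi) simp_all
      ultimately show ?thesis by (simp only:)
    next
      case False
      \<comment> \<open>A pole of x of order - m, at least 2, would give x' a pole of order 1 - m,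
        higher than that of every other term. After multiplication by t^(1 - m) only m g(w) survives
        at w.\<close>
      have e1: "?t powi (1 - m) * rderiv x = rconst (of_int m) * g + ?t * rderiv g"
        unfolding mg(1) by (simp add: rderiv_mult rderiv_powi of_int_ratfun power_int_diff field_simps)
      have e2: "?t powi (1 - m) * (rconst c * x) = rconst c * ?t * g"
        unfolding mg(1) by (simp add: power_int_diff)
      have e3: "?t powi (1 - m) * (rconst \<rho> / ?t) = rconst \<rho> * ?t powi (- m)"
        by (simp add: power_int_diff power_int_minus divide_inverse)
      have e4: "?t powi (1 - m) * (H / ?t\<^sup>2) = H * ?t powi (-1 - m)"
        by (simp add: power_int_diff power_int_minus divide_inverse power2_eq_square)
      have "rconst (of_int m) * g + ?t * rderiv g + rconst c * ?t * g + rconst \<rho> * ?t powi (- m) + ?t powi (1 - m) * s = H * ?t powi (-1 - m)"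
        using arg_cong[OF eq, of "\<lambda>y. ?t powi (1 - m) * y"] by (simp only: distrib_left e1 e2 e3 e4)
      from arg_cong[OF this, of "\<lambda>y. rat_eval y w"] have "of_int m * rat_eval g w = 0"
        using False mg(2) s H
        by (simp add: rat_eval_add rat_eval_mult regular_at_add regular_at_mult regular_at_lin_powi rat_eval_lin_powi regular_at_rderiv)
      thus ?thesis using False mg(3) by simp
    qed
  qed simp
  thus reg: "regular_at w (?t * x)" .
  define X where "X = ?t * x"
  have X: "regular_at w X" using reg by (simp add: X_def)
  have x: "x = X * inverse ?t" by (simp add: X_def)
  have "rderiv x = rderiv X * inverse ?t - X * (inverse ?t)\<^sup>2"
    unfolding x by (simp add: rderiv_mult rderiv_inverse power2_eq_square divide_inverse)
  moreover have "H = ?t\<^sup>2 * (rderiv x + rconst c * x + rconst \<rho> / ?t + s)" using eq by simp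
  ultimately have "H = ?t\<^sup>2 * (rderiv X * inverse ?t - X * (inverse ?t)\<^sup>2 + rconst c * (X * inverse ?t) + rconst \<rho> * inverse ?t + s)"
    unfolding x divide_inverse by (simp only:)
  moreover have ring: "t\<^sup>2 * (a * i - b * i\<^sup>2 + c * (b * i) + r * i + s) = t * a - b + c * t * b + r * t + t\<^sup>2 * s"
    if "t * i = 1" for t i a b c r s :: ratfun
  proof -
    have "t\<^sup>2 * (a * i - b * i\<^sup>2 + c * (b * i) + r * i + s)
      = (t * i) * (t * a) - (t * i) * (t * i) * b + (t * i) * (c * t * b) + (t * i) * (r * t) + t\<^sup>2 * s"
      by (simp only: power2_eq_square algebra_simps)
    thus ?thesis by (simp only: that mult_1_left)
  qed
  ultimately have e: "H = ?t * rderiv X - X + rconst c * ?t * X + rconst \<rho> * ?t + ?t\<^sup>2 * s"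
    unfolding ring[OF right_inverse[OF lin_nonzero]] by (simp only:)
  from arg_cong[OF e, of "\<lambda>y. rat_eval y w"] show e0: "rat_eval (?t * x) w = - rat_eval H w"
    using X s by (simp add: X_def[symmetric] rat_eval_add rat_eval_diff rat_eval_mult regular_at_add regular_at_diff regular_at_mult regular_at_rderiv regular_at_power rat_eval_power)
  \<comment> \<open>In the derivative of \<open>e\<close> the two terms in X' cancel; at w it reads
    H'(w) = c X(w) + \<rho>, and X(w) = - H(w) is already known.\<close>
  have "rderiv H = ?t * rderiv (rderiv X) + rconst c * X + rconst c * ?t * rderiv X + rconst \<rho> + 2 * ?t * s + ?t\<^sup>2 * rderiv s"
    unfolding e by (simp add: rderiv_add rderiv_diff rderiv_mult power2_eq_square algebra_simps)
  also have "2 = rpoly 2" by (metis of_nat_numeral rconst_of_nat numeral_poly)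
  finally have "rat_eval (rderiv H) w = c * rat_eval X w + \<rho>"
    using X s by (simp add: rat_eval_add rat_eval_diff rat_eval_mult regular_at_add regular_at_diff regular_at_mult regular_at_rderiv regular_at_power rat_eval_power)
  thus "\<rho> = rat_eval (rderiv H) w + c * rat_eval H w" using e0 by (simp add: X_def)
qed

subsection \<open>First order equations modulo simple poles\<close>

definition simple_poles :: "ratfun set" where
  "simple_poles = {s. \<exists>W \<rho>. finite W \<and> s = (\<Sum>w\<in>W. rconst (\<rho> w) / lin w)}"

lemma simple_poles_0: "0 \<in> simple_poles"
  unfolding simple_poles_def by (auto intro!: exI[of _ "{}"])

lemma simple_poles_single: "rconst \<rho> / lin w \<in> simple_poles"
  unfolding simple_poles_def by (auto intro!: exI[of _ "{w}"] exI[of _ "\<lambda>_. \<rho>"])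

lemma simple_poles_add:
  assumes "s \<in> simple_poles" "t \<in> simple_poles" shows "s + t \<in> simple_poles"
proof -
  obtain W \<rho> where W: "finite W" "s = (\<Sum>w\<in>W. rconst (\<rho> w) / lin w)" using assms(1) by (auto simp: simple_poles_def)
  obtain V \<sigma> where V: "finite V" "t = (\<Sum>w\<in>V. rconst (\<sigma> w) / lin w)" using assms(2) by (auto simp: simple_poles_def)
  have "s = (\<Sum>w\<in>W \<union> V. rconst (if w \<in> W then \<rho> w else 0) / lin w)"
    unfolding W using W V by (intro sum.mono_neutral_cong_left) (auto simp: rconst_simps)
  moreover have "t = (\<Sum>w\<in>W \<union> V. rconst (if w \<in> V then \<sigma> w else 0) / lin w)"
    unfolding V using W V by (intro sum.mono_neutral_cong_left) (auto simp: rconst_simps)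
  ultimately have "s + t = (\<Sum>w\<in>W \<union> V. rconst ((if w \<in> W then \<rho> w else 0) + (if w \<in> V then \<sigma> w else 0)) / lin w)"
    by (simp only: sum.distrib[symmetric] add_divide_distrib rconst_simps)
  thus ?thesis unfolding simple_poles_def using W(1) V(1)
    by (intro CollectI exI[of _ "W \<union> V"] exI[of _ "\<lambda>w. (if w \<in> W then \<rho> w else 0) + (if w \<in> V then \<sigma> w else 0)"]) simp
qed

text \<open>Induction on the degree of the denominator. At a root w of order m + 1, with cofactor r,
  the term with coefficient b = p(w)/r(w) is split off: then p - b r vanishes at w and one factor z
  - w cancels from the rest.\<close>

lemma partial_fraction_induct:
  assumes add: "\<And>f g. P f \<Longrightarrow> P g \<Longrightarrow> P (f + g)"
    and mon: "\<And>a n. P (rpoly (monom a n))"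
    and pol: "\<And>a w n. P (rconst a * inverse (lin w) ^ Suc n)"
  shows "P f"
proof -
  have poly: "P (rpoly p)" for p
  proof -
    have sum: "P (sum h A)" if "finite A" "\<And>i. P (h i)" for h and A :: "nat set"
      using that(1) by (induction A rule: finite_induct) (use mon[of 0 0] that add in \<open>simp_all add: monom_0\<close>)
    have "rpoly p = (\<Sum>i\<le>degree p. rpoly (monom (coeff p i) i))"
      by (subst poly_as_sum_of_monoms[symmetric]) (rule to_fract_sum)
    thus ?thesis using sum mon by simp
  qed
  have "\<forall>p q. q \<noteq> 0 \<longrightarrow> degree q = n \<longrightarrow> P (Fract p q)" for n
  proof (induction n)
    case 0
    show ?case
    proof (intro allI impI)
      fix p q :: "complex poly" assume q: "q \<noteq> 0" "degree q = 0"
      then obtain b where b: "q = [:b:]" "b \<noteq> 0" by (metis degree_eq_zeroE pCons_eq_0_iff)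
      have "Fract p q = rpoly (smult (inverse b) p)" using b by (simp add: to_fract_def eq_fract)
      thus "P (Fract p q)" using poly by simp
    qed
  next
    case (Suc n)
    show ?case
    proof (intro allI impI)
      fix p q :: "complex poly" assume q: "q \<noteq> 0" "degree q = Suc n"
      obtain w where w: "poly q w = 0"
        using q(2) fundamental_theorem_of_algebra_alt[of q] by (metis degree_pCons_0 nat.distinct(1))
      obtain r where r: "q = [:-w,1:] ^ Polynomial.order w q * r" "\<not> [:-w,1:] dvd r"
        using order_decomp[OF q(1)] by blast
      have "Polynomial.order w q \<noteq> 0" using w q order_root by blast
      then obtain m where m: "Polynomial.order w q = Suc m" using not0_implies_Suc by blast
      define b where "b = poly p w / poly r w"
      have rw: "poly r w \<noteq> 0" using r(2) by (simp add: poly_eq_0_iff_dvd)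
      have "poly (p - smult b r) w = 0" using rw by (simp add: b_def)
      hence "[:-w,1:] dvd p - smult b r" by (simp only: poly_eq_0_iff_dvd)
      then obtain p2 where p2: "p - smult b r = [:-w,1:] * p2" by (rule dvdE)
      have q2: "[:-w,1:] ^ m * r \<noteq> 0" using q(1) r(1) m by auto
      have "q = [:-w,1:] * ([:-w,1:] ^ m * r)" using r(1) unfolding m power_Suc mult.assoc .
      hence "degree q = degree [:-w,1:] + degree ([:-w,1:] ^ m * r)" using q2 by (metis degree_mult_eq pCons_eq_0_iff one_neq_zero)
      hence "degree ([:-w,1:] ^ m * r) = n" using q(2) by simp
      hence P2: "P (Fract p2 ([:-w,1:] ^ m * r))" using Suc q2 by blast
      have p: "p = [:-w,1:] * p2 + smult b r" using p2 by (simp add: algebra_simps)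
      have r0: "r \<noteq> 0" using rw by auto
      have "Fract p q = Fract ([:-w,1:] * p2) q + Fract (smult b r) q"
        unfolding Fract_conv_to_fract by (subst p) (simp only: to_fract_add add_divide_distrib)
      also have "Fract ([:-w,1:] * p2) q = Fract p2 ([:-w,1:] ^ m * r)"
        unfolding \<open>q = [:-w,1:] * ([:-w,1:] ^ m * r)\<close> by (rule mult_fract_cancel) simp
      also have "Fract (smult b r) q = rconst b * inverse (lin w) ^ Suc m"
      proof -
        have rp: "rpoly (p ^ n) = rpoly p ^ n" for p :: "complex poly" and n by (induction n) simp_all
        have q': "q = [:-w,1:] ^ Suc m * r" using r(1) unfolding m .
        have "Fract (smult b r) q = (rconst b * rpoly r) / (lin w ^ Suc m * rpoly r)"
          unfolding q' Fract_conv_to_fract to_fract_mult rp by (simp only: to_fract_mult[symmetric] mult_pCons_left) simp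
        thus ?thesis using r0 by (simp add: field_simps del: power_Suc)
      qed
      finally show "P (Fract p q)" using add P2 pol by simp
    qed
  qed
  thus ?thesis by (metis ratfun_cases)
qed

text \<open>Integration by parts lowers the degree of a monomial when c is nonzero, and lowers the
  order of a pole down to 1; for c = 0 a monomial is a derivative and the procedure is Hermite
  reduction. What cannot be removed in this way is a sum of simple poles.\<close>

lemma first_order_mod_simple_poles:
  "\<exists>x. \<exists>s\<in>simple_poles. g = rderiv x + rconst c * x + s"
proof (induction g rule: partial_fraction_induct)
  case (1 f g)
  then obtain x s y t where "s \<in> simple_poles" "t \<in> simple_poles"
    "f = rderiv x + rconst c * x + s" "g = rderiv y + rconst c * y + t" by blast
  hence "f + g = rderiv (x + y) + rconst c * (x + y) + (s + t)" "s + t \<in> simple_poles"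
    by (simp_all add: rderiv_add algebra_simps simple_poles_add)
  thus ?case by blast
next
  case (2 a n)
  have "\<exists>x. rpoly (monom a n) = rderiv x + rconst c * x"
  proof (cases "c = 0")
    case True
    have "rpoly (monom a n) = rderiv (rpoly (monom (a / of_nat (Suc n)) (Suc n)))"
      by (simp add: rderiv_rpoly pderiv_monom del: of_nat_Suc)
    thus ?thesis using True by (auto simp: rconst_simps)
  next
    case False
    show ?thesis
    proof (induction n arbitrary: a)
      case 0
      have "rpoly (monom a 0) = rderiv (rconst (a / c)) + rconst c * rconst (a / c)"
        using False by (simp add: monom_0 flip: to_fract_mult)
      then show ?case by blast
    next
      case (Suc n)
      obtain y where y: "rpoly (monom (- (of_nat (Suc n) * a / c)) n) = rderiv y + rconst c * y" using Suc by blast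
      have "rpoly (monom a (Suc n)) = rpoly (monom (of_nat (Suc n) * a / c) n) + rconst c * rpoly (monom (a / c) (Suc n)) - rpoly (monom (of_nat (Suc n) * a / c) n)"
        using False by (simp add: smult_monom flip: to_fract_mult)
      also have "\<dots> = rderiv (rpoly (monom (a / c) (Suc n))) + rconst c * rpoly (monom (a / c) (Suc n)) + (rderiv y + rconst c * y)"
        unfolding y[symmetric] by (simp add: rderiv_rpoly pderiv_monom minus_monom[symmetric] del: of_nat_Suc)
      also have "\<dots> = rderiv (rpoly (monom (a / c) (Suc n)) + y) + rconst c * (rpoly (monom (a / c) (Suc n)) + y)"
        by (simp add: rderiv_add algebra_simps)
      finally show ?case by blast
    qed
  qed
  thus ?case using simple_poles_0 by (metis add.right_neutral)
next
  case (3 a w n)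
  show ?case
  proof (induction n arbitrary: a)
    case 0
    have "rconst a * inverse (lin w) ^ Suc 0 = rderiv 0 + rconst c * 0 + rconst a / lin w" by (simp add: divide_inverse)
    then show ?case using simple_poles_single by blast
  next
    case (Suc n)
    \<comment> \<open>\<open>y\<close> integrates the polar term of order n + 2; the error - c y has
      order n + 1 and falls to the induction hypothesis.\<close>
    define y where "y = rconst (- a / of_nat (Suc n)) * inverse (lin w) ^ Suc n"
    obtain x s where x: "s \<in> simple_poles" "rconst (- (c * (- a / of_nat (Suc n)))) * inverse (lin w) ^ Suc n = rderiv x + rconst c * x + s"
      using Suc by blast
    have "rderiv (inverse (lin w) ^ Suc n) = dlog (inverse (lin w) ^ Suc n) * inverse (lin w) ^ Suc n"
      by (rule rderiv_eq_dlog) simp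
    also have "dlog (inverse (lin w) ^ Suc n) = rconst (of_nat (Suc n)) * - inverse (lin w)"
      by (simp only: dlog_power dlog_inverse rconst_of_nat) (simp add: dlog_def divide_inverse)
    finally have d: "rderiv (inverse (lin w) ^ Suc n) = rconst (- of_nat (Suc n)) * inverse (lin w) ^ Suc (Suc n)"
      by (simp only: rconst_simps power_Suc) (simp only: mult_minus_left mult_minus_right mult_ac)
    have "rderiv y = rconst (- a / of_nat (Suc n)) * rconst (- of_nat (Suc n)) * inverse (lin w) ^ Suc (Suc n)"
      unfolding y_def rderiv_cmult d by (simp only: mult.assoc)
    also have "rconst (- a / of_nat (Suc n)) * rconst (- of_nat (Suc n)) = rconst a"
      unfolding rconst_simps(4)[symmetric] by (simp del: of_nat_Suc)
    finally have dy: "rderiv y = rconst a * inverse (lin w) ^ Suc (Suc n)" .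
    have "rconst a * inverse (lin w) ^ Suc (Suc n) = rderiv y + rconst c * y + (rderiv x + rconst c * x + s)"
      unfolding x(2)[symmetric] dy unfolding y_def rconst_simps
      by (simp only: mult.assoc mult_minus_left add.assoc right_minus add_0_right)
    also have "\<dots> = rderiv (x + y) + rconst c * (x + y) + s" by (simp add: rderiv_add algebra_simps)
    finally show ?case using x(1) by blast
  qed
qed

section \<open>Matrices over rational functions\<close>

lemma msc_nth [simp]: "msc c A $ i $ j = c * A $ i $ j"
  by (simp add: msc_def)

lemma const_mat_nth [simp]: "const_mat A $ i $ j = rconst (A $ i $ j)"
  by (simp add: const_mat_def)

lemma mat_deriv_nth [simp]: "mat_deriv A $ i $ j = rderiv (A $ i $ j)"
  by (simp add: mat_deriv_def)

lemma mat_mult_nth: "(A ** B) $ i $ j = (\<Sum>k\<in>UNIV. A $ i $ k * B $ k $ j)"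
  by (simp add: matrix_matrix_mult_def)

lemma mat_eqI: "(\<And>i j. A $ i $ j = B $ i $ j) \<Longrightarrow> A = B" for A B :: "'a^'n^'m"
  by (simp add: vec_eq_iff)

lemma mat_one_nth: "(mat 1 :: 'a::zero_neq_one^'n^'n) $ i $ j = (if i = j then 1 else 0)"
  by (simp add: mat_def)

lemma matrix_ring_simps:
  fixes A B C :: "'a::comm_ring_1^'n^'n"
  shows "A ** (B + C) = A ** B + A ** C" "(A + B) ** C = A ** C + B ** C"
    "A ** (B - C) = A ** B - A ** C" "(A - B) ** C = A ** C - B ** C"
    "A ** (- B) = - (A ** B)" "(- A) ** B = - (A ** B)"
    "msc c A ** B = msc c (A ** B)" "A ** msc c B = msc c (A ** B)"
  by (simp_all add: vec_eq_iff mat_mult_nth sum.distrib sum_subtractf sum_negf distrib_left distrib_right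
      left_diff_distrib right_diff_distrib sum_distrib_left mult_ac)

lemma msc_simps:
  fixes A B :: "'a::comm_ring_1^'n^'m"
  shows "msc c (A + B) = msc c A + msc c B" "msc (c + d) A = msc c A + msc d A"
    "msc c (A - B) = msc c A - msc c B" "msc (c - d) A = msc c A - msc d A"
    "msc c (- A) = - msc c A" "msc (- c) A = - msc c A"
    "msc c (msc d A) = msc (c * d) A" "msc 1 A = A" "msc 0 A = 0" "msc c 0 = 0"
  by (simp_all add: vec_eq_iff distrib_left distrib_right left_diff_distrib right_diff_distrib mult.assoc)

lemma msc_sum: "msc c (sum f I) = (\<Sum>i\<in>I. msc c (f i))"
  by (induction I rule: infinite_finite_induct) (simp_all add: msc_simps)

lemma matrix_sum_ldistrib: "A ** sum f I = (\<Sum>i\<in>I. A ** f i)" for A :: "'a::comm_ring_1^'n^'n" and f :: "'i \<Rightarrow> 'a^'n^'n"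
  by (induction I rule: infinite_finite_induct) (simp_all add: matrix_ring_simps)

lemma matrix_sum_rdistrib: "sum f I ** A = (\<Sum>i\<in>I. f i ** A)" for A :: "'a::comm_ring_1^'n^'n" and f :: "'i \<Rightarrow> 'a^'n^'n"
  by (induction I rule: infinite_finite_induct) (simp_all add: matrix_ring_simps)

lemma const_mat_simps:
  fixes A B :: "complex^'n^'n"
  shows "const_mat (A + B) = const_mat A + const_mat B" "const_mat (A - B) = const_mat A - const_mat B"
    "const_mat (- A) = - const_mat A" "const_mat (A ** B) = const_mat A ** const_mat B"
    "const_mat (msc c A) = msc (rconst c) (const_mat A)" "const_mat (mat 1 :: complex^'n^'n) = mat 1"
    "const_mat (0 :: complex^'n^'n) = 0"
  by (simp_all add: vec_eq_iff rconst_simps mat_mult_nth rconst_sum mat_one_nth del: to_fract_diff to_fract_mult)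

lemma const_mat_sum: "const_mat (sum f I :: complex^'n^'n) = (\<Sum>i\<in>I. const_mat (f i))"
  by (induction I rule: infinite_finite_induct) (simp_all add: const_mat_simps)

lemma mat_deriv_simps:
  fixes A B :: "ratfun^'n^'n"
  shows "mat_deriv (A + B) = mat_deriv A + mat_deriv B" "mat_deriv (A - B) = mat_deriv A - mat_deriv B"
    "mat_deriv (- A) = - mat_deriv A" "mat_deriv (A ** B) = mat_deriv A ** B + A ** mat_deriv B"
    "mat_deriv (msc c A) = msc (rderiv c) A + msc c (mat_deriv A)" "mat_deriv (const_mat C) = 0"
    "mat_deriv (mat 1 :: ratfun^'n^'n) = 0" "mat_deriv (0 :: ratfun^'n^'n) = 0"
  by (simp_all add: vec_eq_iff rderiv_add rderiv_diff rderiv_uminus mat_mult_nth rderiv_sum rderiv_mult sum.distrib mat_one_nth)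

lemma mat_deriv_sum: "mat_deriv (sum f I :: ratfun^'n^'n) = (\<Sum>i\<in>I. mat_deriv (f i))"
  by (induction I rule: infinite_finite_induct) (simp_all add: mat_deriv_simps)

lemma invertible_matrix_inv: 
  assumes "invertible A" shows "A ** matrix_inv A = mat 1" "matrix_inv A ** A = mat 1"
proof -
  have "A ** matrix_inv A = mat 1 \<and> matrix_inv A ** A = mat 1"
    unfolding matrix_inv_def by (rule someI_ex) (use assms in \<open>simp add: invertible_def\<close>)
  thus "A ** matrix_inv A = mat 1" "matrix_inv A ** A = mat 1" by auto
qed

lemma matrix_inv_unique':
  fixes A :: "'a::comm_ring_1^'n^'n"
  assumes "A ** B = mat 1" "B ** A = mat 1" shows "matrix_inv A = B"
proof -
  have "invertible A" using assms by (auto simp: invertible_def)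
  hence "matrix_inv A ** (A ** B) = B" by (simp add: matrix_mul_assoc invertible_matrix_inv)
  thus ?thesis using assms by simp
qed

lemma invertible_inverse: "invertible A \<Longrightarrow> invertible (matrix_inv A)"
  by (metis invertible_def invertible_matrix_inv)

lemma matrix_inv_inv: "invertible A \<Longrightarrow> matrix_inv (matrix_inv A) = A" for A :: "'a::comm_ring_1^'n^'n"
  by (intro matrix_inv_unique' invertible_matrix_inv)

lemma invertible_cancel_right: 
  fixes A B C :: "'a::comm_ring_1^'n^'n"
  assumes "invertible A" "B ** A = C ** A" shows "B = C"
  using arg_cong[OF assms(2), of "\<lambda>X. X ** matrix_inv A"] assms(1)
  by (simp add: matrix_mul_assoc[symmetric] invertible_matrix_inv)

lemma invertible_const_mat: "invertible A \<Longrightarrow> invertible (const_mat A)"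
  and matrix_inv_const_mat: "invertible A \<Longrightarrow> matrix_inv (const_mat A) = const_mat (matrix_inv A)"
  for A :: "complex^'n^'n"
proof -
  assume "invertible A"
  hence "const_mat A ** const_mat (matrix_inv A) = mat 1" "const_mat (matrix_inv A) ** const_mat A = mat 1"
    by (simp_all add: invertible_matrix_inv const_mat_simps flip: const_mat_simps(4))
  thus "invertible (const_mat A)" "matrix_inv (const_mat A) = const_mat (matrix_inv A)"
    by (auto simp: invertible_def intro: matrix_inv_unique')
qed

subsection \<open>Gauge transformations\<close>

lemma mat_deriv_inv:
  fixes g :: "ratfun^'n^'n"
  assumes "invertible g"
  shows "g ** mat_deriv (matrix_inv g) = - (mat_deriv g ** matrix_inv g)"
proof -
  have "0 = mat_deriv (g ** matrix_inv g)" using assms by (simp add: invertible_matrix_inv mat_deriv_simps)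
  thus ?thesis by (simp add: mat_deriv_simps eq_neg_iff_add_eq_0 add.commute)
qed

text \<open>Multiplication by g on the right removes the inverse and leaves a linear differential
  equation for g. Nearly all gauge computations below are done in this form.\<close>

lemma gauge_eq_iff:
  fixes g :: "ratfun^'n^'n"
  assumes "invertible g"
  shows "gauge g M = A \<longleftrightarrow> mat_deriv g = g ** M - A ** g"
proof -
  have "gauge g M = A \<longleftrightarrow> (gauge g M) ** g = A ** g"
    using assms invertible_cancel_right by blast
  also have "gauge g M ** g = g ** M - mat_deriv g"
    using assms by (simp add: gauge_def mat_deriv_inv matrix_ring_simps matrix_mul_assoc[symmetric] invertible_matrix_inv)
  finally show ?thesis by (auto simp: algebra_simps)
qed

lemma gauge_mult:
  fixes g h :: "ratfun^'n^'n"
  assumes "invertible g" "invertible h"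
  shows "gauge (g ** h) M = gauge g (gauge h M)"
proof -
  have h: "mat_deriv h = h ** M - gauge h M ** h" using gauge_eq_iff[OF assms(2)] by blast
  have g: "mat_deriv g = g ** gauge h M - gauge g (gauge h M) ** g" using gauge_eq_iff[OF assms(1)] by blast
  show ?thesis using assms
    by (subst gauge_eq_iff) (simp_all add: invertible_mult mat_deriv_simps g h matrix_ring_simps matrix_mul_assoc)
qed

lemma gauge_one: "gauge (mat 1) M = (M :: ratfun^'n^'n)"
  by (subst gauge_eq_iff) (auto simp: mat_deriv_simps invertible_def)

lemma gauge_inv: "invertible g \<Longrightarrow> gauge (matrix_inv g) (gauge g M) = M" for g :: "ratfun^'n^'n"
  using gauge_mult[of "matrix_inv g" g M] by (simp add: invertible_matrix_inv invertible_inverse gauge_one)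

subsection \<open>Evaluation of matrices\<close>

definition mat_eval :: "complex \<Rightarrow> ratfun^'n^'n \<Rightarrow> complex^'n^'n" where
  "mat_eval w A = (\<chi> i j. rat_eval (A $ i $ j) w)"

definition mat_regular :: "complex \<Rightarrow> ratfun^'n^'n \<Rightarrow> bool" where
  "mat_regular w A \<longleftrightarrow> (\<forall>i j. regular_at w (A $ i $ j))"

lemma mat_eval_nth [simp]: "mat_eval w A $ i $ j = rat_eval (A $ i $ j) w"
  by (simp add: mat_eval_def)

lemma mat_regular_simps:
  "mat_regular w A \<Longrightarrow> mat_regular w B \<Longrightarrow> mat_regular w (A + B)"
  "mat_regular w A \<Longrightarrow> mat_regular w B \<Longrightarrow> mat_regular w (A - B)"
  "mat_regular w A \<Longrightarrow> mat_regular w (- A)"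
  "mat_regular w A \<Longrightarrow> mat_regular w B \<Longrightarrow> mat_regular w (A ** B)"
  "regular_at w c \<Longrightarrow> mat_regular w A \<Longrightarrow> mat_regular w (msc c A)"
  "mat_regular w (const_mat C)" "mat_regular w (mat 1)" "mat_regular w 0"
  "mat_regular w A \<Longrightarrow> mat_regular w (mat_deriv A)"
  by (simp_all add: mat_regular_def regular_at_add regular_at_diff regular_at_uminus regular_at_mult
    regular_at_sum mat_mult_nth regular_at_rderiv mat_one_nth)

lemma mat_eval_simps:
  "mat_regular w A \<Longrightarrow> mat_regular w B \<Longrightarrow> mat_eval w (A + B) = mat_eval w A + mat_eval w B"
  "mat_regular w A \<Longrightarrow> mat_regular w B \<Longrightarrow> mat_eval w (A - B) = mat_eval w A - mat_eval w B"
  "mat_regular w A \<Longrightarrow> mat_eval w (- A) = - mat_eval w A"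
  "mat_regular w A \<Longrightarrow> mat_regular w B \<Longrightarrow> mat_eval w (A ** B) = mat_eval w A ** mat_eval w B"
  "regular_at w c \<Longrightarrow> mat_regular w A \<Longrightarrow> mat_eval w (msc c A) = msc (rat_eval c w) (mat_eval w A)"
  "mat_eval w (const_mat C) = C" "mat_eval w (mat 1 :: ratfun^'n^'n) = mat 1" "mat_eval w (0 :: ratfun^'n^'n) = 0"
  by (simp_all add: mat_regular_def vec_eq_iff rat_eval_add rat_eval_diff rat_eval_uminus rat_eval_mult
    rat_eval_sum mat_mult_nth regular_at_mult mat_one_nth)

lemma mat_regular_sum: "(\<And>i. i \<in> I \<Longrightarrow> mat_regular w (f i)) \<Longrightarrow> mat_regular w (sum f I)"
  by (induction I rule: infinite_finite_induct) (simp_all add: mat_regular_simps)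

lemma mat_eval_sum: "(\<And>i. i \<in> I \<Longrightarrow> mat_regular w (f i)) \<Longrightarrow> mat_eval w (sum f I) = (\<Sum>i\<in>I. mat_eval w (f i))"
  by (induction I rule: infinite_finite_induct) (simp_all add: mat_eval_simps mat_regular_sum)

lemma eventually_mat_regular: "\<forall>\<^sub>F w in cofinite. mat_regular w A"
  unfolding mat_regular_def by (intro eventually_all_finite eventually_regular_at)

lemma mat_eval_eqI:
  assumes "\<forall>\<^sub>F w in cofinite. mat_eval w A = mat_eval w B" shows "A = B"
proof (rule mat_eqI, rule ratfun_eqI)
  fix i j
  show "\<forall>\<^sub>F w in cofinite. rat_eval (A $ i $ j) w = rat_eval (B $ i $ j) w"
    using assms by eventually_elim (metis mat_eval_nth)
qed

lemma eventually_cofinite_at: "\<forall>\<^sub>F w in cofinite. P w \<Longrightarrow> \<forall>\<^sub>F w in at (s::complex). P w"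
proof -
  assume "\<forall>\<^sub>F w in cofinite. P w"
  hence fin: "finite {w. \<not> P w}" by (simp add: eventually_cofinite)
  have "open (- ({w. \<not> P w} - {s}))" using fin by (intro open_Compl finite_imp_closed) auto
  moreover have "s \<in> - ({w. \<not> P w} - {s})" by simp
  ultimately have "\<forall>\<^sub>F w in nhds s. w \<in> - ({w. \<not> P w} - {s})" by (rule eventually_nhds_in_open)
  thus ?thesis unfolding eventually_at_filter by eventually_elim auto
qed

section \<open>Linear algebraic groups\<close>

text \<open>Polynomial functions of the matrix entries: composition, differentiation and evaluation are
  easier to handle for them than for the coefficient families.\<close>
inductive_set polyfun :: "(complex^'n^'n \<Rightarrow> complex) set" where
  const: "(\<lambda>_. c) \<in> polyfun"
| coord: "(\<lambda>x. x $ i $ j) \<in> polyfun"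
| add: "f \<in> polyfun \<Longrightarrow> g \<in> polyfun \<Longrightarrow> (\<lambda>x. f x + g x) \<in> polyfun"
| mult: "f \<in> polyfun \<Longrightarrow> g \<in> polyfun \<Longrightarrow> (\<lambda>x. f x * g x) \<in> polyfun"

lemma polyfun_sum: "(\<And>i. i \<in> I \<Longrightarrow> f i \<in> polyfun) \<Longrightarrow> (\<lambda>x. \<Sum>i\<in>I. f i x) \<in> polyfun"
  by (induction I rule: infinite_finite_induct) (simp_all add: polyfun.intros)

lemma polyfun_prod: "(\<And>i. i \<in> I \<Longrightarrow> f i \<in> polyfun) \<Longrightarrow> (\<lambda>x. \<Prod>i\<in>I. f i x) \<in> polyfun"
  by (induction I rule: infinite_finite_induct) (simp_all add: polyfun.intros)

lemma polyfun_power: "f \<in> polyfun \<Longrightarrow> (\<lambda>x. f x ^ n) \<in> polyfun"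
  by (induction n) (simp_all add: polyfun.intros)

lemma entry_eval_polyfun: "entry_eval (\<lambda>c. c) f \<in> polyfun"
  unfolding entry_eval_def[abs_def] by (intro polyfun_sum polyfun_prod polyfun_power polyfun.intros)

lemma entry_eval_superset:
  assumes "finite K" "Poly_Mapping.keys f \<subseteq> K"
  shows "entry_eval (\<lambda>c. c) f A = (\<Sum>m\<in>K. Poly_Mapping.lookup f m *
     (\<Prod>v\<in>Poly_Mapping.keys m. (A $ fst v $ snd v) ^ Poly_Mapping.lookup m v))"
  unfolding entry_eval_def using assms
  by (intro sum.mono_neutral_left) (auto simp: Poly_Mapping.in_keys_iff)

lemma entry_eval_add: "entry_eval (\<lambda>c. c) (f + g) A = entry_eval (\<lambda>c. c) f A + entry_eval (\<lambda>c. c) g A"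
proof -
  let ?K = "Poly_Mapping.keys f \<union> Poly_Mapping.keys g"
  have "Poly_Mapping.keys (f + g) \<subseteq> ?K" by (rule Poly_Mapping.keys_add)
  thus ?thesis
    by (simp add: entry_eval_superset[of ?K] Poly_Mapping.lookup_add distrib_right sum.distrib)
qed

lemma entry_eval_0: "entry_eval (\<lambda>c. c) 0 A = 0"
  by (simp add: entry_eval_def)

lemma entry_eval_sum: "entry_eval (\<lambda>c. c) (sum f I) A = (\<Sum>i\<in>I. entry_eval (\<lambda>c. c) (f i) A)"
  by (induction I rule: infinite_finite_induct) (simp_all add: entry_eval_0 entry_eval_add)

lemma monomial_eval_superset:
  assumes "finite K" "Poly_Mapping.keys m \<subseteq> K"
  shows "(\<Prod>v\<in>Poly_Mapping.keys m. (A $ fst v $ snd v) ^ Poly_Mapping.lookup m v)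
    = (\<Prod>v\<in>K. (A $ fst v $ snd v :: complex) ^ Poly_Mapping.lookup m v)"
  using assms by (intro prod.mono_neutral_left) (auto simp: Poly_Mapping.in_keys_iff)

lemma entry_eval_single: "entry_eval (\<lambda>c. c) (Poly_Mapping.single m c) A
   = c * (\<Prod>v\<in>Poly_Mapping.keys m. (A $ fst v $ snd v) ^ Poly_Mapping.lookup m v)"
  by (subst entry_eval_superset[of "{m}"]) auto

text \<open>With \<open>entry_eval_polyfun\<close> this identifies polynomial functions with
  evaluated coefficient families, so that vanishing ideals may be tested by functions. For a product
  the coefficients are convolved over pairs of monomials.\<close>

lemma polyfun_entry_eval: "p \<in> polyfun \<Longrightarrow> \<exists>f. p = entry_eval (\<lambda>c. c) f"
proof (induction rule: polyfun.induct)
  case (const c)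
  show ?case by (rule exI[of _ "Poly_Mapping.single 0 c"]) (simp add: entry_eval_single fun_eq_iff)
next
  case (coord i j)
  show ?case by (rule exI[of _ "Poly_Mapping.single (Poly_Mapping.single (i, j) 1) 1"]) (simp add: entry_eval_single fun_eq_iff)
next
  case (add f g)
  then show ?case using entry_eval_add by (metis (no_types, lifting) ext)
next
  case (mult p q)
  then obtain f g where fg: "p = entry_eval (\<lambda>c. c) f" "q = entry_eval (\<lambda>c. c) g" by blast
  define h where "h = (\<Sum>m\<in>Poly_Mapping.keys f. \<Sum>m'\<in>Poly_Mapping.keys g.
    Poly_Mapping.single (m + m') (Poly_Mapping.lookup f m * Poly_Mapping.lookup g m'))"
  have mm: "(\<Prod>v\<in>Poly_Mapping.keys (m + m'). (A $ fst v $ snd v) ^ Poly_Mapping.lookup (m + m') v)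
    = (\<Prod>v\<in>Poly_Mapping.keys m. (A $ fst v $ snd v) ^ Poly_Mapping.lookup m v) *
      (\<Prod>v\<in>Poly_Mapping.keys m'. (A $ fst v $ snd v) ^ Poly_Mapping.lookup m' v)"
    for m m' :: "'a \<times> 'a \<Rightarrow>\<^sub>0 nat" and A :: "complex^'a^'a"
  proof -
    let ?K = "Poly_Mapping.keys m \<union> Poly_Mapping.keys m'"
    have K: "finite ?K" "Poly_Mapping.keys (m + m') \<subseteq> ?K" "Poly_Mapping.keys m \<subseteq> ?K" "Poly_Mapping.keys m' \<subseteq> ?K"
      using Poly_Mapping.keys_add[of m m'] by (simp_all del: split_paired_All)
    show ?thesis
      unfolding monomial_eval_superset[OF K(1,2)] monomial_eval_superset[OF K(1,3)] monomial_eval_superset[OF K(1,4)]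
      by (simp add: Poly_Mapping.lookup_add power_add prod.distrib)
  qed
  have "entry_eval (\<lambda>c. c) h A = p A * q A" for A
    unfolding h_def fg entry_eval_sum entry_eval_single mm entry_eval_def[of _ f] entry_eval_def[of _ g] sum_product
    by (intro sum.cong refl) (simp only: mult_ac)
  thus ?case by (intro exI[of _ h]) auto
qed

lemma polyfun_sandwich: "p \<in> polyfun \<Longrightarrow> (\<lambda>x. p (g ** x ** h)) \<in> polyfun"
  by (induction rule: polyfun.induct)
    (simp_all add: polyfun.intros mat_mult_nth polyfun_sum)

section \<open>Differentiation of polynomial functions along curves of matrices\<close>

definition mat_DERIV :: "(complex \<Rightarrow> complex^'n^'n) \<Rightarrow> complex^'n^'n \<Rightarrow> complex \<Rightarrow> bool" where
  "mat_DERIV E E' s \<longleftrightarrow> (\<forall>i j. ((\<lambda>t. E t $ i $ j) has_field_derivative E' $ i $ j) (at s))"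

lemma mat_DERIV_const: "mat_DERIV (\<lambda>_. A) 0 s"
  by (simp add: mat_DERIV_def)

lemma mat_DERIV_mult:
  assumes "mat_DERIV E E' s" "mat_DERIV F F' s"
  shows "mat_DERIV (\<lambda>t. E t ** F t) (E' ** F s + E s ** F') s"
  using assms unfolding mat_DERIV_def
  by (auto simp: mat_mult_nth sum.distrib[symmetric] intro!: derivative_eq_intros sum.cong)

lemma mat_DERIV_line: "mat_DERIV (\<lambda>t. mat 1 + msc t X) X s"
  unfolding mat_DERIV_def by (auto intro!: derivative_eq_intros)

lemma mat_DERIV_eval: "mat_regular w A \<Longrightarrow> mat_DERIV (\<lambda>t. mat_eval t A) (mat_eval w (mat_deriv A)) w"
  by (simp add: mat_DERIV_def mat_regular_def DERIV_rat_eval)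

text \<open>\<open>D x u\<close> is the directional derivative of \<open>p\<close> at
  \<open>x\<close> along \<open>u\<close>, specified by the chain rule along all curves.\<close>

definition gradient :: "(complex^'n^'n \<Rightarrow> complex) \<Rightarrow> (complex^'n^'n \<Rightarrow> complex^'n^'n \<Rightarrow> complex) \<Rightarrow> bool" where
  "gradient p D \<longleftrightarrow> (\<forall>E E' s. mat_DERIV E E' s \<longrightarrow> ((\<lambda>t. p (E t)) has_field_derivative D (E s) E') (at s))"

lemma polyfun_gradient:
  fixes p :: "complex^'n^'n \<Rightarrow> complex"
  assumes "p \<in> polyfun"
  shows "\<exists>D. gradient p D \<and> (\<forall>L. (\<forall>i j. (\<lambda>x. L x $ i $ j) \<in> polyfun) \<longrightarrow> (\<lambda>x. D x (L x)) \<in> polyfun) \<and>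
     (\<forall>x u v. D x (u + v) = D x u + D x v) \<and> (\<forall>x c u. D x (msc c u) = c * D x u)"
  using assms
proof (induction rule: polyfun.induct)
  case (const c)
  show ?case by (rule exI[of _ "\<lambda>_ _. 0"]) (simp add: gradient_def polyfun.intros)
next
  case (coord i j)
  show ?case by (rule exI[of _ "\<lambda>_ u. u $ i $ j"]) (simp add: gradient_def mat_DERIV_def)
next
  case (add f g)
  then obtain D D' where D: "gradient f D" "\<forall>L. (\<forall>i j. (\<lambda>x. L x $ i $ j) \<in> polyfun) \<longrightarrow> (\<lambda>x. D x (L x)) \<in> polyfun"
      "\<forall>x u v. D x (u + v) = D x u + D x v" "\<forall>x c u. D x (msc c u) = c * D x u"
    and D': "gradient g D'" "\<forall>L. (\<forall>i j. (\<lambda>x. L x $ i $ j) \<in> polyfun) \<longrightarrow> (\<lambda>x. D' x (L x)) \<in> polyfun"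
      "\<forall>x u v. D' x (u + v) = D' x u + D' x v" "\<forall>x c u. D' x (msc c u) = c * D' x u" by blast
  show ?case
  proof (intro exI[of _ "\<lambda>x u. D x u + D' x u"] conjI allI impI)
    show "gradient (\<lambda>x. f x + g x) (\<lambda>x u. D x u + D' x u)"
      using D(1) D'(1) unfolding gradient_def by (intro allI impI DERIV_add) simp_all
  qed (use D D' add.hyps in \<open>auto simp: algebra_simps intro!: polyfun.intros\<close>)
next
  case (mult f g)
  then obtain D D' where D: "gradient f D" "\<forall>L. (\<forall>i j. (\<lambda>x. L x $ i $ j) \<in> polyfun) \<longrightarrow> (\<lambda>x. D x (L x)) \<in> polyfun"
      "\<forall>x u v. D x (u + v) = D x u + D x v" "\<forall>x c u. D x (msc c u) = c * D x u"
    and D': "gradient g D'" "\<forall>L. (\<forall>i j. (\<lambda>x. L x $ i $ j) \<in> polyfun) \<longrightarrow> (\<lambda>x. D' x (L x)) \<in> polyfun"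
      "\<forall>x u v. D' x (u + v) = D' x u + D' x v" "\<forall>x c u. D' x (msc c u) = c * D' x u" by blast
  show ?case
  proof (intro exI[of _ "\<lambda>x u. D x u * g x + f x * D' x u"] conjI allI impI)
    show "gradient (\<lambda>x. f x * g x) (\<lambda>x u. D x u * g x + f x * D' x u)"
      unfolding gradient_def
    proof (intro allI impI)
      fix E :: "complex \<Rightarrow> complex^'n^'n" and E' and s :: complex assume "mat_DERIV E E' s"
      hence "((\<lambda>t. f (E t)) has_field_derivative D (E s) E') (at s)" "((\<lambda>t. g (E t)) has_field_derivative D' (E s) E') (at s)"
        using D(1) D'(1) by (auto simp: gradient_def)
      from DERIV_mult[OF this] show "((\<lambda>t. f (E t) * g (E t)) has_field_derivative D (E s) E' * g (E s) + f (E s) * D' (E s) E') (at s)"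
        by (simp add: algebra_simps)
    qed
  qed (use D D' mult.hyps in \<open>auto simp: algebra_simps intro!: polyfun.intros\<close>)
qed

section \<open>The Lie algebra as a tangent space\<close>

lemma mem_vanishing_ideal: "f \<in> vanishing_ideal S \<longleftrightarrow> (\<forall>A\<in>S. entry_eval (\<lambda>c. c) f A = 0)"
  by (simp add: vanishing_ideal_def)

text \<open>The value of an equation at 1 + s X is a polynomial in s, and its coefficient of s is
  its derivative at 0.\<close>

lemma lie_algebra_iff:
  "X \<in> lie_algebra S \<longleftrightarrow> (\<forall>p\<in>polyfun. (\<forall>A\<in>S. p A = 0) \<longrightarrow>
     ((\<lambda>s. p (mat 1 + msc s X)) has_field_derivative 0) (at 0))"
proof -
  have "coeff (entry_eval (\<lambda>c. [:c:]) f (\<chi> i j. [:(if i = j then 1 else 0), X $ i $ j:])) 1 = 0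
     \<longleftrightarrow> ((\<lambda>s. entry_eval (\<lambda>c. c) f (mat 1 + msc s X)) has_field_derivative 0) (at 0)" for f
  proof -
    let ?q = "entry_eval (\<lambda>c. [:c:]) f (\<chi> i j. [:(if i = j then 1 else 0), X $ i $ j:])"
    have "poly ?q s = entry_eval (\<lambda>c. c) f (mat 1 + msc s X)" for s
      by (simp add: entry_eval_def poly_sum poly_prod poly_power mat_one_nth)
    hence "(\<lambda>s. entry_eval (\<lambda>c. c) f (mat 1 + msc s X)) = poly ?q" by auto
    moreover have "(poly ?q has_field_derivative coeff ?q 1) (at 0)"
      using poly_DERIV[of ?q 0] by (simp add: poly_0_coeff_0 coeff_pderiv)
    ultimately show ?thesis using DERIV_unique by fastforce
  qed
  hence "X \<in> lie_algebra S \<longleftrightarrow> (\<forall>f. (\<forall>A\<in>S. entry_eval (\<lambda>c. c) f A = 0) \<longrightarrow>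
     ((\<lambda>s. entry_eval (\<lambda>c. c) f (mat 1 + msc s X)) has_field_derivative 0) (at 0))"
    by (simp add: lie_algebra_def vanishing_ideal_def)
  also have "\<dots> \<longleftrightarrow> (\<forall>p\<in>range (entry_eval (\<lambda>c. c)). (\<forall>A\<in>S. p A = 0) \<longrightarrow>
     ((\<lambda>s. p (mat 1 + msc s X)) has_field_derivative 0) (at 0))" by simp
  also have "range (entry_eval (\<lambda>c. c)) = (polyfun :: (complex^'a^'a \<Rightarrow> complex) set)"
    using polyfun_entry_eval entry_eval_polyfun by blast
  finally show ?thesis .
qed

lemma lie_algebra_gradient:
  "X \<in> lie_algebra S \<longleftrightarrow> (\<forall>p\<in>polyfun. \<forall>D. (\<forall>A\<in>S. p A = 0) \<longrightarrow> gradient p D \<longrightarrow> D (mat 1) X = 0)"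
proof -
  have d: "((\<lambda>s. p (mat 1 + msc s X)) has_field_derivative D (mat 1) X) (at 0)" if "gradient p D" for p D
  proof -
    have "((\<lambda>s. p (mat 1 + msc s X)) has_field_derivative D (mat 1 + msc 0 X) X) (at 0)"
      using that mat_DERIV_line unfolding gradient_def by blast
    thus ?thesis by (simp add: msc_simps)
  qed
  show ?thesis unfolding lie_algebra_iff
  proof (intro iffI ballI allI impI)
    fix p D assume "\<forall>p\<in>polyfun. (\<forall>A\<in>S. p A = 0) \<longrightarrow> ((\<lambda>s. p (mat 1 + msc s X)) has_field_derivative 0) (at 0)"
      and "p \<in> polyfun" "\<forall>A\<in>S. p A = 0" and D: "gradient p D"
    hence "((\<lambda>s. p (mat 1 + msc s X)) has_field_derivative 0) (at 0)" by blast
    from DERIV_unique[OF this d[OF D]] show "D (mat 1) X = 0" by simp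
  next
    fix p assume a: "\<forall>p\<in>polyfun. \<forall>D. (\<forall>A\<in>S. p A = 0) \<longrightarrow> gradient p D \<longrightarrow> D (mat 1) X = 0"
      and p: "p \<in> polyfun" "\<forall>A\<in>S. p A = 0"
    obtain D where D: "gradient p D" using polyfun_gradient[OF p(1)] by blast
    with a p have "D (mat 1) X = 0" by blast
    thus "((\<lambda>s. p (mat 1 + msc s X)) has_field_derivative 0) (at 0)" using d[OF D] by simp
  qed
qed

text \<open>Straight lines are not adapted to a group. This criterion admits conjugated lines and
  the curves g(w) g(s)^-1; only first order behaviour at one point enters.\<close>

lemma lie_algebra_curve:
  assumes "mat_DERIV E X s" "E s = mat 1" "\<And>p. p \<in> polyfun \<Longrightarrow> (\<And>A. A \<in> S \<Longrightarrow> p A = 0) \<Longrightarrow>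
     ((\<lambda>t. p (E t)) has_field_derivative 0) (at s)"
  shows "X \<in> lie_algebra S"
  unfolding lie_algebra_gradient
proof (intro ballI allI impI)
  fix p D assume "p \<in> polyfun" "\<forall>A\<in>S. p A = 0" "gradient p D"
  hence "((\<lambda>t. p (E t)) has_field_derivative 0) (at s)" "((\<lambda>t. p (E t)) has_field_derivative D (E s) X) (at s)"
    using assms(1,3) unfolding gradient_def by blast+
  thus "D (mat 1) X = 0" using assms(2) DERIV_unique by metis
qed

lemma lie_algebra_curve_deriv:
  assumes "X \<in> lie_algebra S" "p \<in> polyfun" "\<And>A. A \<in> S \<Longrightarrow> p A = 0" "mat_DERIV E X s" "E s = mat 1"
  shows "((\<lambda>t. p (E t)) has_field_derivative 0) (at s)"
proof -
  obtain D where D: "gradient p D" using polyfun_gradient[OF assms(2)] by blast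
  hence "D (mat 1) X = 0" using assms by (auto simp: lie_algebra_gradient)
  moreover have "((\<lambda>t. p (E t)) has_field_derivative D (E s) X) (at s)"
    using D assms(4) by (auto simp: gradient_def)
  ultimately show ?thesis using assms(5) by simp
qed

lemma lie_algebra_subspace:
  fixes S :: "(complex^'n^'n) set"
  shows "0 \<in> lie_algebra S" "X \<in> lie_algebra S \<Longrightarrow> Y \<in> lie_algebra S \<Longrightarrow> X + Y \<in> lie_algebra S"
  "X \<in> lie_algebra S \<Longrightarrow> msc c X \<in> lie_algebra S"
proof -
  have lin: "D (mat 1) (X + Y) = D (mat 1) X + D (mat 1) Y \<and> D (mat 1) (msc c X) = c * D (mat 1) X"
    if gD: "gradient p D" and pp: "p \<in> polyfun" for p D and X Y :: "complex^'n^'n" and c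
  proof -
    obtain D' where D': "gradient p D'" "\<forall>x u v. D' x (u + v) = D' x u + D' x v" "\<forall>x c u. D' x (msc c u) = c * D' x u"
      using polyfun_gradient[OF pp] by blast
    have "D (mat 1) U = D' (mat 1) U" for U
    proof -
      have "D (mat 1 + msc 0 U) U = D' (mat 1 + msc 0 U) U"
        using D'(1) gD mat_DERIV_line[of U 0] unfolding gradient_def by (blast intro: DERIV_unique)
      thus ?thesis by (simp add: msc_simps)
    qed
    thus ?thesis using D' by simp
  qed
  have "D (mat 1) 0 = 0" if "gradient p D" "p \<in> polyfun" for p and D :: "_ \<Rightarrow> complex^'n^'n \<Rightarrow> complex"
    using lin[OF that, of 0 0 0] by simp
  thus "0 \<in> lie_algebra S" by (simp add: lie_algebra_gradient)
  show "X + Y \<in> lie_algebra S" if "X \<in> lie_algebra S" "Y \<in> lie_algebra S"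
    unfolding lie_algebra_gradient
  proof (intro ballI allI impI)
    fix p and D :: "_ \<Rightarrow> complex^'n^'n \<Rightarrow> complex" assume "p \<in> polyfun" "\<forall>A\<in>S. p A = 0" "gradient p D"
    moreover from this that have "D (mat 1) X = 0" "D (mat 1) Y = 0" unfolding lie_algebra_gradient by blast+
    ultimately show "D (mat 1) (X + Y) = 0" using lin[of p D X Y] by simp
  qed
  show "msc c X \<in> lie_algebra S" if "X \<in> lie_algebra S"
    unfolding lie_algebra_gradient
  proof (intro ballI allI impI)
    fix p and D :: "_ \<Rightarrow> complex^'n^'n \<Rightarrow> complex" assume "p \<in> polyfun" "\<forall>A\<in>S. p A = 0" "gradient p D"
    moreover from this that have "D (mat 1) X = 0" unfolding lie_algebra_gradient by blast
    ultimately show "D (mat 1) (msc c X) = 0" using lin[of p D X X c] by simp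
  qed
qed

lemma lie_algebra_mono: "S \<subseteq> T \<Longrightarrow> lie_algebra S \<subseteq> lie_algebra T"
proof
  fix X assume "S \<subseteq> T" "X \<in> lie_algebra S"
  thus "X \<in> lie_algebra T" unfolding lie_algebra_iff by (meson subsetD)
qed

lemma algebraic_group_props:
  assumes "algebraic_group S"
  shows "A \<in> S \<Longrightarrow> B \<in> S \<Longrightarrow> A ** B \<in> S" "mat 1 \<in> S" "A \<in> S \<Longrightarrow> invertible A" "A \<in> S \<Longrightarrow> matrix_inv A \<in> S"
    "invertible A \<Longrightarrow> (\<And>p. p \<in> polyfun \<Longrightarrow> (\<And>B. B \<in> S \<Longrightarrow> p B = 0) \<Longrightarrow> p A = 0) \<Longrightarrow> A \<in> S"
proof -
  have sub: "subgroup S GL" and S: "S = {A. invertible A \<and> (\<forall>f\<in>vanishing_ideal S. entry_eval (\<lambda>c. c) f A = 0)}"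
    using assms by (auto simp: algebraic_group_def)
  show "A \<in> S \<Longrightarrow> B \<in> S \<Longrightarrow> A ** B \<in> S" using subgroup.m_closed[OF sub] by (simp add: GL_def)
  show "mat 1 \<in> S" using subgroup.one_closed[OF sub] by (simp add: GL_def)
  show inv: "A \<in> S \<Longrightarrow> invertible A" using S by blast
  have GLm: "carrier GL = {A::complex^'a^'a. invertible A}" "mult GL = (**)" "one GL = (mat 1 :: complex^'a^'a)"
    by (simp_all add: GL_def)
  show "A \<in> S \<Longrightarrow> matrix_inv A \<in> S"
  proof -
    assume A: "A \<in> S"
    have "inv\<^bsub>GL\<^esub> A = matrix_inv A"
      unfolding m_inv_def GLm
    proof (rule the_equality)
      show "matrix_inv A \<in> {A. invertible A} \<and> A ** matrix_inv A = mat 1 \<and> matrix_inv A ** A = mat 1"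
        using inv[OF A] by (simp add: invertible_matrix_inv invertible_inverse)
    qed (metis matrix_inv_unique')
    thus ?thesis using subgroup.m_inv_closed[OF sub A] by simp
  qed
  show "invertible A \<Longrightarrow> (\<And>p. p \<in> polyfun \<Longrightarrow> (\<And>B. B \<in> S \<Longrightarrow> p B = 0) \<Longrightarrow> p A = 0) \<Longrightarrow> A \<in> S"
    by (subst S) (simp add: mem_vanishing_ideal entry_eval_polyfun)
qed

text \<open>For p vanishing on S, the function p(g x g^-1) is again a polynomial vanishing on S, so
  the conjugated line is tangent to S.\<close>

lemma lie_algebra_Ad:
  assumes S: "algebraic_group S" and g: "g \<in> S" and X: "X \<in> lie_algebra S"
  shows "g ** X ** matrix_inv g \<in> lie_algebra S"
proof (rule lie_algebra_curve[where s = 0 and E = "\<lambda>t. g ** (mat 1 + msc t X) ** matrix_inv g"])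
  note ag = algebraic_group_props[OF S]
  have d: "mat_DERIV (\<lambda>t. mat 1 + msc t X) X 0" by (rule mat_DERIV_line)
  show "mat_DERIV (\<lambda>t. g ** (mat 1 + msc t X) ** matrix_inv g) (g ** X ** matrix_inv g) 0"
    using mat_DERIV_mult[OF mat_DERIV_mult[OF mat_DERIV_const[of g] d] mat_DERIV_const[of "matrix_inv g"]] by simp
  show "g ** (mat 1 + msc 0 X) ** matrix_inv g = mat 1"
    using ag(3)[OF g] by (simp add: msc_simps invertible_matrix_inv)
  fix p :: "complex^'a^'a \<Rightarrow> complex" assume p: "p \<in> polyfun" "\<And>A. A \<in> S \<Longrightarrow> p A = 0"
  show "((\<lambda>t. p (g ** (mat 1 + msc t X) ** matrix_inv g)) has_field_derivative 0) (at 0)"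
  proof (rule lie_algebra_curve_deriv[OF X polyfun_sandwich[OF p(1)] _ d])
    show "p (g ** A ** matrix_inv g) = 0" if "A \<in> S" for A by (intro p(2) ag(1,4) g that)
  qed (simp add: msc_simps)
qed

text \<open>The polynomials vanishing on S are stable under differentiation along the left invariant
  field x X: at A in S this is a derivative along A (1 + t X), and p(A x) vanishes on S. Hence all
  derivatives of p(E(t)) at 0 vanish, and an entire function with zero Taylor series is 0.
  Closedness of S then gives membership.\<close>

lemma one_parameter_subgroup:
  assumes S: "algebraic_group S" and X: "X \<in> lie_algebra S"
    and E: "\<And>s. mat_DERIV E (E s ** X) s" "E 0 = mat 1" "\<And>s. invertible (E s)"
  shows "E s \<in> S"
proof (rule algebraic_group_props(5)[OF S E(3)])
  note ag = algebraic_group_props[OF S]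
  fix p :: "complex^'a^'a \<Rightarrow> complex" assume "p \<in> polyfun" "\<And>A. A \<in> S \<Longrightarrow> p A = 0"
  moreover define I where "I = {p \<in> polyfun. \<forall>A\<in>S. p A = 0}"
  ultimately have p: "p \<in> I" by auto
  have step: "\<exists>q\<in>I. \<forall>s. ((\<lambda>t. p (E t)) has_field_derivative q (E s)) (at s)" if "p \<in> I" for p
  proof -
    have p: "p \<in> polyfun" "\<And>A. A \<in> S \<Longrightarrow> p A = 0" using that by (auto simp: I_def)
    obtain D where D: "gradient p D" "\<forall>L. (\<forall>i j. (\<lambda>x. L x $ i $ j) \<in> polyfun) \<longrightarrow> (\<lambda>x. D x (L x)) \<in> polyfun"
      using polyfun_gradient[OF p(1)] by blast
    define q where "q = (\<lambda>x. D x (x ** X))"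
    have "q \<in> polyfun" unfolding q_def
      by (rule D(2)[rule_format]) (simp add: mat_mult_nth polyfun_sum polyfun.intros)
    moreover have "q A = 0" if A: "A \<in> S" for A
    proof -
      have d: "mat_DERIV (\<lambda>t. mat 1 + msc t X) X 0" by (rule mat_DERIV_line)
      have "((\<lambda>t. p (A ** (mat 1 + msc t X) ** mat 1)) has_field_derivative 0) (at 0)"
      proof (rule lie_algebra_curve_deriv[OF X polyfun_sandwich[OF p(1)] _ d])
        show "p (A ** B ** mat 1) = 0" if "B \<in> S" for B by (intro p(2) ag(1,2) A that)
      qed (simp add: msc_simps)
      moreover have "mat_DERIV (\<lambda>t. A ** (mat 1 + msc t X)) (A ** X) 0"
        using mat_DERIV_mult[OF mat_DERIV_const[of A] d] by simp
      hence "((\<lambda>t. p (A ** (mat 1 + msc t X))) has_field_derivative D (A ** (mat 1 + msc 0 X)) (A ** X)) (at 0)"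
        using D(1) unfolding gradient_def by blast
      ultimately show ?thesis unfolding q_def by (auto simp: msc_simps intro: DERIV_unique)
    qed
    moreover have "((\<lambda>t. p (E t)) has_field_derivative q (E s)) (at s)" for s
      using D(1) E(1) unfolding gradient_def q_def by blast
    ultimately show ?thesis unfolding I_def by blast
  qed
  have "\<exists>q\<in>I. (deriv ^^ n) (\<lambda>t. p (E t)) = (\<lambda>t. q (E t))" for n
  proof (induction n)
    case (Suc n)
    then obtain q where q: "q \<in> I" "(deriv ^^ n) (\<lambda>t. p (E t)) = (\<lambda>t. q (E t))" by blast
    obtain r where "r \<in> I" "\<forall>s. ((\<lambda>t. q (E t)) has_field_derivative r (E s)) (at s)" using step[OF q(1)] by blast
    then show ?case using q(2) by (auto intro!: bexI[of _ r] DERIV_imp_deriv)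
  qed (use p in auto)
  hence der: "(deriv ^^ n) (\<lambda>t. p (E t)) 0 = 0" for n
    using E(2) ag(2) unfolding I_def by (metis (mono_tags, lifting) mem_Collect_eq)
  have "(\<lambda>t. p (E t)) holomorphic_on UNIV"
    using step[OF p] by (auto simp: holomorphic_on_open)
  from holomorphic_fun_eq_0_on_connected[OF this open_UNIV connected_UNIV der] show "p (E s) = 0" by simp
qed

section \<open>Points over the field of rational functions\<close>

lemma entry_eval_rat_eval:
  assumes "mat_regular w g"
  shows "regular_at w (entry_eval rconst f g)" "rat_eval (entry_eval rconst f g) w = entry_eval (\<lambda>c. c) f (mat_eval w g)"
  using assms unfolding entry_eval_def mat_regular_def
  by (auto simp: rat_eval_sum regular_at_sum regular_at_mult rat_eval_mult rat_eval_prod rat_eval_power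
     regular_at_prod regular_at_power)

lemma mat_eval_inverse:
  assumes "invertible g" "mat_regular w g" "mat_regular w (matrix_inv g)"
  shows "invertible (mat_eval w g)" "matrix_inv (mat_eval w g) = mat_eval w (matrix_inv g)"
proof -
  have "mat_eval w g ** mat_eval w (matrix_inv g) = mat 1" "mat_eval w (matrix_inv g) ** mat_eval w g = mat 1"
    using assms by (simp_all add: invertible_matrix_inv mat_eval_simps flip: mat_eval_simps(4))
  thus "invertible (mat_eval w g)" "matrix_inv (mat_eval w g) = mat_eval w (matrix_inv g)"
    by (auto simp: invertible_def intro: matrix_inv_unique')
qed

lemma ratpoints_mat_eval:
  assumes "algebraic_group S" "g \<in> ratpoints S" "mat_regular w g" "mat_regular w (matrix_inv g)"
  shows "mat_eval w g \<in> S"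
proof (rule algebraic_group_props(5)[OF assms(1)])
  have g: "invertible g" "\<And>f. f \<in> vanishing_ideal S \<Longrightarrow> entry_eval rconst f g = 0" using assms(2) by (auto simp: ratpoints_def)
  show "invertible (mat_eval w g)" using mat_eval_inverse(1) g(1) assms by blast
  fix p :: "complex^'a^'a \<Rightarrow> complex" assume p: "p \<in> polyfun" "\<And>A. A \<in> S \<Longrightarrow> p A = 0"
  obtain f where f: "p = entry_eval (\<lambda>c. c) f" using polyfun_entry_eval[OF p(1)] by blast
  have "f \<in> vanishing_ideal S" using p(2) by (simp add: f mem_vanishing_ideal)
  hence "entry_eval rconst f g = 0" by (rule g)
  thus "p (mat_eval w g) = 0" using entry_eval_rat_eval(2)[OF assms(3), of f] by (simp add: f)
qed

lemma ratpointsI: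
  assumes g: "invertible g" and ev: "\<forall>\<^sub>F w in cofinite. mat_eval w g \<in> S"
  shows "g \<in> ratpoints S"
proof -
  have "entry_eval rconst f g = 0" if f: "f \<in> vanishing_ideal S" for f
  proof (rule ratfun_eqI)
    show "\<forall>\<^sub>F w in cofinite. rat_eval (entry_eval rconst f g) w = rat_eval 0 w"
      using ev eventually_mat_regular[of g]
      by eventually_elim (use f in \<open>simp add: entry_eval_rat_eval mem_vanishing_ideal\<close>)
  qed
  thus ?thesis using g by (simp add: ratpoints_def)
qed

text \<open>A point over C(z) is a rational matrix whose value lies in S at almost every point. All
  later arguments use this pointwise form, which reduces them to the complex group.\<close>

lemma ratpoints_iff:
  assumes "algebraic_group S"
  shows "g \<in> ratpoints S \<longleftrightarrow> invertible g \<and> (\<forall>\<^sub>F w in cofinite. mat_eval w g \<in> S)"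
proof (intro iffI conjI)
  assume g: "g \<in> ratpoints S"
  thus "invertible g" by (simp add: ratpoints_def)
  show "\<forall>\<^sub>F w in cofinite. mat_eval w g \<in> S"
    using eventually_mat_regular[of g] eventually_mat_regular[of "matrix_inv g"]
    by eventually_elim (rule ratpoints_mat_eval[OF assms g])
qed (simp add: ratpointsI)

text \<open>At fixed w the curve g(w) g(s)^-1 lies in S for all s near w, passes through 1 at s = w
  and has there the derivative g (g^-1)'.\<close>

lemma lie_algebra_log_derivative:
  assumes S: "algebraic_group S" and g: "g \<in> ratpoints S"
  shows "\<forall>\<^sub>F w in cofinite. mat_eval w (g ** mat_deriv (matrix_inv g)) \<in> lie_algebra S"
proof -
  note ag = algebraic_group_props[OF S]
  let ?h = "matrix_inv g"
  have inv: "invertible g" using g by (simp add: ratpoints_def)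
  have ev: "\<forall>\<^sub>F s in cofinite. mat_eval s ?h \<in> S"
    using eventually_mat_regular[of g] eventually_mat_regular[of ?h]
  proof eventually_elim
    case (elim s)
    thus ?case using mat_eval_inverse(2)[OF inv elim] ag(4)[OF ratpoints_mat_eval[OF S g elim]] by simp
  qed
  show ?thesis
    using eventually_mat_regular[of g] eventually_mat_regular[of ?h]
  proof eventually_elim
    case (elim w)
    have gw: "mat_eval w g \<in> S" using ratpoints_mat_eval[OF S g] elim by blast
    have hw: "mat_eval w ?h \<in> S" using mat_eval_inverse(2)[OF inv elim] ag(4)[OF gw] by simp
    show ?case
    proof (rule lie_algebra_curve[where s = w and E = "\<lambda>s. mat_eval w g ** mat_eval s ?h"])
      show "mat_DERIV (\<lambda>s. mat_eval w g ** mat_eval s ?h) (mat_eval w (g ** mat_deriv ?h)) w"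
        using mat_DERIV_mult[OF mat_DERIV_const[of "mat_eval w g"] mat_DERIV_eval[OF elim(2)]] elim
        by (simp add: mat_eval_simps mat_regular_simps)
      show "mat_eval w g ** mat_eval w ?h = mat 1"
        using inv elim by (simp add: invertible_matrix_inv mat_eval_simps flip: mat_eval_simps(4))
      fix p :: "complex^'a^'a \<Rightarrow> complex" assume p: "p \<in> polyfun" "\<And>A. A \<in> S \<Longrightarrow> p A = 0"
      have "\<forall>\<^sub>F s in at w. p (mat_eval w g ** mat_eval s ?h) = 0"
        using eventually_cofinite_at[OF ev] by eventually_elim (use p(2) ag(1) gw in blast)
      moreover have "p (mat_eval w g ** mat_eval w ?h) = 0" using p(2) ag(1) gw hw by blast
      ultimately have "\<forall>\<^sub>F s in nhds w. p (mat_eval w g ** mat_eval s ?h) = 0"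
        by (auto simp: eventually_at_filter elim: eventually_mono)
      thus "((\<lambda>s. p (mat_eval w g ** mat_eval s ?h)) has_field_derivative 0) (at w)"
        by (subst DERIV_cong_ev[OF refl _ refl]) auto
    qed
  qed
qed

section \<open>Gradings and exponentials of matrices\<close>

text \<open>A function \<open>d\<close> on the index set grades the square matrices, the entry \<open>(a, b)\<close> having degree
  \<open>d a - d b\<close>.\<close>
definition deg_ge :: "('n \<Rightarrow> complex) \<Rightarrow> nat \<Rightarrow> 'a::zero^'n^'n \<Rightarrow> bool" where
  "deg_ge d k M \<longleftrightarrow> (\<forall>a b. M $ a $ b \<noteq> 0 \<longrightarrow> (\<exists>m\<ge>k. d a - d b = of_nat m))"

lemma deg_ge_0 [simp]: "deg_ge d k 0"
  by (simp add: deg_ge_def)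

lemma deg_ge_add: "deg_ge d k A \<Longrightarrow> deg_ge d k B \<Longrightarrow> deg_ge d k (A + B)" for A B :: "'a::comm_ring_1^'n^'n"
  unfolding deg_ge_def
proof (intro allI impI)
  fix a b assume "\<forall>a b. A $ a $ b \<noteq> 0 \<longrightarrow> (\<exists>m\<ge>k. d a - d b = of_nat m)" "\<forall>a b. B $ a $ b \<noteq> 0 \<longrightarrow> (\<exists>m\<ge>k. d a - d b = of_nat m)"
    "(A + B) $ a $ b \<noteq> 0"
  thus "\<exists>m\<ge>k. d a - d b = of_nat m" by (cases "A $ a $ b = 0") auto
qed

lemma deg_ge_uminus: "deg_ge d k A \<Longrightarrow> deg_ge d k (- A)" for A :: "'a::comm_ring_1^'n^'n"
  by (simp add: deg_ge_def)

lemma deg_ge_diff: "deg_ge d k A \<Longrightarrow> deg_ge d k B \<Longrightarrow> deg_ge d k (A - B)" for A B :: "'a::comm_ring_1^'n^'n"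
  using deg_ge_add[of d k A "- B"] deg_ge_uminus by auto

lemma deg_ge_msc: "deg_ge d k A \<Longrightarrow> deg_ge d k (msc c A)" for A :: "'a::comm_ring_1^'n^'n"
  unfolding deg_ge_def by (metis msc_nth mult_zero_right)

lemma deg_ge_sum: "(\<And>i. i \<in> I \<Longrightarrow> deg_ge d k (f i)) \<Longrightarrow> deg_ge d k (sum f I)" for f :: "'i \<Rightarrow> 'a::comm_ring_1^'n^'n"
  by (induction I rule: infinite_finite_induct) (simp_all add: deg_ge_add)

lemma deg_ge_mono: "deg_ge d k A \<Longrightarrow> l \<le> k \<Longrightarrow> deg_ge d l A"
  unfolding deg_ge_def by (meson order_trans)

lemma deg_ge_mult:
  fixes A B :: "'a::comm_ring_1^'n^'n"
  assumes "deg_ge d k A" "deg_ge d l B" shows "deg_ge d (k + l) (A ** B)"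
  unfolding deg_ge_def
proof (intro allI impI)
  fix a b assume "(A ** B) $ a $ b \<noteq> 0"
  then obtain c where "A $ a $ c * B $ c $ b \<noteq> 0" unfolding mat_mult_nth using sum.not_neutral_contains_not_neutral by blast
  hence "A $ a $ c \<noteq> 0" "B $ c $ b \<noteq> 0" by auto
  then obtain m m' where m: "m \<ge> k" "d a - d c = of_nat m" "m' \<ge> l" "d c - d b = of_nat m'"
    using assms unfolding deg_ge_def by blast
  have "d a - d b = (d a - d c) + (d c - d b)" by simp
  also have "\<dots> = of_nat (m + m')" unfolding m(2) m(4) by simp
  finally have "d a - d b = of_nat (m + m')" .
  moreover have "k + l \<le> m + m'" using m(1,3) by simp
  ultimately show "\<exists>m\<ge>k + l. d a - d b = of_nat m" by blast
qed

lemma deg_ge_mult_le: "deg_ge d k A \<Longrightarrow> deg_ge d l B \<Longrightarrow> j \<le> k + l \<Longrightarrow> deg_ge d j (A ** B)" for A B :: "'a::comm_ring_1^'n^'n"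
  using deg_ge_mult deg_ge_mono by blast

lemma deg_ge_one: "deg_ge d 0 (mat 1 :: 'a::comm_ring_1^'n^'n)"
  by (auto simp: deg_ge_def mat_one_nth intro!: exI[of _ 0])

lemma deg_ge_const_mat: "deg_ge d k (const_mat A) \<longleftrightarrow> deg_ge d k A"
  by (simp add: deg_ge_def)

lemma deg_ge_mat_deriv: "deg_ge d k A \<Longrightarrow> deg_ge d k (mat_deriv A)"
  unfolding deg_ge_def by (metis mat_deriv_nth rderiv_0)

text \<open>All degrees that are natural numbers lie below K. A matrix of degree at least K is
  therefore 0, and one of degree at least 1 has K-th power 0.\<close>

definition deg_bound :: "('n \<Rightarrow> complex) \<Rightarrow> nat \<Rightarrow> bool" where
  "deg_bound d K \<longleftrightarrow> (\<forall>a b m. d a - d b = of_nat m \<longrightarrow> m < K)"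

lemma deg_ge_bounded: 
  fixes d :: "'n::finite \<Rightarrow> complex"
  obtains K where "deg_bound d K" "2 \<le> K"
proof -
  have inj: "inj (of_nat :: nat \<Rightarrow> complex)" by (rule inj_of_nat)
  have "finite (of_nat -` ((\<lambda>(a, b). d a - d b) ` UNIV) :: nat set)"
    by (intro finite_vimageI inj) simp
  then obtain K where K: "\<forall>m \<in> (of_nat -` ((\<lambda>(a, b). d a - d b) ` UNIV) :: nat set). m < K"
    using finite_nat_set_iff_bounded by blast
  have "m < K" if "d a - d b = of_nat m" for a b m
  proof -
    have "m \<in> (of_nat -` ((\<lambda>(a, b). d a - d b) ` UNIV) :: nat set)"
      using that by (auto intro!: rev_image_eqI[of "(a, b)"])
    thus ?thesis using K by blast
  qed
  thus ?thesis using that[of "max K 2"] by (auto simp: less_max_iff_disj deg_bound_def)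
qed

lemma deg_ge_zero: "deg_bound d K \<Longrightarrow> deg_ge d K M \<Longrightarrow> M = 0"
  unfolding deg_ge_def deg_bound_def by (metis leD mat_eqI zero_index)

section \<open>Powers and exponentials of nilpotent matrices\<close>

definition mpow :: "'a::comm_ring_1^'n^'n \<Rightarrow> nat \<Rightarrow> 'a^'n^'n" where
  "mpow M k = ((\<lambda>X. M ** X) ^^ k) (mat 1)"

lemma mpow_0 [simp]: "mpow M 0 = mat 1" and mpow_Suc [simp]: "mpow M (Suc k) = M ** mpow M k"
  by (simp_all add: mpow_def)

lemma mpow_Suc2: "mpow M (Suc k) = mpow M k ** M"
  by (induction k) (simp_all add: matrix_mul_assoc[symmetric], simp add: matrix_mul_assoc)

lemma mpow_msc: "mpow (msc c M) k = msc (c ^ k) (mpow M k)"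
  by (induction k) (simp_all add: msc_simps matrix_ring_simps mult.commute)

lemma mpow_const_mat: "mpow (const_mat M) k = const_mat (mpow M k)"
  by (induction k) (simp_all add: const_mat_simps)

lemma deg_ge_mpow: "deg_ge d j M \<Longrightarrow> deg_ge d (j * k) (mpow M k)"
  by (induction k) (simp_all add: deg_ge_one deg_ge_mult)

lemma mpow_mono_zero: "mpow M k = 0 \<Longrightarrow> k \<le> l \<Longrightarrow> mpow M l = 0"
proof (induction l)
  case (Suc l)
  then show ?case by (cases "k = Suc l") (simp_all add: le_Suc_eq)
qed simp

lemma nilpotent_of_deg_ge:
  fixes M :: "'a::comm_ring_1^'n^'n"
  assumes "deg_ge d 1 M" "deg_bound d K"
  shows "mpow M K = 0"
  using deg_ge_zero[of d K "mpow M K"] assms(2) deg_ge_mpow[OF assms(1), of K] by simp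

lemma one_plus_nilpotent_inverse:
  fixes M :: "'a::field^'n^'n"
  assumes "mpow M K = 0" shows "(mat 1 + M) ** (\<Sum>k<K. mpow (- M) k) = mat 1"
proof -
  have "(mat 1 + M) ** (\<Sum>k<L. mpow (- M) k) = mat 1 - mpow (- M) L" for L
  proof (induction L)
    case (Suc L)
    have "(mat 1 + M) ** (\<Sum>k<Suc L. mpow (- M) k) = (mat 1 - mpow (- M) L) + (mat 1 + M) ** mpow (- M) L"
      using Suc by (simp add: matrix_ring_simps)
    thus ?case by (simp add: matrix_ring_simps)
  qed simp
  moreover have "mpow (- M) K = 0"
    using assms mpow_msc[of "-1" M K] by (simp add: msc_simps)
  ultimately show ?thesis by simp
qed

text \<open>The cutoff is a parameter because nilpotency bounds come from the grading. It is mostly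
  \<open>Suc N\<close> with N-th power 0: the additional last term is 0 and makes the index shifts
  exact.\<close>

definition mexp :: "nat \<Rightarrow> 'a::field^'n^'n \<Rightarrow> 'a^'n^'n" where
  "mexp K M = (\<Sum>k<K. msc (inverse (of_nat (fact k))) (mpow M k))"

lemma mexp_expand:
  fixes M :: "'a::field^'n^'n"
  assumes "deg_ge d j M" "2 \<le> K"
  obtains R where "mexp K M = mat 1 + M + R" "deg_ge d (2 * j) R"
proof -
  obtain K' where K: "K = Suc (Suc K')" using assms(2) by (metis add_2_eq_Suc le_Suc_ex)
  define R where "R = (\<Sum>k<K'. msc (inverse (of_nat (fact (Suc (Suc k))))) (mpow M (Suc (Suc k))))"
  have "mexp K M = mat 1 + M + R"
    unfolding mexp_def K R_def by (subst sum.lessThan_Suc_shift, subst sum.lessThan_Suc_shift) (simp add: msc_simps add.assoc del: fact_Suc)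
  moreover have "deg_ge d (2 * j) R" unfolding R_def
  proof (intro deg_ge_sum deg_ge_msc)
    fix k
    show "deg_ge d (2 * j) (mpow M (Suc (Suc k)))"
      using deg_ge_mono[OF deg_ge_mpow[OF assms(1), of "Suc (Suc k)"]] by simp
  qed
  ultimately show ?thesis using that by blast
qed

text \<open>The inverse comes from the geometric series: the exponential is 1 plus a matrix of
  positive degree, which is nilpotent.\<close>

lemma invertible_mexp:
  fixes M :: "'a::field^'n::finite^'n"
  assumes "deg_ge d 1 M" "2 \<le> K" shows "invertible (mexp K M)"
proof -
  obtain R where R: "mexp K M = mat 1 + M + R" "deg_ge d (2 * 1) R" using mexp_expand[OF assms] .
  obtain L where L: "deg_bound d L" using deg_ge_bounded[of d] by blast
  have "deg_ge d 1 (M + R)" using deg_ge_add[OF assms(1) deg_ge_mono[OF R(2), of 1]] by simp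
  hence "mpow (M + R) L = 0" using L by (rule nilpotent_of_deg_ge)
  from one_plus_nilpotent_inverse[OF this] show ?thesis unfolding R(1) add.assoc invertible_right_inverse by blast
qed

lemma of_nat_fact_ratfun: "inverse (of_nat (fact k)) = rconst (inverse (of_nat (fact k)))"
  by (simp only: rconst_inverse rconst_of_nat)

lemma mat_eval_mpow: "mat_regular w M \<Longrightarrow> mat_regular w (mpow M k) \<and> mat_eval w (mpow M k) = mpow (mat_eval w M) k"
  by (induction k) (simp_all add: mat_eval_simps mat_regular_simps)

lemma mat_eval_mexp:
  assumes "mat_regular w M"
  shows "mat_eval w (mexp K M) = mexp K (mat_eval w M)"
  unfolding mexp_def of_nat_fact_ratfun using mat_eval_mpow[OF assms]
  by (simp add: mat_eval_sum mat_eval_simps mat_regular_simps)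

text \<open>The index \<open>k - 1\<close> is harmless for \<open>k = 0\<close>, where the coefficient vanishes.\<close>
lemma mexp_shift:
  fixes F :: "'a::field^'n^'n"
  assumes F: "mpow F N = 0" and ch: "\<And>k. (of_nat (fact k) :: 'a) \<noteq> 0"
  shows "(\<Sum>k<Suc N. msc (of_nat k * c ^ k * inverse (of_nat (fact k))) (mpow F (k - 1))) = msc c (mexp (Suc N) (msc c F))"
proof -
  have "(\<Sum>k<Suc N. msc (of_nat k * c ^ k * inverse (of_nat (fact k))) (mpow F (k - 1)))
    = (\<Sum>k<N. msc (of_nat (Suc k) * c ^ Suc k * inverse (of_nat (fact (Suc k)))) (mpow F k))"
    by (subst sum.lessThan_Suc_shift) (simp add: msc_simps del: of_nat_Suc fact_Suc)
  also have "\<dots> = (\<Sum>k<N. msc (c * c ^ k * inverse (of_nat (fact k))) (mpow F k))"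
  proof (intro sum.cong refl arg_cong2[where f = msc])
    fix k
    have s: "of_nat (Suc k) * of_nat (fact k) = (of_nat (fact (Suc k)) :: 'a)" by (simp only: fact_Suc of_nat_mult of_nat_id)
    have "(of_nat (Suc k) :: 'a) \<noteq> 0" using s ch[of "Suc k"] by auto
    thus "of_nat (Suc k) * c ^ Suc k * inverse (of_nat (fact (Suc k))) = c * c ^ k * inverse (of_nat (fact k) :: 'a)"
      unfolding s[symmetric] using ch[of k] by (simp add: field_simps del: of_nat_Suc of_nat_fact)
  qed
  also have "\<dots> = (\<Sum>k<Suc N. msc (c * c ^ k * inverse (of_nat (fact k))) (mpow F k))" using F by (simp add: msc_simps)
  also have "\<dots> = msc c (mexp (Suc N) (msc c F))"
    by (simp only: mexp_def mpow_msc msc_sum msc_simps mult_ac)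
  finally show ?thesis .
qed

section \<open>Derivatives of exponentials, and conjugation by them\<close>

lemma mat_DERIV_mexp:
  fixes F :: "complex^'n^'n"
  assumes F: "mpow F N = 0"
  shows "mat_DERIV (\<lambda>s. mexp (Suc N) (msc s F)) (mexp (Suc N) (msc s F) ** F) s"
proof -
  have e: "mexp (Suc N) (msc s F) $ i $ j = (\<Sum>k<Suc N. s ^ k * (inverse (of_nat (fact k)) * mpow F k $ i $ j))" for s i j
    by (simp add: mexp_def mpow_msc mult_ac del: sum.lessThan_Suc)
  have "mexp (Suc N) (msc s F) ** F = (\<Sum>k<Suc N. msc (inverse (of_nat (fact k)) * s ^ k) (mpow F (Suc k)))"
    by (simp only: mexp_def mpow_msc matrix_sum_rdistrib matrix_ring_simps msc_simps mpow_Suc2)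
  also have "\<dots> = (\<Sum>k<N. msc (inverse (of_nat (fact k)) * s ^ k) (mpow F (Suc k)))" using F by (simp add: msc_simps)
  also have "\<dots> = (\<Sum>k<Suc N. msc (inverse (of_nat (fact k)) * (of_nat k * s ^ (k - 1))) (mpow F k))"
  proof -
    have e: "inverse (of_nat (fact (Suc k))) * (of_nat (Suc k) * s ^ k) = inverse (of_nat (fact k)) * (s ^ k :: complex)" for k
      by (simp only: fact_Suc of_nat_mult of_nat_id inverse_mult_distrib) (simp del: of_nat_Suc of_nat_fact)
    show ?thesis unfolding sum.lessThan_Suc_shift diff_Suc_1 e by (simp add: msc_simps)
  qed
  finally have d: "(mexp (Suc N) (msc s F) ** F) $ i $ j
     = (\<Sum>k<Suc N. of_nat k * s ^ (k - 1) * (inverse (of_nat (fact k)) * mpow F k $ i $ j))" for i j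
    by (simp add: mult_ac del: sum.lessThan_Suc)
  show ?thesis unfolding mat_DERIV_def e d
    by (auto intro!: derivative_eq_intros sum.cong)
qed

text \<open>This is exp(c F) h exp(- c F) = h + c \<alpha> F with the inverse multiplied away,
  summed from F^k h = h F^k + k \<alpha> F^k. The assumption on factorials expresses characteristic
  0; the intended field is C(z).\<close>

lemma mexp_conj_weight:
  fixes F h :: "'a::field^'n^'n"
  assumes F: "mpow F N = 0" and ch: "\<And>k. (of_nat (fact k) :: 'a) \<noteq> 0"
    and w: "F ** h = h ** F + msc \<alpha> F"
  shows "mexp (Suc N) (msc c F) ** h = h ** mexp (Suc N) (msc c F) + msc (c * \<alpha>) (F ** mexp (Suc N) (msc c F))"
proof -
  have p: "mpow F k ** h = h ** mpow F k + msc (of_nat k * \<alpha>) (mpow F k)" for k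
  proof (induction k)
    case (Suc k)
    have "mpow F (Suc k) ** h = F ** (mpow F k ** h)" by (simp add: matrix_mul_assoc)
    also have "\<dots> = (F ** h) ** mpow F k + msc (of_nat k * \<alpha>) (F ** mpow F k)"
      by (simp only: Suc matrix_ring_simps matrix_mul_assoc)
    also have "\<dots> = h ** mpow F (Suc k) + msc (of_nat (Suc k) * \<alpha>) (mpow F (Suc k))"
      by (simp add: w matrix_ring_simps msc_simps matrix_mul_assoc[symmetric] distrib_right add_ac)
    finally show ?case .
  qed (simp add: msc_simps)
  have pk: "msc (of_nat k) (mpow F k) = msc (of_nat k) (F ** mpow F (k - 1))" for k
    by (cases k) (simp_all add: msc_simps)
  have t: "msc (inverse (of_nat (fact k)) * c ^ k * (of_nat k * \<alpha>)) (mpow F k)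
    = msc \<alpha> (F ** msc (of_nat k * c ^ k * inverse (of_nat (fact k))) (mpow F (k - 1)))" for k
  proof -
    have "msc (inverse (of_nat (fact k)) * c ^ k * (of_nat k * \<alpha>)) (mpow F k)
      = msc (inverse (of_nat (fact k)) * c ^ k * \<alpha>) (msc (of_nat k) (mpow F k))" by (simp add: msc_simps mult_ac)
    thus ?thesis unfolding pk by (simp add: msc_simps matrix_ring_simps mult_ac)
  qed
  have "mexp (Suc N) (msc c F) ** h = h ** mexp (Suc N) (msc c F)
     + (\<Sum>k<Suc N. msc (inverse (of_nat (fact k)) * c ^ k * (of_nat k * \<alpha>)) (mpow F k))"
    by (simp only: mexp_def mpow_msc matrix_sum_rdistrib matrix_sum_ldistrib matrix_ring_simps p msc_simps sum.distrib)
  also have "(\<Sum>k<Suc N. msc (inverse (of_nat (fact k)) * c ^ k * (of_nat k * \<alpha>)) (mpow F k))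
    = msc \<alpha> (F ** (msc c (mexp (Suc N) (msc c F))))"
    unfolding t mexp_shift[OF F ch, symmetric] by (simp only: matrix_sum_ldistrib msc_sum)
  finally show ?thesis by (simp add: matrix_ring_simps msc_simps mult_ac)
qed

text \<open>This is exp(c F) E exp(- c F) = E - c H - c^2 F for an sl2-triple. It is summed from F^k
  E = E F^k - k F^(k-1) H + k (k - 1) F^(k-1); moving H to the left turns the last coefficient into
  - k (k - 1).\<close>

lemma mexp_conj_raising:
  fixes F E H :: "'a::field^'n^'n"
  assumes F: "mpow F N = 0" and ch: "\<And>k. (of_nat (fact k) :: 'a) \<noteq> 0"
    and EF: "E ** F - F ** E = H" and w: "F ** H = H ** F + msc 2 F"
  shows "mexp (Suc N) (msc c F) ** E = E ** mexp (Suc N) (msc c F) - msc c (H ** mexp (Suc N) (msc c F))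
     - msc (c\<^sup>2) (F ** mexp (Suc N) (msc c F))"
proof -
  let ?g = "mexp (Suc N) (msc c F)"
  have hp: "mpow F k ** H = H ** mpow F k + msc (of_nat k * 2) (mpow F k)" for k
  proof (induction k)
    case (Suc k)
    have "mpow F (Suc k) ** H = F ** (mpow F k ** H)" by (simp add: matrix_mul_assoc)
    also have "\<dots> = (F ** H) ** mpow F k + msc (of_nat k * 2) (F ** mpow F k)"
      by (simp only: Suc matrix_ring_simps matrix_mul_assoc)
    also have "\<dots> = H ** mpow F (Suc k) + msc (of_nat (Suc k) * 2) (mpow F (Suc k))"
      by (simp add: w matrix_ring_simps msc_simps matrix_mul_assoc[symmetric] distrib_right add_ac)
    finally show ?case .
  qed (simp add: msc_simps)
  have FE: "F ** E = E ** F - H" using EF by (simp add: algebra_simps)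
  have p: "mpow F k ** E = E ** mpow F k - msc (of_nat k) (mpow F (k - 1) ** H) + msc (of_nat k * (of_nat k - 1)) (mpow F (k - 1))" for k
  proof (induction k)
    case (Suc k)
    show ?case
    proof (cases k)
      case 0
      then show ?thesis by (simp add: FE msc_simps)
    next
      case (Suc j)
      have "mpow F (Suc k) ** E = F ** (mpow F k ** E)" by (simp add: matrix_mul_assoc)
      also have "\<dots> = (F ** E) ** mpow F k - msc (of_nat k) (mpow F k ** H) + msc (of_nat k * (of_nat k - 1)) (mpow F k)"
        unfolding Suc.IH by (simp only: Suc diff_Suc_1 mpow_Suc matrix_ring_simps matrix_mul_assoc)
      also have "(F ** E) ** mpow F k = E ** mpow F (Suc k) - H ** mpow F k" by (simp only: FE matrix_ring_simps mpow_Suc matrix_mul_assoc)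
      also have "H ** mpow F k = mpow F k ** H - msc (of_nat k * 2) (mpow F k)" by (simp add: hp)
      finally show ?thesis by (simp add: msc_simps distrib_right) (simp add: algebra_simps flip: msc_simps(2,4))
    qed
  qed (simp add: msc_simps)
  have t: "msc (inverse (of_nat (fact k)) * c ^ k) (mpow F k ** E) = msc (inverse (of_nat (fact k)) * c ^ k) (E ** mpow F k)
     - H ** msc (of_nat k * c ^ k * inverse (of_nat (fact k))) (mpow F (k - 1))
     - msc (of_nat k * (of_nat k - 1) * c ^ k * inverse (of_nat (fact k))) (mpow F (k - 1))" for k
  proof (cases k)
    case (Suc j)
    show ?thesis unfolding p
      by (simp add: Suc hp msc_simps matrix_ring_simps del: fact_Suc) (simp add: algebra_simps msc_simps(9) flip: msc_simps(2,4) del: fact_Suc)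
  qed (simp add: msc_simps)
  have s2: "(\<Sum>k<Suc N. msc (of_nat k * (of_nat k - 1) * c ^ k * inverse (of_nat (fact k))) (mpow F (k - 1))) = msc (c\<^sup>2) (F ** ?g)"
  proof -
    have "(\<Sum>k<Suc N. msc (of_nat k * (of_nat k - 1) * c ^ k * inverse (of_nat (fact k))) (mpow F (k - 1)))
      = (\<Sum>k<N. msc (of_nat (Suc k) * of_nat k * c ^ Suc k * inverse (of_nat (fact (Suc k)))) (mpow F k))"
      by (subst sum.lessThan_Suc_shift) (simp add: msc_simps del: fact_Suc)
    also have "\<dots> = (\<Sum>k<N. msc c (F ** msc (of_nat k * c ^ k * inverse (of_nat (fact k))) (mpow F (k - 1))))"
    proof (intro sum.cong refl)
      fix k
      have s: "of_nat (Suc k) * of_nat (fact k) = (of_nat (fact (Suc k)) :: 'a)" by (simp only: fact_Suc of_nat_mult of_nat_id)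
      have "(of_nat (Suc k) :: 'a) \<noteq> 0" using s ch[of "Suc k"] by auto
      hence "of_nat (Suc k) * of_nat k * c ^ Suc k * inverse (of_nat (fact (Suc k))) = c * (of_nat k * c ^ k * inverse (of_nat (fact k) :: 'a))"
        unfolding s[symmetric] using ch[of k] by (simp add: field_simps del: of_nat_Suc of_nat_fact)
      moreover have "msc (of_nat k * x) (mpow F k) = msc (of_nat k * x) (F ** mpow F (k - 1))" for x
        by (cases k) (simp_all add: msc_simps)
      ultimately show "msc (of_nat (Suc k) * of_nat k * c ^ Suc k * inverse (of_nat (fact (Suc k)))) (mpow F k)
        = msc c (F ** msc (of_nat k * c ^ k * inverse (of_nat (fact k))) (mpow F (k - 1)))"
        by (simp only: matrix_ring_simps msc_simps mult.left_commute[of c] mult.assoc)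
    qed
    also have "\<dots> = (\<Sum>k<Suc N. msc c (F ** msc (of_nat k * c ^ k * inverse (of_nat (fact k))) (mpow F (k - 1))))"
    proof -
      have "msc c (F ** msc (of_nat N * x * y) (mpow F (N - 1))) = 0" for x y
        using F by (cases N) (simp_all add: msc_simps matrix_ring_simps)
      thus ?thesis by simp
    qed
    also have "\<dots> = msc c (F ** msc c ?g)"
      unfolding mexp_shift[OF F ch, symmetric] by (simp only: matrix_sum_ldistrib msc_sum)
    finally show ?thesis by (simp add: matrix_ring_simps msc_simps power2_eq_square)
  qed
  have "?g ** E = (\<Sum>k<Suc N. msc (inverse (of_nat (fact k)) * c ^ k) (mpow F k ** E))"
    by (simp only: mexp_def mpow_msc matrix_sum_rdistrib matrix_ring_simps msc_simps)
  also have "\<dots> = E ** ?g - H ** msc c ?g - msc (c\<^sup>2) (F ** ?g)"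
    unfolding t sum_subtractf s2 matrix_sum_ldistrib[symmetric] mexp_shift[OF F ch]
    by (simp only: mexp_def mpow_msc matrix_sum_ldistrib matrix_ring_simps msc_simps)
  finally show ?thesis by (simp add: matrix_ring_simps)
qed

text \<open>The derivative of \<mu>^k is written as k \<mu>^k times \<open>dlog \<mu>\<close>, which
  avoids exponents k - 1 but requires the case \<mu> = 0 to be separated.\<close>

lemma mat_deriv_mexp:
  fixes F :: "complex^'n^'n"
  assumes F: "mpow F N = 0"
  shows "mat_deriv (mexp (Suc N) (msc \<mu> (const_mat F))) = msc (rderiv \<mu>) (const_mat F ** mexp (Suc N) (msc \<mu> (const_mat F)))"
proof (cases "\<mu> = 0")
  case True
  have "mat_deriv (mpow 0 k :: ratfun^'n^'n) = 0" for k by (cases k) (simp_all add: mat_deriv_simps)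
  thus ?thesis using True
    by (simp add: mexp_def mat_deriv_sum mat_deriv_simps of_nat_fact_ratfun msc_simps del: of_nat_fact)
next
  case \<mu>: False
  have F': "mpow (const_mat F) N = 0" using F by (simp add: mpow_const_mat const_mat_simps)
  have ch: "of_nat (fact k) \<noteq> (0 :: ratfun)" for k
    using rconst_of_nat[of "fact k"] by (metis fact_nonzero of_nat_eq_0_iff rconst_eq_0_iff)
  let ?g = "mexp (Suc N) (msc \<mu> (const_mat F))"
  have d: "rderiv (rconst (inverse (of_nat (fact k))) * \<mu> ^ k) = dlog \<mu> * (of_nat k * \<mu> ^ k * inverse (of_nat (fact k)))" for k
  proof -
    have "rderiv (\<mu> ^ k) = dlog (\<mu> ^ k) * \<mu> ^ k" using \<mu> by (intro rderiv_eq_dlog) simp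
    thus ?thesis unfolding rderiv_cmult by (simp add: dlog_power of_nat_fact_ratfun mult_ac)
  qed
  have t: "msc (of_nat k * x) (mpow (const_mat F) k) = const_mat F ** msc (of_nat k * x) (mpow (const_mat F) (k - 1))" for k x
    by (cases k) (simp_all add: msc_simps matrix_ring_simps)
  have "mat_deriv ?g = (\<Sum>k<Suc N. msc (dlog \<mu> * (of_nat k * \<mu> ^ k * inverse (of_nat (fact k)))) (mpow (const_mat F) k))"
    unfolding mexp_def mpow_msc mpow_const_mat of_nat_fact_ratfun mat_deriv_sum
    by (simp only: msc_simps mat_deriv_simps d add_0_right of_nat_fact_ratfun)
  also have "\<dots> = msc (dlog \<mu>) (const_mat F ** (\<Sum>k<Suc N. msc (of_nat k * \<mu> ^ k * inverse (of_nat (fact k))) (mpow (const_mat F) (k - 1))))"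
    by (simp only: matrix_sum_ldistrib msc_sum mult.assoc t[symmetric] msc_simps)
  also have "\<dots> = msc (dlog \<mu> * \<mu>) (const_mat F ** ?g)"
    unfolding mexp_shift[OF F' ch] by (simp only: matrix_ring_simps msc_simps)
  also have "dlog \<mu> * \<mu> = rderiv \<mu>" using \<mu> by (simp add: dlog_def)
  finally show ?thesis .
qed

section \<open>Roots and the triangular decomposition\<close>

lemma functional_on_simps:
  assumes "functional_on V \<beta>"
  shows "X \<in> V \<Longrightarrow> Y \<in> V \<Longrightarrow> \<beta> (X + Y) = \<beta> X + \<beta> Y" "X \<in> V \<Longrightarrow> \<beta> (msc c X) = c * \<beta> X"
  using assms by (auto simp: functional_on_def)

text \<open>Elimination of one functional at a time: a vector Y in the kernel of the others on which
  \<open>al j\<close> is nonzero fixes the coefficient of \<open>al j\<close> as \<beta>(Y) divided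
  by the value of \<open>al j\<close> at Y.\<close>

lemma functional_in_span:
  fixes V :: "(complex^'n^'n) set" and al :: "'r \<Rightarrow> complex^'n^'n \<Rightarrow> complex"
  assumes V: "\<And>X Y. X \<in> V \<Longrightarrow> Y \<in> V \<Longrightarrow> X + Y \<in> V" "\<And>c X. X \<in> V \<Longrightarrow> msc c X \<in> V"
    and al: "\<And>i. functional_on V (al i)" and I: "finite I" and \<beta>: "functional_on V \<beta>"
    and ker: "\<And>Y. Y \<in> V \<Longrightarrow> \<forall>i\<in>I. al i Y = 0 \<Longrightarrow> \<beta> Y = 0"
  shows "\<exists>c. \<forall>Y\<in>V. \<beta> Y = (\<Sum>i\<in>I. c i * al i Y)"
  using I \<beta> ker
proof (induction I arbitrary: \<beta> rule: finite_induct)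
  case (insert j I)
  have ext: "(\<Sum>i\<in>insert j I. (c(j := x)) i * al i Y) = x * al j Y + (\<Sum>i\<in>I. c i * al i Y)" for c x Y
    using insert.hyps by (auto intro!: sum.cong)
  show ?case
  proof (cases "\<forall>Y\<in>V. (\<forall>i\<in>I. al i Y = 0) \<longrightarrow> al j Y = 0")
    case True
    hence "\<exists>c. \<forall>Y\<in>V. \<beta> Y = (\<Sum>i\<in>I. c i * al i Y)" using insert.prems by (intro insert.IH) auto
    then obtain c where "\<forall>Y\<in>V. \<beta> Y = (\<Sum>i\<in>I. c i * al i Y)" by blast
    thus ?thesis by (intro exI[of _ "c(j := 0)"]) (simp only: ext mult_zero_left add_0_left)
  next
    case False
    then obtain Y where Y: "Y \<in> V" "\<forall>i\<in>I. al i Y = 0" "al j Y \<noteq> 0" by blast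
    define x where "x = \<beta> Y / al j Y"
    note fs = functional_on_simps[OF al] functional_on_simps[OF insert.prems(1)]
    have "\<exists>c. \<forall>X\<in>V. \<beta> X - x * al j X = (\<Sum>i\<in>I. c i * al i X)"
    proof (rule insert.IH)
      show "functional_on V (\<lambda>X. \<beta> X - x * al j X)"
        using V by (simp add: functional_on_def fs algebra_simps)
      fix X assume X: "X \<in> V" "\<forall>i\<in>I. al i X = 0"
      define X' where "X' = X + msc (- al j X / al j Y) Y"
      have X': "X' \<in> V" using X Y V by (simp add: X'_def)
      have "\<forall>i\<in>insert j I. al i X' = 0" using X Y V by (simp add: X'_def fs)
      hence "\<beta> X' = 0" using insert.prems(2) X' by blast
      thus "\<beta> X - x * al j X = 0" using X Y V by (simp add: X'_def fs x_def)
    qed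
    then obtain c where "\<forall>X\<in>V. \<beta> X - x * al j X = (\<Sum>i\<in>I. c i * al i X)" by blast
    hence "\<forall>X\<in>V. \<beta> X = x * al j X + (\<Sum>i\<in>I. c i * al i X)" by (simp add: algebra_simps)
    thus ?thesis by (intro exI[of _ "c(j := x)"]) (simp only: ext)
  qed
qed simp

text \<open>By independence \<open>al i\<close> is no combination of the others, so it is nonzero
  somewhere on their common kernel; a vector there is rescaled.\<close>

lemma functional_dual_basis:
  fixes V :: "(complex^'n^'n) set" and al :: "'r::finite \<Rightarrow> complex^'n^'n \<Rightarrow> complex"
  assumes V: "\<And>X Y. X \<in> V \<Longrightarrow> Y \<in> V \<Longrightarrow> X + Y \<in> V" "\<And>c X. X \<in> V \<Longrightarrow> msc c X \<in> V"
    and al: "\<And>i. functional_on V (al i)"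
    and ind: "\<And>c i. \<forall>Y\<in>V. (\<Sum>j\<in>UNIV. c j * al j Y) = 0 \<Longrightarrow> c i = 0"
  shows "\<exists>Y. \<forall>i. Y i \<in> V \<and> (\<forall>j. al j (Y i) = (if j = i then 1 else 0))"
proof (rule choice, rule allI)
  fix i
  have "\<not> (\<forall>Y\<in>V. (\<forall>j\<in>UNIV - {i}. al j Y = 0) \<longrightarrow> al i Y = 0)"
  proof
    assume "\<forall>Y\<in>V. (\<forall>j\<in>UNIV - {i}. al j Y = 0) \<longrightarrow> al i Y = 0"
    hence "\<exists>c. \<forall>Y\<in>V. al i Y = (\<Sum>j\<in>UNIV - {i}. c j * al j Y)"
      by (intro functional_in_span[of V al] V al) auto
    then obtain c where c: "\<forall>Y\<in>V. al i Y = (\<Sum>j\<in>UNIV - {i}. c j * al j Y)" by blast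
    have "(\<Sum>j\<in>UNIV. (c(i := -1)) j * al j Y) = - al i Y + (\<Sum>j\<in>UNIV - {i}. c j * al j Y)" for Y
      by (subst sum.remove[of _ i]) (auto intro!: sum.cong)
    hence "\<forall>Y\<in>V. (\<Sum>j\<in>UNIV. (c(i := -1)) j * al j Y) = 0" using c by simp
    from ind[OF this, of i] show False by simp
  qed
  then obtain Y where Y: "Y \<in> V" "\<forall>j\<in>UNIV - {i}. al j Y = 0" "al i Y \<noteq> 0" by blast
  hence "msc (1 / al i Y) Y \<in> V \<and> (\<forall>j. al j (msc (1 / al i Y) Y) = (if j = i then 1 else 0))"
    using V by (auto simp: functional_on_simps[OF al])
  thus "\<exists>Y. Y \<in> V \<and> (\<forall>j. al j Y = (if j = i then 1 else 0))" by blast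
qed

text \<open>At the last nonzero vector x_j the relation reads 0 = - (j + 1) (a + j) x_j. Scaling and
  lowering operator are abstract because the lemma serves both column vectors and the adjoint action
  on matrices.\<close>

lemma lowest_weight:
  fixes x :: "nat \<Rightarrow> 'v::zero" and s :: "complex \<Rightarrow> 'v \<Rightarrow> 'v"
  assumes s: "\<And>c v. s c v = 0 \<Longrightarrow> c = 0 \<or> v = 0"
    and x: "x 0 \<noteq> 0" "x N = 0" and F: "F 0 = 0"
    and step: "\<And>k. F (x (Suc k)) = s (- of_nat (Suc k) * (a + of_nat k)) (x k)"
  shows "\<exists>n. a = - of_nat n"
proof -
  define k where "k = (LEAST k. x k = 0)"
  have k: "x k = 0" unfolding k_def using x(2) by (rule LeastI)
  obtain j where j: "k = Suc j" using k x(1) by (cases k) auto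
  have "x j \<noteq> 0" using not_less_Least[of j "\<lambda>k. x k = 0"] j unfolding k_def by auto
  moreover have "s (- of_nat (Suc j) * (a + of_nat j)) (x j) = 0" using step[of j] k j F by simp
  ultimately have "- of_nat (Suc j) * (a + of_nat j) = 0" using s by blast
  hence "a + of_nat j = 0" by (simp del: of_nat_Suc)
  thus ?thesis by (auto simp: eq_neg_iff_add_eq_0)
qed

text \<open>Applying F to v until the next step gives 0 produces a lowest weight vector of weight a
  = la - 2 j. Its images under powers of E satisfy the relations of \<open>lowest_weight\<close>, so
  a = - n and la = 2 j - n.\<close>

lemma sl2_integral:
  fixes E F H :: "complex^'n^'n" and v :: "complex^'n"
  assumes EF: "E ** F - F ** E = H" and HE: "H ** E = E ** H + msc 2 E" and HF: "H ** F = F ** H - msc 2 F"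
    and nil: "mpow E N = 0" "mpow F N = 0" and v: "v \<noteq> 0" "H *v v = la *s v"
  shows "\<exists>k::int. la = of_int k"
proof -
  have mv: "msc c M *v u = c *s (M *v u)" for c :: complex and M :: "complex^'n^'n" and u
    by (simp add: matrix_vector_mult_def vec_eq_iff sum_distrib_left mult.assoc)
  have comp: "M *v (M' *v u) = (M ** M') *v u" for M M' :: "complex^'n^'n" and u
    by (simp add: matrix_vector_mul_assoc)
  define u where "u = (\<lambda>k. mpow F k *v v)"
  have Hu: "H *v u k = (la - 2 * of_nat k) *s u k" for k
  proof (induction k)
    case (Suc k)
    have "H *v u (Suc k) = (H ** F) *v u k" by (simp add: u_def comp matrix_mul_assoc)
    also have "\<dots> = F *v (H *v u k) - 2 *s (F *v u k)"
      unfolding HF by (simp add: matrix_vector_mult_diff_rdistrib mv comp)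
    also have "\<dots> = (la - 2 * of_nat (Suc k)) *s u (Suc k)"
      unfolding Suc by (simp add: u_def matrix_vector_mul_assoc[symmetric] vector_scalar_commute[symmetric] vec_eq_iff algebra_simps)
    finally show ?case .
  qed (simp add: u_def v)
  define k where "k = (LEAST k. u k = 0)"
  have "u N = 0" by (simp add: u_def nil)
  hence k: "u k = 0" unfolding k_def by (rule LeastI)
  obtain j where j: "k = Suc j" using k v(1) by (cases k) (auto simp: u_def)
  have uj: "u j \<noteq> 0" using not_less_Least[of j "\<lambda>k. u k = 0"] j unfolding k_def by auto
  define a where "a = la - 2 * of_nat j"
  define x where "x = (\<lambda>k. mpow E k *v u j)"
  have Fu: "F *v u j = 0" using k j by (simp add: u_def matrix_vector_mul_assoc)
  have Hx: "H *v x k = (a + 2 * of_nat k) *s x k" for k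
  proof (induction k)
    case (Suc k)
    have "H *v x (Suc k) = (H ** E) *v x k" by (simp add: x_def comp matrix_mul_assoc)
    also have "\<dots> = E *v (H *v x k) + 2 *s (E *v x k)"
      unfolding HE by (simp add: matrix_vector_mult_add_rdistrib mv comp)
    also have "\<dots> = (a + 2 * of_nat (Suc k)) *s x (Suc k)"
      unfolding Suc by (simp add: x_def matrix_vector_mul_assoc[symmetric] vector_scalar_commute[symmetric] vec_eq_iff algebra_simps)
    finally show ?case .
  qed (simp add: x_def Hu a_def)
  have Fx: "F *v x (Suc k) = (- of_nat (Suc k) * (a + of_nat k)) *s x k" for k
  proof (induction k)
    case 0
    have "F *v x (Suc 0) = (E ** F - H) *v u j" unfolding EF[symmetric] by (simp add: x_def comp)
    also have "\<dots> = E *v (F *v u j) - H *v u j" by (simp add: matrix_vector_mult_diff_rdistrib comp)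
    finally show ?case unfolding Fu Hu by (simp add: a_def x_def vec_eq_iff)
  next
    case (Suc k)
    have "F *v x (Suc (Suc k)) = (E ** F - H) *v x (Suc k)" unfolding EF[symmetric] by (simp add: x_def comp matrix_mul_assoc)
    also have "\<dots> = E *v (F *v x (Suc k)) - H *v x (Suc k)" by (simp add: matrix_vector_mult_diff_rdistrib comp)
    also have "E *v (F *v x (Suc k)) = (- of_nat (Suc k) * (a + of_nat k)) *s x (Suc k)"
      unfolding Suc by (simp add: x_def matrix_vector_mul_assoc[symmetric] vector_scalar_commute[symmetric])
    finally show ?case unfolding Hx by (simp add: vec_eq_iff algebra_simps)
  qed
  have "\<exists>n. a = - of_nat n"
  proof (rule lowest_weight[where x = x and s = "(*s)" and F = "\<lambda>v. F *v v" and N = N])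
    show "c *s w = 0 \<Longrightarrow> c = 0 \<or> w = 0" for c :: complex and w :: "complex^'n" by (simp add: vector_mul_eq_0)
  qed (use uj nil Fx in \<open>simp_all add: x_def\<close>)
  then obtain n where "a = - of_nat n" by blast
  hence "la = of_int (2 * int j - int n)" by (simp add: a_def algebra_simps)
  thus ?thesis by blast
qed

section \<open>Lie brackets and generated subalgebras\<close>

lemma lie_bracket_simps:
  fixes X Y Z :: "complex^'n^'n"
  shows "lie_bracket X (Y + Z) = lie_bracket X Y + lie_bracket X Z"
    "lie_bracket (X + Y) Z = lie_bracket X Z + lie_bracket Y Z"
    "lie_bracket X (msc c Y) = msc c (lie_bracket X Y)" "lie_bracket (msc c X) Y = msc c (lie_bracket X Y)"
    "lie_bracket X 0 = 0" "lie_bracket 0 X = 0"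
  by (simp_all add: lie_bracket_def matrix_ring_simps msc_simps)

lemma lie_bracket_swap: "lie_bracket X Y = msc (-1) (lie_bracket Y X)"
  by (simp add: lie_bracket_def msc_simps)

lemma lie_bracket_jacobi: "lie_bracket X (lie_bracket Y Z) = lie_bracket (lie_bracket X Y) Z + lie_bracket Y (lie_bracket X Z)"
  by (simp add: lie_bracket_def matrix_ring_simps matrix_mul_assoc)

lemma lie_generated_bracket_stable:
  assumes "\<And>g. g \<in> G \<Longrightarrow> lie_bracket h g \<in> lie_generated G" and "X \<in> lie_generated G"
  shows "lie_bracket h X \<in> lie_generated G"
  using assms(2) by induction (auto simp: assms(1) lie_bracket_simps lie_bracket_jacobi[of h] intro: lie_generated.intros)

text \<open>Prepared for the triangular decomposition: x is some e_i or f_i, H the span of the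
  coroots, G the generators of opposite sign. The Jacobi identity propagates the claim from
  generators to brackets, the terms [h, Y] with h in H falling back into the generated
  algebra.\<close>

lemma lie_generated_bracket_into:
  assumes H: "\<And>h h'. h \<in> H \<Longrightarrow> h' \<in> H \<Longrightarrow> h + h' \<in> H" "\<And>h c. h \<in> H \<Longrightarrow> msc c h \<in> H" "0 \<in> H"
    and xg: "\<And>g. g \<in> G \<Longrightarrow> lie_bracket x g \<in> H" and hg: "\<And>h g. h \<in> H \<Longrightarrow> g \<in> G \<Longrightarrow> lie_bracket h g \<in> lie_generated G"
    and X: "X \<in> lie_generated G"
  shows "\<exists>h\<in>H. \<exists>m\<in>lie_generated G. lie_bracket x X = h + m"
  using X
proof induction
  case (gen X)
  hence "msc 0 X \<in> lie_generated G" by (intro lie_generated.intros)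
  moreover have "lie_bracket x X = lie_bracket x X + msc 0 X" by (simp add: msc_simps)
  ultimately
  show ?case using xg[OF gen] by blast
next
  case (add X Y)
  then obtain h m h' m' where "h \<in> H" "m \<in> lie_generated G" "h' \<in> H" "m' \<in> lie_generated G"
    "lie_bracket x X = h + m" "lie_bracket x Y = h' + m'" by blast
  hence "h + h' \<in> H" "m + m' \<in> lie_generated G" "lie_bracket x (X + Y) = (h + h') + (m + m')"
    using H by (auto intro: lie_generated.intros simp: lie_bracket_simps)
  then show ?case by blast
next
  case (scale X c)
  then obtain h m where "h \<in> H" "m \<in> lie_generated G" "lie_bracket x X = h + m" by blast
  hence "msc c h \<in> H" "msc c m \<in> lie_generated G" "lie_bracket x (msc c X) = msc c h + msc c m"
    using H by (auto intro: lie_generated.intros simp: lie_bracket_simps msc_simps)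
  then show ?case by blast
next
  case (bracket X Y)
  then obtain h m h' m' where hm: "h \<in> H" "m \<in> lie_generated G" "h' \<in> H" "m' \<in> lie_generated G"
    "lie_bracket x X = h + m" "lie_bracket x Y = h' + m'" by blast
  have hX: "lie_bracket h Y \<in> lie_generated G" "lie_bracket h' X \<in> lie_generated G"
    using lie_generated_bracket_stable hg hm(1,3) bracket.hyps by blast+
  have "lie_bracket x (lie_bracket X Y) = lie_bracket h Y + lie_bracket m Y + (msc (-1) (lie_bracket h' X) + lie_bracket X m')"
    unfolding lie_bracket_jacobi[of x] hm(5,6) lie_bracket_simps using lie_bracket_swap[of X h'] by simp
  moreover have "lie_bracket h Y + lie_bracket m Y + (msc (-1) (lie_bracket h' X) + lie_bracket X m') \<in> lie_generated G"
    using hX hm bracket.hyps by (intro lie_generated.add lie_generated.scale) (auto intro: lie_generated.bracket)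
  ultimately show ?case using H(3) by (metis add_0)
qed

lemma diag_mult_nth:
  fixes Y X :: "'a::comm_ring_1^'n^'n"
  assumes "\<And>a b. a \<noteq> b \<Longrightarrow> Y $ a $ b = 0"
  shows "(Y ** X) $ a $ b = Y $ a $ a * X $ a $ b" "(X ** Y) $ a $ b = X $ a $ b * Y $ b $ b"
proof -
  show "(Y ** X) $ a $ b = Y $ a $ a * X $ a $ b"
    unfolding mat_mult_nth by (subst sum.remove[of _ a]) (use assms in \<open>auto intro!: sum.neutral\<close>)
  show "(X ** Y) $ a $ b = X $ a $ b * Y $ b $ b"
    unfolding mat_mult_nth by (subst sum.remove[of _ b]) (use assms in \<open>auto intro!: sum.neutral\<close>)
qed

text \<open>The situation of the theorem after conjugating the torus \<open>H\<close> into the diagonal matrices: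
  \<open>hh\<close>, \<open>gg\<close> and \<open>bb\<close> are the Lie algebras of \<open>H\<close>, \<open>G\<close> and \<open>B\<^sub>+\<close>, and \<open>BB\<close> is \<open>B\<^sub>+\<close> itself.\<close>
locale diagonal_group =
  fixes hh gg bb BB :: "(complex^'n::finite^'n) set"
    and al :: "'r::finite \<Rightarrow> complex^'n^'n \<Rightarrow> complex"
    and co e f :: "'r \<Rightarrow> complex^'n^'n"
  assumes hh_diag: "Y \<in> hh \<Longrightarrow> a \<noteq> b \<Longrightarrow> Y $ a $ b = 0"
    and hh_zero: "0 \<in> hh" and hh_add: "X \<in> hh \<Longrightarrow> Y \<in> hh \<Longrightarrow> X + Y \<in> hh" and hh_msc: "X \<in> hh \<Longrightarrow> msc c X \<in> hh"
    and co_hh: "co i \<in> hh"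
    and al_functional: "functional_on hh (al i)"
    and al_indep: "\<forall>Y\<in>hh. (\<Sum>j\<in>UNIV. u j * al j Y) = 0 \<Longrightarrow> u i = 0"
    and e_weight: "Y \<in> hh \<Longrightarrow> lie_bracket Y (e i) = msc (al i Y) (e i)"
    and f_weight: "Y \<in> hh \<Longrightarrow> lie_bracket Y (f i) = msc (- al i Y) (f i)"
    and ef_co: "lie_bracket (e i) (f i) = co i" and al_co: "al i (co i) = 2"
    and gg_eq: "gg = lie_generated (range e \<union> range f)"
    and gg_roots: "X \<in> gg \<Longrightarrow> X \<noteq> 0 \<Longrightarrow> (\<And>Y. Y \<in> hh \<Longrightarrow> lie_bracket Y X = msc (\<beta> Y) X) \<Longrightarrow>
      \<exists>n::'r \<Rightarrow> nat. (\<forall>Y\<in>hh. \<beta> Y = (\<Sum>i\<in>UNIV. of_nat (n i) * al i Y)) \<or> (\<forall>Y\<in>hh. - \<beta> Y = (\<Sum>i\<in>UNIV. of_nat (n i) * al i Y))"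
    and bb_gg: "bb \<subseteq> gg" and hh_bb: "hh \<subseteq> bb"
    and bb_add: "X \<in> bb \<Longrightarrow> Y \<in> bb \<Longrightarrow> X + Y \<in> bb" and bb_msc: "X \<in> bb \<Longrightarrow> msc c X \<in> bb"
    and bb_roots: "X \<in> bb \<Longrightarrow> X \<noteq> 0 \<Longrightarrow> (\<And>Y. Y \<in> hh \<Longrightarrow> lie_bracket Y X = msc (\<beta> Y) X) \<Longrightarrow>
      \<exists>n::'r \<Rightarrow> nat. \<forall>Y\<in>hh. \<beta> Y = (\<Sum>i\<in>UNIV. of_nat (n i) * al i Y)"
    and bb_simple: "\<exists>X\<in>bb. X \<noteq> 0 \<and> (\<forall>Y\<in>hh. lie_bracket Y X = msc (al i Y) X)"
    and BB_mult: "g \<in> BB \<Longrightarrow> h \<in> BB \<Longrightarrow> g ** h \<in> BB" and BB_one: "mat 1 \<in> BB"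
    and BB_inv: "g \<in> BB \<Longrightarrow> matrix_inv g \<in> BB" and BB_invertible: "g \<in> BB \<Longrightarrow> invertible g"
    and BB_Ad: "g \<in> BB \<Longrightarrow> X \<in> bb \<Longrightarrow> g ** X ** matrix_inv g \<in> bb"
    and BB_torus: "Y \<in> hh \<Longrightarrow> (\<chi> a b. if a = b then exp (Y $ a $ a) else 0) \<in> BB"
    and BB_unip: "X \<in> bb \<Longrightarrow> mpow X N = 0 \<Longrightarrow> (\<And>s. invertible (mexp (Suc N) (msc s X))) \<Longrightarrow> mexp (Suc N) X \<in> BB"
    and BB_log: "invertible q \<Longrightarrow> (\<forall>\<^sub>F w in cofinite. mat_eval w q \<in> BB) \<Longrightarrow>
      (\<forall>\<^sub>F w in cofinite. mat_eval w (q ** mat_deriv (matrix_inv q)) \<in> bb)"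
begin

lemma al_simps: "X \<in> hh \<Longrightarrow> Y \<in> hh \<Longrightarrow> al i (X + Y) = al i X + al i Y" "X \<in> hh \<Longrightarrow> al i (msc c X) = c * al i X" "al i 0 = 0"
  using functional_on_simps[OF al_functional[of i]] functional_on_simps(2)[OF al_functional[of i] hh_zero, of 0]
  by (auto simp: msc_simps)

lemma hh_sum: "(\<And>i. i \<in> I \<Longrightarrow> Y i \<in> hh) \<Longrightarrow> (\<Sum>i\<in>I. Y i) \<in> hh"
  by (induction I rule: infinite_finite_induct) (simp_all add: hh_zero hh_add)

lemma al_sum: "(\<And>i. i \<in> I \<Longrightarrow> Y i \<in> hh) \<Longrightarrow> al j (\<Sum>i\<in>I. Y i) = (\<Sum>i\<in>I. al j (Y i))"
  by (induction I rule: infinite_finite_induct) (simp_all add: al_simps hh_sum)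

lemma bb_zero: "0 \<in> bb" using hh_zero hh_bb by blast

lemma bb_sum: "(\<And>i. i \<in> I \<Longrightarrow> Y i \<in> bb) \<Longrightarrow> (\<Sum>i\<in>I. Y i) \<in> bb"
  by (induction I rule: infinite_finite_induct) (simp_all add: bb_zero bb_add)

lemma bb_uminus: "X \<in> bb \<Longrightarrow> - X \<in> bb"
  using bb_msc[of X "-1"] by (simp add: msc_simps)

lemma bb_diff: "X \<in> bb \<Longrightarrow> Y \<in> bb \<Longrightarrow> X - Y \<in> bb"
  using bb_add[of X "- Y"] bb_uminus[of Y] by simp

lemma bracket_nth: "Y \<in> hh \<Longrightarrow> lie_bracket Y X $ a $ b = (Y $ a $ a - Y $ b $ b) * X $ a $ b"
  by (simp add: lie_bracket_def diag_mult_nth hh_diag algebra_simps)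

lemma weight_entry: "Y \<in> hh \<Longrightarrow> lie_bracket Y X = msc c X \<Longrightarrow> X $ a $ b \<noteq> 0 \<Longrightarrow> Y $ a $ a - Y $ b $ b = c"
  by (metis bracket_nth msc_nth mult_right_cancel)

lemma e_entry: "Y \<in> hh \<Longrightarrow> e i $ a $ b \<noteq> 0 \<Longrightarrow> Y $ a $ a - Y $ b $ b = al i Y"
  using weight_entry e_weight by blast

lemma f_entry: "Y \<in> hh \<Longrightarrow> f i $ a $ b \<noteq> 0 \<Longrightarrow> Y $ a $ a - Y $ b $ b = - al i Y"
  using weight_entry f_weight by blast

lemma al_inj: "(\<And>Y. Y \<in> hh \<Longrightarrow> al i Y = al j Y) \<Longrightarrow> i = j"
proof (rule ccontr)
  assume a: "\<And>Y. Y \<in> hh \<Longrightarrow> al i Y = al j Y" and "i \<noteq> j"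
  have "(\<Sum>k\<in>UNIV. ((\<lambda>_. 0)(i := 1, j := -1)) k * al k Y) = al i Y - al j Y" for Y
    using \<open>i \<noteq> j\<close> by (subst sum.remove[of _ i], simp, simp, subst sum.remove[of _ j]) (auto intro!: sum.neutral)
  hence "\<forall>Y\<in>hh. (\<Sum>k\<in>UNIV. ((\<lambda>_. 0)(i := 1, j := -1)) k * al k Y) = 0" using a by simp
  from al_indep[OF this, of i] show False using \<open>i \<noteq> j\<close> by simp
qed

text \<open>The fundamental coweights. Their sum \<open>rho\<close> takes the value 1 at every
  simple root and defines the grading by height.\<close>

definition dual :: "'r \<Rightarrow> complex^'n^'n" where
  "dual = (SOME Y. \<forall>i. Y i \<in> hh \<and> (\<forall>j. al j (Y i) = (if j = i then 1 else 0)))"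

lemma dual: "dual i \<in> hh" "al j (dual i) = (if j = i then 1 else 0)"
proof -
  have "\<exists>Y. \<forall>i. Y i \<in> hh \<and> (\<forall>j. al j (Y i) = (if j = i then 1 else 0))"
  proof (rule functional_dual_basis)
    fix u i assume "\<forall>Y\<in>hh. (\<Sum>j\<in>UNIV. u j * al j Y) = 0"
    thus "u i = 0" by (rule al_indep)
  qed (auto intro: hh_add hh_msc al_functional)
  from someI_ex[OF this] show "dual i \<in> hh" "al j (dual i) = (if j = i then 1 else 0)"
    unfolding dual_def by blast+
qed

definition rho :: "complex^'n^'n" where "rho = (\<Sum>i\<in>UNIV. dual i)"

lemma rho_hh: "rho \<in> hh" unfolding rho_def by (rule hh_sum) (rule dual)

lemma al_rho: "al i rho = 1"
  unfolding rho_def by (subst al_sum) (simp_all add: dual)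

text \<open>The diagonal entries of \<open>rho\<close> are arbitrary complex numbers; integrality
  holds only for differences along root vectors. This is why gradings have complex values and are
  compared through natural number differences.\<close>

definition ht :: "'n \<Rightarrow> complex" where "ht a = rho $ a $ a"

lemma e_deg: "e i $ a $ b \<noteq> 0 \<Longrightarrow> ht a - ht b = 1"
  using e_entry[OF rho_hh] by (simp add: ht_def al_rho)

lemma f_deg: "f i $ a $ b \<noteq> 0 \<Longrightarrow> ht a - ht b = - 1"
  using f_entry[OF rho_hh] by (simp add: ht_def al_rho)

lemma deg_ge_e: "deg_ge ht 1 (e i)"
  unfolding deg_ge_def using e_deg by (metis of_nat_1 order_refl)

lemma deg_ge_f: "deg_ge (\<lambda>a. - ht a) 1 (f i)"
  unfolding deg_ge_def
proof (intro allI impI)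
  fix a b assume "f i $ a $ b \<noteq> 0"
  hence "- ht a - - ht b = of_nat 1" using f_deg[of i a b] by (simp add: algebra_simps)
  thus "\<exists>m\<ge>1. - ht a - - ht b = of_nat m" by blast
qed

lemma nilpotent_ef: "\<exists>N. (\<forall>i. mpow (e i) N = 0) \<and> (\<forall>i. mpow (f i) N = 0)"
proof -
  obtain K where K: "deg_bound ht K" using deg_ge_bounded[of ht] by blast
  obtain L where L: "deg_bound (\<lambda>a. - ht a) L" using deg_ge_bounded[of "\<lambda>a. - ht a"] by blast
  have "mpow (e i) (max K L) = 0" for i
    by (rule mpow_mono_zero[OF nilpotent_of_deg_ge[OF deg_ge_e[of i] K]]) simp
  moreover have "mpow (f i) (max K L) = 0" for i
    by (rule mpow_mono_zero[OF nilpotent_of_deg_ge[OF deg_ge_f[of i] L]]) simp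
  ultimately show ?thesis by blast
qed

text \<open>A nonzero bracket would have weight \<alpha>_i - \<alpha>_j, whose coefficients have
  both signs; \<open>gg_roots\<close> and the independence of the simple roots exclude this.\<close>

lemma ef_orth: assumes "i \<noteq> j" shows "lie_bracket (e i) (f j) = 0"
proof (rule ccontr)
  assume X0: "lie_bracket (e i) (f j) \<noteq> 0"
  have Xgg: "lie_bracket (e i) (f j) \<in> gg" unfolding gg_eq by (intro lie_generated.intros) auto
  have "lie_bracket Y (lie_bracket (e i) (f j)) = msc (al i Y - al j Y) (lie_bracket (e i) (f j))" if "Y \<in> hh" for Y
    unfolding lie_bracket_jacobi[of Y] e_weight[OF that] f_weight[OF that] lie_bracket_simps by (simp add: msc_simps)
  from gg_roots[OF Xgg X0 this] obtain n :: "'r \<Rightarrow> nat" where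
    n: "(\<forall>Y\<in>hh. al i Y - al j Y = (\<Sum>k\<in>UNIV. of_nat (n k) * al k Y)) \<or>
       (\<forall>Y\<in>hh. - (al i Y - al j Y) = (\<Sum>k\<in>UNIV. of_nat (n k) * al k Y))" by blast
  have s: "(\<Sum>k\<in>UNIV. (if k = l then 1 else 0) * al k Y) = al l Y" for l Y
    by (subst sum.remove[of _ l]) (auto intro!: sum.neutral)
  from n show False
  proof
    assume a: "\<forall>Y\<in>hh. al i Y - al j Y = (\<Sum>k\<in>UNIV. of_nat (n k) * al k Y)"
    have "\<forall>Y\<in>hh. (\<Sum>k\<in>UNIV. (of_nat (n k) - (if k = i then 1 else 0) + (if k = j then 1 else 0)) * al k Y) = 0"
      by (simp only: distrib_right left_diff_distrib sum.distrib sum_subtractf s) (use a in \<open>simp add: algebra_simps\<close>)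
    from al_indep[OF this, of j] have "of_nat (Suc (n j)) = (0::complex)" using assms by (simp add: add.commute)
    thus False by (simp only: of_nat_eq_0_iff)
  next
    assume a: "\<forall>Y\<in>hh. - (al i Y - al j Y) = (\<Sum>k\<in>UNIV. of_nat (n k) * al k Y)"
    have "\<forall>Y\<in>hh. (\<Sum>k\<in>UNIV. (of_nat (n k) + (if k = i then 1 else 0) - (if k = j then 1 else 0)) * al k Y) = 0"
      by (simp only: distrib_right left_diff_distrib sum.distrib sum_subtractf s) (use a in \<open>simp add: algebra_simps\<close>)
    from al_indep[OF this, of i] have "of_nat (Suc (n i)) = (0::complex)" using assms by (simp add: add.commute)
    thus False by (simp only: of_nat_eq_0_iff)
  qed
qed

section \<open>Triangular decomposition of the Lie algebra\<close>

definition cospan :: "(complex^'n^'n) set" where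
  "cospan = {h. \<exists>c. h = (\<Sum>i\<in>UNIV. msc (c i) (co i))}"

lemma cospan_add: "h \<in> cospan \<Longrightarrow> h' \<in> cospan \<Longrightarrow> h + h' \<in> cospan"
proof -
  assume "h \<in> cospan" "h' \<in> cospan"
  then obtain c c' where "h = (\<Sum>i\<in>UNIV. msc (c i) (co i))" "h' = (\<Sum>i\<in>UNIV. msc (c' i) (co i))" by (auto simp: cospan_def)
  hence "h + h' = (\<Sum>i\<in>UNIV. msc (c i + c' i) (co i))" by (simp add: msc_simps sum.distrib)
  thus ?thesis by (auto simp: cospan_def)
qed

lemma cospan_msc: "h \<in> cospan \<Longrightarrow> msc c h \<in> cospan"
proof -
  assume "h \<in> cospan"
  then obtain c' where "h = (\<Sum>i\<in>UNIV. msc (c' i) (co i))" by (auto simp: cospan_def)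
  hence "msc c h = (\<Sum>i\<in>UNIV. msc (c * c' i) (co i))" by (simp add: msc_simps msc_sum)
  thus ?thesis by (auto simp: cospan_def)
qed

lemma cospan_zero: "0 \<in> cospan"
  unfolding cospan_def by (auto simp: msc_simps intro!: exI[of _ "\<lambda>_. 0"])

lemma co_cospan: "co i \<in> cospan"
proof -
  have "co i = (\<Sum>j\<in>UNIV. msc (if j = i then 1 else 0) (co j))"
    by (simp add: if_distrib[of "\<lambda>x. msc x _"] msc_simps cong: if_cong)
  thus ?thesis unfolding cospan_def by (intro CollectI exI[of _ "\<lambda>j. if j = i then 1 else 0"])
qed

lemma cospan_hh: "h \<in> cospan \<Longrightarrow> h \<in> hh"
  unfolding cospan_def by (auto intro!: hh_sum hh_msc co_hh)

lemma lie_generated_zero: "0 \<in> lie_generated (range e)" "0 \<in> lie_generated (range f)"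
  using lie_generated.scale[OF lie_generated.gen, of _ "range e" 0] lie_generated.scale[OF lie_generated.gen, of _ "range f" 0]
  by (auto simp: msc_simps)

text \<open>The sum W of the three pieces contains the generators and is stable under bracketing
  with each e_i and f_i, hence with everything they generate. The only delicate brackets are those
  of e_i with the f-part and of f_i with the e-part; they meet the coroots by
  \<open>ef_orth\<close>.\<close>

lemma triangular:
  assumes "X \<in> gg"
  shows "\<exists>p\<in>lie_generated (range e). \<exists>h\<in>cospan. \<exists>m\<in>lie_generated (range f). X = p + h + m"
proof -
  let ?P = "lie_generated (range e)" and ?M = "lie_generated (range f)"
  define W where "W = {X. \<exists>p\<in>?P. \<exists>h\<in>cospan. \<exists>m\<in>?M. X = p + h + m}"
  have Wadd: "X + Y \<in> W" if "X \<in> W" "Y \<in> W" for X Y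
  proof -
    obtain p h m p' h' m' where "p \<in> ?P" "h \<in> cospan" "m \<in> ?M" "p' \<in> ?P" "h' \<in> cospan" "m' \<in> ?M"
      "X = p + h + m" "Y = p' + h' + m'" using \<open>X \<in> W\<close> \<open>Y \<in> W\<close> unfolding W_def by blast
    hence "p + p' \<in> ?P" "h + h' \<in> cospan" "m + m' \<in> ?M" "X + Y = (p + p') + (h + h') + (m + m')"
      by (auto intro: lie_generated.intros cospan_add)
    thus ?thesis unfolding W_def by blast
  qed
  have Wmsc: "msc c X \<in> W" if "X \<in> W" for X c
  proof -
    obtain p h m where "p \<in> ?P" "h \<in> cospan" "m \<in> ?M" "X = p + h + m" using \<open>X \<in> W\<close> unfolding W_def by blast
    hence "msc c p \<in> ?P" "msc c h \<in> cospan" "msc c m \<in> ?M" "msc c X = msc c p + msc c h + msc c m"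
      by (auto intro: lie_generated.intros cospan_msc simp: msc_simps)
    thus ?thesis unfolding W_def by blast
  qed
  have PW: "?P \<subseteq> W" and HW: "cospan \<subseteq> W" and MW: "?M \<subseteq> W"
    unfolding W_def using lie_generated_zero cospan_zero
    by (auto, metis add.right_neutral, metis add.left_neutral add.right_neutral, metis add.left_neutral)
  have he: "lie_bracket h (e i) \<in> ?P" if "h \<in> hh" for h i
    using that by (simp add: e_weight) (auto intro: lie_generated.intros)
  have hf: "lie_bracket h (f i) \<in> ?M" if "h \<in> hh" for h i
    using that by (simp add: f_weight) (auto intro: lie_generated.intros)
  have efc: "lie_bracket (e i) (f j) \<in> cospan" for i j
    by (cases "i = j") (simp_all add: ef_co ef_orth co_cospan cospan_zero)
  have eW: "lie_bracket (e i) X \<in> W" if XW: "X \<in> W" for i X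
  proof -
    obtain p h m where X: "p \<in> ?P" "h \<in> cospan" "m \<in> ?M" "X = p + h + m" using XW unfolding W_def by blast
    have "lie_bracket (e i) p \<in> W" using PW X(1) lie_generated.intros(1,4)[of _ "range e"] by blast
    moreover have "lie_bracket (e i) h \<in> W"
      using he[OF cospan_hh[OF X(2)]] PW Wmsc unfolding lie_bracket_swap[of "e i"] by blast
    moreover have "lie_bracket (e i) m \<in> W"
    proof -
      have "\<exists>h\<in>cospan. \<exists>m'\<in>?M. lie_bracket (e i) m = h + m'"
        by (rule lie_generated_bracket_into[OF cospan_add cospan_msc cospan_zero _ _ X(3)])
          (use efc hf cospan_hh in auto)
      then obtain h' m' where "h' \<in> cospan" "m' \<in> ?M" "lie_bracket (e i) m = h' + m'" by blast
      thus ?thesis using HW MW Wadd[of h' m'] by auto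
    qed
    ultimately show ?thesis unfolding X(4) lie_bracket_simps by (intro Wadd)
  qed
  have fW: "lie_bracket (f i) X \<in> W" if XW: "X \<in> W" for i X
  proof -
    obtain p h m where X: "p \<in> ?P" "h \<in> cospan" "m \<in> ?M" "X = p + h + m" using XW unfolding W_def by blast
    have "lie_bracket (f i) m \<in> W" using MW X(3) lie_generated.intros(1,4)[of _ "range f"] by blast
    moreover have "lie_bracket (f i) h \<in> W"
      using hf[OF cospan_hh[OF X(2)]] MW Wmsc unfolding lie_bracket_swap[of "f i"] by blast
    moreover have "lie_bracket (f i) p \<in> W"
    proof -
      have "lie_bracket (f i) (e j) \<in> cospan" for j using cospan_msc[OF efc[of j i], of "-1"] lie_bracket_swap by metis
      hence "\<exists>h\<in>cospan. \<exists>m'\<in>?P. lie_bracket (f i) p = h + m'"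
        by (intro lie_generated_bracket_into[OF cospan_add cospan_msc cospan_zero _ _ X(1)])
          (use he cospan_hh in auto)
      then obtain h' m' where "h' \<in> cospan" "m' \<in> ?P" "lie_bracket (f i) p = h' + m'" by blast
      thus ?thesis using HW PW Wadd[of h' m'] by auto
    qed
    ultimately show ?thesis unfolding X(4) lie_bracket_simps by (intro Wadd)
  qed
  \<comment> \<open>Stability of W under bracketing with X is carried along, because membership of X
    and Y alone would not place [X, Y] in W.\<close>
  have "X \<in> W \<and> (\<forall>w\<in>W. lie_bracket X w \<in> W)" using assms unfolding gg_eq
  proof induction
    case (gen X)
    then show ?case using PW MW eW fW by (auto intro: lie_generated.gen)
  next
    case (add X Y)
    then show ?case using Wadd by (simp add: lie_bracket_simps)
  next
    case (scale X c)
    then show ?case using Wmsc by (simp add: lie_bracket_simps)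
  next
    case (bracket X Y)
    have "lie_bracket (lie_bracket X Y) w = lie_bracket X (lie_bracket Y w) + msc (-1) (lie_bracket Y (lie_bracket X w))" for w
      using lie_bracket_jacobi[of X Y w] by (simp add: msc_simps)
    then show ?case using bracket Wadd Wmsc by auto
  qed
  thus ?thesis unfolding W_def by blast
qed

lemma lie_generated_e:
  assumes "p \<in> lie_generated (range e)"
  shows "deg_ge ht 1 p \<and> (\<exists>c. deg_ge ht 2 (p - (\<Sum>i\<in>UNIV. msc (c i) (e i))))"
  using assms
proof induction
  case (gen X)
  then obtain i where i: "X = e i" by auto
  have "X = (\<Sum>j\<in>UNIV. msc (if j = i then 1 else 0) (e j))"
    unfolding i by (simp add: if_distrib[of "\<lambda>x. msc x _"] msc_simps cong: if_cong)
  then show ?case using deg_ge_e i by (metis deg_ge_0 diff_self)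
next
  case (add X Y)
  then obtain c c' where c: "deg_ge ht 2 (X - (\<Sum>i\<in>UNIV. msc (c i) (e i)))" "deg_ge ht 2 (Y - (\<Sum>i\<in>UNIV. msc (c' i) (e i)))" by blast
  have "X + Y - (\<Sum>i\<in>UNIV. msc (c i + c' i) (e i)) = (X - (\<Sum>i\<in>UNIV. msc (c i) (e i))) + (Y - (\<Sum>i\<in>UNIV. msc (c' i) (e i)))"
    by (simp add: msc_simps sum.distrib)
  hence "deg_ge ht 2 (X + Y - (\<Sum>i\<in>UNIV. msc (c i + c' i) (e i)))" using deg_ge_add[OF c] by (simp only:)
  moreover have "deg_ge ht 1 (X + Y)" using add.IH deg_ge_add by blast
  ultimately show ?case by (intro conjI exI[of _ "\<lambda>i. c i + c' i"])
next
  case (scale X a)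
  then obtain c where c: "deg_ge ht 2 (X - (\<Sum>i\<in>UNIV. msc (c i) (e i)))" by blast
  have "msc a X - (\<Sum>i\<in>UNIV. msc (a * c i) (e i)) = msc a (X - (\<Sum>i\<in>UNIV. msc (c i) (e i)))"
    by (simp add: msc_simps msc_sum)
  hence "deg_ge ht 2 (msc a X - (\<Sum>i\<in>UNIV. msc (a * c i) (e i)))" using deg_ge_msc[OF c, of a] by (simp only:)
  moreover have "deg_ge ht 1 (msc a X)" using scale.IH deg_ge_msc by blast
  ultimately show ?case by (intro conjI exI[of _ "\<lambda>i. a * c i"])
next
  case (bracket X Y)
  have "deg_ge ht 2 (lie_bracket X Y)" unfolding lie_bracket_def
    using bracket.IH by (intro deg_ge_diff) (auto intro!: deg_ge_mult_le[where k = 1 and l = 1])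
  moreover have "lie_bracket X Y - (\<Sum>i\<in>UNIV. msc 0 (e i)) = lie_bracket X Y" by (simp add: msc_simps)
  ultimately have "deg_ge ht 2 (lie_bracket X Y - (\<Sum>i\<in>UNIV. msc 0 (e i)))" by (simp only:)
  moreover have "deg_ge ht 1 (lie_bracket X Y)"
    using deg_ge_mono[OF \<open>deg_ge ht 2 (lie_bracket X Y)\<close>, of 1] by simp
  ultimately show ?case by (intro conjI exI[of _ "\<lambda>_. 0"])
qed

lemma lie_generated_f:
  assumes "p \<in> lie_generated (range f)" shows "deg_ge (\<lambda>a. - ht a) 1 p"
  using assms
proof induction
  case (bracket X Y)
  then show ?case unfolding lie_bracket_def by (intro deg_ge_diff) (auto intro!: deg_ge_mult_le[where k = 1 and l = 1])
qed (use deg_ge_f in \<open>auto intro: deg_ge_add deg_ge_msc\<close>)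

text \<open>In the triangular decomposition the e-part starts in degree 1, where only the e_i
  themselves contribute, and the f-part stays in negative degrees. Degree 0 therefore sees only the
  coroots.\<close>

lemma gg_entries:
  assumes "X \<in> gg"
  shows "\<exists>h\<in>cospan. \<exists>c. (\<forall>a b. ht a = ht b \<longrightarrow> X $ a $ b = h $ a $ b) \<and>
    (\<forall>a b. ht a - ht b = 1 \<longrightarrow> X $ a $ b = (\<Sum>i\<in>UNIV. c i * e i $ a $ b))"
proof -
  obtain p h m where X: "p \<in> lie_generated (range e)" "h \<in> cospan" "m \<in> lie_generated (range f)" "X = p + h + m"
    using triangular[OF assms] by blast
  obtain c where c: "deg_ge ht 1 p" "deg_ge ht 2 (p - (\<Sum>i\<in>UNIV. msc (c i) (e i)))" using lie_generated_e[OF X(1)] by blast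
  have m: "deg_ge (\<lambda>a. - ht a) 1 m" by (rule lie_generated_f[OF X(3)])
  have "X $ a $ b = h $ a $ b" if "ht a = ht b" for a b
  proof -
    have "p $ a $ b = 0" "m $ a $ b = 0"
      using c(1) m that unfolding deg_ge_def
      by (metis diff_self not_one_le_zero of_nat_eq_0_iff)+
    thus ?thesis using X(4) by simp
  qed
  moreover have "X $ a $ b = (\<Sum>i\<in>UNIV. c i * e i $ a $ b)" if ab: "ht a - ht b = 1" for a b
  proof -
    have "m $ a $ b = 0"
    proof (rule ccontr)
      assume "m $ a $ b \<noteq> 0"
      then obtain k where "- ht a - - ht b = of_nat k" using m unfolding deg_ge_def by blast
      hence "of_nat k = ht b - ht a" by simp
      hence "of_nat (Suc k) = (ht b - ht a) + (ht a - ht b)" using ab by simp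
      hence "of_nat (Suc k) = (0::complex)" by simp
      thus False by (simp only: of_nat_eq_0_iff)
    qed
    moreover have "a \<noteq> b" using ab by auto
    hence "h $ a $ b = 0" using hh_diag cospan_hh X(2) by blast
    moreover have "(p - (\<Sum>i\<in>UNIV. msc (c i) (e i))) $ a $ b = 0"
    proof (rule ccontr)
      assume "(p - (\<Sum>i\<in>UNIV. msc (c i) (e i))) $ a $ b \<noteq> 0"
      then obtain k where "k \<ge> 2" "ht a - ht b = of_nat k" using c(2) unfolding deg_ge_def by blast
      thus False using ab by (metis of_nat_1 of_nat_eq_iff numeral_le_one_iff semiring_norm(69))
    qed
    ultimately show ?thesis using X(4) by simp
  qed
  ultimately show ?thesis using X(2) by blast
qed

text \<open>An element of \<open>hh\<close> is diagonal and so equals its part of degree 0. This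
  yields the coefficients \<zeta>_i of a given twist.\<close>

lemma hh_cospan: "hh = cospan"
proof
  show "hh \<subseteq> cospan"
  proof
    fix Y assume Y: "Y \<in> hh"
    hence "Y \<in> gg" using hh_bb bb_gg by blast
    then obtain h where h: "h \<in> cospan" "\<And>a b. ht a = ht b \<Longrightarrow> Y $ a $ b = h $ a $ b" using gg_entries by blast
    have "Y = h"
    proof (rule mat_eqI)
      fix a b show "Y $ a $ b = h $ a $ b"
        using h hh_diag[OF Y, of a b] hh_diag[OF cospan_hh[OF h(1)], of a b] by (cases "a = b") auto
    qed
    thus "Y \<in> cospan" using h by simp
  qed
qed (use cospan_hh in blast)

text \<open>The weight space of \<alpha>_i is one-dimensional: it sits in degree 1, where the
  elements of \<open>gg\<close> are combinations of the e_j, and the e_j have distinct weights. So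
  the root vector supplied by \<open>bb_simple\<close> is a multiple of e_i.\<close>

lemma e_bb: "e i \<in> bb"
proof -
  obtain X where X: "X \<in> bb" "X \<noteq> 0" "\<forall>Y\<in>hh. lie_bracket Y X = msc (al i Y) X" using bb_simple by blast
  have "X \<in> gg" using X(1) bb_gg by blast
  then obtain c where c: "\<And>a b. ht a - ht b = 1 \<Longrightarrow> X $ a $ b = (\<Sum>j\<in>UNIV. c j * e j $ a $ b)" using gg_entries by blast
  have "X = msc (c i) (e i)"
  proof (rule mat_eqI)
    fix a b
    show "X $ a $ b = msc (c i) (e i) $ a $ b"
    proof (cases "\<forall>Y\<in>hh. Y $ a $ a - Y $ b $ b = al i Y")
      case True
      hence "ht a - ht b = 1" using rho_hh by (simp add: ht_def al_rho)
      moreover have "e j $ a $ b = 0" if "j \<noteq> i" for j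
        using that True e_entry al_inj by metis
      hence "(\<Sum>j\<in>UNIV. c j * e j $ a $ b) = c i * e i $ a $ b"
        by (subst sum.remove[of _ i]) (auto intro!: sum.neutral)
      ultimately show ?thesis using c by simp
    next
      case False
      hence "X $ a $ b = 0" "e i $ a $ b = 0" using X(3) weight_entry e_entry by blast+
      thus ?thesis by simp
    qed
  qed
  moreover from this X(2) have "c i \<noteq> 0" by (auto simp: msc_simps)
  ultimately have "e i = msc (inverse (c i)) X" by (simp add: msc_simps)
  thus ?thesis using bb_msc[OF X(1)] by simp
qed

section \<open>Integrality of the coroots and the Cartan matrix\<close>

lemma co_e_f:
  "co i ** e i = e i ** co i + msc 2 (e i)" "co i ** f i = f i ** co i - msc 2 (f i)" "e i ** f i - f i ** e i = co i"
  using e_weight[OF co_hh, of i i] f_weight[OF co_hh, of i i] ef_co[of i]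
  by (simp_all add: lie_bracket_def al_co algebra_simps msc_simps)

text \<open>Basis vectors are eigenvectors of the diagonal matrix \<open>co i\<close>, and e_i, f_i
  are nilpotent by the grading, so \<open>sl2_integral\<close> applies. The integers become the
  exponents in \<open>torus_elt\<close>.\<close>

lemma co_integral: "\<exists>k::int. co i $ a $ a = of_int k"
proof -
  obtain N where N: "mpow (e i) N = 0" "mpow (f i) N = 0" using nilpotent_ef by blast
  have "co i *v axis a 1 = (co i $ a $ a) *s axis a 1"
    using hh_diag[OF co_hh, of _ a i] by (auto simp: vec_eq_iff matrix_vector_mult_def axis_def if_distrib cong: if_cong)
  from sl2_integral[OF co_e_f(3,1,2) N _ this] show ?thesis by (simp add: axis_eq_0_iff)
qed

lemma e_nonzero: "e i \<noteq> 0"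
  using ef_co[of i] al_co[of i] by (auto simp: lie_bracket_simps al_simps)

lemma cartan_integral: "\<exists>k::int. al j (co i) = of_int k"
proof -
  obtain a b where "e j $ a $ b \<noteq> 0" using e_nonzero[of j] by (metis mat_eqI zero_index)
  hence "al j (co i) = co i $ a $ a - co i $ b $ b" using e_entry[OF co_hh] by simp
  thus ?thesis using co_integral[of i a] co_integral[of i b] by (metis of_int_diff)
qed

text \<open>The string of e_j under repeated bracketing with e_i starts at a vector killed by f_i,
  as i and j differ, and stops because its degree grows. Its lowest weight is the Cartan
  integer.\<close>

lemma cartan_nonpos: assumes "i \<noteq> j" shows "\<exists>n. al j (co i) = - of_nat n"
proof -
  define x where "x = (\<lambda>k. (lie_bracket (e i) ^^ k) (e j))"
  have xS: "x (Suc k) = lie_bracket (e i) (x k)" for k by (simp add: x_def)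
  let ?a = "al j (co i)"
  have Hx: "lie_bracket (co i) (x k) = msc (?a + 2 * of_nat k) (x k)" for k
  proof (induction k)
    case 0
    then show ?case by (simp add: x_def e_weight[OF co_hh])
  next
    case (Suc k)
    have "lie_bracket (co i) (x (Suc k)) = lie_bracket (lie_bracket (co i) (e i)) (x k) + lie_bracket (e i) (lie_bracket (co i) (x k))"
      unfolding xS by (rule lie_bracket_jacobi)
    also have "\<dots> = msc 2 (x (Suc k)) + msc (?a + 2 * of_nat k) (x (Suc k))"
      unfolding Suc e_weight[OF co_hh] al_co lie_bracket_simps xS ..
    finally show ?case by (simp add: msc_simps(2)[symmetric] algebra_simps)
  qed
  have fe: "lie_bracket (f i) (e i) = msc (-1) (co i)" using lie_bracket_swap[of "f i" "e i"] ef_co by simp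
  have Fx: "lie_bracket (f i) (x (Suc k)) = msc (- of_nat (Suc k) * (?a + of_nat k)) (x k)" for k
  proof (induction k)
    case 0
    have "lie_bracket (f i) (e j) = 0" using lie_bracket_swap[of "f i" "e j"] ef_orth[of j i] assms by (simp add: msc_simps)
    then show ?case unfolding xS lie_bracket_jacobi[of "f i"] fe lie_bracket_simps Hx
      by (simp add: x_def lie_bracket_simps msc_simps)
  next
    case (Suc k)
    have "lie_bracket (f i) (x (Suc (Suc k))) = msc (-1) (lie_bracket (co i) (x (Suc k))) + lie_bracket (e i) (lie_bracket (f i) (x (Suc k)))"
      unfolding xS[of "Suc k"] lie_bracket_jacobi[of "f i"] fe lie_bracket_simps ..
    also have "\<dots> = msc (- 1 * (?a + 2 * of_nat (Suc k))) (x (Suc k)) + msc (- of_nat (Suc k) * (?a + of_nat k)) (x (Suc k))"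
      unfolding Suc Hx lie_bracket_simps xS[symmetric] msc_simps(7) ..
    finally show ?case unfolding msc_simps(2)[symmetric] by (simp add: algebra_simps)
  qed
  have deg: "deg_ge ht (Suc k) (x k)" for k
  proof (induction k)
    case 0
    then show ?case using deg_ge_e[of j] by (simp add: x_def)
  next
    case (Suc k)
    show ?case unfolding xS lie_bracket_def
      using deg_ge_mult_le[OF deg_ge_e[of i] Suc, of "Suc (Suc k)"] deg_ge_mult_le[OF Suc deg_ge_e[of i], of "Suc (Suc k)"]
      by (intro deg_ge_diff) auto
  qed
  obtain K where K: "deg_bound ht K" using deg_ge_bounded[of ht] by blast
  have "x K = 0" using deg_ge_zero[OF K, of "x K"] deg_ge_mono[OF deg[of K], of K] by simp
  show ?thesis
  proof (rule lowest_weight[where x = x and s = msc and F = "lie_bracket (f i)" and N = K])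
    show "c = 0 \<or> v = 0" if "msc c v = 0" for c and v :: "complex^'n^'n"
      using that by (auto simp: vec_eq_iff)
    show "x 0 \<noteq> 0" using e_nonzero by (simp add: x_def)
  qed (use \<open>x K = 0\<close> Fx in \<open>simp_all add: lie_bracket_simps\<close>)
qed

text \<open>The coweights are combinations of the coroots, which gives a left inverse of the square
  matrix of values \<open>al j (co i)\<close>, hence a two-sided one. Applying all simple roots to
  the relation then kills its coefficients.\<close>

lemma co_independent:
  assumes "(\<Sum>i\<in>UNIV. msc (c i) (co i)) = 0" shows "c k = 0"
proof -
  have "\<exists>z. dual i = (\<Sum>k\<in>UNIV. msc (z k) (co k))" for i
    using dual(1)[of i] unfolding hh_cospan cospan_def by blast
  then obtain z where z: "\<And>i. dual i = (\<Sum>k\<in>UNIV. msc (z i k) (co k))" by metis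
  define C B :: "complex^'r^'r" where "C = (\<chi> i j. al j (co i))" and "B = (\<chi> i k. z i k)"
  have lin: "al j (\<Sum>k\<in>UNIV. msc (y k) (co k)) = (\<Sum>k\<in>UNIV. y k * al j (co k))" for y j
    by (subst al_sum) (auto simp: hh_msc co_hh al_simps)
  have "B ** C = mat 1"
    by (rule mat_eqI) (simp add: mat_mult_nth B_def C_def mat_one_nth lin[symmetric] z[symmetric] dual)
  hence CB: "C ** B = mat 1" by (simp add: matrix_left_right_inverse)
  have 0: "(\<Sum>i\<in>UNIV. c i * C $ i $ j) = 0" for j
    using lin[of j c] assms by (simp add: C_def al_simps)
  have "c k = (\<Sum>i\<in>UNIV. c i * (C ** B) $ i $ k)"
    unfolding CB by (simp add: mat_one_nth if_distrib cong: if_cong)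
  also have "\<dots> = (\<Sum>i\<in>UNIV. \<Sum>j\<in>UNIV. c i * C $ i $ j * B $ j $ k)" by (simp add: mat_mult_nth sum_distrib_left mult.assoc)
  also have "\<dots> = (\<Sum>j\<in>UNIV. (\<Sum>i\<in>UNIV. c i * C $ i $ j) * B $ j $ k)"
    by (subst sum.swap) (simp add: sum_distrib_right)
  finally show ?thesis by (simp add: 0)
qed

subsection \<open>Weight components\<close>

definition wproj :: "'n \<Rightarrow> 'n \<Rightarrow> complex^'n^'n \<Rightarrow> complex^'n^'n" where
  "wproj c d X = (\<chi> a b. if \<forall>Y\<in>hh. Y $ a $ a - Y $ b $ b = Y $ c $ c - Y $ d $ d then X $ a $ b else 0)"

lemma wproj_weight: "Y \<in> hh \<Longrightarrow> lie_bracket Y (wproj c d X) = msc (Y $ c $ c - Y $ d $ d) (wproj c d X)"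
  by (rule mat_eqI) (simp add: bracket_nth wproj_def)

lemma torus_Ad:
  assumes Y: "Y \<in> hh" and X: "X \<in> bb"
  shows "(\<chi> a b. exp (Y $ a $ a - Y $ b $ b) * X $ a $ b) \<in> bb"
proof -
  define T where "T = (\<lambda>Y::complex^'n^'n. (\<chi> a b. if a = b then exp (Y $ a $ a) else 0) :: complex^'n^'n)"
  have diag: "(T Y ** X) $ a $ b = T Y $ a $ a * X $ a $ b" "(X ** T Y) $ a $ b = X $ a $ b * T Y $ b $ b" for Y X a b
    by (rule diag_mult_nth, simp add: T_def)+
  have inv: "matrix_inv (T Y) = T (- Y)"
  proof -
    have "T Y ** T (- Y) = mat 1" for Y
    proof (rule mat_eqI)
      fix a b show "(T Y ** T (- Y)) $ a $ b = (mat 1 :: complex^'n^'n) $ a $ b"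
        unfolding diag(1) by (simp add: T_def mat_one_nth exp_minus)
    qed
    from this[of Y] this[of "- Y"] show ?thesis by (intro matrix_inv_unique') simp_all
  qed
  have "T Y ** X ** T (- Y) = (\<chi> a b. exp (Y $ a $ a - Y $ b $ b) * X $ a $ b)"
  proof (rule mat_eqI)
    fix a b show "(T Y ** X ** T (- Y)) $ a $ b = (\<chi> a b. exp (Y $ a $ a - Y $ b $ b) * X $ a $ b) $ a $ b"
      unfolding diag by (simp add: T_def exp_diff exp_minus divide_inverse)
  qed
  moreover have "T Y \<in> BB" unfolding T_def by (rule BB_torus[OF Y])
  ultimately show ?thesis using BB_Ad[of "T Y" X] X by (simp add: inv)
qed

text \<open>The operators at hand are conjugations by exp Y with Y in \<open>hh\<close>, multiplying
  the entry (a, b) by exp(Y_aa - Y_bb). Unwanted positions (p, q) are killed one after another: the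
  conjugation minus its factor at (p, q), suitably normalised, is 0 at (p, q) and the identity on
  the wanted weight.\<close>

lemma wproj_bb:
  assumes X: "X \<in> bb" shows "wproj c d X \<in> bb"
proof -
  let ?eq = "\<lambda>a b. \<forall>Y\<in>hh. Y $ a $ a - Y $ b $ b = Y $ c $ c - Y $ d $ d"
  have "\<exists>X'\<in>bb. (\<forall>a b. ?eq a b \<longrightarrow> X' $ a $ b = X $ a $ b) \<and> (\<forall>(a, b)\<in>R. X' $ a $ b = 0)"
    if "finite R" "R \<subseteq> {(a, b). \<not> ?eq a b}" for R
    using that
  proof (induction R rule: finite_induct)
    case empty
    then show ?case using X by auto
  next
    case (insert pq R)
    obtain p q where pq: "pq = (p, q)" by (cases pq)
    obtain X' where X': "X' \<in> bb" "\<forall>a b. ?eq a b \<longrightarrow> X' $ a $ b = X $ a $ b" "\<forall>(a, b)\<in>R. X' $ a $ b = 0" using insert by auto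
    obtain Y0 where Y0: "Y0 \<in> hh" "Y0 $ p $ p - Y0 $ q $ q \<noteq> Y0 $ c $ c - Y0 $ d $ d" using insert.prems pq by auto
    \<comment> \<open>The rescaling makes the two weights differ by exactly 1 on Y. Unscaled, a
      difference in 2 \<pi> i Z would make the exponentials agree.\<close>
    define Y where "Y = msc (1 / ((Y0 $ p $ p - Y0 $ q $ q) - (Y0 $ c $ c - Y0 $ d $ d))) Y0"
    have Y: "Y \<in> hh" unfolding Y_def by (rule hh_msc[OF Y0(1)])
    let ?w = "\<lambda>a b. exp (Y $ a $ a - Y $ b $ b)"
    have "(Y $ p $ p - Y $ q $ q) - (Y $ c $ c - Y $ d $ d) = (1 / ((Y0 $ p $ p - Y0 $ q $ q) - (Y0 $ c $ c - Y0 $ d $ d))) * ((Y0 $ p $ p - Y0 $ q $ q) - (Y0 $ c $ c - Y0 $ d $ d))"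
      unfolding Y_def msc_nth by (simp only: right_diff_distrib)
    also have "\<dots> = 1" using Y0(2) by simp
    finally have "(Y $ p $ p - Y $ q $ q) = (Y $ c $ c - Y $ d $ d) + 1" by (simp add: algebra_simps)
    hence "?w p q = ?w c d * exp 1" by (simp only: exp_add)
    moreover have "exp (1::complex) \<noteq> 1" 
      using exp_eq_1[of "1::complex"] by simp
    ultimately have k: "?w c d - ?w p q \<noteq> 0" by simp
    define X'' where "X'' = msc (1 / (?w c d - ?w p q)) ((\<chi> a b. ?w a b * X' $ a $ b) - msc (?w p q) X')"
    have "X'' \<in> bb" unfolding X''_def using torus_Ad[OF Y X'(1)] X'(1) by (intro bb_msc bb_diff)
    moreover have ent: "X'' $ a $ b = (?w a b - ?w p q) / (?w c d - ?w p q) * X' $ a $ b" for a b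
      by (simp add: X''_def left_diff_distrib)
    hence "\<forall>a b. ?eq a b \<longrightarrow> X'' $ a $ b = X $ a $ b" using X'(2) Y k by auto
    moreover have "\<forall>(a, b)\<in>insert pq R. X'' $ a $ b = 0" unfolding pq using ent X'(3) by auto
    ultimately show ?case by blast
  qed
  from this[of "{(a, b). \<not> ?eq a b}"] obtain X' where
    X': "X' \<in> bb" "\<forall>a b. ?eq a b \<longrightarrow> X' $ a $ b = X $ a $ b" "\<forall>(a, b)\<in>{(a, b). \<not> ?eq a b}. X' $ a $ b = 0" by auto
  have "wproj c d X = X'" unfolding wproj_def using X'(2,3) by (intro mat_eqI) auto
  thus ?thesis using X'(1) by simp
qed

lemma bb_entry:
  assumes X: "X \<in> bb" and nz: "X $ c $ d \<noteq> 0"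
  obtains n :: "'r \<Rightarrow> nat" where "\<And>Y. Y \<in> hh \<Longrightarrow> Y $ c $ c - Y $ d $ d = (\<Sum>i\<in>UNIV. of_nat (n i) * al i Y)"
    "ht c - ht d = of_nat (\<Sum>i\<in>UNIV. n i)"
proof -
  have "wproj c d X $ c $ d = X $ c $ d" by (simp add: wproj_def)
  hence "wproj c d X \<noteq> 0" using nz by auto
  from bb_roots[OF wproj_bb[OF X] this wproj_weight] obtain n :: "'r \<Rightarrow> nat"
    where n: "\<forall>Y\<in>hh. Y $ c $ c - Y $ d $ d = (\<Sum>i\<in>UNIV. of_nat (n i) * al i Y)" by blast
  moreover from this rho_hh have "ht c - ht d = of_nat (\<Sum>i\<in>UNIV. n i)" by (simp add: ht_def al_rho)
  ultimately show ?thesis using that by blast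
qed

lemma bb_deg: "X \<in> bb \<Longrightarrow> deg_ge ht 0 X"
  unfolding deg_ge_def using bb_entry by (metis le0)

lemma bb_deg0: assumes "X \<in> bb" "ht a = ht b" "a \<noteq> b" shows "X $ a $ b = 0"
proof -
  have "X \<in> gg" using assms(1) bb_gg by blast
  then obtain h where h: "h \<in> cospan" "\<And>a b. ht a = ht b \<Longrightarrow> X $ a $ b = h $ a $ b" using gg_entries by blast
  show ?thesis using hh_diag[OF cospan_hh[OF h(1)] assms(3)] h(2)[OF assms(2)] by simp
qed

end

section \<open>From opers to first order equations\<close>

text \<open>If f vanished to finite order m > 0, then f' would have order m - 1 while \<beta> f has
  order at least m.\<close>

lemma linear_ode_zero:
  assumes f: "regular_at w f" "rat_eval f w = 0" and \<beta>: "regular_at w \<beta>" and ode: "rderiv f = \<beta> * f"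
  shows "f = 0"
proof (rule ccontr)
  assume "f \<noteq> 0"
  then obtain m g where mg: "f = lin w powi m * g" "regular_at w g" "rat_eval g w \<noteq> 0" by (rule ratfun_order)
  have m: "m > 0"
  proof (rule ccontr)
    assume "\<not> m > 0"
    have "g = lin w powi (- m) * f" unfolding mg(1) by (simp add: power_int_minus)
    moreover have "regular_at w (lin w powi (- m))" using \<open>\<not> m > 0\<close> by (simp add: regular_at_lin_powi)
    ultimately have "rat_eval g w = 0" using f by (simp add: rat_eval_mult)
    thus False using mg by simp
  qed
  have "lin w powi (m - 1) * (rconst (of_int m) * g + lin w * rderiv g) = rderiv f"
    unfolding mg(1) by (simp add: rderiv_mult rderiv_powi of_int_ratfun power_int_diff field_simps)
  also have "\<dots> = \<beta> * (lin w powi m * g)" unfolding ode by (simp only: mg(1)[symmetric])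
  also have "\<dots> = lin w powi (m - 1) * (lin w * \<beta> * g)" by (simp add: power_int_diff)
  finally have "rconst (of_int m) * g + lin w * rderiv g = lin w * \<beta> * g" by simp
  from arg_cong[OF this, of "\<lambda>y. rat_eval y w"] have "of_int m * rat_eval g w = 0"
    using mg(2) \<beta> by (simp add: rat_eval_add rat_eval_mult regular_at_mult regular_at_rderiv)
  thus False using m mg(3) by simp
qed

lemma simple_poles_eq_0:
  assumes "s \<in> simple_poles" and res: "\<And>w \<rho> r. s = rconst \<rho> / lin w + r \<Longrightarrow> regular_at w r \<Longrightarrow> \<rho> = 0"
  shows "s = 0"
proof -
  obtain W \<rho> where W: "finite W" "s = (\<Sum>w\<in>W. rconst (\<rho> w) / lin w)" using assms(1) by (auto simp: simple_poles_def)
  have "\<rho> w = 0" if "w \<in> W" for w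
  proof (rule res)
    show "s = rconst (\<rho> w) / lin w + (\<Sum>v\<in>W - {w}. rconst (\<rho> v) / lin v)"
      unfolding W(2) by (rule sum.remove[OF W(1) that])
    show "regular_at w (\<Sum>v\<in>W - {w}. rconst (\<rho> v) / lin v)"
      unfolding divide_inverse by (intro regular_at_sum regular_at_mult regular_at_inverse) auto
  qed
  thus ?thesis unfolding W(2) by (simp add: rconst_simps)
qed

context diagonal_group
begin

definition aint :: "'r \<Rightarrow> 'r \<Rightarrow> int" where
  "aint i j = (THE k. of_int k = al j (co i))"

lemma aint: "of_int (aint i j) = al j (co i)"
proof -
  obtain k :: int where k: "al j (co i) = of_int k" using cartan_integral by blast
  show ?thesis unfolding aint_def k by (rule theI[of _ k]) (simp_all add: of_int_eq_iff)
qed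

lemma aint_diag: "aint i i = 2"
  using aint[of i i] al_co[of i] by (metis of_int_eq_iff of_int_numeral)

lemma aint_nonpos: "i \<noteq> j \<Longrightarrow> aint i j \<le> 0"
proof -
  assume "i \<noteq> j"
  then obtain n where "of_int (aint i j) = (- of_nat n :: complex)" using cartan_nonpos aint by metis
  hence "of_int (aint i j) = (of_int (- int n) :: complex)" by simp
  hence "aint i j = - int n" by (simp only: of_int_eq_iff)
  thus ?thesis by simp
qed

text \<open>The inverse of the character \<alpha>_i evaluated at the torus element with components
  y_j along the coroots. Multiplied by \<Lambda>_i it is the right-hand side of the first order
  equation of \<alpha>_i.\<close>

definition torus_factor :: "('r \<Rightarrow> complex poly) \<Rightarrow> 'r \<Rightarrow> ratfun" where
  "torus_factor y i = (\<Prod>j\<in>UNIV. rpoly (y j) powi (- aint j i))"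

definition conn :: "('r \<Rightarrow> complex poly) \<Rightarrow> complex^'n^'n \<Rightarrow> ('r \<Rightarrow> complex poly) \<Rightarrow> ratfun^'n^'n" where
  "conn \<Lambda> Z y = const_mat Z - (\<Sum>i\<in>UNIV. msc (dlog (rpoly (y i))) (const_mat (co i)))
     + (\<Sum>i\<in>UNIV. msc (rpoly (\<Lambda> i)) (const_mat (e i)))"

definition GB :: "(ratfun^'n^'n) set" where
  "GB = {g. invertible g \<and> (\<forall>\<^sub>F w in cofinite. mat_eval w g \<in> BB)}"

lemma e_diag: "e i $ a $ a = 0"
  using e_deg[of i a a] by auto

lemma conn_diag: "Z \<in> hh \<Longrightarrow> conn \<Lambda> Z y $ a $ a = rconst (Z $ a $ a) - (\<Sum>i\<in>UNIV. dlog (rpoly (y i)) * rconst (co i $ a $ a))"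
  by (simp add: conn_def e_diag rconst_simps)

lemma conn_off: "Z \<in> hh \<Longrightarrow> a \<noteq> b \<Longrightarrow> conn \<Lambda> Z y $ a $ b = (\<Sum>i\<in>UNIV. rpoly (\<Lambda> i) * rconst (e i $ a $ b))"
  by (simp add: conn_def hh_diag co_hh rconst_simps)

lemma conn_deg: "Z \<in> hh \<Longrightarrow> a \<noteq> b \<Longrightarrow> conn \<Lambda> Z y $ a $ b \<noteq> 0 \<Longrightarrow> ht a - ht b = 1"
proof -
  assume Z: "Z \<in> hh" "a \<noteq> b" and nz: "conn \<Lambda> Z y $ a $ b \<noteq> 0"
  then obtain i where "rpoly (\<Lambda> i) * rconst (e i $ a $ b) \<noteq> 0"
    unfolding conn_off[OF Z] using sum.not_neutral_contains_not_neutral by blast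
  thus ?thesis using e_deg[of i a b] by auto
qed

lemma torus_factor_nonzero: "(\<And>j. y j \<noteq> 0) \<Longrightarrow> torus_factor y i \<noteq> 0"
  by (simp add: torus_factor_def)

lemma dlog_torus_factor: "(\<And>j. y j \<noteq> 0) \<Longrightarrow> dlog (torus_factor y i) = - (\<Sum>j\<in>UNIV. dlog (rpoly (y j)) * rconst (al i (co j)))"
  unfolding torus_factor_def
  by (subst dlog_prod) (simp_all add: dlog_powi sum_negf[symmetric] aint[symmetric] rconst_of_int mult.commute)

text \<open>At a position (a, b) of weight \<alpha>_i the equation of the normalised transformation
  u couples only u_ab with the diagonal entries u_aa and u_bb. Dividing by u_aa gives a scalar
  equation, whose inhomogeneous part is governed by the ratio u_bb / u_aa; that ratio is a constant
  multiple of \<open>torus_factor y i\<close>.\<close>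

theorem oper_imp_first_order:
  assumes Z: "Z \<in> hh" and y: "\<And>j. y j \<noteq> 0" and v: "v \<in> GB" and gauge: "gauge v (const_mat Z) = conn \<Lambda> Z y"
  shows "\<exists>x \<kappa> c0. \<kappa> \<noteq> 0 \<and> rderiv x + rconst (al i Z) * x = rconst c0 - rconst \<kappa> * (rpoly (\<Lambda> i) * torus_factor y i)"
proof -
  let ?A = "conn \<Lambda> Z y"
  have inv: "invertible v" and ev: "\<forall>\<^sub>F w in cofinite. mat_eval w v \<in> BB" using v by (auto simp: GB_def)
  have dv: "mat_deriv v = v ** const_mat Z - ?A ** v" using gauge gauge_eq_iff[OF inv] by blast
  have "\<forall>\<^sub>F w in cofinite. mat_eval w v \<in> BB \<and> mat_regular w v \<and> mat_regular w ?A"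
    using ev eventually_mat_regular[of v] eventually_mat_regular[of ?A] by eventually_elim auto
  then obtain w where w: "mat_eval w v \<in> BB" "mat_regular w v" "mat_regular w ?A"
    using eventually_happens'[of "cofinite :: complex filter"] by (auto simp: infinite_UNIV_char_0)
  define V where "V = mat_eval w v"
  have V: "invertible V" "V ** matrix_inv V = mat 1" "matrix_inv V ** V = mat 1"
    using BB_invertible[OF w(1)] by (auto simp: V_def invertible_matrix_inv)
  define Z0 where "Z0 = V ** Z ** matrix_inv V"
  have Z0: "Z0 \<in> bb" unfolding Z0_def V_def using BB_Ad[OF w(1)] Z hh_bb by blast
  \<comment> \<open>Now u(w) = 1, at the price of replacing Z by the conjugate \<open>Z0\<close> in
    \<open>bb\<close>, whose entries off the diagonal have positive degree.\<close>
  define u where "u = v ** const_mat (matrix_inv V)"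
  have ureg: "mat_regular w u" unfolding u_def by (intro mat_regular_simps w)
  have uw: "mat_eval w u = mat 1" unfolding u_def using w V by (simp add: mat_eval_simps mat_regular_simps flip: V_def)
  have vu: "v = u ** const_mat V"
    unfolding u_def by (simp add: matrix_mul_assoc[symmetric] V const_mat_simps flip: const_mat_simps(4))
  have "mat_deriv u = (v ** const_mat Z - ?A ** v) ** const_mat (matrix_inv V)"
    unfolding u_def by (simp add: mat_deriv_simps dv)
  also have "\<dots> = u ** const_mat Z0 - ?A ** u"
    unfolding vu Z0_def const_mat_simps matrix_ring_simps
    by (simp add: matrix_mul_assoc[symmetric] V const_mat_simps flip: const_mat_simps(4))
  finally have du: "mat_deriv u = u ** const_mat Z0 - ?A ** u" .
  have ent: "rderiv (u $ a $ b) = (\<Sum>c\<in>UNIV. u $ a $ c * rconst (Z0 $ c $ b)) - (\<Sum>c\<in>UNIV. ?A $ a $ c * u $ c $ b)" for a b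
    using arg_cong[OF du, of "\<lambda>M. M $ a $ b"] by (simp add: mat_mult_nth)
  have Z0_deg: "\<exists>m\<ge>1. ht c - ht b = of_nat m" if nz: "Z0 $ c $ b \<noteq> 0" "c \<noteq> b" for c b
  proof -
    obtain m where m: "ht c - ht b = of_nat m" using bb_deg[OF Z0] nz(1) unfolding deg_ge_def by blast
    moreover have "m \<noteq> 0"
    proof
      assume "m = 0"
      hence "ht c = ht b" using m by simp
      thus False using bb_deg0[OF Z0 _ nz(2)] nz(1) by blast
    qed
    ultimately show ?thesis by (metis Suc_leI One_nat_def gr0I)
  qed
  have A_deg: "ht a - ht c = 1" if "?A $ a $ c \<noteq> 0" "a \<noteq> c" for a c
    using conn_deg[OF Z] that by blast
  have Areg: "regular_at w (?A $ a $ b)" for a b using w(3) by (simp add: mat_regular_def)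
  \<comment> \<open>Induction measure: the positions whose degree is smaller by a positive integer.
    Degrees are complex, so only those with integral difference are comparable.\<close>
  define lower where "lower = (\<lambda>a b. {(a', b'). \<exists>m\<ge>1. (ht a - ht b) - (ht a' - ht b') = of_nat m})"
  have lower: "card (lower a' b') < card (lower a b)" if "m \<ge> 1" "(ht a - ht b) - (ht a' - ht b') = of_nat m" for a b a' b' m
  proof (rule psubset_card_mono)
    show "lower a' b' \<subset> lower a b"
    proof
      show "lower a' b' \<subseteq> lower a b"
      proof
        fix x assume "x \<in> lower a' b'"
        then obtain a'' b'' k where k: "x = (a'', b'')" "k \<ge> 1" "(ht a' - ht b') - (ht a'' - ht b'') = of_nat k" by (auto simp: lower_def)
        have "(ht a - ht b) - (ht a'' - ht b'') = ((ht a - ht b) - (ht a' - ht b')) + ((ht a' - ht b') - (ht a'' - ht b''))" by simp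
        also have "\<dots> = of_nat (m + k)" unfolding that(2) k(3) by simp
        finally show "x \<in> lower a b" unfolding lower_def k(1) using k(2) by (auto intro!: exI[of _ "m + k"])
      qed
      have "(a', b') \<in> lower a b" using that by (auto simp: lower_def)
      moreover have "(a', b') \<notin> lower a' b'" by (auto simp: lower_def)
      ultimately show "lower a' b' \<noteq> lower a b" by blast
    qed
  qed simp
  \<comment> \<open>All other entries in the equation of u_ab have smaller degree and vanish by
    induction, being again off the diagonal and of no positive degree. What is left is homogeneous
    with value 0 at w.\<close>
  have zero: "u $ a $ b = 0" if "a \<noteq> b" "\<not> (\<exists>m\<ge>1. ht a - ht b = of_nat m)" for a b
    using that
  proof (induction "card (lower a b)" arbitrary: a b rule: less_induct)
    case less
    have low: "u $ a' $ b' = 0" if m: "m \<ge> 1" "(ht a - ht b) - (ht a' - ht b') = of_nat m" for a' b' m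
    proof (rule less.hyps[OF lower[OF m]])
      have d: "ht a - ht b = of_nat m + (ht a' - ht b')" using m(2) by (simp add: algebra_simps)
      show "a' \<noteq> b'" using d less.prems(2) m(1) by auto
      show "\<not> (\<exists>k\<ge>1. ht a' - ht b' = of_nat k)"
      proof
        assume "\<exists>k\<ge>1. ht a' - ht b' = of_nat k"
        then obtain k where "ht a' - ht b' = of_nat k" by blast
        hence "ht a - ht b = of_nat (m + k)" using d by simp
        thus False using less.prems(2) m(1) by (metis trans_le_add1)
      qed
    qed
    have 1: "(\<Sum>c\<in>UNIV. u $ a $ c * rconst (Z0 $ c $ b)) = u $ a $ b * rconst (Z0 $ b $ b)"
    proof -
      have "u $ a $ c * rconst (Z0 $ c $ b) = 0" if c: "c \<noteq> b" for c
      proof (cases "Z0 $ c $ b = 0")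
        case False
        then obtain m where "m \<ge> 1" "ht c - ht b = of_nat m" using Z0_deg c by blast
        hence "u $ a $ c = 0" by (intro low[of m]) simp_all
        thus ?thesis by simp
      qed (simp add: rconst_simps)
      hence "(\<Sum>c\<in>UNIV - {b}. u $ a $ c * rconst (Z0 $ c $ b)) = 0" by (intro sum.neutral) blast
      thus ?thesis by (subst sum.remove[of _ b]) simp_all
    qed
    have 2: "(\<Sum>c\<in>UNIV. ?A $ a $ c * u $ c $ b) = ?A $ a $ a * u $ a $ b"
    proof -
      have "?A $ a $ c * u $ c $ b = 0" if c: "c \<noteq> a" for c
      proof (cases "?A $ a $ c = 0")
        case False
        hence "ht a - ht c = 1" using A_deg c by metis
        hence "u $ c $ b = 0" by (intro low[of 1]) simp_all
        thus ?thesis by simp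
      qed simp
      hence "(\<Sum>c\<in>UNIV - {a}. ?A $ a $ c * u $ c $ b) = 0" by (intro sum.neutral) blast
      thus ?thesis by (subst sum.remove[of _ a]) simp_all
    qed
    show ?case
    proof (rule linear_ode_zero[of w _ "rconst (Z0 $ b $ b) - ?A $ a $ a"])
      show "regular_at w (u $ a $ b)" using ureg by (simp add: mat_regular_def)
      show "rat_eval (u $ a $ b) w = 0"
        using arg_cong[OF uw, of "\<lambda>M. M $ a $ b"] less.prems(1) by (simp add: mat_one_nth)
      show "regular_at w (rconst (Z0 $ b $ b) - ?A $ a $ a)" by (intro regular_at_diff Areg) simp
      show "rderiv (u $ a $ b) = (rconst (Z0 $ b $ b) - ?A $ a $ a) * u $ a $ b"
        unfolding ent 1 2 by (simp add: algebra_simps)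
    qed
  qed
  have udiag_nz: "u $ a $ a \<noteq> 0" for a
    using arg_cong[OF uw, of "\<lambda>M. M $ a $ a"] by (auto simp: mat_one_nth)
  have udiag: "dlog (u $ a $ a) = rconst (Z0 $ a $ a) - ?A $ a $ a" for a
  proof -
    have "u $ a $ c * rconst (Z0 $ c $ a) = 0" if c: "c \<noteq> a" for c
    proof (cases "Z0 $ c $ a = 0")
      case False
      then obtain m where m: "m \<ge> 1" "ht c - ht a = of_nat m" using Z0_deg c by blast
      have "\<not> (\<exists>k\<ge>1. ht a - ht c = of_nat k)"
      proof
        assume "\<exists>k\<ge>1. ht a - ht c = of_nat k"
        then obtain k where "ht a - ht c = of_nat k" by blast
        hence "of_nat (m + k) = (ht c - ht a) + (ht a - ht c)" using m(2) by simp
        hence "of_nat (m + k) = (0::complex)" by simp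
        thus False using m(1) by (simp only: of_nat_eq_0_iff)
      qed
      hence "u $ a $ c = 0" by (rule zero[OF c[symmetric]])
      thus ?thesis by simp
    qed (simp add: rconst_simps)
    hence "(\<Sum>c\<in>UNIV - {a}. u $ a $ c * rconst (Z0 $ c $ a)) = 0" by (intro sum.neutral) blast
    hence 1: "(\<Sum>c\<in>UNIV. u $ a $ c * rconst (Z0 $ c $ a)) = u $ a $ a * rconst (Z0 $ a $ a)"
      by (subst sum.remove[of _ a]) simp_all
    have "?A $ a $ c * u $ c $ a = 0" if c: "c \<noteq> a" for c
    proof (cases "?A $ a $ c = 0")
      case False
      hence m: "ht a - ht c = 1" using A_deg c by metis
      have "\<not> (\<exists>k\<ge>1. ht c - ht a = of_nat k)"
      proof
        assume "\<exists>k\<ge>1. ht c - ht a = of_nat k"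
        then obtain k where "ht c - ht a = of_nat k" by blast
        hence "of_nat (Suc k) = (ht a - ht c) + (ht c - ht a)" using m by simp
        hence "of_nat (Suc k) = (0::complex)" by simp
        thus False by (simp only: of_nat_eq_0_iff)
      qed
      hence "u $ c $ a = 0" by (rule zero[OF c])
      thus ?thesis by simp
    qed simp
    hence "(\<Sum>c\<in>UNIV - {a}. ?A $ a $ c * u $ c $ a) = 0" by (intro sum.neutral) blast
    hence 2: "(\<Sum>c\<in>UNIV. ?A $ a $ c * u $ c $ a) = ?A $ a $ a * u $ a $ a"
      by (subst sum.remove[of _ a]) simp_all
    have "rderiv (u $ a $ a) = (rconst (Z0 $ a $ a) - ?A $ a $ a) * u $ a $ a"
      unfolding ent 1 2 by (simp add: algebra_simps)
    thus ?thesis using udiag_nz[of a] by (simp add: dlog_def)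
  qed
  \<comment> \<open>Where e_i has a nonzero entry, the weight of the position is exactly \<alpha>_i,
    so the other e_j vanish there.\<close>
  obtain a b where eab: "e i $ a $ b \<noteq> 0" using e_nonzero[of i] by (metis mat_eqI zero_index)
  have ab: "ht a - ht b = 1" "a \<noteq> b" using e_deg[OF eab] by auto
  have wt: "Y $ a $ a - Y $ b $ b = al i Y" if "Y \<in> hh" for Y using e_entry[OF that eab] .
  have Aab: "?A $ a $ b = rpoly (\<Lambda> i) * rconst (e i $ a $ b)"
  proof -
    have "e j $ a $ b = 0" if "j \<noteq> i" for j
      using that wt e_entry[of _ j a b] al_inj[of i j] by metis
    thus ?thesis unfolding conn_off[OF Z ab(2)] by (subst sum.remove[of _ i]) (auto intro!: sum.neutral simp: rconst_simps)
  qed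
  have 1: "(\<Sum>c\<in>UNIV. u $ a $ c * rconst (Z0 $ c $ b)) = u $ a $ b * rconst (Z0 $ b $ b) + u $ a $ a * rconst (Z0 $ a $ b)"
  proof -
    have "u $ a $ c * rconst (Z0 $ c $ b) = 0" if c: "c \<noteq> a" "c \<noteq> b" for c
    proof (cases "Z0 $ c $ b = 0")
      case False
      then obtain m where m: "m \<ge> 1" "ht c - ht b = of_nat m" using Z0_deg c by blast
      have "\<not> (\<exists>k\<ge>1. ht a - ht c = of_nat k)"
      proof
        assume "\<exists>k\<ge>1. ht a - ht c = of_nat k"
        then obtain k where k: "k \<ge> 1" "ht a - ht c = of_nat k" by blast
        have "of_nat (m + k) = (ht c - ht b) + (ht a - ht c)" using m k by simp
        also have "\<dots> = of_nat 1" using ab(1) by simp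
        finally have "m + k = 1" by (simp only: of_nat_eq_iff)
        thus False using m(1) k(1) by simp
      qed
      hence "u $ a $ c = 0" by (rule zero[OF c(1)[symmetric]])
      thus ?thesis by simp
    qed (simp add: rconst_simps)
    hence "(\<Sum>c\<in>UNIV - {b} - {a}. u $ a $ c * rconst (Z0 $ c $ b)) = 0" by (intro sum.neutral) blast
    thus ?thesis using ab(2)
      by (subst sum.remove[of _ b], simp, simp, subst sum.remove[of _ a]) simp_all
  qed
  have 2: "(\<Sum>c\<in>UNIV. ?A $ a $ c * u $ c $ b) = ?A $ a $ a * u $ a $ b + ?A $ a $ b * u $ b $ b"
  proof -
    have "?A $ a $ c * u $ c $ b = 0" if c: "c \<noteq> a" "c \<noteq> b" for c
    proof (cases "?A $ a $ c = 0")
      case False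
      hence "ht a - ht c = 1" using A_deg c by metis
      hence "ht c - ht b = 0" using ab(1) by (simp add: algebra_simps)
      hence "u $ c $ b = 0" using zero c by auto
      thus ?thesis by simp
    qed simp
    hence "(\<Sum>c\<in>UNIV - {a} - {b}. ?A $ a $ c * u $ c $ b) = 0" by (intro sum.neutral) blast
    thus ?thesis using ab(2)
      by (subst sum.remove[of _ a], simp, simp, subst sum.remove[of _ b]) simp_all
  qed
  \<comment> \<open>The logarithmic derivatives of \<open>\<tau>\<close> and
    \<open>torus_factor y i\<close> differ by a constant. By \<open>dlog_const_imp\<close> that
    constant is 0, which also shows that Z0 and Z have the same weight at (a, b).\<close>
  define \<tau> where "\<tau> = u $ b $ b * inverse (u $ a $ a)"
  have \<tau>: "\<tau> \<noteq> 0" using udiag_nz by (simp add: \<tau>_def)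
  have "dlog \<tau> = (rconst (Z0 $ b $ b) - ?A $ b $ b) - (rconst (Z0 $ a $ a) - ?A $ a $ a)"
    unfolding \<tau>_def using udiag_nz by (simp add: dlog_mult dlog_inverse udiag)
  also have "\<dots> = rconst (al i Z - (Z0 $ a $ a - Z0 $ b $ b)) - (\<Sum>j\<in>UNIV. dlog (rpoly (y j)) * rconst (al i (co j)))"
    unfolding wt[OF Z, symmetric] wt[OF co_hh, symmetric] rconst_simps conn_diag[OF Z]
    by (simp only: right_diff_distrib sum_subtractf) (simp only: algebra_simps)
  also have "\<dots> = rconst (al i Z - (Z0 $ a $ a - Z0 $ b $ b)) + dlog (torus_factor y i)"
    by (simp only: dlog_torus_factor[OF y] diff_conv_add_uminus)
  finally have "dlog \<tau> - dlog (torus_factor y i) = rconst (al i Z - (Z0 $ a $ a - Z0 $ b $ b))"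
    by (simp only: add_diff_cancel_right')
  moreover have "dlog (\<tau> * inverse (torus_factor y i)) = dlog \<tau> - dlog (torus_factor y i)"
    using \<tau> torus_factor_nonzero[OF y] by (simp add: dlog_mult dlog_inverse)
  ultimately have d\<tau>: "dlog (\<tau> * inverse (torus_factor y i)) = rconst (al i Z - (Z0 $ a $ a - Z0 $ b $ b))" by (simp only:)
  have nz: "\<tau> * inverse (torus_factor y i) \<noteq> 0" using \<tau> torus_factor_nonzero[OF y] by simp
  have c: "Z0 $ a $ a - Z0 $ b $ b = al i Z" using dlog_const_imp(1)[OF nz d\<tau>] by simp
  obtain \<kappa> where \<kappa>: "\<kappa> \<noteq> 0" "\<tau> * inverse (torus_factor y i) = rconst \<kappa>" using dlog_const_imp(2)[OF nz d\<tau>] by blast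
  have \<tau>_eq: "\<tau> = rconst \<kappa> * torus_factor y i" using \<kappa>(2) torus_factor_nonzero[OF y] by (simp add: field_simps)
  \<comment> \<open>The division cancels the diagonal coefficient of the connection at a. The
    constant \<open>c0\<close> is the entry of Z0 at (a, b), and the final constant in front of the
    right-hand side also absorbs the entry of e_i.\<close>
  define x where "x = u $ a $ b * inverse (u $ a $ a)"
  let ?p = "inverse (u $ a $ a)"
  have dp: "rderiv ?p = - (rconst (Z0 $ a $ a) - ?A $ a $ a) * ?p"
    using rderiv_eq_dlog[of ?p] udiag_nz[of a] by (simp add: dlog_inverse udiag)
  have "rderiv x = (u $ a $ b * rconst (Z0 $ b $ b) + u $ a $ a * rconst (Z0 $ a $ b) - (?A $ a $ a * u $ a $ b + ?A $ a $ b * u $ b $ b)) * ?p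
      + u $ a $ b * (- (rconst (Z0 $ a $ a) - ?A $ a $ a) * ?p)"
    unfolding x_def rderiv_mult ent 1 2 dp ..
  also have "\<dots> = (u $ a $ a * ?p) * rconst (Z0 $ a $ b) - ?A $ a $ b * \<tau> - (rconst (Z0 $ a $ a) - rconst (Z0 $ b $ b)) * x"
    unfolding x_def \<tau>_def minus_diff_eq by (simp only: algebra_simps)
  also have "u $ a $ a * ?p = 1" using udiag_nz[of a] by simp
  also have "rconst (Z0 $ a $ a) - rconst (Z0 $ b $ b) = rconst (al i Z)" unfolding c[symmetric] rconst_simps ..
  finally have "rderiv x + rconst (al i Z) * x = rconst (Z0 $ a $ b) - rconst (e i $ a $ b * \<kappa>) * (rpoly (\<Lambda> i) * torus_factor y i)"
    unfolding Aab \<tau>_eq rconst_simps by (simp only: mult_1_left diff_add_cancel mult_ac)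
  moreover have "e i $ a $ b * \<kappa> \<noteq> 0" using eab \<kappa> by simp
  ultimately show ?thesis by blast
qed

section \<open>Bethe equations and first order equations\<close>

text \<open>Polynomials of orthogonal simple roots may share the root w; the vanishing Cartan
  integers then keep them out of each other's equations and reflections.\<close>

definition nondeg_at :: "('r \<Rightarrow> complex poly) \<Rightarrow> ('r \<Rightarrow> complex poly) \<Rightarrow> 'r \<Rightarrow> complex \<Rightarrow> bool" where
  "nondeg_at \<Lambda> y i w \<longleftrightarrow> poly (y i) w = 0 \<longrightarrow> Polynomial.order w (y i) = 1 \<and> poly (\<Lambda> i) w \<noteq> 0 \<and>
     (\<forall>j. j \<noteq> i \<longrightarrow> poly (y j) w = 0 \<longrightarrow> aint i j = 0 \<and> aint j i = 0)"

text \<open>The function inside the logarithm of the Bethe equation. At a simple root w of y_i the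
  factor (z - w)^2 cancels the double pole coming from the exponent - a_ii = - 2, and the result
  plays the role of H in \<open>first_order_residue\<close>.\<close>

definition bethe_fun :: "('r \<Rightarrow> complex poly) \<Rightarrow> ('r \<Rightarrow> complex poly) \<Rightarrow> 'r \<Rightarrow> complex \<Rightarrow> ratfun" where
  "bethe_fun \<Lambda> y i w = rpoly (\<Lambda> i) * torus_factor y i * (lin w)\<^sup>2"

lemma simple_root_factor:
  assumes "p \<noteq> 0" "Polynomial.order w p = 1"
  obtains q where "rpoly p = lin w * rpoly q" "poly q w \<noteq> 0"
proof -
  obtain q where "p = [:-w, 1:] ^ 1 * q" "\<not> [:-w, 1:] dvd q" using order_decomp[OF assms(1), of w] assms(2) by auto
  thus ?thesis using that[of q] by (auto simp: poly_eq_0_iff_dvd simp flip: to_fract_mult)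
qed

lemma bethe_fun_regular:
  assumes y: "\<And>j. y j \<noteq> 0" and nd: "nondeg_at \<Lambda> y i w" and root: "poly (y i) w = 0"
  shows "regular_at w (bethe_fun \<Lambda> y i w)" "rat_eval (bethe_fun \<Lambda> y i w) w \<noteq> 0"
proof -
  have o: "Polynomial.order w (y i) = 1" and \<Lambda>: "poly (\<Lambda> i) w \<noteq> 0"
    and other: "\<And>j. j \<noteq> i \<Longrightarrow> poly (y j) w = 0 \<Longrightarrow> aint j i = 0" using nd root by (auto simp: nondeg_at_def)
  obtain q where q: "rpoly (y i) = lin w * rpoly q" "poly q w \<noteq> 0" by (rule simple_root_factor[OF y o])
  have q0: "rpoly q \<noteq> 0" using q(2) by auto
  have f: "regular_at w (rpoly (y j) powi (- aint j i)) \<and> rat_eval (rpoly (y j) powi (- aint j i)) w \<noteq> 0" if "j \<noteq> i" for j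
    using other[OF that] by (cases "poly (y j) w = 0") (simp_all add: regular_at_powi rat_eval_powi)
  have "bethe_fun \<Lambda> y i w = rpoly (\<Lambda> i) * ((lin w * rpoly q) powi (-2) * (\<Prod>j\<in>UNIV - {i}. rpoly (y j) powi (- aint j i))) * (lin w)\<^sup>2"
    unfolding bethe_fun_def torus_factor_def by (subst prod.remove[of _ i]) (simp_all add: q(1) aint_diag)
  also have "(lin w * rpoly q) powi (-2) = inverse ((lin w)\<^sup>2) * inverse (rpoly q ^ 2)"
    by (simp add: power_int_def power_mult_distrib nat_numeral power_inverse)
  finally have e: "bethe_fun \<Lambda> y i w = rpoly (\<Lambda> i) * (inverse (rpoly q ^ 2) * (\<Prod>j\<in>UNIV - {i}. rpoly (y j) powi (- aint j i)))"
    by (simp add: field_simps)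
  have r: "regular_at w (inverse (rpoly q ^ 2))" "rat_eval (inverse (rpoly q ^ 2)) w \<noteq> 0"
    using q(2) by (simp_all add: regular_at_inverse rat_eval_inverse regular_at_power rat_eval_power)
  have p: "regular_at w (\<Prod>j\<in>UNIV - {i}. rpoly (y j) powi (- aint j i))" "rat_eval (\<Prod>j\<in>UNIV - {i}. rpoly (y j) powi (- aint j i)) w \<noteq> 0"
    using f by (auto intro!: regular_at_prod) (subst (asm) rat_eval_prod, auto)
  show "regular_at w (bethe_fun \<Lambda> y i w)" "rat_eval (bethe_fun \<Lambda> y i w) w \<noteq> 0"
    unfolding e using r p \<Lambda> by (simp_all add: regular_at_mult rat_eval_mult)
qed

text \<open>Multiplication by the nonzero value of \<open>bethe_fun\<close> at w turns the Bethe
  equation into the vanishing of the residue in \<open>first_order_residue\<close>.\<close>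

lemma bethe_residue_iff:
  assumes y: "\<And>j. y j \<noteq> 0" and nd: "nondeg_at \<Lambda> y i w" and root: "poly (y i) w = 0"
  shows "c + rat_eval (dlog (bethe_fun \<Lambda> y i w)) w = 0 \<longleftrightarrow>
    rat_eval (rderiv (bethe_fun \<Lambda> y i w)) w + c * rat_eval (bethe_fun \<Lambda> y i w) w = 0"
proof -
  note r = bethe_fun_regular[OF assms]
  have "rat_eval (dlog (bethe_fun \<Lambda> y i w)) w = rat_eval (rderiv (bethe_fun \<Lambda> y i w)) w / rat_eval (bethe_fun \<Lambda> y i w) w"
    unfolding dlog_def divide_inverse using r by (simp add: rat_eval_mult regular_at_rderiv regular_at_inverse rat_eval_inverse)
  hence "rat_eval (rderiv (bethe_fun \<Lambda> y i w)) w + c * rat_eval (bethe_fun \<Lambda> y i w) w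
    = (c + rat_eval (dlog (bethe_fun \<Lambda> y i w)) w) * rat_eval (bethe_fun \<Lambda> y i w) w"
    using r(2) by (simp add: distrib_right)
  thus ?thesis using r(2) by (simp only: mult_eq_0_iff simp_thms)
qed

lemma first_order_imp_bethe:
  assumes y: "\<And>j. y j \<noteq> 0" and nd: "nondeg_at \<Lambda> y i w" and root: "poly (y i) w = 0" and \<kappa>: "\<kappa> \<noteq> 0"
    and eq: "rderiv x + rconst c * x = rconst c0 - rconst \<kappa> * (rpoly (\<Lambda> i) * torus_factor y i)"
  shows "c + rat_eval (dlog (bethe_fun \<Lambda> y i w)) w = 0"
proof -
  let ?H = "bethe_fun \<Lambda> y i w"
  note r = bethe_fun_regular[OF y nd root]
  have "rderiv x + rconst c * x + rconst 0 / lin w + (- rconst c0) = (rconst (- \<kappa>) * ?H) / (lin w)\<^sup>2"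
    unfolding eq by (simp add: bethe_fun_def rconst_simps)
  from first_order_residue(3)[OF this] have "0 = rat_eval (rderiv (rconst (- \<kappa>) * ?H)) w + c * rat_eval (rconst (- \<kappa>) * ?H) w"
    using r by (simp add: regular_at_uminus regular_at_mult)
  hence "0 = - \<kappa> * (rat_eval (rderiv ?H) w + c * rat_eval ?H w)"
    unfolding rderiv_cmult using r by (simp add: rat_eval_mult regular_at_rderiv rat_eval_rpoly algebra_simps del: to_fract_uminus)
  thus ?thesis using \<kappa> bethe_residue_iff[OF y nd root] by simp
qed

text \<open>Modulo simple poles the equation is solvable, and the coefficient left at w is the
  residue. At a root of y_i it vanishes by the Bethe equation. Elsewhere the right-hand side is
  regular, all exponents with j different from i being nonnegative, so \<open>bethe_fun\<close> has
  a double zero at w.\<close>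

lemma bethe_imp_first_order:
  assumes y: "\<And>j. y j \<noteq> 0" and nd: "\<And>w. nondeg_at \<Lambda> y i w"
    and bethe: "\<And>w. poly (y i) w = 0 \<Longrightarrow> c + rat_eval (dlog (bethe_fun \<Lambda> y i w)) w = 0"
  shows "\<exists>x. rderiv x + rconst c * x = rpoly (\<Lambda> i) * torus_factor y i"
proof -
  let ?G = "rpoly (\<Lambda> i) * torus_factor y i"
  obtain x s where xs: "s \<in> simple_poles" "?G = rderiv x + rconst c * x + s" using first_order_mod_simple_poles by blast
  have "s = 0"
  proof (rule simple_poles_eq_0[OF xs(1)])
    fix w \<rho> r assume s: "s = rconst \<rho> / lin w + r" and r: "regular_at w r"
    have eq: "rderiv x + rconst c * x + rconst \<rho> / lin w + r = bethe_fun \<Lambda> y i w / (lin w)\<^sup>2"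
      using xs(2) unfolding s bethe_fun_def by (simp add: add.assoc)
    show "\<rho> = 0"
    proof (cases "poly (y i) w = 0")
      case True
      thus ?thesis using first_order_residue(3)[OF eq r] bethe_fun_regular[OF y nd True]
        bethe_residue_iff[OF y nd True, of c] bethe[OF True] by simp
    next
      case False
      have "regular_at w (rpoly (y j) powi (- aint j i))" for j
      proof (cases "j = i")
        case False
        have "rpoly (y j) powi (- aint j i) = rpoly (y j) ^ nat (- aint j i)"
          using aint_nonpos[OF False] by (simp add: power_int_def)
        thus ?thesis by (simp add: regular_at_power)
      qed (use False in \<open>simp add: regular_at_powi\<close>)
      hence G: "regular_at w ?G" unfolding torus_factor_def by (intro regular_at_mult regular_at_prod) simp_all
      hence reg: "regular_at w (bethe_fun \<Lambda> y i w)" unfolding bethe_fun_def by (simp add: regular_at_mult regular_at_power)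
      have "rderiv (bethe_fun \<Lambda> y i w) = lin w * (rderiv ?G * lin w + ?G + ?G)"
        unfolding bethe_fun_def by (simp add: rderiv_mult power2_eq_square algebra_simps)
      moreover have "regular_at w (rderiv ?G * lin w + ?G + ?G)"
        using G by (intro regular_at_add regular_at_mult[of w "rderiv ?G"] regular_at_rderiv) simp_all
      ultimately have "rat_eval (rderiv (bethe_fun \<Lambda> y i w)) w = 0" by (simp only: rat_eval_mult regular_at_rpoly) simp
      moreover have "rat_eval (bethe_fun \<Lambda> y i w) w = 0"
        unfolding bethe_fun_def using G by (simp add: rat_eval_mult regular_at_power rat_eval_power)
      ultimately show ?thesis using first_order_residue(3)[OF eq r reg] by simp
    qed
  qed
  thus ?thesis using xs(2) by auto
qed

end

section \<open>From first order equations to opers\<close>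

lemma matrix_order:
  fixes u :: "ratfun^'n::finite^'n"
  assumes "u \<noteq> 0"
  obtains m :: int and U where "u = msc (lin w powi m) U" "mat_regular w U" "mat_eval w U \<noteq> 0"
proof -
  let ?I = "{(a, b). u $ a $ b \<noteq> 0}"
  have "\<exists>m g. u $ a $ b = lin w powi m * g \<and> regular_at w g \<and> rat_eval g w \<noteq> 0" if "(a, b) \<in> ?I" for a b
  proof -
    have "u $ a $ b \<noteq> 0" using that by simp
    thus ?thesis using ratfun_order by metis
  qed
  hence "\<forall>p. \<exists>m g. p \<in> ?I \<longrightarrow> u $ fst p $ snd p = lin w powi m * g \<and> regular_at w g \<and> rat_eval g w \<noteq> 0" by (metis prod.collapse)
  then obtain m g where mg: "\<And>p. p \<in> ?I \<Longrightarrow> u $ fst p $ snd p = lin w powi (m p) * g p \<and> regular_at w (g p) \<and> rat_eval (g p) w \<noteq> 0"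
    by metis
  have "?I \<noteq> {}"
  proof
    assume "?I = {}"
    hence "u $ a $ b = 0" for a b by auto
    hence "u = 0" by (intro mat_eqI) simp
    thus False using assms by simp
  qed
  moreover have "finite ?I" by (rule finite_subset[of _ UNIV]) auto
  ultimately have mem: "Min (m ` ?I) \<in> m ` ?I" and le: "\<And>p. p \<in> ?I \<Longrightarrow> Min (m ` ?I) \<le> m p" by auto
  define k where "k = Min (m ` ?I)"
  define U where "U = msc (lin w powi (- k)) u"
  have U: "U $ a $ b = lin w powi (m (a, b) - k) * g (a, b)" if "(a, b) \<in> ?I" for a b
    using mg[OF that] by (simp add: U_def power_int_diff power_int_minus field_simps)
  have "u = msc (lin w powi k) U" by (simp add: U_def msc_simps power_int_minus)
  moreover have "mat_regular w U" unfolding mat_regular_def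
  proof (intro allI)
    fix a b
    show "regular_at w (U $ a $ b)"
    proof (cases "(a, b) \<in> ?I")
      case True
      thus ?thesis unfolding U[OF True] using le[OF True] mg[OF True] by (simp add: regular_at_mult regular_at_lin_powi k_def)
    next
      case False
      thus ?thesis by (simp add: U_def)
    qed
  qed
  moreover have "mat_eval w U \<noteq> 0"
  proof -
    obtain a b where ab: "(a, b) \<in> ?I" "k = m (a, b)" using mem unfolding k_def by auto
    hence "mat_eval w U $ a $ b \<noteq> 0" using U[OF ab(1)] mg[OF ab(1)] by simp
    thus ?thesis by (metis zero_index)
  qed
  ultimately show ?thesis using that by blast
qed

text \<open>With m the order of u at w, the coefficients of (z - w)^(m - 1) on both sides are
  compared; the regular parts R and R' only contribute in higher order.\<close>

lemma leading_coefficient_gauge: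
  fixes u :: "ratfun^'n::finite^'n"
  assumes "u \<noteq> 0" and d: "mat_deriv u = u ** (msc (inverse (lin w)) (const_mat N) + R) - (msc (inverse (lin w)) (const_mat N') + R') ** u"
    and R: "mat_regular w R" "mat_regular w R'"
  obtains m :: int and U where "u = msc (lin w powi m) U" "mat_regular w U" "mat_eval w U \<noteq> 0"
    "msc (of_int m) (mat_eval w U) = mat_eval w U ** N - N' ** mat_eval w U"
proof -
  obtain m U where U: "u = msc (lin w powi m) U" "mat_regular w U" "mat_eval w U \<noteq> 0" by (rule matrix_order[OF assms(1)])
  let ?t = "lin w"
  have c: "msc (?t powi (1 - m)) (msc (?t powi m) X) = msc ?t X" for X :: "ratfun^'n^'n"
    by (simp add: msc_simps power_int_diff)
  have c': "msc ?t (msc (inverse ?t) X) = X" for X :: "ratfun^'n^'n" by (simp add: msc_simps)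
  have dt: "rderiv (?t powi m) * ?t powi (1 - m) = rconst (of_int m)"
    by (simp add: rderiv_powi of_int_ratfun power_int_diff)
  have "msc (?t powi (1 - m)) (mat_deriv u) = msc (rconst (of_int m)) U + msc ?t (mat_deriv U)"
    unfolding U(1) mat_deriv_simps msc_simps(1) c by (simp add: msc_simps(7) mult.commute[of "?t powi (1 - m)"] dt)
  moreover have "msc (?t powi (1 - m)) (mat_deriv u) = U ** const_mat N - const_mat N' ** U + msc ?t (U ** R - R' ** U)"
    unfolding d unfolding U(1) by (simp only: matrix_ring_simps msc_simps(1,3) c c')
      (simp only: msc_simps(7) mult.commute[of "inverse ?t"] mult.assoc, simp add: msc_simps power_int_diff algebra_simps)
  ultimately have e: "msc (rconst (of_int m)) U + msc ?t (mat_deriv U) = U ** const_mat N - const_mat N' ** U + msc ?t (U ** R - R' ** U)"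
    by simp
  have "msc (of_int m) (mat_eval w U) = mat_eval w U ** N - N' ** mat_eval w U"
    using arg_cong[OF e, of "mat_eval w"] U(2) R by (simp add: mat_eval_simps mat_regular_simps msc_simps)
  thus ?thesis using that U by blast
qed

text \<open>The orders at \<open>w\<close> of the gauge transformation and of its inverse are, up to sign, eigenvalues
  of the nilpotent residue, hence \<open>0\<close>; so both are regular at \<open>w\<close>.\<close>
lemma nilpotent_residue_zero:
  fixes u :: "ratfun^'n::finite^'n"
  assumes u: "invertible u" and d: "mat_deriv u = u ** (msc (inverse (lin w)) (const_mat N) + R) - R' ** u"
    and R: "mat_regular w R" "mat_regular w R'" and N: "mpow N K = 0"
  shows "N = 0"
proof -
  let ?v = "matrix_inv u"
  have uv: "u ** ?v = mat 1" "?v ** u = mat 1" using u by (simp_all add: invertible_matrix_inv)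
  have "mat 1 \<noteq> (0 :: ratfun^'n^'n)" by (auto simp: vec_eq_iff mat_one_nth)
  hence nz: "u \<noteq> 0" "?v \<noteq> 0" using uv by (metis times0_left, metis times0_right)
  have dv: "mat_deriv ?v = ?v ** R' - (msc (inverse (lin w)) (const_mat N) + R) ** ?v"
  proof -
    have "mat_deriv ?v = ?v ** (u ** mat_deriv ?v)" by (simp add: matrix_mul_assoc uv)
    also have "\<dots> = - (?v ** mat_deriv u ** ?v)" unfolding mat_deriv_inv[OF u] by (simp add: matrix_ring_simps matrix_mul_assoc)
    also have "\<dots> = - ((?v ** u) ** (msc (inverse (lin w)) (const_mat N) + R) ** ?v - ?v ** R' ** (u ** ?v))"
      unfolding d by (simp only: matrix_ring_simps matrix_mul_assoc)
    finally show ?thesis by (simp add: uv)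
  qed
  have dv': "mat_deriv ?v = ?v ** (msc (inverse (lin w)) (const_mat 0) + R') - (msc (inverse (lin w)) (const_mat N) + R) ** ?v"
    and du': "mat_deriv u = u ** (msc (inverse (lin w)) (const_mat N) + R) - (msc (inverse (lin w)) (const_mat 0) + R') ** u"
    by (simp_all add: d dv const_mat_simps msc_simps)
  obtain m U where U: "u = msc (lin w powi m) U" "mat_regular w U" "mat_eval w U \<noteq> 0"
    "msc (of_int m) (mat_eval w U) = mat_eval w U ** N - 0 ** mat_eval w U"
    by (rule leading_coefficient_gauge[OF nz(1) du' R])
  obtain m' V where V: "?v = msc (lin w powi m') V" "mat_regular w V" "mat_eval w V \<noteq> 0"
    "msc (of_int m') (mat_eval w V) = mat_eval w V ** 0 - N ** mat_eval w V"
    by (rule leading_coefficient_gauge[OF nz(2) dv' R(2,1)])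
  have "mat_eval w U ** mpow N k = msc (of_int m ^ k) (mat_eval w U)" for k
  proof (induction k)
    case (Suc k)
    have "mat_eval w U ** mpow N (Suc k) = mat_eval w U ** N ** mpow N k" by (simp add: matrix_mul_assoc)
    also have "mat_eval w U ** N = msc (of_int m) (mat_eval w U)" using U(4) by simp
    finally show ?case by (simp add: matrix_ring_simps Suc msc_simps)
  qed (simp add: msc_simps)
  from this[of K] have "msc (of_int m ^ K) (mat_eval w U) = 0" by (simp add: N)
  hence m: "m = 0" using U(3) by (auto simp: vec_eq_iff)
  have "mpow N k ** mat_eval w V = msc ((- of_int m') ^ k) (mat_eval w V)" for k
  proof (induction k)
    case (Suc k)
    have "mpow N (Suc k) ** mat_eval w V = N ** (mpow N k ** mat_eval w V)" by (simp add: matrix_mul_assoc)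
    also have "\<dots> = msc ((- of_int m') ^ k) (N ** mat_eval w V)" by (simp add: Suc matrix_ring_simps)
    also have "N ** mat_eval w V = msc (- of_int m') (mat_eval w V)" using V(4) by (simp add: msc_simps)
    finally show ?case by (simp add: msc_simps mult.commute)
  qed (simp add: msc_simps)
  from this[of K] have "msc ((- of_int m') ^ K) (mat_eval w V) = 0" by (simp add: N)
  hence m': "m' = 0" using V(3) by (auto simp: vec_eq_iff)
  \<comment> \<open>Both orders are 0, so u(w) is invertible with inverse the value of
    \<open>?v\<close>, and the leading coefficient relation has become u(w) N = 0.\<close>
  have "U = u" "V = ?v" using U(1) V(1) m m' by (simp_all add: msc_simps)
  hence "mat_eval w ?v ** mat_eval w u = mat 1"
    using U(2) V(2) uv by (simp add: mat_eval_simps flip: mat_eval_simps(4))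
  moreover have "mat_eval w u ** N = 0" using U(4) m \<open>U = u\<close> by (simp add: msc_simps)
  ultimately show ?thesis by (metis matrix_mul_assoc matrix_mul_lid times0_right)
qed

lemma deg_ge_inverse:
  fixes M :: "'a::field^'n::finite^'n"
  assumes "deg_ge d 1 M" shows "deg_ge d 0 (matrix_inv (mat 1 + M))"
proof -
  obtain K where K: "deg_bound d K" using deg_ge_bounded[of d] by blast
  define B where "B = (\<Sum>k<K. mpow (- M) k)"
  have B: "(mat 1 + M) ** B = mat 1"
    unfolding B_def by (rule one_plus_nilpotent_inverse[OF nilpotent_of_deg_ge[OF assms K]])
  hence "matrix_inv (mat 1 + M) = B" using matrix_left_right_inverse by (intro matrix_inv_unique') auto
  moreover have "deg_ge d 0 B" unfolding B_def
    using deg_ge_mono[OF deg_ge_mpow[OF deg_ge_uminus[OF assms]], of 0] by (intro deg_ge_sum) simp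
  ultimately show ?thesis by simp
qed

text \<open>Applied to the matrix units, such a projection writes a V-valued rational matrix as a
  combination of constant elements of V with rational coefficients.\<close>

lemma complex_projection:
  fixes V :: "(complex^'n^'n) set"
  assumes "0 \<in> V" "\<And>X Y. X \<in> V \<Longrightarrow> Y \<in> V \<Longrightarrow> X + Y \<in> V" "\<And>c X. X \<in> V \<Longrightarrow> msc c X \<in> V"
  shows "\<exists>p. (\<forall>X. p X \<in> V) \<and> (\<forall>X\<in>V. p X = X) \<and> (\<forall>X Y. p (X + Y) = p X + p Y) \<and> (\<forall>c X. p (msc c X) = msc c (p X))"
proof -
  interpret vector_space "msc :: complex \<Rightarrow> complex^'n^'n \<Rightarrow> _" by unfold_locales (simp_all add: msc_simps)
  interpret vector_space_pair "msc :: complex \<Rightarrow> complex^'n^'n \<Rightarrow> _" "msc :: complex \<Rightarrow> complex^'n^'n \<Rightarrow> _" ..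
  have "Vector_Spaces.linear msc msc (\<lambda>X::complex^'n^'n. X)" by unfold_locales simp_all
  moreover have "subspace V" using assms by (simp add: subspace_def)
  ultimately obtain p where p: "p ` UNIV \<subseteq> V" "Vector_Spaces.linear msc msc p" "\<forall>v\<in>V. p v = v"
    using linear_exists_left_inverse_on[of "\<lambda>X. X" V] by (auto simp: inj_on_def)
  interpret l: Vector_Spaces.linear msc msc p by fact
  show ?thesis using p(1,3) l.add l.scale by (intro exI[of _ p]) auto
qed

context diagonal_group
begin

section \<open>Gauge transformations with values in the Borel subgroup\<close>

lemma GB_mult: assumes "g \<in> GB" "h \<in> GB" shows "g ** h \<in> GB"
proof -
  have "\<forall>\<^sub>F w in cofinite. mat_eval w g \<in> BB" "\<forall>\<^sub>F w in cofinite. mat_eval w h \<in> BB" using assms by (auto simp: GB_def)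
  with eventually_mat_regular[of g] eventually_mat_regular[of h]
  have "\<forall>\<^sub>F w in cofinite. mat_eval w (g ** h) \<in> BB"
    by eventually_elim (simp add: mat_eval_simps BB_mult)
  thus ?thesis using assms by (simp add: GB_def invertible_mult)
qed

lemma GB_inv: assumes "g \<in> GB" shows "matrix_inv g \<in> GB"
proof -
  have g: "\<forall>\<^sub>F w in cofinite. mat_eval w g \<in> BB" "invertible g" using assms by (auto simp: GB_def)
  from g(1) eventually_mat_regular[of g] eventually_mat_regular[of "matrix_inv g"]
  have "\<forall>\<^sub>F w in cofinite. mat_eval w (matrix_inv g) \<in> BB"
  proof eventually_elim
    case (elim w)
    thus ?case using mat_eval_inverse(2)[OF g(2) elim(2,3)] BB_inv[OF elim(1)] by simp
  qed
  thus ?thesis using g by (simp add: GB_def invertible_inverse)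
qed

definition bb_valued :: "ratfun^'n^'n \<Rightarrow> bool" where
  "bb_valued M \<longleftrightarrow> (\<forall>\<^sub>F w in cofinite. mat_eval w M \<in> bb)"

lemma bb_valued_add: assumes "bb_valued M" "bb_valued N" shows "bb_valued (M + N)"
  using assms[unfolded bb_valued_def] eventually_mat_regular[of M] eventually_mat_regular[of N]
  unfolding bb_valued_def by eventually_elim (simp add: mat_eval_simps bb_add)

lemma bb_valued_diff: assumes "bb_valued M" "bb_valued N" shows "bb_valued (M - N)"
  using assms[unfolded bb_valued_def] eventually_mat_regular[of M] eventually_mat_regular[of N]
  unfolding bb_valued_def by eventually_elim (simp add: mat_eval_simps bb_diff)

lemma bb_valued_msc: assumes "bb_valued M" shows "bb_valued (msc c M)"
  using assms[unfolded bb_valued_def] eventually_mat_regular[of M] eventually_regular_at[of c]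
  unfolding bb_valued_def by eventually_elim (simp add: mat_eval_simps bb_msc)

lemma bb_valued_const: "X \<in> bb \<Longrightarrow> bb_valued (const_mat X)"
  by (simp add: bb_valued_def mat_eval_simps)

lemma bb_valued_0: "bb_valued 0"
  by (simp add: bb_valued_def mat_eval_simps bb_zero)

lemma bb_valued_sum: "(\<And>i. i \<in> I \<Longrightarrow> bb_valued (F i)) \<Longrightarrow> bb_valued (sum F I)"
  by (induction I rule: infinite_finite_induct) (simp_all add: bb_valued_add bb_valued_0)

lemma bb_valued_gauge:
  assumes g: "g \<in> GB" and M: "bb_valued M" shows "bb_valued (gauge g M)"
proof -
  have inv: "invertible g" and ev: "\<forall>\<^sub>F w in cofinite. mat_eval w g \<in> BB" using g by (auto simp: GB_def)
  show ?thesis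
    using BB_log[OF inv ev] ev M[unfolded bb_valued_def] eventually_mat_regular[of g]
      eventually_mat_regular[of "matrix_inv g"] eventually_mat_regular[of M]
    unfolding bb_valued_def
  proof eventually_elim
    case (elim w)
    have "mat_eval w (gauge g M) = mat_eval w g ** mat_eval w M ** matrix_inv (mat_eval w g) + mat_eval w (g ** mat_deriv (matrix_inv g))"
      unfolding gauge_def mat_eval_inverse(2)[OF inv elim(4,5)]
      using elim(4-6) by (simp add: mat_eval_simps mat_regular_simps)
    thus ?case using BB_Ad[OF elim(2,3)] elim(1) bb_add by simp
  qed
qed

text \<open>The residues are required to have positive degree, which makes them nilpotent and so
  accessible to \<open>nilpotent_residue_zero\<close>.\<close>

definition simple_pole_mats :: "(ratfun^'n^'n) set" where
  "simple_pole_mats = {S. \<exists>W N. finite W \<and> (\<forall>w. N w \<in> bb \<and> deg_ge ht 1 (N w)) \<and>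
     S = (\<Sum>w\<in>W. msc (inverse (lin w)) (const_mat (N w)))}"

lemma simple_pole_mats_0: "0 \<in> simple_pole_mats"
  unfolding simple_pole_mats_def by (auto intro!: exI[of _ "{}"] exI[of _ "\<lambda>_. 0"] simp: bb_zero)

lemma simple_pole_mats_add:
  assumes "S \<in> simple_pole_mats" "T \<in> simple_pole_mats" shows "S + T \<in> simple_pole_mats"
proof -
  obtain W N where W: "finite W" "\<forall>w. N w \<in> bb \<and> deg_ge ht 1 (N w)" "S = (\<Sum>w\<in>W. msc (inverse (lin w)) (const_mat (N w)))"
    using assms(1) by (auto simp: simple_pole_mats_def)
  obtain V M where V: "finite V" "\<forall>w. M w \<in> bb \<and> deg_ge ht 1 (M w)" "T = (\<Sum>w\<in>V. msc (inverse (lin w)) (const_mat (M w)))"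
    using assms(2) by (auto simp: simple_pole_mats_def)
  define P where "P = (\<lambda>w. (if w \<in> W then N w else 0) + (if w \<in> V then M w else 0))"
  have "S = (\<Sum>w\<in>W \<union> V. msc (inverse (lin w)) (const_mat (if w \<in> W then N w else 0)))"
    unfolding W(3) using W(1) V(1) by (intro sum.mono_neutral_cong_left) (auto simp: const_mat_simps msc_simps)
  moreover have "T = (\<Sum>w\<in>W \<union> V. msc (inverse (lin w)) (const_mat (if w \<in> V then M w else 0)))"
    unfolding V(3) using W(1) V(1) by (intro sum.mono_neutral_cong_left) (auto simp: const_mat_simps msc_simps)
  ultimately have "S + T = (\<Sum>w\<in>W \<union> V. msc (inverse (lin w)) (const_mat (P w)))"
    unfolding P_def const_mat_simps msc_simps sum.distrib by (simp only:)
  moreover have "\<forall>w. P w \<in> bb \<and> deg_ge ht 1 (P w)" using W(2) V(2) unfolding P_def by (auto intro!: bb_add deg_ge_add bb_zero)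
  ultimately show ?thesis unfolding simple_pole_mats_def using W(1) V(1)
    by (intro CollectI exI[of _ "W \<union> V"] exI[of _ P]) simp
qed

lemma simple_pole_mats_deg: "S \<in> simple_pole_mats \<Longrightarrow> deg_ge ht 1 S"
  unfolding simple_pole_mats_def by (auto intro!: deg_ge_sum deg_ge_msc simp: deg_ge_const_mat)

lemma simple_pole_mats_bb: "S \<in> simple_pole_mats \<Longrightarrow> bb_valued S"
  unfolding simple_pole_mats_def by (auto intro!: bb_valued_sum bb_valued_msc bb_valued_const)

lemma simple_pole_mats_scalar:
  assumes s: "s \<in> simple_poles" and B: "B \<in> bb" "deg_ge ht 1 B"
  shows "msc s (const_mat B) \<in> simple_pole_mats"
proof -
  obtain W \<rho> where W: "finite W" "s = (\<Sum>w\<in>W. rconst (\<rho> w) / lin w)" using s by (auto simp: simple_poles_def)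
  have sum: "msc (sum h W) M = (\<Sum>w\<in>W. msc (h w) M)" for h :: "complex \<Rightarrow> ratfun" and M :: "ratfun^'n^'n"
    by (induction W rule: infinite_finite_induct) (simp_all add: msc_simps)
  have "msc s (const_mat B) = (\<Sum>w\<in>W. msc (inverse (lin w)) (const_mat (msc (\<rho> w) B)))"
    unfolding W(2) sum const_mat_simps msc_simps divide_inverse by (simp only: mult.commute)
  thus ?thesis unfolding simple_pole_mats_def using W(1) B
    by (intro CollectI exI[of _ W] exI[of _ "\<lambda>w. msc (\<rho> w) B"]) (auto intro: bb_msc deg_ge_msc)
qed

lemma simple_pole_mats_eq_0:
  assumes S: "S \<in> simple_pole_mats"
    and res: "\<And>w N R. S = msc (inverse (lin w)) (const_mat N) + R \<Longrightarrow> mat_regular w R \<Longrightarrow> deg_ge ht 1 N \<Longrightarrow> N = 0"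
  shows "S = 0"
proof -
  obtain W N where W: "finite W" "\<forall>w. N w \<in> bb \<and> deg_ge ht 1 (N w)" "S = (\<Sum>w\<in>W. msc (inverse (lin w)) (const_mat (N w)))"
    using S by (auto simp: simple_pole_mats_def)
  have "N w = 0" if "w \<in> W" for w
  proof (rule res)
    show "S = msc (inverse (lin w)) (const_mat (N w)) + (\<Sum>v\<in>W - {w}. msc (inverse (lin v)) (const_mat (N v)))"
      unfolding W(3) by (rule sum.remove[OF W(1) that])
    show "mat_regular w (\<Sum>v\<in>W - {w}. msc (inverse (lin v)) (const_mat (N v)))"
      by (intro mat_regular_sum mat_regular_simps regular_at_inverse) auto
  qed (use W(2) in blast)
  thus ?thesis unfolding W(3) by (simp add: const_mat_simps msc_simps)
qed

subsection \<open>Solving one degree\<close>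

definition homogeneous :: "nat \<Rightarrow> 'a::zero^'n^'n \<Rightarrow> bool" where
  "homogeneous k M \<longleftrightarrow> (\<forall>a b. M $ a $ b \<noteq> 0 \<longrightarrow> ht a - ht b = of_nat k)"

lemma homogeneous_deg_ge: "homogeneous k M \<Longrightarrow> deg_ge ht k M"
  unfolding homogeneous_def deg_ge_def by blast

definition weight_class :: "'n \<times> 'n \<Rightarrow> complex^'n^'n \<Rightarrow> complex" where
  "weight_class p = restrict (\<lambda>Y. Y $ fst p $ fst p - Y $ snd p $ snd p) hh"

lemma weight_class_eq: "weight_class (a, b) = weight_class (c, d) \<longleftrightarrow> (\<forall>Y\<in>hh. Y $ a $ a - Y $ b $ b = Y $ c $ c - Y $ d $ d)"
  unfolding weight_class_def by (auto simp: fun_eq_iff restrict_def)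

text \<open>One position for each weight, so that the sum in \<open>weight_decomposition\<close>
  counts every weight once although many positions share it.\<close>

definition class_rep :: "(complex^'n^'n \<Rightarrow> complex) \<Rightarrow> 'n \<times> 'n" where
  "class_rep \<beta> = (SOME p. weight_class p = \<beta>)"

lemma class_rep: "\<beta> \<in> range weight_class \<Longrightarrow> weight_class (class_rep \<beta>) = \<beta>"
  unfolding class_rep_def by (rule someI_ex) auto

lemma weight_decomposition: "B = (\<Sum>\<beta>\<in>range weight_class. wproj (fst (class_rep \<beta>)) (snd (class_rep \<beta>)) B)"
proof (rule mat_eqI)
  fix a b
  have "wproj (fst (class_rep \<beta>)) (snd (class_rep \<beta>)) B $ a $ b = (if \<beta> = weight_class (a, b) then B $ a $ b else 0)"
    if "\<beta> \<in> range weight_class" for \<beta>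
  proof -
    have "weight_class (a, b) = weight_class (fst (class_rep \<beta>), snd (class_rep \<beta>)) \<longleftrightarrow> \<beta> = weight_class (a, b)"
      using class_rep[OF that] by auto
    thus ?thesis unfolding weight_class_eq by (simp add: wproj_def)
  qed
  hence "(\<Sum>\<beta>\<in>range weight_class. wproj (fst (class_rep \<beta>)) (snd (class_rep \<beta>)) B $ a $ b)
     = (\<Sum>\<beta>\<in>range weight_class. if \<beta> = weight_class (a, b) then B $ a $ b else 0)" by (intro sum.cong) auto
  also have "\<dots> = B $ a $ b" by simp
  finally show "B $ a $ b = (\<Sum>\<beta>\<in>range weight_class. wproj (fst (class_rep \<beta>)) (snd (class_rep \<beta>)) B) $ a $ b" by simp
qed

text \<open>Positions of equal weight have equal degree because \<open>rho\<close> lies in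
  \<open>hh\<close>. The part of a given degree is therefore a sum of weight components, which stay
  in \<open>bb\<close> by \<open>wproj_bb\<close>.\<close>

lemma degree_part_bb:
  assumes "X \<in> bb" shows "(\<chi> a b. if ht a - ht b = of_nat k then X $ a $ b else 0) \<in> bb"
proof -
  have "(\<chi> a b. if ht a - ht b = of_nat k then X $ a $ b else 0)
    = (\<Sum>\<beta>\<in>range weight_class. msc (if ht (fst (class_rep \<beta>)) - ht (snd (class_rep \<beta>)) = of_nat k then 1 else 0)
         (wproj (fst (class_rep \<beta>)) (snd (class_rep \<beta>)) X))" (is "?L = ?R")
  proof (rule mat_eqI)
    fix a b
    have sw: "(if ht c - ht d = of_nat k then 1 else 0) * wproj c d X $ a $ b
      = (if ht a - ht b = of_nat k then 1 else 0) * wproj c d X $ a $ b" for c d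
      using rho_hh by (auto simp: wproj_def ht_def)
    have "?R $ a $ b = (if ht a - ht b = of_nat k then 1 else 0) * (\<Sum>\<beta>\<in>range weight_class. wproj (fst (class_rep \<beta>)) (snd (class_rep \<beta>)) X) $ a $ b"
      unfolding sum_component msc_nth sw sum_distrib_left ..
    thus "?L $ a $ b = ?R $ a $ b" unfolding weight_decomposition[symmetric] by simp
  qed
  also have "\<dots> \<in> bb" by (intro bb_sum bb_msc wproj_bb assms)
  finally show ?thesis .
qed

text \<open>The gauge equation on d/dz + Z linearised at the identity: a transformation exp X
  removes M to first order and leaves the simple poles S.\<close>

definition solvable_in :: "complex^'n^'n \<Rightarrow> nat \<Rightarrow> ratfun^'n^'n \<Rightarrow> bool" where
  "solvable_in Z k M \<longleftrightarrow> (\<exists>X. \<exists>S\<in>simple_pole_mats. bb_valued X \<and> deg_ge ht k X \<and>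
     M = mat_deriv X + const_mat Z ** X - X ** const_mat Z + S)"

lemma solvable_in_0: "solvable_in Z k 0"
  unfolding solvable_in_def using simple_pole_mats_0 bb_valued_0
  by (intro exI[of _ 0] bexI[of _ 0]) (auto simp: mat_deriv_simps)

lemma solvable_in_add: assumes "solvable_in Z k M" "solvable_in Z k N" shows "solvable_in Z k (M + N)"
proof -
  obtain X S where X: "S \<in> simple_pole_mats" "bb_valued X" "deg_ge ht k X" "M = mat_deriv X + const_mat Z ** X - X ** const_mat Z + S"
    using assms(1) by (auto simp: solvable_in_def)
  obtain Y T where Y: "T \<in> simple_pole_mats" "bb_valued Y" "deg_ge ht k Y" "N = mat_deriv Y + const_mat Z ** Y - Y ** const_mat Z + T"
    using assms(2) by (auto simp: solvable_in_def)
  have "M + N = mat_deriv (X + Y) + const_mat Z ** (X + Y) - (X + Y) ** const_mat Z + (S + T)"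
    unfolding X(4) Y(4) mat_deriv_simps matrix_ring_simps by simp
  thus ?thesis unfolding solvable_in_def using X Y simple_pole_mats_add bb_valued_add deg_ge_add by blast
qed

lemma solvable_in_sum: "(\<And>i. i \<in> I \<Longrightarrow> solvable_in Z k (F i)) \<Longrightarrow> solvable_in Z k (sum F I)"
  by (induction I rule: infinite_finite_induct) (simp_all add: solvable_in_add solvable_in_0)

text \<open>On a weight component bracketing with Z is multiplication by a number z, so the matrix
  equation becomes the scalar equation x' + z x + s = g.\<close>

lemma solvable_in_const:
  assumes Z: "Z \<in> hh" and B: "B \<in> bb" "homogeneous k B" and k: "k \<ge> 1"
  shows "solvable_in Z k (msc g (const_mat B))"
proof -
  have w: "solvable_in Z k (msc g (const_mat (wproj c d B)))" for c d
  proof -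
    define C where "C = wproj c d B"
    define z where "z = Z $ c $ c - Z $ d $ d"
    have C: "C \<in> bb" unfolding C_def by (rule wproj_bb[OF B(1)])
    have "homogeneous k C" using B(2) unfolding C_def wproj_def homogeneous_def by auto
    hence Cd: "deg_ge ht k C" by (rule homogeneous_deg_ge)
    have "lie_bracket Z C = msc z C" unfolding C_def z_def by (rule wproj_weight[OF Z])
    hence ZC: "const_mat Z ** const_mat C - const_mat C ** const_mat Z = msc (rconst z) (const_mat C)"
      unfolding lie_bracket_def by (simp flip: const_mat_simps)
    obtain x s where xs: "s \<in> simple_poles" "g = rderiv x + rconst z * x + s" using first_order_mod_simple_poles by blast
    have "msc g (const_mat C) = msc (rderiv x) (const_mat C) + msc x (msc (rconst z) (const_mat C)) + msc s (const_mat C)"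
      unfolding xs(2) msc_simps by (simp only: mult.commute)
    also have "\<dots> = mat_deriv (msc x (const_mat C)) + const_mat Z ** msc x (const_mat C) - msc x (const_mat C) ** const_mat Z + msc s (const_mat C)"
      unfolding ZC[symmetric] mat_deriv_simps matrix_ring_simps msc_simps by simp
    finally have "msc g (const_mat C) = \<dots>" .
    moreover have "msc s (const_mat C) \<in> simple_pole_mats"
      using simple_pole_mats_scalar[OF xs(1) C] deg_ge_mono[OF Cd k] by blast
    moreover have "bb_valued (msc x (const_mat C))" by (intro bb_valued_msc bb_valued_const C)
    moreover have "deg_ge ht k (msc x (const_mat C))" by (intro deg_ge_msc) (simp add: deg_ge_const_mat Cd)
    ultimately show ?thesis unfolding solvable_in_def C_def by blast
  qed
  have "msc g (const_mat B) = (\<Sum>\<beta>\<in>range weight_class. msc g (const_mat (wproj (fst (class_rep \<beta>)) (snd (class_rep \<beta>)) B)))"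
    by (subst weight_decomposition) (simp only: const_mat_sum msc_sum)
  thus ?thesis using w by (simp only: solvable_in_sum)
qed

text \<open>A projection onto the homogeneous elements of \<open>bb\<close> fixes almost every value
  of M. Applied to the expansion of M in matrix units it replaces them by constants in
  \<open>bb\<close>, to which \<open>solvable_in_const\<close> applies with the entries of M as
  coefficients.\<close>

lemma solvable_in_homogeneous:
  assumes Z: "Z \<in> hh" and M: "bb_valued M" "homogeneous k M" and k: "k \<ge> 1"
  shows "solvable_in Z k M"
proof -
  define V where "V = {X \<in> bb. homogeneous k X}"
  have "\<exists>p. (\<forall>X. p X \<in> V) \<and> (\<forall>X\<in>V. p X = X) \<and> (\<forall>X Y. p (X + Y) = p X + p Y) \<and> (\<forall>c X. p (msc c X) = msc c (p X))"
  proof (rule complex_projection)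
    show "0 \<in> V" by (simp add: V_def bb_zero homogeneous_def)
    show "X + Y \<in> V" if "X \<in> V" "Y \<in> V" for X Y
      using that unfolding V_def homogeneous_def by (auto intro: bb_add) (metis add_0)
    show "msc c X \<in> V" if "X \<in> V" for c X
      using that unfolding V_def homogeneous_def by (auto intro: bb_msc)
  qed
  then obtain p where p: "\<And>X. p X \<in> V" "\<And>X. X \<in> V \<Longrightarrow> p X = X" "\<And>X Y. p (X + Y) = p X + p Y" "\<And>c X. p (msc c X) = msc c (p X)" by blast
  have psum: "p (\<Sum>i\<in>I. F i) = (\<Sum>i\<in>I. p (F i))" for I :: "('n \<times> 'n) set" and F
  proof -
    have "p 0 = 0" using p(4)[of 0 0] by (simp add: msc_simps)
    thus ?thesis by (induction I rule: infinite_finite_induct) (simp_all add: p(3))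
  qed
  define E :: "'n \<times> 'n \<Rightarrow> complex^'n^'n" where "E = (\<lambda>q. \<chi> a b. if (a, b) = q then 1 else 0)"
  have expand: "X = (\<Sum>q\<in>UNIV. msc (X $ fst q $ snd q) (E q))" for X :: "complex^'n^'n"
  proof (rule mat_eqI)
    fix a b
    have "(\<Sum>q\<in>UNIV. X $ fst q $ snd q * (if (a, b) = q then 1 else 0)) = X $ a $ b"
      by (simp add: if_distrib cong: if_cong)
    thus "X $ a $ b = (\<Sum>q\<in>UNIV. msc (X $ fst q $ snd q) (E q)) $ a $ b" by (simp add: E_def)
  qed
  have "M = (\<Sum>q\<in>UNIV. msc (M $ fst q $ snd q) (const_mat (p (E q))))"
  proof (rule mat_eval_eqI)
    show "\<forall>\<^sub>F w in cofinite. mat_eval w M = mat_eval w (\<Sum>q\<in>UNIV. msc (M $ fst q $ snd q) (const_mat (p (E q))))"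
      using M(1)[unfolded bb_valued_def] eventually_mat_regular[of M]
    proof eventually_elim
      case (elim w)
      have "homogeneous k (mat_eval w M)" using M(2) unfolding homogeneous_def by (metis mat_eval_nth rat_eval_0)
      hence "mat_eval w M \<in> V" using elim by (simp add: V_def)
      hence "mat_eval w M = p (mat_eval w M)" using p(2) by simp
      also have "\<dots> = p (\<Sum>q\<in>UNIV. msc (mat_eval w M $ fst q $ snd q) (E q))" by (rule arg_cong[where f = p, OF expand])
      also have "\<dots> = (\<Sum>q\<in>UNIV. msc (mat_eval w M $ fst q $ snd q) (p (E q)))" by (simp only: psum p(4))
      also have "\<dots> = mat_eval w (\<Sum>q\<in>UNIV. msc (M $ fst q $ snd q) (const_mat (p (E q))))"
        using elim(2) by (subst mat_eval_sum) (simp_all add: mat_regular_simps mat_eval_simps mat_regular_def[of w M])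
      finally show ?case .
    qed
  qed
  moreover have "solvable_in Z k (\<Sum>q\<in>UNIV. msc (M $ fst q $ snd q) (const_mat (p (E q))))"
    using p(1) unfolding V_def by (intro solvable_in_sum solvable_in_const[OF Z _ _ k]) auto
  ultimately show ?thesis by simp
qed

text \<open>The part M of R in degree k is X' + [Z, X] + S1. Gauging by exp X replaces M by S1; the
  error consists of R - M, of products of X with S, S1 or R, and of terms in the remainder Q of the
  exponential, of degree at least 2 k. As k is positive and S, S1, R have positive degree, all of it
  has degree above k.\<close>

lemma normal_form_step:
  assumes Z: "Z \<in> hh" and g: "g \<in> GB" and S: "S \<in> simple_pole_mats" and R: "bb_valued R" "deg_ge ht k R" and k: "k \<ge> 1"
    and A: "gauge g (const_mat Z + S + R) = A"
  shows "\<exists>g\<in>GB. \<exists>S\<in>simple_pole_mats. \<exists>R. bb_valued R \<and> deg_ge ht (Suc k) R \<and> gauge g (const_mat Z + S + R) = A"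
proof -
  let ?Z = "const_mat Z :: ratfun^'n^'n"
  define M :: "ratfun^'n^'n" where "M = (\<chi> a b. if ht a - ht b = of_nat k then R $ a $ b else 0)"
  have Mh: "homogeneous k M" by (auto simp: M_def homogeneous_def)
  have "bb_valued M" using R(1)[unfolded bb_valued_def] unfolding bb_valued_def
  proof eventually_elim
    case (elim w)
    have "mat_eval w M = (\<chi> a b. if ht a - ht b = of_nat k then mat_eval w R $ a $ b else 0)"
      by (rule mat_eqI) (simp add: M_def)
    thus ?case using degree_part_bb[OF elim] by simp
  qed
  then obtain X S1 where X: "S1 \<in> simple_pole_mats" "bb_valued X" "deg_ge ht k X" "M = mat_deriv X + ?Z ** X - X ** ?Z + S1"
    using solvable_in_homogeneous[OF Z _ Mh k] by (auto simp: solvable_in_def)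
  have RM: "deg_ge ht (Suc k) (R - M)" unfolding deg_ge_def
  proof (intro allI impI)
    fix a b assume "(R - M) $ a $ b \<noteq> 0"
    hence "R $ a $ b \<noteq> 0" "ht a - ht b \<noteq> of_nat k" by (auto simp: M_def split: if_splits)
    then obtain m where "m \<ge> k" "ht a - ht b = of_nat m" "m \<noteq> k" using R(2) unfolding deg_ge_def by blast
    thus "\<exists>m\<ge>Suc k. ht a - ht b = of_nat m" by (intro exI[of _ m]) auto
  qed
  have X1: "deg_ge ht 1 X" by (rule deg_ge_mono[OF X(3) k])
  obtain K where K: "deg_bound ht K" "2 \<le> K" by (rule deg_ge_bounded[of ht])
  define q where "q = mexp (Suc K) X"
  have qinv: "invertible q" unfolding q_def by (rule invertible_mexp[OF X1]) (use K in simp)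
  have q: "q \<in> GB"
  proof -
    have "\<forall>\<^sub>F w in cofinite. mat_eval w q \<in> BB" using X(2)[unfolded bb_valued_def] eventually_mat_regular[of X]
    proof eventually_elim
      case (elim w)
      have d: "deg_ge ht 1 (mat_eval w X)" using X1 unfolding deg_ge_def by (metis mat_eval_nth rat_eval_0)
      have "mexp (Suc K) (mat_eval w X) \<in> BB"
      proof (rule BB_unip[OF elim(1)])
        show "mpow (mat_eval w X) K = 0" by (rule nilpotent_of_deg_ge[OF d K(1)])
        show "invertible (mexp (Suc K) (msc s (mat_eval w X)))" for s
          by (rule invertible_mexp[OF deg_ge_msc[OF d]]) (use K in simp)
      qed
      thus ?case unfolding q_def mat_eval_mexp[OF elim(2)] .
    qed
    thus ?thesis using qinv by (simp add: GB_def)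
  qed
  obtain Q where Q: "q = mat 1 + X + Q" "deg_ge ht (2 * k) Q"
    unfolding q_def by (rule mexp_expand[OF X(3), of "Suc K"]) (use K in auto)
  have Q': "deg_ge ht (Suc k) Q" using deg_ge_mono[OF Q(2)] k by simp
  define A1 where "A1 = gauge q (?Z + S + R)"
  have A1q: "mat_deriv q = q ** (?Z + S + R) - A1 ** q" using gauge_eq_iff[OF qinv] A1_def by blast
  define D where "D = A1 - (?Z + (S + S1))"
  have Zd: "deg_ge ht 0 ?Z" unfolding deg_ge_const_mat
    unfolding deg_ge_def using hh_diag[OF Z] by (metis diff_self le0 of_nat_0)
  note Sd = simple_pole_mats_deg[OF S] simple_pole_mats_deg[OF X(1)]
  have Rd: "deg_ge ht 1 R" by (rule deg_ge_mono[OF R(2) k])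
  \<comment> \<open>The degree of D q is estimated first, since the equation for q' gives it without
    an inverse. The inverse of q has degree at least 0, so the estimate passes to D.\<close>
  have "D ** q = (q ** (?Z + S + R) - mat_deriv q) - (?Z + (S + S1)) ** q"
    unfolding D_def A1q by (simp add: matrix_ring_simps)
  also have "\<dots> = (R - M) + (M - S1 + X ** ?Z - ?Z ** X - mat_deriv X) + (X ** S + X ** R + Q ** (?Z + S + R) - mat_deriv Q - (S + S1) ** X - (?Z + (S + S1)) ** Q)"
    unfolding Q(1) by (simp add: matrix_ring_simps mat_deriv_simps)
  also have "M - S1 + X ** ?Z - ?Z ** X - mat_deriv X = 0" unfolding X(4) by simp
  finally have Dq: "D ** q = (R - M) + 0 + (X ** S + X ** R + Q ** (?Z + S + R) - mat_deriv Q - (S + S1) ** X - (?Z + (S + S1)) ** Q)" .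
  have rest: "deg_ge ht (Suc k) (X ** S + X ** R + Q ** (?Z + S + R) - mat_deriv Q - (S + S1) ** X - (?Z + (S + S1)) ** Q)"
  proof (intro deg_ge_add deg_ge_diff deg_ge_mat_deriv[OF Q'])
    show "deg_ge ht (Suc k) (X ** S)" by (rule deg_ge_mult_le[OF X(3) Sd(1)]) simp
    show "deg_ge ht (Suc k) (X ** R)" by (rule deg_ge_mult_le[OF X(3) Rd]) simp
    have "deg_ge ht 0 (?Z + S + R)" by (intro deg_ge_add Zd deg_ge_mono[OF Sd(1)] deg_ge_mono[OF Rd]) simp_all
    thus "deg_ge ht (Suc k) (Q ** (?Z + S + R))" by (rule deg_ge_mult_le[OF Q']) simp
    show "deg_ge ht (Suc k) ((S + S1) ** X)" by (rule deg_ge_mult_le[OF deg_ge_add[OF Sd] X(3)]) simp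
    have "deg_ge ht 0 (?Z + (S + S1))" by (intro deg_ge_add Zd deg_ge_mono[OF Sd(1)] deg_ge_mono[OF Sd(2)]) simp_all
    thus "deg_ge ht (Suc k) ((?Z + (S + S1)) ** Q)" by (rule deg_ge_mult_le[OF _ Q']) simp
  qed
  have "deg_ge ht (Suc k) (D ** q)" unfolding Dq by (rule deg_ge_add[OF deg_ge_add[OF RM deg_ge_0] rest])
  moreover have "deg_ge ht 1 (X + Q)" using X1 Q' by (intro deg_ge_add) (auto intro: deg_ge_mono)
  hence "deg_ge ht 0 (matrix_inv q)" using deg_ge_inverse[of ht "X + Q"] by (simp add: Q(1) add.assoc)
  ultimately have "deg_ge ht (Suc k) (D ** q ** matrix_inv q)" by (rule deg_ge_mult_le) simp
  hence Dd: "deg_ge ht (Suc k) D" using qinv by (simp add: matrix_mul_assoc[symmetric] invertible_matrix_inv)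
  have Zbb: "bb_valued ?Z" using bb_valued_const Z hh_bb by blast
  have S1: "S + S1 \<in> simple_pole_mats" by (rule simple_pole_mats_add[OF S X(1)])
  have "bb_valued (?Z + S + R)" by (intro bb_valued_add Zbb simple_pole_mats_bb[OF S] R(1))
  hence "bb_valued A1" unfolding A1_def by (rule bb_valued_gauge[OF q])
  hence "bb_valued D" unfolding D_def by (intro bb_valued_diff bb_valued_add Zbb simple_pole_mats_bb[OF S1])
  moreover have "gauge (g ** matrix_inv q) (?Z + (S + S1) + D) = A"
  proof -
    have "gauge (g ** matrix_inv q) A1 = gauge g (gauge (matrix_inv q) A1)"
      using g qinv by (intro gauge_mult) (auto simp: GB_def invertible_inverse)
    also have "\<dots> = A" unfolding A1_def gauge_inv[OF qinv] by (rule A)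
    finally show ?thesis by (simp add: D_def)
  qed
  ultimately show ?thesis using Dd S1 GB_mult[OF g GB_inv[OF q]] by blast
qed

text \<open>The degree of the remainder rises at each step, and only finitely many degrees
  occur.\<close>

lemma normal_form:
  assumes Z: "Z \<in> hh" and g: "g \<in> GB" and R: "bb_valued R" "deg_ge ht 1 R" and A: "gauge g (const_mat Z + R) = A"
  shows "\<exists>g\<in>GB. \<exists>S\<in>simple_pole_mats. gauge g (const_mat Z + S) = A"
proof -
  have "\<exists>g\<in>GB. \<exists>S\<in>simple_pole_mats. \<exists>R. bb_valued R \<and> deg_ge ht (Suc k) R \<and> gauge g (const_mat Z + S + R) = A" for k
  proof (induction k)
    case 0
    then show ?case using g R A simple_pole_mats_0 by (intro bexI[of _ g] bexI[of _ 0] exI[of _ R]) auto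
  next
    case (Suc k)
    then obtain g S R where "g \<in> GB" "S \<in> simple_pole_mats" "bb_valued R" "deg_ge ht (Suc k) R" "gauge g (const_mat Z + S + R) = A" by blast
    then show ?case by (intro normal_form_step[OF Z]) auto
  qed
  moreover obtain K where K: "deg_bound ht K" using deg_ge_bounded[of ht] by blast
  ultimately obtain g S R where gS: "g \<in> GB" "S \<in> simple_pole_mats" "deg_ge ht (Suc K) R" "gauge g (const_mat Z + S + R) = A" by blast
  have "R = 0" by (rule deg_ge_zero[OF K deg_ge_mono[OF gS(3)]]) simp
  thus ?thesis using gS by auto
qed

end

context diagonal_group
begin

subsection \<open>Removing the poles of the Cartan part\<close>

definition co_weight :: "'r \<Rightarrow> 'n \<Rightarrow> int" where
  "co_weight j a = (SOME k. co j $ a $ a = of_int k)"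

lemma co_weight: "co j $ a $ a = of_int (co_weight j a)"
  unfolding co_weight_def by (rule someI_ex) (rule co_integral)

text \<open>The product over j of the coroot of index j, read as a cocharacter, evaluated at y_j.
  Integrality of the diagonal entries of the coroots makes it a rational matrix.\<close>

definition torus_elt :: "('r \<Rightarrow> complex poly) \<Rightarrow> ratfun^'n^'n" where
  "torus_elt y = (\<chi> a b. if a = b then (\<Prod>j\<in>UNIV. rpoly (y j) powi co_weight j a) else 0)"

lemma torus_elt_mult: "(torus_elt y ** X) $ a $ b = torus_elt y $ a $ a * X $ a $ b" "(X ** torus_elt y) $ a $ b = X $ a $ b * torus_elt y $ b $ b"
  by (rule diag_mult_nth, simp add: torus_elt_def)+

lemma torus_elt_nonzero: "(\<And>j. y j \<noteq> 0) \<Longrightarrow> torus_elt y $ a $ a \<noteq> 0"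
  by (simp add: torus_elt_def)

text \<open>Where no y_j vanishes, the value is the exponential of the sum of Ln(y_j(w)) times the
  coroots; any branch of the logarithm serves, the exponents being integers.\<close>

lemma torus_elt_GB:
  assumes y: "\<And>j. y j \<noteq> 0" shows "torus_elt y \<in> GB"
proof -
  define T :: "ratfun^'n^'n" where "T = (\<chi> a b. if a = b then inverse (torus_elt y $ a $ a) else 0)"
  have "torus_elt y ** T = mat 1"
  proof (rule mat_eqI)
    fix a b
    show "(torus_elt y ** T) $ a $ b = (mat 1 :: ratfun^'n^'n) $ a $ b"
      unfolding torus_elt_mult using torus_elt_nonzero[of y a] y by (auto simp: T_def mat_one_nth)
  qed
  hence inv: "invertible (torus_elt y)" by (auto simp: invertible_right_inverse)
  have "\<forall>\<^sub>F w in cofinite. \<forall>j. rat_eval (rpoly (y j)) w \<noteq> 0"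
    using y by (intro eventually_all_finite eventually_rat_eval_nonzero) simp
  hence "\<forall>\<^sub>F w in cofinite. mat_eval w (torus_elt y) \<in> BB"
  proof eventually_elim
    case (elim w)
    define Y where "Y = (\<Sum>j\<in>UNIV. msc (Ln (poly (y j) w)) (co j))"
    have Y: "Y \<in> hh" unfolding Y_def by (intro hh_sum hh_msc co_hh)
    have "mat_eval w (torus_elt y) = (\<chi> a b. if a = b then exp (Y $ a $ a) else 0)"
    proof (rule mat_eqI)
      fix a b
      have "exp (Y $ a $ a) = (\<Prod>j\<in>UNIV. poly (y j) w powi co_weight j a)"
      proof -
        have "exp (Y $ a $ a) = (\<Prod>j\<in>UNIV. exp (Ln (poly (y j) w) * of_int (co_weight j a)))"
          by (simp add: Y_def co_weight exp_sum)
        also have "\<dots> = (\<Prod>j\<in>UNIV. exp (Ln (poly (y j) w)) powi co_weight j a)"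
          by (simp add: exp_power_int mult.commute)
        finally show ?thesis using elim by simp
      qed
      moreover have "rat_eval (\<Prod>j\<in>UNIV. rpoly (y j) powi co_weight j a) w = (\<Prod>j\<in>UNIV. poly (y j) w powi co_weight j a)"
        using elim by (subst rat_eval_prod) (auto simp: regular_at_powi rat_eval_powi)
      ultimately show "mat_eval w (torus_elt y) $ a $ b = (\<chi> a b. if a = b then exp (Y $ a $ a) else 0) $ a $ b"
        by (auto simp: torus_elt_def)
    qed
    thus ?case using BB_torus[OF Y] by simp
  qed
  thus ?thesis using inv by (simp add: GB_def)
qed

text \<open>The logarithmic derivative of the torus element accounts for the terms
  \<open>dlog (rpoly (y i))\<close>. The price is the factor \<open>torus_factor y i\<close> on e_i:
  where e_i has a nonzero entry, the weights at a and b differ by the Cartan integers.\<close>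

lemma torus_elt_gauge:
  assumes y: "\<And>j. y j \<noteq> 0" and Z: "Z \<in> hh"
  shows "gauge (torus_elt y) (const_mat Z + (\<Sum>i\<in>UNIV. msc (rpoly (\<Lambda> i) * torus_factor y i) (const_mat (e i)))) = conn \<Lambda> Z y"
proof -
  let ?h = "torus_elt y" and ?E = "\<Sum>i\<in>UNIV. msc (rpoly (\<Lambda> i) * torus_factor y i) (const_mat (e i))"
  have inv: "invertible ?h" using torus_elt_GB[OF y] by (simp add: GB_def)
  have dh: "dlog (?h $ a $ a) = (\<Sum>j\<in>UNIV. dlog (rpoly (y j)) * rconst (co j $ a $ a))" for a
    using y by (simp add: torus_elt_def dlog_prod dlog_powi co_weight rconst_of_int mult.commute)
  have hh_e: "?h $ a $ a * torus_factor y i = ?h $ b $ b" if "e i $ a $ b \<noteq> 0" for a b i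
  proof -
    have "co_weight j a = co_weight j b + aint j i" for j
    proof -
      have "of_int (co_weight j a - co_weight j b) = (of_int (aint j i) :: complex)"
        using e_entry[OF co_hh that, of j] by (simp add: co_weight aint)
      hence "co_weight j a - co_weight j b = aint j i" by (simp only: of_int_eq_iff)
      thus ?thesis by simp
    qed
    hence "?h $ a $ a * torus_factor y i = (\<Prod>j\<in>UNIV. rpoly (y j) powi (co_weight j b + aint j i) * rpoly (y j) powi (- aint j i))"
      by (simp add: torus_elt_def torus_factor_def prod.distrib)
    also have "\<dots> = (\<Prod>j\<in>UNIV. rpoly (y j) powi co_weight j b)"
      using y by (intro prod.cong refl) (simp add: power_int_add power_int_minus)
    finally show ?thesis by (simp add: torus_elt_def)
  qed
  show ?thesis
  proof (subst gauge_eq_iff[OF inv], rule mat_eqI)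
    fix a b
    show "mat_deriv ?h $ a $ b = (?h ** (const_mat Z + ?E) - conn \<Lambda> Z y ** ?h) $ a $ b"
    proof (cases "a = b")
      case True
      have "mat_deriv ?h $ a $ a = (\<Sum>j\<in>UNIV. dlog (rpoly (y j)) * rconst (co j $ a $ a)) * ?h $ a $ a"
        unfolding mat_deriv_nth rderiv_eq_dlog[OF torus_elt_nonzero[OF y]] dh ..
      moreover have "?E $ a $ a = 0" by (simp add: e_diag rconst_simps)
      ultimately show ?thesis unfolding True[symmetric] vector_minus_component torus_elt_mult conn_diag[OF Z] vector_add_component
        by (simp add: algebra_simps)
    next
      case False
      have "?h $ a $ a * ?E $ a $ b = conn \<Lambda> Z y $ a $ b * ?h $ b $ b"
      proof -
        have t: "?h $ a $ a * (rpoly (\<Lambda> i) * torus_factor y i * rconst (e i $ a $ b)) = rpoly (\<Lambda> i) * rconst (e i $ a $ b) * ?h $ b $ b" for i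
          using hh_e[of i a b] by (cases "e i $ a $ b = 0") (auto simp: rconst_simps mult_ac)
        show ?thesis unfolding conn_off[OF Z False] sum_component msc_nth const_mat_nth sum_distrib_left sum_distrib_right t ..
      qed
      moreover have "mat_deriv ?h $ a $ b = 0" using False by (simp add: torus_elt_def)
      moreover have "(const_mat Z + ?E) $ a $ b = ?E $ a $ b" using hh_diag[OF Z False] by (simp add: rconst_simps)
      ultimately show ?thesis unfolding vector_minus_component torus_elt_mult by simp
    qed
  qed
qed

lemma ratfun_fact_nonzero: "of_nat (fact k) \<noteq> (0 :: ratfun)"
  using rconst_of_nat[of "fact k"] by (metis fact_nonzero of_nat_eq_0_iff rconst_eq_0_iff)

text \<open>The reflected connection: \<open>\<mu>\<^sub>i = T\<^sub>i/x\<^sub>i\<close>, with \<open>T\<^sub>i\<close> the torus factor and \<open>x\<^sub>i\<close> a solution of the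
  first order equation, solves the Riccati equation that makes the coefficient of \<open>f\<^sub>i\<close> vanish.\<close>
lemma reflection_gauge:
  assumes y: "\<And>j. y j \<noteq> 0" and Z: "Z \<in> hh" and J: "finite J"
    and orth: "\<And>i j. i \<in> J \<Longrightarrow> j \<in> J \<Longrightarrow> i \<noteq> j \<Longrightarrow> aint j i = 0"
    and x: "\<And>i. i \<in> J \<Longrightarrow> x i \<noteq> 0"
      "\<And>i. i \<in> J \<Longrightarrow> rderiv (x i) + rconst (al i Z) * x i = rpoly (\<Lambda> i) * torus_factor y i"
  shows "\<exists>g. invertible g \<and> gauge g (conn \<Lambda> Z y) = conn \<Lambda> Z y -
    (\<Sum>i\<in>J. msc (rpoly (\<Lambda> i) * torus_factor y i / x i) (const_mat (co i)))"
  using J orth x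
proof (induction J rule: finite_induct)
  case empty
  show ?case by (rule exI[of _ "mat 1"]) (auto simp: gauge_one invertible_def)
next
  case (insert i J)
  define H :: "ratfun^'n^'n" where "H = const_mat Z - (\<Sum>j\<in>UNIV. msc (dlog (rpoly (y j))) (const_mat (co j)))
     - (\<Sum>j\<in>J. msc (rpoly (\<Lambda> j) * torus_factor y j / x j) (const_mat (co j)))"
  define A :: "ratfun^'n^'n" where "A = H + (\<Sum>j\<in>UNIV. msc (rpoly (\<Lambda> j)) (const_mat (e j)))"
  have "\<exists>g. invertible g \<and> gauge g (conn \<Lambda> Z y) = conn \<Lambda> Z y - (\<Sum>j\<in>J. msc (rpoly (\<Lambda> j) * torus_factor y j / x j) (const_mat (co j)))"
    by (rule insert.IH) (use insert.prems in auto)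
  then obtain g where g: "invertible g" "gauge g (conn \<Lambda> Z y) = A"
    unfolding A_def H_def conn_def by (auto simp: algebra_simps)
  define \<mu> where "\<mu> = torus_factor y i / x i"
  \<comment> \<open>The value of the simple root i on the Cartan part of the connection. The
    corrections from J do not appear in it, because a_ji = 0 for j in J.\<close>
  define \<alpha> where "\<alpha> = rconst (al i Z) - (\<Sum>j\<in>UNIV. dlog (rpoly (y j)) * rconst (al i (co j)))"
  obtain N where N: "mpow (f i) N = 0" using nilpotent_ef by blast
  let ?F = "const_mat (f i) :: ratfun^'n^'n"
  have F: "mpow ?F N = 0" using N by (simp add: mpow_const_mat const_mat_simps)
  define q where "q = mexp (Suc N) (msc \<mu> ?F)"
  have Fh: "?F ** const_mat Y = const_mat Y ** ?F + msc (rconst (al i Y)) ?F" if "Y \<in> hh" for Y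
  proof -
    have "f i ** Y = Y ** f i + msc (al i Y) (f i)"
      using f_weight[OF that, of i] by (simp add: lie_bracket_def msc_simps algebra_simps)
    thus ?thesis by (simp flip: const_mat_simps)
  qed
  \<comment> \<open>Earlier reflections have only added multiples of coroots that commute with
    f_i.\<close>
  have sum0: "msc (rpoly (\<Lambda> j) * torus_factor y j / x j) (const_mat (co j)) ** ?F = ?F ** msc (rpoly (\<Lambda> j) * torus_factor y j / x j) (const_mat (co j))"
    if "j \<in> J" for j
  proof -
    have "aint j i = 0" using insert.prems(1)[of i j] insert.hyps that by auto
    hence "al i (co j) = 0" using aint[of j i] by simp
    thus ?thesis unfolding matrix_ring_simps Fh[OF co_hh] by (simp add: rconst_simps msc_simps)
  qed
  have "?F ** H = ?F ** const_mat Z - (\<Sum>j\<in>UNIV. msc (dlog (rpoly (y j))) (?F ** const_mat (co j)))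
     - (\<Sum>j\<in>J. ?F ** msc (rpoly (\<Lambda> j) * torus_factor y j / x j) (const_mat (co j)))"
    unfolding H_def by (simp only: matrix_ring_simps(3) matrix_sum_ldistrib matrix_ring_simps(8))
  also have "(\<Sum>j\<in>J. ?F ** msc (rpoly (\<Lambda> j) * torus_factor y j / x j) (const_mat (co j)))
    = (\<Sum>j\<in>J. msc (rpoly (\<Lambda> j) * torus_factor y j / x j) (const_mat (co j)) ** ?F)"
    by (rule sum.cong) (simp_all only: sum0)
  also have "(\<Sum>j\<in>UNIV. msc (dlog (rpoly (y j))) (?F ** const_mat (co j)))
     = (\<Sum>j\<in>UNIV. msc (dlog (rpoly (y j))) (const_mat (co j)) ** ?F) + msc (\<Sum>j\<in>UNIV. dlog (rpoly (y j)) * rconst (al i (co j))) ?F"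
  proof -
    have sum: "msc (sum h I) M = (\<Sum>w\<in>I. msc (h w) M)" for h :: "'r \<Rightarrow> ratfun" and M :: "ratfun^'n^'n" and I
      by (induction I rule: infinite_finite_induct) (simp_all add: msc_simps)
    show ?thesis unfolding Fh[OF co_hh] sum sum.distrib[symmetric] matrix_ring_simps msc_simps ..
  qed
  finally have FH: "?F ** H = H ** ?F + msc \<alpha> ?F"
    unfolding H_def \<alpha>_def matrix_ring_simps(4) matrix_sum_rdistrib Fh[OF Z] by (simp add: msc_simps algebra_simps)
  have qH: "q ** H = H ** q + msc (\<mu> * \<alpha>) (?F ** q)"
    unfolding q_def by (rule mexp_conj_weight[OF F ratfun_fact_nonzero FH])
  have qe: "q ** const_mat (e j) = const_mat (e j) ** q" if "j \<noteq> i" for j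
  proof -
    have "?F ** const_mat (e j) = const_mat (e j) ** ?F + msc 0 ?F"
      using ef_orth[OF that] by (simp add: lie_bracket_def msc_simps flip: const_mat_simps)
    from mexp_conj_weight[OF F ratfun_fact_nonzero this, of \<mu>] show ?thesis by (simp add: q_def msc_simps)
  qed
  have qi: "q ** const_mat (e i) = const_mat (e i) ** q - msc \<mu> (const_mat (co i) ** q) - msc (\<mu>\<^sup>2) (?F ** q)"
    unfolding q_def
  proof (rule mexp_conj_raising[OF F ratfun_fact_nonzero])
    show "const_mat (e i) ** ?F - ?F ** const_mat (e i) = const_mat (co i)"
      using ef_co[of i] by (simp add: lie_bracket_def flip: const_mat_simps)
    have "rconst 2 = 2" by (metis of_nat_numeral rconst_of_nat)
    thus "?F ** const_mat (co i) = const_mat (co i) ** ?F + msc 2 ?F"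
      using Fh[OF co_hh, of i] by (simp only: al_co)
  qed
  have qE: "q ** (\<Sum>j\<in>UNIV. msc (rpoly (\<Lambda> j)) (const_mat (e j))) = (\<Sum>j\<in>UNIV. msc (rpoly (\<Lambda> j)) (const_mat (e j))) ** q
     - msc (rpoly (\<Lambda> i) * \<mu>) (const_mat (co i) ** q) - msc (rpoly (\<Lambda> i) * \<mu>\<^sup>2) (?F ** q)"
  proof -
    have "q ** (\<Sum>j\<in>UNIV. msc (rpoly (\<Lambda> j)) (const_mat (e j))) = msc (rpoly (\<Lambda> i)) (q ** const_mat (e i)) + (\<Sum>j\<in>UNIV - {i}. msc (rpoly (\<Lambda> j)) (q ** const_mat (e j)))"
      unfolding matrix_sum_ldistrib matrix_ring_simps by (rule sum.remove) simp_all
    also have "(\<Sum>j\<in>UNIV - {i}. msc (rpoly (\<Lambda> j)) (q ** const_mat (e j))) = (\<Sum>j\<in>UNIV - {i}. msc (rpoly (\<Lambda> j)) (const_mat (e j) ** q))"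
      by (rule sum.cong) (simp_all add: qe)
    also have "msc (rpoly (\<Lambda> i)) (q ** const_mat (e i)) = msc (rpoly (\<Lambda> i)) (const_mat (e i) ** q)
      - msc (rpoly (\<Lambda> i) * \<mu>) (const_mat (co i) ** q) - msc (rpoly (\<Lambda> i) * \<mu>\<^sup>2) (?F ** q)"
      unfolding qi by (simp add: msc_simps)
    finally have "q ** (\<Sum>j\<in>UNIV. msc (rpoly (\<Lambda> j)) (const_mat (e j))) =
       (msc (rpoly (\<Lambda> i)) (const_mat (e i) ** q) + (\<Sum>j\<in>UNIV - {i}. msc (rpoly (\<Lambda> j)) (const_mat (e j) ** q)))
       - msc (rpoly (\<Lambda> i) * \<mu>) (const_mat (co i) ** q) - msc (rpoly (\<Lambda> i) * \<mu>\<^sup>2) (?F ** q)" by simp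
    also have "msc (rpoly (\<Lambda> i)) (const_mat (e i) ** q) + (\<Sum>j\<in>UNIV - {i}. msc (rpoly (\<Lambda> j)) (const_mat (e j) ** q))
      = (\<Sum>j\<in>UNIV. msc (rpoly (\<Lambda> j)) (const_mat (e j))) ** q"
      unfolding matrix_sum_rdistrib matrix_ring_simps by (rule sum.remove[symmetric]) simp_all
    finally show ?thesis .
  qed
  have x0: "x i \<noteq> 0" and xi: "rderiv (x i) + rconst (al i Z) * x i = rpoly (\<Lambda> i) * torus_factor y i"
    using insert.prems by auto
  have riccati: "rderiv \<mu> = \<mu> * \<alpha> - rpoly (\<Lambda> i) * \<mu>\<^sup>2"
  proof -
    have \<mu>0: "\<mu> \<noteq> 0" using x0 torus_factor_nonzero[OF y] by (simp add: \<mu>_def)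
    have "dlog (x i) = (rpoly (\<Lambda> i) * torus_factor y i - rconst (al i Z) * x i) / x i"
      unfolding xi[symmetric] by (simp add: dlog_def)
    hence dx: "dlog (x i) = rpoly (\<Lambda> i) * \<mu> - rconst (al i Z)" using x0 by (simp add: \<mu>_def diff_divide_distrib)
    have "dlog \<mu> = dlog (torus_factor y i) - dlog (x i)"
      unfolding \<mu>_def divide_inverse using x0 torus_factor_nonzero[OF y] by (simp add: dlog_mult dlog_inverse)
    also have "\<dots> = \<alpha> - rpoly (\<Lambda> i) * \<mu>" unfolding dx dlog_torus_factor[OF y] \<alpha>_def by simp
    finally have dm: "dlog \<mu> = \<alpha> - rpoly (\<Lambda> i) * \<mu>" .
    show ?thesis unfolding rderiv_eq_dlog[OF \<mu>0] dm by (simp add: algebra_simps power2_eq_square)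
  qed
  have qinv: "invertible q" unfolding q_def
  proof (rule invertible_mexp)
    show "deg_ge (\<lambda>a. - ht a) 1 (msc \<mu> ?F)" using deg_ge_f by (intro deg_ge_msc) (simp add: deg_ge_const_mat)
    show "2 \<le> Suc N"
    proof (cases N)
      case 0
      hence "(mat 1 :: complex^'n^'n) $ undefined $ undefined = 0" using N by simp
      thus ?thesis by (simp add: mat_one_nth)
    qed simp
  qed
  have "gauge q A = A - msc (rpoly (\<Lambda> i) * \<mu>) (const_mat (co i))"
  proof (subst gauge_eq_iff[OF qinv])
    have "mat_deriv q = msc (rderiv \<mu>) (?F ** q)" unfolding q_def by (rule mat_deriv_mexp[OF N])
    also have "\<dots> = q ** A - (A - msc (rpoly (\<Lambda> i) * \<mu>) (const_mat (co i))) ** q"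
      unfolding riccati A_def matrix_ring_simps(1) qH qE by (simp add: matrix_ring_simps msc_simps algebra_simps)
    finally show "mat_deriv q = q ** A - (A - msc (rpoly (\<Lambda> i) * \<mu>) (const_mat (co i))) ** q" .
  qed
  hence "gauge (q ** g) (conn \<Lambda> Z y) = A - msc (rpoly (\<Lambda> i) * torus_factor y i / x i) (const_mat (co i))"
    using gauge_mult[OF qinv g(1)] g(2) by (simp add: \<mu>_def)
  also have "\<dots> = conn \<Lambda> Z y - (\<Sum>j\<in>insert i J. msc (rpoly (\<Lambda> j) * torus_factor y j / x j) (const_mat (co j)))"
    using insert.hyps unfolding A_def H_def conn_def by (simp add: algebra_simps)
  finally show ?case using invertible_mult[OF qinv g(1)] by blast
qed

text \<open>One reflection is made for each i with y_i(w) = 0. It changes the coefficient of the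
  coroot from - dlog y_i to - (dlog(y_i x_i) + \<langle>\<alpha>_i, Z\<rangle>). Since x_i has
  exactly a simple pole at w and y_i a simple zero, the product y_i x_i is regular and nonzero
  there.\<close>

lemma locally_regular:
  assumes y: "\<And>j. y j \<noteq> 0" and Z: "Z \<in> hh" and nd: "\<And>i. nondeg_at \<Lambda> y i w"
    and \<Lambda>: "\<And>i. \<Lambda> i \<noteq> 0"
    and x: "\<And>i. rderiv (x i) + rconst (al i Z) * x i = rpoly (\<Lambda> i) * torus_factor y i"
  shows "\<exists>g. invertible g \<and> mat_regular w (gauge g (conn \<Lambda> Z y))"
proof -
  define J where "J = {i. poly (y i) w = 0}"
  have x0: "x i \<noteq> 0" for i
  proof
    assume "x i = 0"
    hence "rpoly (\<Lambda> i) * torus_factor y i = 0" using x[of i] by simp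
    thus False using \<Lambda> torus_factor_nonzero[OF y] by simp
  qed
  have "\<exists>g. invertible g \<and> gauge g (conn \<Lambda> Z y) = conn \<Lambda> Z y - (\<Sum>i\<in>J. msc (rpoly (\<Lambda> i) * torus_factor y i / x i) (const_mat (co i)))"
  proof (rule reflection_gauge[OF y Z])
    show "aint j i = 0" if "i \<in> J" "j \<in> J" "i \<noteq> j" for i j using nd[of i] that by (auto simp: nondeg_at_def J_def)
  qed (use x0 x in auto)
  then obtain g where g: "invertible g" "gauge g (conn \<Lambda> Z y) = conn \<Lambda> Z y - (\<Sum>i\<in>J. msc (rpoly (\<Lambda> i) * torus_factor y i / x i) (const_mat (co i)))" by blast
  have "gauge g (conn \<Lambda> Z y) = const_mat Z + (\<Sum>i\<in>UNIV. msc (rpoly (\<Lambda> i)) (const_mat (e i)))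
     - (\<Sum>i\<in>UNIV - J. msc (dlog (rpoly (y i))) (const_mat (co i)))
     - (\<Sum>i\<in>J. msc (dlog (rpoly (y i)) + rpoly (\<Lambda> i) * torus_factor y i / x i) (const_mat (co i)))"
  proof -
    have "(\<Sum>i\<in>UNIV. msc (dlog (rpoly (y i))) (const_mat (co i)) :: ratfun^'n^'n) = (\<Sum>i\<in>UNIV - J. msc (dlog (rpoly (y i))) (const_mat (co i)))
        + (\<Sum>i\<in>J. msc (dlog (rpoly (y i))) (const_mat (co i)))" by (rule sum.subset_diff) auto
    thus ?thesis unfolding g(2) unfolding conn_def msc_simps sum.distrib by (simp add: algebra_simps)
  qed
  also have "mat_regular w \<dots>"
  proof (intro mat_regular_simps mat_regular_sum)
    fix i assume "i \<in> UNIV - J"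
    hence "poly (y i) w \<noteq> 0" by (simp add: J_def)
    thus "regular_at w (dlog (rpoly (y i)))" unfolding dlog_def divide_inverse
      by (intro regular_at_mult regular_at_rderiv regular_at_inverse) simp_all
  next
    fix i assume "i \<in> J"
    hence root: "poly (y i) w = 0" by (simp add: J_def)
    have o: "Polynomial.order w (y i) = 1" using nd[of i] root by (simp add: nondeg_at_def)
    obtain p where p: "rpoly (y i) = lin w * rpoly p" "poly p w \<noteq> 0" by (rule simple_root_factor[OF y o])
    have eq: "rderiv (x i) + rconst (al i Z) * x i + rconst 0 / lin w + 0 = bethe_fun \<Lambda> y i w / (lin w)\<^sup>2"
      unfolding x bethe_fun_def by (simp add: rconst_simps)
    note fr = first_order_residue[OF eq regular_at_0 bethe_fun_regular(1)[OF y nd root]]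
    have nz: "rat_eval (lin w * x i) w \<noteq> 0" using fr(2) bethe_fun_regular(2)[OF y nd root] by simp
    have "rpoly (\<Lambda> i) * torus_factor y i / x i = dlog (x i) + rconst (al i Z)"
      unfolding x[symmetric] dlog_def using x0[of i] by (simp add: add_divide_distrib)
    moreover have "dlog (rpoly (y i)) + dlog (x i) = dlog (rpoly p * (lin w * x i))"
    proof -
      have "rpoly (y i) \<noteq> 0" using y by simp
      hence "dlog (rpoly (y i)) + dlog (x i) = dlog (rpoly (y i) * x i)" using x0[of i] by (simp only: dlog_mult not_False_eq_True)
      thus ?thesis unfolding p(1) by (simp only: mult_ac)
    qed
    ultimately have "dlog (rpoly (y i)) + rpoly (\<Lambda> i) * torus_factor y i / x i = dlog (rpoly p * (lin w * x i)) + rconst (al i Z)"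
      by (simp only: add.assoc[symmetric])
    moreover have "regular_at w (rpoly p * (lin w * x i))" by (intro regular_at_mult[of w "rpoly p"] fr(1)) simp
    moreover from this have "rat_eval (rpoly p * (lin w * x i)) w \<noteq> 0"
      using nz p(2) fr(1) by (subst rat_eval_mult) simp_all
    ultimately show "regular_at w (dlog (rpoly (y i)) + rpoly (\<Lambda> i) * torus_factor y i / x i)"
      unfolding dlog_def[of "rpoly p * (lin w * x i)"] divide_inverse[of "rderiv (rpoly p * (lin w * x i))"]
      by (simp only:) (intro regular_at_add regular_at_mult[of w "rderiv _"] regular_at_rderiv regular_at_inverse; simp)
  qed simp_all
  finally show ?thesis using g(1) by blast
qed

theorem first_order_imp_oper:
  assumes y: "\<And>j. y j \<noteq> 0" and Z: "Z \<in> hh" and nd: "\<And>i w. nondeg_at \<Lambda> y i w" and \<Lambda>: "\<And>i. \<Lambda> i \<noteq> 0"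
    and x: "\<And>i. \<exists>x. rderiv x + rconst (al i Z) * x = rpoly (\<Lambda> i) * torus_factor y i"
  shows "\<exists>v\<in>GB. gauge v (const_mat Z) = conn \<Lambda> Z y"
proof -
  obtain x where x: "\<And>i. rderiv (x i) + rconst (al i Z) * x i = rpoly (\<Lambda> i) * torus_factor y i" using x by metis
  let ?E = "\<Sum>i\<in>UNIV. msc (rpoly (\<Lambda> i) * torus_factor y i) (const_mat (e i)) :: ratfun^'n^'n"
  have E: "bb_valued ?E" by (intro bb_valued_sum bb_valued_msc bb_valued_const e_bb)
  have "deg_ge ht 1 ?E" using deg_ge_e by (intro deg_ge_sum deg_ge_msc) (simp add: deg_ge_const_mat)
  then obtain g S where g: "g \<in> GB" "S \<in> simple_pole_mats" "gauge g (const_mat Z + S) = conn \<Lambda> Z y"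
    using normal_form[OF Z torus_elt_GB[OF y] E _ torus_elt_gauge[OF y Z]] by blast
  have ginv: "invertible g" using g(1) by (simp add: GB_def)
  have "S = 0"
  proof (rule simple_pole_mats_eq_0[OF g(2)])
    fix w N R assume S: "S = msc (inverse (lin w)) (const_mat N) + R" and R: "mat_regular w R" and N: "deg_ge ht 1 N"
    \<comment> \<open>\<open>h\<close> need not take values in B_+;
      \<open>nilpotent_residue_zero\<close> speaks of arbitrary invertible rational
      matrices.\<close>
    obtain h where h: "invertible h" "mat_regular w (gauge h (conn \<Lambda> Z y))" using locally_regular[OF y Z nd \<Lambda> x] by blast
    obtain K where K: "deg_bound ht K" using deg_ge_bounded[of ht] by blast
    have hg: "invertible (h ** g)" using h(1) ginv by (rule invertible_mult)
    have "gauge (h ** g) (const_mat Z + S) = gauge h (conn \<Lambda> Z y)" using gauge_mult[OF h(1) ginv] g(3) by simp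
    hence d: "mat_deriv (h ** g) = (h ** g) ** (const_mat Z + S) - gauge h (conn \<Lambda> Z y) ** (h ** g)"
      using gauge_eq_iff[OF hg] by blast
    have ZS: "const_mat Z + S = msc (inverse (lin w)) (const_mat N) + (R + const_mat Z)" by (simp add: S)
    show "N = 0"
      by (rule nilpotent_residue_zero[OF hg d[unfolded ZS] _ h(2) nilpotent_of_deg_ge[OF N K]]) (intro mat_regular_simps R)
  qed
  thus ?thesis using g by auto
qed

end

section \<open>Conjugating the torus into diagonal matrices\<close>

definition conj_mat :: "'a::comm_ring_1^'n^'n \<Rightarrow> 'a^'n^'n \<Rightarrow> 'a^'n^'n" where
  "conj_mat P X = P ** X ** matrix_inv P"

lemma conj_mat_simps:
  fixes P :: "'a::comm_ring_1^'n^'n"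
  shows "conj_mat P (X + Y) = conj_mat P X + conj_mat P Y" "conj_mat P (X - Y) = conj_mat P X - conj_mat P Y"
    "conj_mat P (msc c X) = msc c (conj_mat P X)" "conj_mat P 0 = 0"
  by (simp_all add: conj_mat_def matrix_ring_simps)

lemma conj_mat_sum: "conj_mat P (sum f I) = (\<Sum>i\<in>I. conj_mat P (f i))" for f :: "'i \<Rightarrow> 'a::comm_ring_1^'n^'n"
  by (induction I rule: infinite_finite_induct) (simp_all add: conj_mat_simps)

lemma conj_mat_mult:
  fixes P :: "'a::comm_ring_1^'n^'n"
  assumes "invertible P"
  shows "conj_mat P (X ** Y) = conj_mat P X ** conj_mat P Y" "conj_mat P (mat 1) = mat 1"
    "conj_mat (matrix_inv P) (conj_mat P X) = X" "conj_mat P (conj_mat (matrix_inv P) X) = X"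
proof -
  have c: "matrix_inv P ** (P ** X) = X" "P ** (matrix_inv P ** X) = X" for X
    by (simp_all add: matrix_mul_assoc invertible_matrix_inv[OF assms])
  show "conj_mat P (X ** Y) = conj_mat P X ** conj_mat P Y"
    by (simp add: conj_mat_def matrix_mul_assoc[symmetric] c)
  show "conj_mat P (mat 1) = mat 1" by (simp add: conj_mat_def invertible_matrix_inv[OF assms])
  show "conj_mat (matrix_inv P) (conj_mat P X) = X" "conj_mat P (conj_mat (matrix_inv P) X) = X"
    using assms by (simp_all add: conj_mat_def matrix_inv_inv matrix_mul_assoc[symmetric] c invertible_matrix_inv)
qed

lemma conj_mat_inj: "invertible P \<Longrightarrow> conj_mat P X = conj_mat P Y \<longleftrightarrow> X = Y" for P :: "'a::comm_ring_1^'n^'n"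
  by (metis conj_mat_mult(3))

lemma conj_mat_invertible:
  fixes P :: "'a::comm_ring_1^'n^'n"
  assumes P: "invertible P"
  shows "invertible (conj_mat P X) \<longleftrightarrow> invertible X" "invertible X \<Longrightarrow> matrix_inv (conj_mat P X) = conj_mat P (matrix_inv X)"
proof -
  have i: "conj_mat P X ** conj_mat P (matrix_inv X) = mat 1 \<and> conj_mat P (matrix_inv X) ** conj_mat P X = mat 1"
    if "invertible X" "invertible P" for X and P :: "'a^'n^'n"
    unfolding conj_mat_mult(1)[OF that(2), symmetric] invertible_matrix_inv[OF that(1)] conj_mat_mult(2)[OF that(2)] by simp
  show "matrix_inv (conj_mat P X) = conj_mat P (matrix_inv X)" if "invertible X"
    using i[OF that P] by (intro matrix_inv_unique') auto
  have imp: "invertible (conj_mat P X)" if "invertible X" "invertible P" for X and P :: "'a^'n^'n"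
    using i[OF that] by (auto simp: invertible_def)
  show "invertible (conj_mat P X) \<longleftrightarrow> invertible X"
    using imp[OF _ P] imp[OF _ invertible_inverse[OF P], of "conj_mat P X"] conj_mat_mult(3)[OF P] by metis
qed

lemma conj_mat_lie_bracket: "invertible P \<Longrightarrow> conj_mat P (lie_bracket X Y) = lie_bracket (conj_mat P X) (conj_mat P Y)"
  by (simp add: lie_bracket_def conj_mat_mult conj_mat_simps)

lemma conj_mat_mpow: "invertible P \<Longrightarrow> conj_mat P (mpow X k) = mpow (conj_mat P X) k"
  by (induction k) (simp_all add: conj_mat_mult)

lemma conj_mat_mexp: "invertible P \<Longrightarrow> conj_mat P (mexp K X) = mexp K (conj_mat P X)"
  by (simp add: mexp_def conj_mat_sum conj_mat_simps conj_mat_mpow)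

lemma conj_mat_const: "invertible P \<Longrightarrow> conj_mat (const_mat P) (const_mat X) = const_mat (conj_mat P X)"
  by (simp add: conj_mat_def const_mat_simps matrix_inv_const_mat)

lemma mat_eval_conj_mat:
  assumes "invertible P" "mat_regular w X"
  shows "mat_eval w (conj_mat (const_mat P) X) = conj_mat P (mat_eval w X)"
  using assms by (simp add: conj_mat_def matrix_inv_const_mat mat_eval_simps mat_regular_simps)

lemma mat_deriv_conj_mat: "invertible P \<Longrightarrow> mat_deriv (conj_mat (const_mat P) X) = conj_mat (const_mat P) (mat_deriv X)"
  by (simp add: conj_mat_def matrix_inv_const_mat mat_deriv_simps)

lemma conj_mat_gauge:
  assumes P: "invertible P" and g: "invertible g"
  shows "conj_mat (const_mat P) (gauge g M) = gauge (conj_mat (const_mat P) g) (conj_mat (const_mat P) M)"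
proof -
  have P': "invertible (const_mat P)" by (rule invertible_const_mat[OF P])
  show ?thesis unfolding gauge_def conj_mat_invertible(2)[OF P' g] mat_deriv_conj_mat[OF P] conj_mat_simps conj_mat_mult(1)[OF P'] ..
qed

lemma conj_mat_lie_generated:
  assumes P: "invertible P"
  shows "conj_mat P ` lie_generated S = lie_generated (conj_mat P ` S)"
proof -
  have sub: "conj_mat P X \<in> lie_generated (conj_mat P ` S)" if "X \<in> lie_generated S" "invertible P" for X S and P :: "complex^'n^'n"
    using that(1) by induction (auto simp: conj_mat_simps conj_mat_lie_bracket[OF that(2)] intro: lie_generated.intros)
  have "X \<in> conj_mat P ` lie_generated S" if "X \<in> lie_generated (conj_mat P ` S)" for X
  proof -
    have "conj_mat (matrix_inv P) X \<in> lie_generated (conj_mat (matrix_inv P) ` conj_mat P ` S)"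
      by (rule sub[OF that invertible_inverse[OF P]])
    also have "conj_mat (matrix_inv P) ` conj_mat P ` S = S" by (simp add: image_image conj_mat_mult[OF P])
    finally show ?thesis using conj_mat_mult(4)[OF P, of X] by (metis image_eqI)
  qed
  thus ?thesis using sub[OF _ P] by blast
qed

lemma mexp_zero: "mexp (Suc N) (0 :: 'a::field^'n^'n) = mat 1"
proof -
  have "mpow (0 :: 'a^'n^'n) (Suc k) = 0" for k by simp
  thus ?thesis unfolding mexp_def by (subst sum.lessThan_Suc_shift) (simp add: msc_simps)
qed

text \<open>Linearity of a weight follows from the weight equation by comparing a nonzero entry of
  X. In the group data a root is a function subject to that equation.\<close>

lemma weight_functional_on:
  assumes "X \<noteq> 0" "\<And>Y. Y \<in> V \<Longrightarrow> lie_bracket Y X = msc (\<beta> Y) X"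
    and V: "\<And>Y Y'. Y \<in> V \<Longrightarrow> Y' \<in> V \<Longrightarrow> Y + Y' \<in> V" "\<And>c Y. Y \<in> V \<Longrightarrow> msc c Y \<in> V"
  shows "functional_on V \<beta>"
proof -
  obtain a b where ab: "X $ a $ b \<noteq> 0" using assms(1) by (metis mat_eqI zero_index)
  have eq: "c = d" if "msc c X = msc d X" for c d
    using arg_cong[OF that, of "\<lambda>M. M $ a $ b"] ab by simp
  have "\<beta> (Y + Y') = \<beta> Y + \<beta> Y'" if "Y \<in> V" "Y' \<in> V" for Y Y'
    by (rule eq) (simp add: assms(2)[symmetric] that V lie_bracket_simps msc_simps)
  moreover have "\<beta> (msc c Y) = c * \<beta> Y" if "Y \<in> V" for c Y
    by (rule eq) (simp add: assms(2)[symmetric] that V lie_bracket_simps msc_simps, simp add: assms(2) that msc_simps)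
  ultimately show ?thesis by (simp add: functional_on_def)
qed

lemma roots_onI:
  assumes "X \<in> V" "X \<noteq> 0" "\<And>Y. Y \<in> cartan D \<Longrightarrow> lie_bracket Y X = msc (\<beta> Y) X" "Y0 \<in> cartan D" "\<beta> Y0 \<noteq> 0"
  shows "restrict \<beta> (cartan D) \<in> roots_on D V"
  using assms unfolding roots_on_def by auto

text \<open>The entry (i, j) after conjugation is itself a polynomial vanishing on T, and it is
  linear, so its derivative along 1 + s X is that entry of the conjugate of X.\<close>

lemma lie_algebra_diagonal:
  fixes P Q X :: "complex^'n^'n"
  assumes "\<And>A. A \<in> T \<Longrightarrow> (P ** A ** Q) $ i $ j = 0" and X: "X \<in> lie_algebra T" and PQ: "P ** Q = mat 1" and ij: "i \<noteq> j"
  shows "(P ** X ** Q) $ i $ j = 0"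
proof -
  have pf: "(\<lambda>x. (P ** x ** Q) $ i $ j) \<in> polyfun" by (rule polyfun_sandwich[OF polyfun.coord])
  have "((\<lambda>s. (P ** (mat 1 + msc s X) ** Q) $ i $ j) has_field_derivative 0) (at 0)"
    by (rule X[unfolded lie_algebra_iff, THEN bspec, OF pf, THEN mp]) (use assms(1) in simp)
  moreover have "(P ** (mat 1 + msc s X) ** Q) $ i $ j = s * (P ** X ** Q) $ i $ j" for s
    using ij by (simp add: matrix_ring_simps PQ mat_one_nth)
  moreover have "((\<lambda>s. s * (P ** X ** Q) $ i $ j) has_field_derivative (P ** X ** Q) $ i $ j) (at 0)"
    by (auto intro!: derivative_eq_intros)
  ultimately show ?thesis using DERIV_unique by fastforce
qed

text \<open>P diagonalises the maximal torus, and all data are transported by conjugation with P.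
  The cases follow the order of the locale assumptions; those on the group rest on
  \<open>lie_algebra_Ad\<close>, \<open>one_parameter_subgroup\<close> and
  \<open>lie_algebra_log_derivative\<close>.\<close>

lemma setup_diagonal_group:
  fixes D :: "('n::finite, 'r::finite) group_data"
  assumes D: "simple_group_setup D"
  obtains P :: "complex^'n^'n" where "invertible P"
    "diagonal_group (conj_mat P ` cartan D) (conj_mat P ` lie_algebra (grp D)) (conj_mat P ` lie_algebra (borel_plus D))
       (conj_mat P ` borel_plus D) (\<lambda>i Y. sroot D i (conj_mat (matrix_inv P) Y)) (\<lambda>i. conj_mat P (coroot D i))
       (\<lambda>i. conj_mat P (gen_e D i)) (\<lambda>i. conj_mat P (gen_f D i))"
proof -
  have borel: "borel_plus D \<subseteq> grp D" "algebraic_group (borel_plus D)"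
    and tor: "torus (max_torus D)" and sr: "simple_roots D" and ch: "chevalley_generators D"
    using D by (auto simp: simple_group_setup_def borel_subgroup_def Let_def maximal_torus_def)
  obtain P :: "complex^'n^'n" where P: "invertible P" "\<forall>A\<in>max_torus D. \<forall>i j. i \<noteq> j \<longrightarrow> (P ** A ** matrix_inv P) $ i $ j = 0"
    using tor by (auto simp: torus_def)
  let ?Q = "matrix_inv P"
  have Q: "invertible ?Q" by (rule invertible_inverse[OF P(1)])
  note cm = conj_mat_mult[OF P(1)] and ls = lie_algebra_subspace
  have csub: "X \<in> cartan D \<Longrightarrow> Y \<in> cartan D \<Longrightarrow> X + Y \<in> cartan D" "X \<in> cartan D \<Longrightarrow> msc c X \<in> cartan D" "0 \<in> cartan D" for X Y c
    unfolding cartan_def using ls by blast+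
  have cb: "cartan D \<subseteq> lie_algebra (borel_plus D)" unfolding cartan_def max_torus_def by (rule lie_algebra_mono) simp
  have bg: "lie_algebra (borel_plus D) \<subseteq> lie_algebra (grp D)" by (rule lie_algebra_mono[OF borel(1)])
  have sroot: "sroot D i \<in> all_roots D" for i using sr by (simp add: simple_roots_def)
  have sfun: "functional_on (cartan D) (sroot D i)" for i
  proof -
    obtain X where "X \<noteq> 0" "\<forall>Y\<in>cartan D. lie_bracket Y X = msc (sroot D i Y) X" using sroot[of i] by (auto simp: all_roots_def roots_on_def)
    thus ?thesis by (intro weight_functional_on[of X]) (auto intro: csub)
  qed
  have sind: "c i = 0" if "\<forall>Y\<in>cartan D. (\<Sum>j\<in>UNIV. c j * sroot D j Y) = 0" for c i
  proof -
    have "\<forall>\<beta>. functional_on (cartan D) \<beta> \<longrightarrow> (\<exists>!c::'r \<Rightarrow> complex. \<forall>Y\<in>cartan D. \<beta> Y = (\<Sum>i\<in>UNIV. c i * sroot D i Y))"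
      using sr unfolding simple_roots_def by blast
    moreover have "functional_on (cartan D) (\<lambda>_. 0)" by (simp add: functional_on_def)
    ultimately have "\<exists>!c::'r \<Rightarrow> complex. \<forall>Y\<in>cartan D. 0 = (\<Sum>i\<in>UNIV. c i * sroot D i Y)" by blast
    then obtain c0 where c0: "\<And>d. \<forall>Y\<in>cartan D. 0 = (\<Sum>i\<in>UNIV. d i * sroot D i Y) \<Longrightarrow> d = c0" by (elim ex1E) blast
    have "c = c0" using that by (intro c0) simp
    moreover have "(\<lambda>_. 0) = c0" by (intro c0) simp
    ultimately show ?thesis by (metis)
  qed
  have weights: "lie_bracket Y (gen_e D i) = msc (sroot D i Y) (gen_e D i)" "lie_bracket Y (gen_f D i) = msc (- sroot D i Y) (gen_f D i)"
    if "Y \<in> cartan D" for Y i using ch that by (simp_all add: chevalley_generators_def)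
  have co: "lie_bracket (gen_e D i) (gen_f D i) = coroot D i" "coroot D i \<in> cartan D" "sroot D i (coroot D i) = 2" for i
    using ch by (simp_all add: chevalley_generators_def)
  have gen: "lie_generated (range (gen_e D) \<union> range (gen_f D)) = lie_algebra (grp D)" using ch by (simp add: chevalley_generators_def)
  \<comment> \<open>A root is nonzero by definition, while the locale speaks of all weights; weight
    0 is the empty combination.\<close>
  have zero_comb: "\<exists>n::'r \<Rightarrow> nat. \<forall>Y\<in>cartan D. 0 = (\<Sum>i\<in>UNIV. of_nat (n i) * sroot D i Y)"
    by (rule exI[of _ "\<lambda>_. 0"]) simp
  have groots: "\<exists>n::'r \<Rightarrow> nat. (\<forall>Y\<in>cartan D. \<beta> Y = (\<Sum>i\<in>UNIV. of_nat (n i) * sroot D i Y)) \<or> (\<forall>Y\<in>cartan D. - \<beta> Y = (\<Sum>i\<in>UNIV. of_nat (n i) * sroot D i Y))"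
    if X: "X \<in> lie_algebra (grp D)" "X \<noteq> 0" "\<And>Y. Y \<in> cartan D \<Longrightarrow> lie_bracket Y X = msc (\<beta> Y) X" for X \<beta>
  proof (cases "\<forall>Y\<in>cartan D. \<beta> Y = 0")
    case True
    then show ?thesis using zero_comb by auto
  next
    case False
    then obtain Y0 where "Y0 \<in> cartan D" "\<beta> Y0 \<noteq> 0" by blast
    hence "restrict \<beta> (cartan D) \<in> all_roots D" unfolding all_roots_def using X by (intro roots_onI[of X]) auto
    hence "nonneg_comb D (restrict \<beta> (cartan D)) \<or> nonneg_comb D (\<lambda>Y. - restrict \<beta> (cartan D) Y)"
      using sr unfolding simple_roots_def by blast
    thus ?thesis unfolding nonneg_comb_def by auto
  qed
  have broots: "\<exists>n::'r \<Rightarrow> nat. \<forall>Y\<in>cartan D. \<beta> Y = (\<Sum>i\<in>UNIV. of_nat (n i) * sroot D i Y)"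
    if X: "X \<in> lie_algebra (borel_plus D)" "X \<noteq> 0" "\<And>Y. Y \<in> cartan D \<Longrightarrow> lie_bracket Y X = msc (\<beta> Y) X" for X \<beta>
  proof (cases "\<forall>Y\<in>cartan D. \<beta> Y = 0")
    case True
    then show ?thesis using zero_comb by auto
  next
    case False
    then obtain Y0 where "Y0 \<in> cartan D" "\<beta> Y0 \<noteq> 0" by blast
    hence "restrict \<beta> (cartan D) \<in> roots_on D (lie_algebra (borel_plus D))" using X by (intro roots_onI[of X]) auto
    hence "nonneg_comb D (restrict \<beta> (cartan D))" using sr unfolding simple_roots_def by blast
    thus ?thesis unfolding nonneg_comb_def by auto
  qed
  \<comment> \<open>A simple root is a nonnegative combination with a single coefficient 1, hence a
    root of B_+.\<close>
  have bsimple: "\<exists>X\<in>lie_algebra (borel_plus D). X \<noteq> 0 \<and> (\<forall>Y\<in>cartan D. lie_bracket Y X = msc (sroot D i Y) X)" for i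
  proof -
    have "sroot D i Y = (\<Sum>j\<in>UNIV. of_nat (if j = i then 1 else 0) * sroot D j Y)" for Y
      by (subst sum.remove[of _ i]) (auto intro!: sum.neutral)
    hence "nonneg_comb D (sroot D i)" unfolding nonneg_comb_def by (intro exI[of _ "\<lambda>j. if j = i then 1 else 0"]) blast
    hence "sroot D i \<in> roots_on D (lie_algebra (borel_plus D))" using sr sroot[of i] unfolding simple_roots_def by blast
    thus ?thesis by (auto simp: roots_on_def)
  qed
  note ag = algebraic_group_props[OF borel(2)]
  have "diagonal_group (conj_mat P ` cartan D) (conj_mat P ` lie_algebra (grp D)) (conj_mat P ` lie_algebra (borel_plus D))
       (conj_mat P ` borel_plus D) (\<lambda>i Y. sroot D i (conj_mat ?Q Y)) (\<lambda>i. conj_mat P (coroot D i))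
       (\<lambda>i. conj_mat P (gen_e D i)) (\<lambda>i. conj_mat P (gen_f D i))"
  proof (unfold_locales, goal_cases)
    case (1 Y a b)
    then obtain X where X: "X \<in> lie_algebra (max_torus D)" "Y = conj_mat P X" by (auto simp: cartan_def)
    show ?case unfolding X(2) conj_mat_def
      by (rule lie_algebra_diagonal[OF _ X(1) invertible_matrix_inv(1)[OF P(1)] 1(2)]) (use P(2) 1(2) in blast)
  next
    case 2
    show ?case using csub(3) by (metis conj_mat_simps(4) image_eqI)
  next
    case (3 X Y)
    then show ?case by (auto simp flip: conj_mat_simps intro: csub)
  next
    case (4 X c)
    then show ?case by (auto simp flip: conj_mat_simps intro: csub)
  next
    case (5 i)
    show ?case using co(2) by blast
  next
    case (6 i)
    then show ?case using functional_on_simps[OF sfun[of i]] unfolding functional_on_def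
      by (auto simp: cm conj_mat_simps)
  next
    case (7 u i)
    then show ?case by (intro sind) (auto simp: cm)
  next
    case (8 Y i)
    then show ?case by (auto simp: cm weights conj_mat_simps simp flip: conj_mat_lie_bracket[OF P(1)])
  next
    case (9 Y i)
    then show ?case by (auto simp: cm weights conj_mat_simps simp flip: conj_mat_lie_bracket[OF P(1)])
  next
    case (10 i)
    show ?case by (simp add: co flip: conj_mat_lie_bracket[OF P(1)])
  next
    case (11 i)
    show ?case by (simp add: cm co)
  next
    case 12
    show ?case unfolding gen[symmetric] conj_mat_lie_generated[OF P(1)] by (simp add: image_Un image_image)
  next
    case (13 X \<beta>)
    then obtain X' where X': "X' \<in> lie_algebra (grp D)" "X = conj_mat P X'" by blast
    have "lie_bracket Y X' = msc (\<beta> (conj_mat P Y)) X'" if "Y \<in> cartan D" for Y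
    proof -
      have "lie_bracket (conj_mat P Y) X = msc (\<beta> (conj_mat P Y)) X" using 13(3) that by blast
      hence "conj_mat P (lie_bracket Y X') = conj_mat P (msc (\<beta> (conj_mat P Y)) X')"
        by (simp add: X'(2) conj_mat_lie_bracket[OF P(1)] conj_mat_simps)
      thus ?thesis by (simp only: conj_mat_inj[OF P(1)])
    qed
    moreover have "X' \<noteq> 0" using 13(2) X'(2) by (auto simp: conj_mat_simps)
    ultimately show ?case using groots[of X' "\<lambda>Y. \<beta> (conj_mat P Y)"] X'(1) by (simp add: cm)
  next
    case 14
    show ?case using bg by blast
  next
    case 15
    show ?case using cb by blast
  next
    case (16 X Y)
    then show ?case by (auto simp flip: conj_mat_simps intro: ls)
  next
    case (17 X c)
    then show ?case by (auto simp flip: conj_mat_simps intro: ls)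
  next
    case (18 X \<beta>)
    then obtain X' where X': "X' \<in> lie_algebra (borel_plus D)" "X = conj_mat P X'" by blast
    have "lie_bracket Y X' = msc (\<beta> (conj_mat P Y)) X'" if "Y \<in> cartan D" for Y
    proof -
      have "lie_bracket (conj_mat P Y) X = msc (\<beta> (conj_mat P Y)) X" using 18(3) that by blast
      hence "conj_mat P (lie_bracket Y X') = conj_mat P (msc (\<beta> (conj_mat P Y)) X')"
        by (simp add: X'(2) conj_mat_lie_bracket[OF P(1)] conj_mat_simps)
      thus ?thesis by (simp only: conj_mat_inj[OF P(1)])
    qed
    moreover have "X' \<noteq> 0" using 18(2) X'(2) by (auto simp: conj_mat_simps)
    ultimately show ?case using broots[of X' "\<lambda>Y. \<beta> (conj_mat P Y)"] X'(1) by (simp add: cm)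
  next
    case (19 i)
    obtain X where X: "X \<in> lie_algebra (borel_plus D)" "X \<noteq> 0" "\<forall>Y\<in>cartan D. lie_bracket Y X = msc (sroot D i Y) X" using bsimple by blast
    have "conj_mat P X \<noteq> 0" using X(2) conj_mat_inj[OF P(1), of X 0] by (simp add: conj_mat_simps)
    thus ?case using X by (intro bexI[of _ "conj_mat P X"]) (auto simp: cm conj_mat_simps simp flip: conj_mat_lie_bracket[OF P(1)])
  next
    case (20 g h)
    then show ?case by (auto simp flip: cm(1) intro: ag)
  next
    case 21
    show ?case using ag(2) cm(2) by (metis image_eqI)
  next
    case (22 g)
    then obtain g' where g': "g' \<in> borel_plus D" "g = conj_mat P g'" by blast
    show ?case unfolding g'(2) conj_mat_invertible(2)[OF P(1) ag(3)[OF g'(1)]] using ag(4)[OF g'(1)] by blast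
  next
    case (23 g)
    then obtain g' where g': "g' \<in> borel_plus D" "g = conj_mat P g'" by blast
    show ?case unfolding g'(2) conj_mat_invertible(1)[OF P(1)] by (rule ag(3)[OF g'(1)])
  next
    case (24 g X)
    then obtain g' X' where g: "g' \<in> borel_plus D" "g = conj_mat P g'" "X' \<in> lie_algebra (borel_plus D)" "X = conj_mat P X'" by blast
    have "g ** X ** matrix_inv g = conj_mat P (g' ** X' ** matrix_inv g')"
      unfolding g(2,4) conj_mat_invertible(2)[OF P(1) ag(3)[OF g(1)]] cm(1) ..
    thus ?case using lie_algebra_Ad[OF borel(2) g(1,3)] by blast
  next
    case (25 Y)
    then obtain X where X: "X \<in> cartan D" "Y = conj_mat P X" by blast
    have diag: "Y $ a $ b = 0" if "a \<noteq> b" for a b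
      using lie_algebra_diagonal[OF _ X(1)[unfolded cartan_def] invertible_matrix_inv(1)[OF P(1)] that] P(2) that
      unfolding X(2) conj_mat_def by blast
    \<comment> \<open>T(s) is the diagonal matrix exp(s Y). Conjugated back it is the one-parameter
      subgroup with tangent X, and s = 1 gives the required element.\<close>
    define T :: "complex \<Rightarrow> complex^'n^'n" where "T = (\<lambda>s. \<chi> a b. if a = b then exp (s * Y $ a $ a) else 0)"
    define E where "E = (\<lambda>s. conj_mat ?Q (T s))"
    have Tm: "(T s ** M) $ a $ b = exp (s * Y $ a $ a) * M $ a $ b" for s a b and M :: "complex^'n^'n"
      by (subst diag_mult_nth(1)) (simp_all add: T_def)
    have dT: "mat_DERIV T (T s ** Y) s" for s unfolding mat_DERIV_def Tm
    proof (intro allI)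
      fix a b
      show "((\<lambda>t. T t $ a $ b) has_field_derivative exp (s * Y $ a $ a) * Y $ a $ b) (at s)"
        by (cases "a = b") (auto simp: T_def diag intro!: derivative_eq_intros)
    qed
    have "T s ** T (- s) = mat 1" for s
    proof (rule mat_eqI)
      fix a b show "(T s ** T (- s)) $ a $ b = (mat 1 :: complex^'n^'n) $ a $ b"
        unfolding Tm by (auto simp: T_def mat_one_nth exp_minus)
    qed
    hence Tinv: "invertible (T s)" for s by (auto simp: invertible_right_inverse)
    have "E 1 \<in> borel_plus D"
    proof (rule one_parameter_subgroup[OF borel(2)])
      show "X \<in> lie_algebra (borel_plus D)" using X(1) cb by blast
      show "mat_DERIV E (E s ** X) s" for s
      proof -
        have "E s ** X = conj_mat ?Q (T s ** Y)" unfolding E_def conj_mat_mult(1)[OF Q] X(2) cm(3) ..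
        thus ?thesis using mat_DERIV_mult[OF mat_DERIV_mult[OF mat_DERIV_const[of ?Q] dT] mat_DERIV_const[of "matrix_inv ?Q"]]
          by (simp add: E_def conj_mat_def)
      qed
      have "T 0 = mat 1" by (rule mat_eqI) (simp add: T_def mat_one_nth)
      thus "E 0 = mat 1" by (simp add: E_def conj_mat_mult(2)[OF Q])
      show "invertible (E s)" for s unfolding E_def using conj_mat_invertible(1)[OF Q] Tinv by blast
    qed
    moreover have "conj_mat P (E 1) = (\<chi> a b. if a = b then exp (Y $ a $ a) else 0)"
      by (rule mat_eqI) (auto simp: E_def cm T_def)
    ultimately show ?case by (metis image_eqI)
  next
    case (26 X N)
    then obtain X' where X': "X' \<in> lie_algebra (borel_plus D)" "X = conj_mat P X'" by blast
    have "conj_mat P (mpow X' N) = conj_mat P 0" using 26(2) by (simp add: X'(2) conj_mat_mpow[OF P(1)] conj_mat_simps)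
    hence N: "mpow X' N = 0" by (simp only: conj_mat_inj[OF P(1)])
    have c: "conj_mat P (mexp (Suc N) (msc s X')) = mexp (Suc N) (msc s X)" for s
      by (simp add: X'(2) conj_mat_mexp[OF P(1)] conj_mat_simps)
    have "mexp (Suc N) (msc 1 X') \<in> borel_plus D"
    proof (rule one_parameter_subgroup[OF borel(2) X'(1)])
      show "mat_DERIV (\<lambda>s. mexp (Suc N) (msc s X')) (mexp (Suc N) (msc s X') ** X') s" for s by (rule mat_DERIV_mexp[OF N])
      show "mexp (Suc N) (msc 0 X') = mat 1" by (simp add: msc_simps mexp_zero)
      show "invertible (mexp (Suc N) (msc s X'))" for s using 26(3)[of s] conj_mat_invertible(1)[OF P(1)] c by metis
    qed
    hence "conj_mat P (mexp (Suc N) (msc 1 X')) \<in> conj_mat P ` borel_plus D" by blast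
    thus ?case unfolding c by (simp add: msc_simps)
  next
    case (27 q)
    let ?CP = "const_mat P" and ?CQ = "const_mat ?Q"
    have CP: "invertible ?CP" by (rule invertible_const_mat[OF P(1)])
    have CQ: "?CQ = matrix_inv ?CP" by (simp add: matrix_inv_const_mat[OF P(1)])
    \<comment> \<open>Back in the original coordinates g is a point of B_+ over C(z), where the
      statement on logarithmic derivatives is available.\<close>
    define g where "g = conj_mat ?CQ q"
    have qg: "q = conj_mat ?CP g" unfolding g_def CQ by (simp add: conj_mat_mult[OF CP])
    have ginv: "invertible g" using 27(1) conj_mat_invertible(1)[OF CP] unfolding qg by blast
    have "\<forall>\<^sub>F w in cofinite. mat_eval w g \<in> borel_plus D"
      using 27(2) eventually_mat_regular[of q]
    proof eventually_elim
      case (elim w)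
      then obtain b where "b \<in> borel_plus D" "mat_eval w q = conj_mat P b" by blast
      thus ?case unfolding g_def mat_eval_conj_mat[OF Q elim(2)] by (simp add: cm)
    qed
    hence "g \<in> ratpoints (borel_plus D)" by (rule ratpointsI[OF ginv])
    from lie_algebra_log_derivative[OF borel(2) this] eventually_mat_regular[of "g ** mat_deriv (matrix_inv g)"]
    show ?case
    proof eventually_elim
      case (elim w)
      have "q ** mat_deriv (matrix_inv q) = conj_mat ?CP (g ** mat_deriv (matrix_inv g))"
        unfolding qg conj_mat_invertible(2)[OF CP ginv] mat_deriv_conj_mat[OF P(1)] conj_mat_mult(1)[OF CP] ..
      thus ?case using elim(1) by (simp add: mat_eval_conj_mat[OF P(1) elim(2)])
    qed
  qed
  thus ?thesis using that P(1) by blast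
qed

section \<open>The correspondence\<close>

lemma bethe_poly_proots:
  fixes p :: "complex poly"
  assumes "lead_coeff p = 1" shows "(\<Prod>w\<in>#proots p. [:- w, 1:]) = p"
  using complex_poly_decompose_multiset[of p] assms by simp

lemma proots_bethe_poly: "proots (bethe_poly W i) = W i"
proof -
  have "proots (\<Prod>w\<in>#M. [:- w, 1:]) = M \<and> (\<Prod>w\<in>#M. [:- w, 1:]) \<noteq> 0" for M :: "complex multiset"
  proof (induction M)
    case (add x M)
    then show ?case by (simp add: proots_mult del: mult_pCons_left)
  qed simp
  thus ?thesis by (simp add: bethe_poly_def)
qed

lemma lead_coeff_bethe_poly: "lead_coeff (bethe_poly W i) = 1"
proof -
  have "lead_coeff (\<Prod>w\<in>#M. [:- w, 1:]) = 1" for M :: "complex multiset"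
    by (induction M) (simp_all add: lead_coeff_mult del: mult_pCons_left)
  thus ?thesis by (simp add: bethe_poly_def)
qed

theorem theorem6p19:
  fixes D :: "('n::finite, 'r::finite) group_data"
    and \<Lambda> :: "'r \<Rightarrow> complex poly"
    and Z :: "complex^'n^'n"
  assumes "simple_group_setup D"
    and "monic_family \<Lambda>"
    and "Z \<in> cartan D"
  shows "\<exists>F. bij_betw F
      {A \<in> nondegenerate_twisted_opers D \<Lambda> Z. admissible D (oper_datum D \<Lambda> Z A)}
      {W \<in> bethe_solutions D \<Lambda> Z. admissible D (bethe_datum D \<Lambda> Z W)} \<and>
    (\<forall>A \<in> nondegenerate_twisted_opers D \<Lambda> Z. admissible D (oper_datum D \<Lambda> Z A) \<longrightarrow>
      bethe_datum D \<Lambda> Z (F A) = oper_datum D \<Lambda> Z A \<and>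
      (\<forall>i. bethe_poly (F A) i = oper_polys D \<Lambda> Z A i))"
proof -

  \<comment> \<open>Transport of the opers to diagonal coordinates\<close>
  obtain P :: "complex^'n^'n" where P: "invertible P" and
    dg: "diagonal_group (conj_mat P ` cartan D) (conj_mat P ` lie_algebra (grp D)) (conj_mat P ` lie_algebra (borel_plus D))
       (conj_mat P ` borel_plus D) (\<lambda>i Y. sroot D i (conj_mat (matrix_inv P) Y)) (\<lambda>i. conj_mat P (coroot D i))
       (\<lambda>i. conj_mat P (gen_e D i)) (\<lambda>i. conj_mat P (gen_f D i))"
    by (rule setup_diagonal_group[OF assms(1)])
  interpret G: diagonal_group "conj_mat P ` cartan D" "conj_mat P ` lie_algebra (grp D)" "conj_mat P ` lie_algebra (borel_plus D)"
       "conj_mat P ` borel_plus D" "\<lambda>i Y. sroot D i (conj_mat (matrix_inv P) Y)" "\<lambda>i. conj_mat P (coroot D i)"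
       "\<lambda>i. conj_mat P (gen_e D i)" "\<lambda>i. conj_mat P (gen_f D i)" by (rule dg)
  note cm = conj_mat_mult[OF P]
  have CP: "invertible (const_mat P)" by (rule invertible_const_mat[OF P])
  have alg: "algebraic_group (borel_plus D)"
    using assms(1) by (simp add: simple_group_setup_def borel_subgroup_def Let_def)
  have ce: "cartan_entry D i j = G.aint i j" for i j
    by (simp add: cartan_entry_def G.aint_def cm)
  let ?Z = "conj_mat P Z"
  have Z: "?Z \<in> conj_mat P ` cartan D" using assms(3) by blast
  have \<Lambda>: "\<Lambda> i \<noteq> 0" for i using assms(2)[unfolded monic_family_def, THEN spec, of i] by auto
  \<comment> \<open>Consequently the coefficients \<zeta>_i of Z are unique, and two expressions of
    one oper can be compared term by term.\<close>
  have co_ind: "c = c'" if "(\<Sum>i\<in>UNIV. msc (c i) (coroot D i)) = (\<Sum>i\<in>UNIV. msc (c' i) (coroot D i))" for c c'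
  proof
    fix k
    have "conj_mat P (\<Sum>i\<in>UNIV. msc (c i - c' i) (coroot D i)) = 0"
      using that by (simp add: msc_simps sum_subtractf conj_mat_simps)
    hence "(\<Sum>i\<in>UNIV. msc (c i - c' i) (conj_mat P (coroot D i))) = 0" by (simp add: conj_mat_sum conj_mat_simps)
    from G.co_independent[OF this, of k] show "c k = c' k" by simp
  qed
  have ratpoints: "v \<in> ratpoints (borel_plus D) \<longleftrightarrow> conj_mat (const_mat P) v \<in> G.GB" for v
  proof -
    have "(\<forall>\<^sub>F w in cofinite. mat_eval w v \<in> borel_plus D) \<longleftrightarrow> (\<forall>\<^sub>F w in cofinite. mat_eval w (conj_mat (const_mat P) v) \<in> conj_mat P ` borel_plus D)"
    proof (rule eventually_subst)
      show "\<forall>\<^sub>F w in cofinite. (mat_eval w v \<in> borel_plus D) = (mat_eval w (conj_mat (const_mat P) v) \<in> conj_mat P ` borel_plus D)"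
        using eventually_mat_regular[of v]
        by eventually_elim (auto simp: mat_eval_conj_mat[OF P] conj_mat_inj[OF P])
    qed
    thus ?thesis by (simp add: ratpoints_iff[OF alg] G.GB_def conj_mat_invertible(1)[OF CP])
  qed
  have conn: "conj_mat (const_mat P) (miura_connection D \<Lambda> (\<lambda>i. rconst (\<zeta> i) - dlog (rpoly (y i)))) = G.conn \<Lambda> ?Z y"
    if "Z = (\<Sum>i\<in>UNIV. msc (\<zeta> i) (coroot D i))" for \<zeta> y
  proof -
    have "const_mat ?Z = (\<Sum>i\<in>UNIV. msc (rconst (\<zeta> i)) (const_mat (conj_mat P (coroot D i))) :: ratfun^'n^'n)"
      unfolding that by (simp add: conj_mat_sum conj_mat_simps const_mat_sum const_mat_simps)
    thus ?thesis
      by (simp add: miura_connection_def G.conn_def conj_mat_simps conj_mat_sum conj_mat_const[OF P] msc_simps sum_subtractf)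
  qed
  have twisted: "(\<exists>v\<in>ratpoints (borel_plus D). A = gauge v (const_mat Z)) \<longleftrightarrow> (\<exists>v\<in>G.GB. gauge v (const_mat ?Z) = conj_mat (const_mat P) A)" for A
  proof
    assume "\<exists>v\<in>ratpoints (borel_plus D). A = gauge v (const_mat Z)"
    then obtain v where v: "v \<in> ratpoints (borel_plus D)" "A = gauge v (const_mat Z)" by blast
    have "invertible v" using v(1) by (simp add: ratpoints_def)
    hence "conj_mat (const_mat P) A = gauge (conj_mat (const_mat P) v) (const_mat ?Z)"
      unfolding v(2) by (simp add: conj_mat_gauge[OF P] conj_mat_const[OF P])
    thus "\<exists>v\<in>G.GB. gauge v (const_mat ?Z) = conj_mat (const_mat P) A" using v(1) ratpoints by metis
  next
    assume "\<exists>v\<in>G.GB. gauge v (const_mat ?Z) = conj_mat (const_mat P) A"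
    then obtain u where u: "u \<in> G.GB" "gauge u (const_mat ?Z) = conj_mat (const_mat P) A" by blast
    define v where "v = conj_mat (matrix_inv (const_mat P)) u"
    have uv: "u = conj_mat (const_mat P) v" by (simp add: v_def conj_mat_mult[OF CP])
    have v: "v \<in> ratpoints (borel_plus D)" using u(1) by (simp add: ratpoints uv)
    hence "invertible v" by (simp add: ratpoints_def)
    hence "conj_mat (const_mat P) A = conj_mat (const_mat P) (gauge v (const_mat Z))"
      unfolding u(2)[symmetric] uv by (simp add: conj_mat_gauge[OF P] conj_mat_const[OF P])
    hence "A = gauge v (const_mat Z)" by (simp only: conj_mat_inj[OF CP])
    thus "\<exists>v\<in>ratpoints (borel_plus D). A = gauge v (const_mat Z)" using v by blast
  qed

  \<comment> \<open>Uniqueness of the polynomials attached to an oper\<close>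
  have fam_unique: "y = y'" if f: "is_y_family D \<Lambda> Z A y" "is_y_family D \<Lambda> Z A y'" for A y y'
  proof
    fix k
    obtain \<zeta> where z: "Z = (\<Sum>i\<in>UNIV. msc (\<zeta> i) (coroot D i))" "A = miura_connection D \<Lambda> (\<lambda>i. rconst (\<zeta> i) - dlog (rpoly (y i)))"
      using f(1) unfolding is_y_family_def by blast
    obtain \<zeta>' where z': "Z = (\<Sum>i\<in>UNIV. msc (\<zeta>' i) (coroot D i))" "A = miura_connection D \<Lambda> (\<lambda>i. rconst (\<zeta>' i) - dlog (rpoly (y' i)))"
      using f(2) unfolding is_y_family_def by blast
    have "\<zeta> = \<zeta>'" using z(1) z'(1) by (intro co_ind) simp
    hence e: "(\<Sum>i\<in>UNIV. msc (dlog (rpoly (y i))) (const_mat (coroot D i)) :: ratfun^'n^'n) = (\<Sum>i\<in>UNIV. msc (dlog (rpoly (y' i))) (const_mat (coroot D i)))"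
      using z(2) z'(2) by (simp add: miura_connection_def msc_simps sum_subtractf)
    \<comment> \<open>Independence of the coroots is known over the complex numbers; evaluation at
      almost every point carries it to rational coefficients.\<close>
    have "dlog (rpoly (y k)) = dlog (rpoly (y' k))"
    proof (rule ratfun_eqI)
      have "\<forall>\<^sub>F w in cofinite. \<forall>i. regular_at w (dlog (rpoly (y i))) \<and> regular_at w (dlog (rpoly (y' i)))"
        by (intro eventually_all_finite eventually_conj eventually_regular_at)
      thus "\<forall>\<^sub>F w in cofinite. rat_eval (dlog (rpoly (y k))) w = rat_eval (dlog (rpoly (y' k))) w"
      proof eventually_elim
        case (elim w)
        have "mat_eval w (\<Sum>i\<in>UNIV. msc (dlog (rpoly (h i))) (const_mat (coroot D i))) = (\<Sum>i\<in>UNIV. msc (rat_eval (dlog (rpoly (h i))) w) (coroot D i))"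
          if "\<forall>i. regular_at w (dlog (rpoly (h i)))" for h
          using that by (subst mat_eval_sum) (simp_all add: mat_eval_simps mat_regular_simps)
        from this[of y] this[of y'] have "(\<lambda>i. rat_eval (dlog (rpoly (y i))) w) = (\<lambda>i. rat_eval (dlog (rpoly (y' i))) w)"
          using elim e by (intro co_ind) simp
        thus ?case by (rule fun_cong)
      qed
    qed
    thus "y k = y' k" using f by (intro dlog_rpoly_inj) (auto simp: is_y_family_def monic_family_def)
  qed
  have polys: "oper_polys D \<Lambda> Z A = y" if "is_y_family D \<Lambda> Z A y" for A y
    unfolding oper_polys_def by (rule the_equality) (use that fam_unique in blast)+
  have nondeg_at: "G.nondeg_at \<Lambda> y i w" if nd: "nondegenerate_family D \<Lambda> y" and y: "\<And>j. y j \<noteq> 0" for y i w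
    unfolding G.nondeg_at_def
  proof (intro impI conjI allI)
    assume root: "poly (y i) w = 0"
    have "Polynomial.order w (y i) \<noteq> 0" using root y order_root by blast
    moreover have "Polynomial.order w (y i) \<le> 1" using nd by (simp add: nondegenerate_family_def)
    ultimately show "Polynomial.order w (y i) = 1" by simp
    show "poly (\<Lambda> i) w \<noteq> 0" using nd root by (auto simp: nondegenerate_family_def)
    fix j assume "j \<noteq> i" "poly (y j) w = 0"
    thus "G.aint i j = 0" "G.aint j i = 0" using nd root unfolding nondegenerate_family_def ce[symmetric] by metis+
  qed
  have beq: "bethe_equation D \<Lambda> Z W i w \<longleftrightarrow> sroot D i (conj_mat (matrix_inv P) ?Z) + rat_eval (dlog (G.bethe_fun \<Lambda> (bethe_poly W) i w)) w = 0" for W i w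
    by (simp add: bethe_equation_def G.bethe_fun_def G.torus_factor_def ce cm)

  \<comment> \<open>The map from opers to Bethe roots and its inverse\<close>
  define F where "F = (\<lambda>A i. proots (oper_polys D \<Lambda> Z A i))"
  have forward: "bethe_poly (F A) = oper_polys D \<Lambda> Z A \<and> F A \<in> bethe_solutions D \<Lambda> Z \<and> is_y_family D \<Lambda> Z A (oper_polys D \<Lambda> Z A)"
    if A: "A \<in> nondegenerate_twisted_opers D \<Lambda> Z" for A
  proof -
    obtain y where y: "is_y_family D \<Lambda> Z A y" "nondegenerate_family D \<Lambda> y" using A by (auto simp: nondegenerate_twisted_opers_def)
    obtain \<zeta> where \<zeta>: "Z = (\<Sum>i\<in>UNIV. msc (\<zeta> i) (coroot D i))" "A = miura_connection D \<Lambda> (\<lambda>i. rconst (\<zeta> i) - dlog (rpoly (y i)))"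
      using y(1) by (auto simp: is_y_family_def)
    have monic: "lead_coeff (y i) = 1" for i using y(1) by (simp add: is_y_family_def monic_family_def)
    have y0: "y i \<noteq> 0" for i using monic[of i] by auto
    have F: "F A = (\<lambda>i. proots (y i))" by (simp add: F_def polys[OF y(1)])
    have bp: "bethe_poly (F A) = y" unfolding F bethe_poly_def using bethe_poly_proots[OF monic] by auto
    have nd: "G.nondeg_at \<Lambda> y i w" for i w by (rule nondeg_at[OF y(2) y0])
    have root: "w \<in># F A i \<longleftrightarrow> poly (y i) w = 0" for i w using y0 by (simp add: F)
    obtain v where v: "v \<in> G.GB" "gauge v (const_mat ?Z) = G.conn \<Lambda> ?Z y"
    proof -
      have "\<exists>v\<in>ratpoints (borel_plus D). A = gauge v (const_mat Z)" using A by (auto simp: nondegenerate_twisted_opers_def twisted_miura_opers_def)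
      thus ?thesis using that unfolding twisted \<zeta>(2) conn[OF \<zeta>(1)] by blast
    qed
    have "F A \<in> bethe_solutions D \<Lambda> Z" unfolding bethe_solutions_def
    proof (intro CollectI conjI allI ballI impI)
      fix i w assume w: "w \<in># F A i"
      show "poly (\<Lambda> i) w \<noteq> 0" using nd[of i w] w by (simp add: root G.nondeg_at_def)
      obtain x \<kappa> c0 where x: "\<kappa> \<noteq> 0"
        "rderiv x + rconst (sroot D i (conj_mat (matrix_inv P) ?Z)) * x = rconst c0 - rconst \<kappa> * (rpoly (\<Lambda> i) * G.torus_factor y i)"
        using G.oper_imp_first_order[OF Z y0 v, of i] by blast
      show "bethe_equation D \<Lambda> Z (F A) i w"
        unfolding beq bp by (rule G.first_order_imp_bethe[OF y0 nd _ x]) (use w root in blast)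
    next
      fix i j w assume a: "cartan_entry D j i \<noteq> 0" and w: "w \<in># F A i"
      show "w \<notin># (if i = j then F A i - {#w#} else F A j)"
      proof (cases "i = j")
        case True
        have "count (F A i) w \<le> 1" using y(2) y0 by (simp add: F nondegenerate_family_def)
        hence "count (F A i - {#w#}) w = 0" by simp
        thus ?thesis using True by (simp add: not_in_iff)
      next
        case False
        thus ?thesis using nd[of i w] a w by (auto simp: root G.nondeg_at_def ce)
      qed
    qed
    thus ?thesis using bp polys[OF y(1)] y(1) by simp
  qed
  have backward: "\<exists>A\<in>nondegenerate_twisted_opers D \<Lambda> Z. is_y_family D \<Lambda> Z A (bethe_poly W)" if W: "W \<in> bethe_solutions D \<Lambda> Z" for W
  proof -
    define y where "y = bethe_poly W"
    have monic: "lead_coeff (y i) = 1" for i unfolding y_def by (rule lead_coeff_bethe_poly)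
    have y0: "y i \<noteq> 0" for i using monic[of i] by auto
    have root: "w \<in># W i \<longleftrightarrow> poly (y i) w = 0" for i w
      using y0[of i] set_count_proots[of "y i"] proots_bethe_poly[of W i] by (auto simp: y_def)
    have W1: "\<And>i w. w \<in># W i \<Longrightarrow> poly (\<Lambda> i) w \<noteq> 0"
      and W2: "\<And>i j w. cartan_entry D j i \<noteq> 0 \<Longrightarrow> w \<in># W i \<Longrightarrow> w \<notin># (if i = j then W i - {#w#} else W j)"
      and W3: "\<And>i w. w \<in># W i \<Longrightarrow> bethe_equation D \<Lambda> Z W i w"
      using W by (auto simp: bethe_solutions_def)
    have ndf: "nondegenerate_family D \<Lambda> y" unfolding nondegenerate_family_def
    proof (intro conjI allI impI notI)
      fix i w
      have "Polynomial.order w (y i) = count (W i) w" using y0[of i] proots_bethe_poly[of W i] by (metis count_proots y_def)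
      moreover have "count (W i) w \<le> 1"
      proof (cases "w \<in># W i")
        case True
        have "cartan_entry D i i \<noteq> 0" by (simp add: ce G.aint_diag)
        from W2[OF this True] have "count (W i - {#w#}) w = 0" by (simp add: not_in_iff)
        thus ?thesis by simp
      next
        case False
        thus ?thesis by (simp add: not_in_iff)
      qed
      ultimately show "Polynomial.order w (y i) \<le> 1" by simp
    next
      fix i assume "\<exists>w. poly (y i) w = 0 \<and> poly (\<Lambda> i) w = 0"
      thus False using W1 root by blast
    next
      fix i j assume ij: "i \<noteq> j \<and> cartan_entry D i j \<noteq> 0" and "\<exists>w. poly (y i) w = 0 \<and> poly (y j) w = 0"
      then obtain w where "w \<in># W i" "w \<in># W j" using root by blast
      thus False using W2[of i j w] ij by auto
    qed
    have nd: "G.nondeg_at \<Lambda> y i w" for i w by (rule nondeg_at[OF ndf y0])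
    \<comment> \<open>The twist is a combination of the coroots, whose coefficients define the oper
      with the given polynomials.\<close>
    have "?Z \<in> G.cospan" using Z G.hh_cospan by simp
    then obtain \<zeta> where "?Z = (\<Sum>i\<in>UNIV. msc (\<zeta> i) (conj_mat P (coroot D i)))" by (auto simp: G.cospan_def)
    hence "?Z = conj_mat P (\<Sum>i\<in>UNIV. msc (\<zeta> i) (coroot D i))" by (simp add: conj_mat_sum conj_mat_simps)
    hence \<zeta>: "Z = (\<Sum>i\<in>UNIV. msc (\<zeta> i) (coroot D i))" by (simp only: conj_mat_inj[OF P])
    define A where "A = miura_connection D \<Lambda> (\<lambda>i. rconst (\<zeta> i) - dlog (rpoly (y i)))"
    have fam: "is_y_family D \<Lambda> Z A y" unfolding is_y_family_def monic_family_def using monic \<zeta> A_def by blast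
    have "\<exists>x. rderiv x + rconst (sroot D i (conj_mat (matrix_inv P) ?Z)) * x = rpoly (\<Lambda> i) * G.torus_factor y i" for i
    proof (rule G.bethe_imp_first_order[OF y0 nd])
      fix w assume "poly (y i) w = 0"
      hence "bethe_equation D \<Lambda> Z W i w" using W3 root by blast
      thus "sroot D i (conj_mat (matrix_inv P) ?Z) + rat_eval (dlog (G.bethe_fun \<Lambda> y i w)) w = 0" unfolding beq y_def .
    qed
    from G.first_order_imp_oper[OF y0 Z nd \<Lambda> this] have "\<exists>v\<in>G.GB. gauge v (const_mat ?Z) = G.conn \<Lambda> ?Z y" .
    hence "\<exists>v\<in>ratpoints (borel_plus D). A = gauge v (const_mat Z)" unfolding twisted A_def conn[OF \<zeta>] .
    hence "A \<in> nondegenerate_twisted_opers D \<Lambda> Z"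
      using fam ndf by (auto simp: nondegenerate_twisted_opers_def twisted_miura_opers_def miura_opers_def A_def)
    thus ?thesis using fam unfolding y_def by blast
  qed
  \<comment> \<open>The map preserves the combinatorial datum, so it matches the two subsets cut out
    by admissibility.\<close>
  have datum: "bethe_datum D \<Lambda> Z (F A) = oper_datum D \<Lambda> Z A" if "A \<in> nondegenerate_twisted_opers D \<Lambda> Z" for A
    using forward[OF that] by (simp add: bethe_datum_def oper_datum_def)
  have "bij_betw F {A \<in> nondegenerate_twisted_opers D \<Lambda> Z. admissible D (oper_datum D \<Lambda> Z A)}
      {W \<in> bethe_solutions D \<Lambda> Z. admissible D (bethe_datum D \<Lambda> Z W)}"
  proof (rule bij_betw_imageI)
    show "inj_on F {A \<in> nondegenerate_twisted_opers D \<Lambda> Z. admissible D (oper_datum D \<Lambda> Z A)}"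
    proof (rule inj_onI)
      fix A A' assume a: "A \<in> {A \<in> nondegenerate_twisted_opers D \<Lambda> Z. admissible D (oper_datum D \<Lambda> Z A)}"
        "A' \<in> {A \<in> nondegenerate_twisted_opers D \<Lambda> Z. admissible D (oper_datum D \<Lambda> Z A)}" "F A = F A'"
      have "oper_polys D \<Lambda> Z A = oper_polys D \<Lambda> Z A'" using forward[of A] forward[of A'] a by simp
      moreover have "is_y_family D \<Lambda> Z A (oper_polys D \<Lambda> Z A)" "is_y_family D \<Lambda> Z A' (oper_polys D \<Lambda> Z A')"
        using forward a by auto
      ultimately obtain y where f: "is_y_family D \<Lambda> Z A y" "is_y_family D \<Lambda> Z A' y" by metis
      obtain \<zeta> where z: "Z = (\<Sum>i\<in>UNIV. msc (\<zeta> i) (coroot D i))" "A = miura_connection D \<Lambda> (\<lambda>i. rconst (\<zeta> i) - dlog (rpoly (y i)))"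
        using f(1) unfolding is_y_family_def by blast
      obtain \<zeta>' where z': "Z = (\<Sum>i\<in>UNIV. msc (\<zeta>' i) (coroot D i))" "A' = miura_connection D \<Lambda> (\<lambda>i. rconst (\<zeta>' i) - dlog (rpoly (y i)))"
        using f(2) unfolding is_y_family_def by blast
      have "\<zeta> = \<zeta>'" using z(1) z'(1) by (intro co_ind) simp
      thus "A = A'" using z(2) z'(2) by simp
    qed
    show "F ` {A \<in> nondegenerate_twisted_opers D \<Lambda> Z. admissible D (oper_datum D \<Lambda> Z A)} = {W \<in> bethe_solutions D \<Lambda> Z. admissible D (bethe_datum D \<Lambda> Z W)}"
    proof (intro equalityI subsetI)
      fix W assume "W \<in> F ` {A \<in> nondegenerate_twisted_opers D \<Lambda> Z. admissible D (oper_datum D \<Lambda> Z A)}"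
      thus "W \<in> {W \<in> bethe_solutions D \<Lambda> Z. admissible D (bethe_datum D \<Lambda> Z W)}" using forward datum by auto
    next
      fix W assume W: "W \<in> {W \<in> bethe_solutions D \<Lambda> Z. admissible D (bethe_datum D \<Lambda> Z W)}"
      then obtain A where A: "A \<in> nondegenerate_twisted_opers D \<Lambda> Z" "is_y_family D \<Lambda> Z A (bethe_poly W)" using backward by blast
      have "F A = W" unfolding F_def polys[OF A(2)] by (simp add: proots_bethe_poly)
      moreover have "admissible D (oper_datum D \<Lambda> Z A)" using datum[OF A(1)] W \<open>F A = W\<close> by simp
      ultimately show "W \<in> F ` {A \<in> nondegenerate_twisted_opers D \<Lambda> Z. admissible D (oper_datum D \<Lambda> Z A)}" using A(1) by blast
    qed
  qed
  moreover have "\<forall>i. bethe_poly (F A) i = oper_polys D \<Lambda> Z A i" if "A \<in> nondegenerate_twisted_opers D \<Lambda> Z" for A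
    using forward[OF that] by simp
  ultimately show ?thesis using datum by (intro exI[of _ F]) simp
qed

end
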